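(* Let $B$ and $B'$ be doubly degenerate tricategories, and let $F:B\to B'$ be a (weak) functor between them. Then the monoidal functor $F$ between the associated monoidal categories is braided with respect to the braided monoidal categories $B$ and $B'$, whose braidings are those induced by the multiplications $\varphi(X,Y)=R\otimes((X\boxtimes Y)\otimes L^{\cdot})$ and $\varphi'(X,Y)=R'\otimes'((X\boxtimes' Y)\otimes' (L')^{\cdot})$.
   Context: Tricategories and weak functors are weak, in Gurski's fully algebraic version of the Gordon–Power–Street definition. A tricategory is doubly degenerate if it has exactly one 0-cell $\star$ and exactly one 1-cell. Its hom-bicategory $B(\star,\star)$ then has one object, so it is a monoidal category $(B,\otimes,U)$: objects are 2-cells, morphisms are 3-cells, $\otimes$ is composition of 2-cells along the 1-cell, $U$ is the identity 2-cell. The composition functor of the tricategory is a monoidal functor $\boxtimes:B\times B\to B$. The unit functor $1\to B(\star,\star)$ gives a monoid $I$ in $B$ with an isomorphism of monoids $I\cong U$. The left unit adjoint equivalence $\mathbf l$ gives an object $L$ with dual $L^{\cdot}$ (invertible unit and counit) and natural isomorphisms $L\otimes(I\boxtimes X)\cong X\otimes L$; the right unit adjoint equivalence gives likewise $R,R^{\cdot}$ and $R\otimes(X\boxtimes I)\cong X\otimes R$. A weak functor $F:B\to B'$ induces on hom-bicategories a monoidal functor $F:B\to B'$. A multiplication on a monoidal category $M$ (unit $E$) is a monoidal functor $\varphi:M\times M\to M$ with invertible monoidal transformations $\rho:\varphi(-,E)\Rightarrow\mathrm{id}$, $\lambda:\varphi(E,-)\Rightarrow\mathrm{id}$. It induces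 (Joyal–Street) the braiding $$ab\xrightarrow{\lambda^{-1}\rho^{-1}}\varphi(E,a)\varphi(b,E)\cong\varphi(Eb,aE)\cong\varphi(b,a)\cong\varphi(bE,Ea)\cong\varphi(b,E)\varphi(E,a)\xrightarrow{\rho\lambda}ba.$$ On a doubly degenerate tricategory $B$ one uses the multiplication $\varphi(X,Y)=R\otimes((X\boxtimes Y)\otimes L^{\cdot})$, whose structure is built from the constraint cells of the tricategory: $\rho_X$ is $R(X\boxtimes U)L^{\cdot}\cong R(X\boxtimes I)L^{\cdot}\cong XRL^{\cdot}\cong XLL^{\cdot}\cong X$ and $\lambda_Y$ is $R(U\boxtimes Y)L^{\cdot}\cong L(I\boxtimes Y)L^{\cdot}\cong YLL^{\cdot}\cong Y$, with $R\cong L$ the canonical coherence isomorphism of the tricategory; the monoidal constraint of $\varphi$ is likewise given by constraint cells. *)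

theory Defs
  imports Main
begin

section \<open>Bicategories\<close>

text \<open>Every 1-cell and 2-cell knows its endpoints.  Compositions are written in applicative order:
  \<open>g \<odot> f\<close> is \<open>f\<close> followed by \<open>g\<close>, and \<open>\<beta> \<cdot> \<alpha>\<close> is \<open>\<alpha>\<close> followed by \<open>\<beta>\<close>.\<close>

record ('o, 'm, 'c) bicat =
  Obj :: "'o set"
  Mor :: "'m set"
  Cel :: "'c set"
  src :: "'m \<Rightarrow> 'o"
  trg :: "'m \<Rightarrow> 'o"
  Dom :: "'c \<Rightarrow> 'm"
  Cod :: "'c \<Rightarrow> 'm"
  Id1 :: "'o \<Rightarrow> 'm"
  comp1 :: "'m \<Rightarrow> 'm \<Rightarrow> 'm"  (infixr "\<odot>\<index>" 75)
  Id2 :: "'m \<Rightarrow> 'c"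
  vcomp :: "'c \<Rightarrow> 'c \<Rightarrow> 'c"  (infixr "\<cdot>\<index>" 65)
  hcomp :: "'c \<Rightarrow> 'c \<Rightarrow> 'c"  (infixr "\<star>\<index>" 75)
  asc :: "'m \<Rightarrow> 'm \<Rightarrow> 'm \<Rightarrow> 'c"
  lun :: "'m \<Rightarrow> 'c"
  run :: "'m \<Rightarrow> 'c"

definition hom1 :: "('o, 'm, 'c) bicat \<Rightarrow> 'o \<Rightarrow> 'o \<Rightarrow> 'm set" where
  "hom1 B a b = {f \<in> Mor B. src B f = a \<and> trg B f = b}"

definition hom2 :: "('o, 'm, 'c) bicat \<Rightarrow> 'm \<Rightarrow> 'm \<Rightarrow> 'c set" where
  "hom2 B f g = {\<alpha> \<in> Cel B. Dom B \<alpha> = f \<and> Cod B \<alpha> = g}"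

definition inverse2 :: "('o, 'm, 'c) bicat \<Rightarrow> 'c \<Rightarrow> 'c \<Rightarrow> bool" where
  "inverse2 B \<alpha> \<beta> \<longleftrightarrow> \<alpha> \<in> Cel B \<and> \<beta> \<in> hom2 B (Cod B \<alpha>) (Dom B \<alpha>) \<and>
     vcomp B \<beta> \<alpha> = Id2 B (Dom B \<alpha>) \<and> vcomp B \<alpha> \<beta> = Id2 B (Cod B \<alpha>)"

definition iso2 :: "('o, 'm, 'c) bicat \<Rightarrow> 'm \<Rightarrow> 'm \<Rightarrow> 'c set" where
  "iso2 B f g = {\<alpha> \<in> hom2 B f g. \<exists>\<beta>. inverse2 B \<alpha> \<beta>}"

definition inv2 :: "('o, 'm, 'c) bicat \<Rightarrow> 'c \<Rightarrow> 'c" where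
  "inv2 B \<alpha> = (THE \<beta>. inverse2 B \<alpha> \<beta>)"

locale bicategory =
  fixes B :: "('o, 'm, 'c) bicat" (structure)
  assumes src_trg: "f \<in> Mor B \<Longrightarrow> src B f \<in> Obj B \<and> trg B f \<in> Obj B"
    and Id1_type: "a \<in> Obj B \<Longrightarrow> Id1 B a \<in> hom1 B a a"
    and comp1_type: "\<lbrakk>f \<in> hom1 B a b; g \<in> hom1 B b c\<rbrakk> \<Longrightarrow> g \<odot> f \<in> hom1 B a c"
    and Dom_Cod: "\<alpha> \<in> Cel B \<Longrightarrow> Dom B \<alpha> \<in> Mor B \<and> Cod B \<alpha> \<in> Mor B \<and>
          src B (Dom B \<alpha>) = src B (Cod B \<alpha>) \<and> trg B (Dom B \<alpha>) = trg B (Cod B \<alpha>)"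
    and Id2_type: "f \<in> Mor B \<Longrightarrow> Id2 B f \<in> hom2 B f f"
    and vcomp_type: "\<lbrakk>\<alpha> \<in> hom2 B f g; \<beta> \<in> hom2 B g h\<rbrakk> \<Longrightarrow> \<beta> \<cdot> \<alpha> \<in> hom2 B f h"
    and vcomp_assoc: "\<lbrakk>\<alpha> \<in> hom2 B f g; \<beta> \<in> hom2 B g h; \<gamma> \<in> hom2 B h k\<rbrakk>
          \<Longrightarrow> (\<gamma> \<cdot> \<beta>) \<cdot> \<alpha> = \<gamma> \<cdot> (\<beta> \<cdot> \<alpha>)"
    and vcomp_Id2: "\<alpha> \<in> hom2 B f g \<Longrightarrow> Id2 B g \<cdot> \<alpha> = \<alpha> \<and> \<alpha> \<cdot> Id2 B f = \<alpha>"
    and hcomp_type: "\<lbrakk>\<alpha> \<in> hom2 B f f'; \<beta> \<in> hom2 B g g'; src B g = trg B f\<rbrakk>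
          \<Longrightarrow> \<beta> \<star> \<alpha> \<in> hom2 B (g \<odot> f) (g' \<odot> f')"
    and hcomp_Id2: "\<lbrakk>f \<in> hom1 B a b; g \<in> hom1 B b c\<rbrakk> \<Longrightarrow> Id2 B g \<star> Id2 B f = Id2 B (g \<odot> f)"
    and interchange: "\<lbrakk>\<alpha> \<in> hom2 B f f'; \<alpha>' \<in> hom2 B f' f''; \<beta> \<in> hom2 B g g'; \<beta>' \<in> hom2 B g' g'';
          src B g = trg B f\<rbrakk> \<Longrightarrow> (\<beta>' \<cdot> \<beta>) \<star> (\<alpha>' \<cdot> \<alpha>) = (\<beta>' \<star> \<alpha>') \<cdot> (\<beta> \<star> \<alpha>)"
    and asc_type: "\<lbrakk>f \<in> hom1 B a b; g \<in> hom1 B b c; h \<in> hom1 B c d\<rbrakk>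
          \<Longrightarrow> asc B h g f \<in> iso2 B ((h \<odot> g) \<odot> f) (h \<odot> (g \<odot> f))"
    and asc_natural: "\<lbrakk>\<alpha> \<in> hom2 B f f'; \<beta> \<in> hom2 B g g'; \<gamma> \<in> hom2 B h h';
          src B g = trg B f; src B h = trg B g\<rbrakk>
          \<Longrightarrow> asc B h' g' f' \<cdot> ((\<gamma> \<star> \<beta>) \<star> \<alpha>) = (\<gamma> \<star> (\<beta> \<star> \<alpha>)) \<cdot> asc B h g f"
    and lun_type: "f \<in> hom1 B a b \<Longrightarrow> lun B f \<in> iso2 B (Id1 B b \<odot> f) f"
    and run_type: "f \<in> hom1 B a b \<Longrightarrow> run B f \<in> iso2 B (f \<odot> Id1 B a) f"
    and lun_natural: "\<lbrakk>f \<in> hom1 B a b; \<alpha> \<in> hom2 B f g\<rbrakk>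
          \<Longrightarrow> lun B g \<cdot> (Id2 B (Id1 B b) \<star> \<alpha>) = \<alpha> \<cdot> lun B f"
    and run_natural: "\<lbrakk>f \<in> hom1 B a b; \<alpha> \<in> hom2 B f g\<rbrakk>
          \<Longrightarrow> run B g \<cdot> (\<alpha> \<star> Id2 B (Id1 B a)) = \<alpha> \<cdot> run B f"
    and pentagon: "\<lbrakk>f \<in> hom1 B a b; g \<in> hom1 B b c; h \<in> hom1 B c d; k \<in> hom1 B d e\<rbrakk>
          \<Longrightarrow> (Id2 B k \<star> asc B h g f) \<cdot> asc B k (h \<odot> g) f \<cdot> (asc B k h g \<star> Id2 B f)
              = asc B k h (g \<odot> f) \<cdot> asc B (k \<odot> h) g f"
    and triangle: "\<lbrakk>f \<in> hom1 B a b; g \<in> hom1 B b c\<rbrakk>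
          \<Longrightarrow> (Id2 B g \<star> lun B f) \<cdot> asc B g (Id1 B b) f = run B g \<star> Id2 B f"

definition prod_bicat ::
  "('o, 'm, 'c) bicat \<Rightarrow> ('o2, 'm2, 'c2) bicat \<Rightarrow> ('o \<times> 'o2, 'm \<times> 'm2, 'c \<times> 'c2) bicat"
  (infixr "\<times>\<^sub>b" 70) where
  "A \<times>\<^sub>b B =
    \<lparr> Obj = Obj A \<times> Obj B, Mor = Mor A \<times> Mor B, Cel = Cel A \<times> Cel B,
      src = map_prod (src A) (src B), trg = map_prod (trg A) (trg B),
      Dom = map_prod (Dom A) (Dom B), Cod = map_prod (Cod A) (Cod B),
      Id1 = map_prod (Id1 A) (Id1 B),
      comp1 = (\<lambda>g f. (comp1 A (fst g) (fst f), comp1 B (snd g) (snd f))),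
      Id2 = map_prod (Id2 A) (Id2 B),
      vcomp = (\<lambda>\<beta> \<alpha>. (vcomp A (fst \<beta>) (fst \<alpha>), vcomp B (snd \<beta>) (snd \<alpha>))),
      hcomp = (\<lambda>\<beta> \<alpha>. (hcomp A (fst \<beta>) (fst \<alpha>), hcomp B (snd \<beta>) (snd \<alpha>))),
      asc = (\<lambda>h g f. (asc A (fst h) (fst g) (fst f), asc B (snd h) (snd g) (snd f))),
      lun = map_prod (lun A) (lun B), run = map_prod (run A) (run B) \<rparr>"

definition unit_bicat :: "(unit, unit, unit) bicat" where
  "unit_bicat =
    \<lparr> Obj = UNIV, Mor = UNIV, Cel = UNIV, src = (\<lambda>_. ()), trg = (\<lambda>_. ()), Dom = (\<lambda>_. ()),
      Cod = (\<lambda>_. ()), Id1 = (\<lambda>_. ()), comp1 = (\<lambda>_ _. ()), Id2 = (\<lambda>_. ()),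
      vcomp = (\<lambda>_ _. ()), hcomp = (\<lambda>_ _. ()), asc = (\<lambda>_ _ _. ()), lun = (\<lambda>_. ()), run = (\<lambda>_. ()) \<rparr>"


section \<open>Pseudofunctors\<close>

text \<open>The constraints are \<open>pfc F g f : F g \<odot> F f \<Rightarrow> F (g \<odot> f)\<close> and \<open>pfu F a : 1 \<Rightarrow> F 1\<close>.\<close>

record ('o, 'm, 'c, 'o2, 'm2, 'c2) psf =
  PDom :: "('o, 'm, 'c) bicat"
  PCod :: "('o2, 'm2, 'c2) bicat"
  pf0 :: "'o \<Rightarrow> 'o2"
  pf1 :: "'m \<Rightarrow> 'm2"
  pf2 :: "'c \<Rightarrow> 'c2"
  pfc :: "'m \<Rightarrow> 'm \<Rightarrow> 'c2"
  pfu :: "'o \<Rightarrow> 'c2"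

locale pseudofunctor =
  fixes F :: "('o, 'm, 'c, 'o2, 'm2, 'c2) psf"
    and D :: "('o, 'm, 'c) bicat"
    and C :: "('o2, 'm2, 'c2) bicat" (structure)
  assumes PDom_eq: "PDom F = D"
    and PCod_eq: "PCod F = C"
    and Dom_bicategory: "bicategory D"
    and Cod_bicategory: "bicategory C"
    and pf0_type: "a \<in> Obj D \<Longrightarrow> pf0 F a \<in> Obj C"
    and pf1_type: "f \<in> hom1 D a b \<Longrightarrow> pf1 F f \<in> hom1 C (pf0 F a) (pf0 F b)"
    and pf2_type: "\<alpha> \<in> hom2 D f g \<Longrightarrow> pf2 F \<alpha> \<in> hom2 C (pf1 F f) (pf1 F g)"
    and pf2_Id2: "f \<in> Mor D \<Longrightarrow> pf2 F (Id2 D f) = Id2 C (pf1 F f)"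
    and pf2_vcomp: "\<lbrakk>\<alpha> \<in> hom2 D f g; \<beta> \<in> hom2 D g h\<rbrakk>
          \<Longrightarrow> pf2 F (vcomp D \<beta> \<alpha>) = pf2 F \<beta> \<cdot> pf2 F \<alpha>"
    and pfc_type: "\<lbrakk>f \<in> hom1 D a b; g \<in> hom1 D b c\<rbrakk>
          \<Longrightarrow> pfc F g f \<in> iso2 C (pf1 F g \<odot> pf1 F f) (pf1 F (comp1 D g f))"
    and pfc_natural: "\<lbrakk>\<alpha> \<in> hom2 D f f'; \<beta> \<in> hom2 D g g'; src D g = trg D f\<rbrakk>
          \<Longrightarrow> pfc F g' f' \<cdot> (pf2 F \<beta> \<star> pf2 F \<alpha>) = pf2 F (hcomp D \<beta> \<alpha>) \<cdot> pfc F g f"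
    and pfu_type: "a \<in> Obj D \<Longrightarrow> pfu F a \<in> iso2 C (Id1 C (pf0 F a)) (pf1 F (Id1 D a))"
    and pf_asc: "\<lbrakk>f \<in> hom1 D a b; g \<in> hom1 D b c; h \<in> hom1 D c d\<rbrakk>
          \<Longrightarrow> pf2 F (asc D h g f) \<cdot> pfc F (comp1 D h g) f \<cdot> (pfc F h g \<star> Id2 C (pf1 F f))
              = pfc F h (comp1 D g f) \<cdot> (Id2 C (pf1 F h) \<star> pfc F g f)
                  \<cdot> asc C (pf1 F h) (pf1 F g) (pf1 F f)"
    and pf_lun: "f \<in> hom1 D a b
          \<Longrightarrow> pf2 F (lun D f) \<cdot> pfc F (Id1 D b) f \<cdot> (pfu F b \<star> Id2 C (pf1 F f)) = lun C (pf1 F f)"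
    and pf_run: "f \<in> hom1 D a b
          \<Longrightarrow> pf2 F (run D f) \<cdot> pfc F f (Id1 D a) \<cdot> (Id2 C (pf1 F f) \<star> pfu F a) = run C (pf1 F f)"

definition pid :: "('o, 'm, 'c) bicat \<Rightarrow> ('o, 'm, 'c, 'o, 'm, 'c) psf" where
  "pid B = \<lparr> PDom = B, PCod = B, pf0 = id, pf1 = id, pf2 = id,
     pfc = (\<lambda>g f. Id2 B (comp1 B g f)), pfu = (\<lambda>a. Id2 B (Id1 B a)) \<rparr>"

definition pcomp ::
  "('o2, 'm2, 'c2, 'o3, 'm3, 'c3) psf \<Rightarrow> ('o, 'm, 'c, 'o2, 'm2, 'c2) psf
    \<Rightarrow> ('o, 'm, 'c, 'o3, 'm3, 'c3) psf"  (infixr "\<circ>\<^sub>p" 60) where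
  "G \<circ>\<^sub>p F = \<lparr> PDom = PDom F, PCod = PCod G,
     pf0 = pf0 G \<circ> pf0 F, pf1 = pf1 G \<circ> pf1 F, pf2 = pf2 G \<circ> pf2 F,
     pfc = (\<lambda>g f. vcomp (PCod G) (pf2 G (pfc F g f)) (pfc G (pf1 F g) (pf1 F f))),
     pfu = (\<lambda>a. vcomp (PCod G) (pf2 G (pfu F a)) (pfu G (pf0 F a))) \<rparr>"

definition ppair ::
  "('o, 'm, 'c, 'o2, 'm2, 'c2) psf \<Rightarrow> ('o, 'm, 'c, 'o3, 'm3, 'c3) psf
    \<Rightarrow> ('o, 'm, 'c, 'o2 \<times> 'o3, 'm2 \<times> 'm3, 'c2 \<times> 'c3) psf" where
  "ppair F G = \<lparr> PDom = PDom F, PCod = PCod F \<times>\<^sub>b PCod G,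
     pf0 = (\<lambda>a. (pf0 F a, pf0 G a)), pf1 = (\<lambda>f. (pf1 F f, pf1 G f)), pf2 = (\<lambda>\<alpha>. (pf2 F \<alpha>, pf2 G \<alpha>)),
     pfc = (\<lambda>g f. (pfc F g f, pfc G g f)), pfu = (\<lambda>a. (pfu F a, pfu G a)) \<rparr>"

definition pfst :: "('o, 'm, 'c) bicat \<Rightarrow> ('o2, 'm2, 'c2) bicat
    \<Rightarrow> ('o \<times> 'o2, 'm \<times> 'm2, 'c \<times> 'c2, 'o, 'm, 'c) psf" where
  "pfst A B = \<lparr> PDom = A \<times>\<^sub>b B, PCod = A, pf0 = fst, pf1 = fst, pf2 = fst,
     pfc = (\<lambda>g f. Id2 A (comp1 A (fst g) (fst f))), pfu = (\<lambda>a. Id2 A (Id1 A (fst a))) \<rparr>"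

definition psnd :: "('o, 'm, 'c) bicat \<Rightarrow> ('o2, 'm2, 'c2) bicat
    \<Rightarrow> ('o \<times> 'o2, 'm \<times> 'm2, 'c \<times> 'c2, 'o2, 'm2, 'c2) psf" where
  "psnd A B = \<lparr> PDom = A \<times>\<^sub>b B, PCod = B, pf0 = snd, pf1 = snd, pf2 = snd,
     pfc = (\<lambda>g f. Id2 B (comp1 B (snd g) (snd f))), pfu = (\<lambda>a. Id2 B (Id1 B (snd a))) \<rparr>"

definition pconst :: "('o, 'm, 'c) bicat \<Rightarrow> ('o2, 'm2, 'c2) bicat \<Rightarrow> 'o2
    \<Rightarrow> ('o, 'm, 'c, 'o2, 'm2, 'c2) psf" where
  "pconst A B b = \<lparr> PDom = A, PCod = B,
     pf0 = (\<lambda>_. b), pf1 = (\<lambda>_. Id1 B b), pf2 = (\<lambda>_. Id2 B (Id1 B b)),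
     pfc = (\<lambda>_ _. lun B (Id1 B b)), pfu = (\<lambda>_. Id2 B (Id1 B b)) \<rparr>"

definition pbang :: "('o, 'm, 'c) bicat \<Rightarrow> ('o, 'm, 'c, unit, unit, unit) psf" where
  "pbang A = pconst A unit_bicat ()"


section \<open>Pseudonatural transformations, modifications, adjoint equivalences\<close>

text \<open>For \<open>\<sigma> : F \<Rightarrow> G\<close> and \<open>f : x \<rightarrow> y\<close> the naturality cell is
  \<open>t2 \<sigma> f : G f \<odot> \<sigma>\<^sub>x \<Rightarrow> \<sigma>\<^sub>y \<odot> F f\<close>.\<close>

record ('o, 'm, 'c, 'o2, 'm2, 'c2) trans =
  TSrc :: "('o, 'm, 'c, 'o2, 'm2, 'c2) psf"
  TTrg :: "('o, 'm, 'c, 'o2, 'm2, 'c2) psf"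
  t1 :: "'o \<Rightarrow> 'm2"
  t2 :: "'m \<Rightarrow> 'c2"

locale transformation =
  fixes \<sigma> :: "('o, 'm, 'c, 'o2, 'm2, 'c2) trans"
    and F G :: "('o, 'm, 'c, 'o2, 'm2, 'c2) psf"
    and D :: "('o, 'm, 'c) bicat"
    and C :: "('o2, 'm2, 'c2) bicat" (structure)
  assumes TSrc_eq: "TSrc \<sigma> = F"
    and TTrg_eq: "TTrg \<sigma> = G"
    and src_functor: "pseudofunctor F D C"
    and trg_functor: "pseudofunctor G D C"
    and t1_type: "x \<in> Obj D \<Longrightarrow> t1 \<sigma> x \<in> hom1 C (pf0 F x) (pf0 G x)"
    and t2_type: "f \<in> hom1 D x y \<Longrightarrow> t2 \<sigma> f \<in> iso2 C (pf1 G f \<odot> t1 \<sigma> x) (t1 \<sigma> y \<odot> pf1 F f)"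
    and t2_natural: "\<lbrakk>f \<in> hom1 D x y; \<alpha> \<in> hom2 D f g\<rbrakk>
          \<Longrightarrow> t2 \<sigma> g \<cdot> (pf2 G \<alpha> \<star> Id2 C (t1 \<sigma> x)) = (Id2 C (t1 \<sigma> y) \<star> pf2 F \<alpha>) \<cdot> t2 \<sigma> f"
    and t2_comp: "\<lbrakk>f \<in> hom1 D x y; g \<in> hom1 D y z\<rbrakk>
          \<Longrightarrow> t2 \<sigma> (comp1 D g f) \<cdot> (pfc G g f \<star> Id2 C (t1 \<sigma> x))
              = (Id2 C (t1 \<sigma> z) \<star> pfc F g f) \<cdot> asc C (t1 \<sigma> z) (pf1 F g) (pf1 F f)
                  \<cdot> (t2 \<sigma> g \<star> Id2 C (pf1 F f)) \<cdot> inv2 C (asc C (pf1 G g) (t1 \<sigma> y) (pf1 F f))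
                  \<cdot> (Id2 C (pf1 G g) \<star> t2 \<sigma> f) \<cdot> asc C (pf1 G g) (pf1 G f) (t1 \<sigma> x)"
    and t2_Id1: "x \<in> Obj D
          \<Longrightarrow> t2 \<sigma> (Id1 D x) \<cdot> (pfu G x \<star> Id2 C (t1 \<sigma> x))
              = (Id2 C (t1 \<sigma> x) \<star> pfu F x) \<cdot> inv2 C (run C (t1 \<sigma> x)) \<cdot> lun C (t1 \<sigma> x)"

definition tid ::
  "('o, 'm, 'c, 'o2, 'm2, 'c2) psf \<Rightarrow> ('o, 'm, 'c, 'o2, 'm2, 'c2) trans" where
  "tid F = \<lparr> TSrc = F, TTrg = F, t1 = (\<lambda>x. Id1 (PCod F) (pf0 F x)),
     t2 = (\<lambda>f. vcomp (PCod F) (inv2 (PCod F) (lun (PCod F) (pf1 F f))) (run (PCod F) (pf1 F f))) \<rparr>"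

definition tcomp :: "('o, 'm, 'c, 'o2, 'm2, 'c2) trans \<Rightarrow> ('o, 'm, 'c, 'o2, 'm2, 'c2) trans
    \<Rightarrow> ('o, 'm, 'c, 'o2, 'm2, 'c2) trans"  (infixr "\<bullet>\<^sub>t" 55) where
  "\<tau> \<bullet>\<^sub>t \<sigma> =
    (let D = PDom (TSrc \<sigma>); C = PCod (TSrc \<sigma>);
         F = pf1 (TSrc \<sigma>); G = pf1 (TTrg \<sigma>); H = pf1 (TTrg \<tau>)
     in \<lparr> TSrc = TSrc \<sigma>, TTrg = TTrg \<tau>,
          t1 = (\<lambda>x. t1 \<tau> x \<odot>\<^bsub>C\<^esub> t1 \<sigma> x),
          t2 = (\<lambda>f. let x = src D f; y = trg D f in
                 inv2 C (asc C (t1 \<tau> y) (t1 \<sigma> y) (F f))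
                 \<cdot>\<^bsub>C\<^esub> (Id2 C (t1 \<tau> y) \<star>\<^bsub>C\<^esub> t2 \<sigma> f)
                 \<cdot>\<^bsub>C\<^esub> asc C (t1 \<tau> y) (G f) (t1 \<sigma> x)
                 \<cdot>\<^bsub>C\<^esub> (t2 \<tau> f \<star>\<^bsub>C\<^esub> Id2 C (t1 \<sigma> x))
                 \<cdot>\<^bsub>C\<^esub> inv2 C (asc C (H f) (t1 \<tau> x) (t1 \<sigma> x))) \<rparr>)"

text \<open>Whiskering a transformation with a pseudofunctor, after (\<open>H * \<sigma>\<close>) and before (\<open>\<sigma> * K\<close>).\<close>

definition twl :: "('o2, 'm2, 'c2, 'o3, 'm3, 'c3) psf \<Rightarrow> ('o, 'm, 'c, 'o2, 'm2, 'c2) trans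
    \<Rightarrow> ('o, 'm, 'c, 'o3, 'm3, 'c3) trans" where
  "twl H \<sigma> =
    (let D = PDom (TSrc \<sigma>); E = PCod H; F = TSrc \<sigma>; G = TTrg \<sigma>
     in \<lparr> TSrc = H \<circ>\<^sub>p F, TTrg = H \<circ>\<^sub>p G,
          t1 = (\<lambda>x. pf1 H (t1 \<sigma> x)),
          t2 = (\<lambda>f. inv2 E (pfc H (t1 \<sigma> (trg D f)) (pf1 F f))
                    \<cdot>\<^bsub>E\<^esub> pf2 H (t2 \<sigma> f) \<cdot>\<^bsub>E\<^esub> pfc H (pf1 G f) (t1 \<sigma> (src D f))) \<rparr>)"

definition twr :: "('o2, 'm2, 'c2, 'o3, 'm3, 'c3) trans \<Rightarrow> ('o, 'm, 'c, 'o2, 'm2, 'c2) psf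
    \<Rightarrow> ('o, 'm, 'c, 'o3, 'm3, 'c3) trans" where
  "twr \<sigma> K = \<lparr> TSrc = TSrc \<sigma> \<circ>\<^sub>p K, TTrg = TTrg \<sigma> \<circ>\<^sub>p K,
     t1 = (\<lambda>x. t1 \<sigma> (pf0 K x)), t2 = (\<lambda>f. t2 \<sigma> (pf1 K f)) \<rparr>"

definition tpair :: "('o, 'm, 'c, 'o2, 'm2, 'c2) trans \<Rightarrow> ('o, 'm, 'c, 'o3, 'm3, 'c3) trans
    \<Rightarrow> ('o, 'm, 'c, 'o2 \<times> 'o3, 'm2 \<times> 'm3, 'c2 \<times> 'c3) trans" where
  "tpair \<sigma> \<tau> = \<lparr> TSrc = ppair (TSrc \<sigma>) (TSrc \<tau>), TTrg = ppair (TTrg \<sigma>) (TTrg \<tau>),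
     t1 = (\<lambda>x. (t1 \<sigma> x, t1 \<tau> x)), t2 = (\<lambda>f. (t2 \<sigma> f, t2 \<tau> f)) \<rparr>"

definition invertible_modification :: "('o, 'm, 'c, 'o2, 'm2, 'c2) trans
    \<Rightarrow> ('o, 'm, 'c, 'o2, 'm2, 'c2) trans \<Rightarrow> ('o \<Rightarrow> 'c2) \<Rightarrow> bool" where
  "invertible_modification \<sigma> \<tau> m \<longleftrightarrow>
    (let D = PDom (TSrc \<sigma>); C = PCod (TSrc \<sigma>); F = TSrc \<sigma>; G = TTrg \<sigma>
     in (\<forall>x \<in> Obj D. m x \<in> iso2 C (t1 \<sigma> x) (t1 \<tau> x)) \<and>
        (\<forall>f \<in> Mor D. t2 \<tau> f \<cdot>\<^bsub>C\<^esub> (Id2 C (pf1 G f) \<star>\<^bsub>C\<^esub> m (src D f))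
                   = (m (trg D f) \<star>\<^bsub>C\<^esub> Id2 C (pf1 F f)) \<cdot>\<^bsub>C\<^esub> t2 \<sigma> f))"

text \<open>An adjoint equivalence in the bicategory of pseudofunctors, transformations and modifications,
  with the right adjoint \<open>bwd\<close>, the unit and the counit as part of the data.  Composition of modifications
  is componentwise, so the triangle identities are stated at each object.\<close>

record ('o, 'm, 'c, 'o2, 'm2, 'c2) adjeq =
  fwd :: "('o, 'm, 'c, 'o2, 'm2, 'c2) trans"
  bwd :: "('o, 'm, 'c, 'o2, 'm2, 'c2) trans"
  adjunit :: "'o \<Rightarrow> 'c2"
  adjcounit :: "'o \<Rightarrow> 'c2"

definition adjoint_equivalence :: "('o, 'm, 'c, 'o2, 'm2, 'c2) psf
    \<Rightarrow> ('o, 'm, 'c, 'o2, 'm2, 'c2) psf \<Rightarrow> ('o, 'm, 'c, 'o2, 'm2, 'c2) adjeq \<Rightarrow> bool" where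
  "adjoint_equivalence F G e \<longleftrightarrow>
     transformation (fwd e) F G (PDom F) (PCod F) \<and> transformation (bwd e) G F (PDom F) (PCod F) \<and>
     invertible_modification (tid F) (bwd e \<bullet>\<^sub>t fwd e) (adjunit e) \<and>
     invertible_modification (fwd e \<bullet>\<^sub>t bwd e) (tid G) (adjcounit e) \<and>
     (\<forall>x \<in> Obj (PDom F). let C = PCod F; f = t1 (fwd e) x; g = t1 (bwd e) x in
        lun C f \<cdot>\<^bsub>C\<^esub> (adjcounit e x \<star>\<^bsub>C\<^esub> Id2 C f) \<cdot>\<^bsub>C\<^esub> inv2 C (asc C f g f)
          \<cdot>\<^bsub>C\<^esub> (Id2 C f \<star>\<^bsub>C\<^esub> adjunit e x) \<cdot>\<^bsub>C\<^esub> inv2 C (run C f) = Id2 C f \<and>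
        run C g \<cdot>\<^bsub>C\<^esub> (Id2 C g \<star>\<^bsub>C\<^esub> adjcounit e x) \<cdot>\<^bsub>C\<^esub> asc C g f g
          \<cdot>\<^bsub>C\<^esub> (adjunit e x \<star>\<^bsub>C\<^esub> Id2 C g) \<cdot>\<^bsub>C\<^esub> inv2 C (lun C g) = Id2 C g)"


section \<open>Pasting in a bicategory\<close>

text \<open>A nonempty list \<open>[f\<^sub>1, \<dots>, f\<^sub>n]\<close> of composable 1-cells stands for
  \<open>f\<^sub>1 \<odot> (f\<^sub>2 \<odot> \<dots> \<odot> f\<^sub>n)\<close>.  A rewrite \<open>(us, \<theta>, vs)\<close> consists of two such lists and a 2-cell
  \<open>\<theta> : path us \<Rightarrow> path vs\<close>.  A pasting composite is a starting list together with a sequence of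
  rewrites, each applied to the segment beginning at a given position; all the associativity
  constraints needed for rebracketing are inserted by \<open>glue\<close>.\<close>

type_synonym ('m, 'c) rewrite = "'m list \<times> 'c \<times> 'm list"

fun path :: "('o, 'm, 'c) bicat \<Rightarrow> 'm list \<Rightarrow> 'm" where
  "path B [] = undefined"
| "path B [f] = f"
| "path B (f # g # fs) = f \<odot>\<^bsub>B\<^esub> path B (g # fs)"

text \<open>The rebracketing \<open>path us \<odot> path ws \<Rightarrow> path (us @ ws)\<close>, for nonempty lists.\<close>

fun glue :: "('o, 'm, 'c) bicat \<Rightarrow> 'm list \<Rightarrow> 'm list \<Rightarrow> 'c" where
  "glue B [] ws = undefined"
| "glue B [u] ws = Id2 B (u \<odot>\<^bsub>B\<^esub> path B ws)"
| "glue B (u # v # us) ws =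
     (Id2 B u \<star>\<^bsub>B\<^esub> glue B (v # us) ws) \<cdot>\<^bsub>B\<^esub> asc B u (path B (v # us)) (path B ws)"

definition whisk :: "('o, 'm, 'c) bicat \<Rightarrow> 'm list \<Rightarrow> ('m, 'c) rewrite \<Rightarrow> 'm list \<Rightarrow> 'c" where
  "whisk B fs r hs =
    (case r of (us, \<theta>, vs) \<Rightarrow>
      foldr (\<lambda>f \<alpha>. Id2 B f \<star>\<^bsub>B\<^esub> \<alpha>) fs
        (if hs = [] then \<theta>
         else glue B vs hs \<cdot>\<^bsub>B\<^esub> (\<theta> \<star>\<^bsub>B\<^esub> Id2 B (path B hs)) \<cdot>\<^bsub>B\<^esub> inv2 B (glue B us hs)))"

fun paste :: "('o, 'm, 'c) bicat \<Rightarrow> 'm list \<Rightarrow> (nat \<times> ('m, 'c) rewrite) list \<Rightarrow> 'c" where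
  "paste B ws [] = Id2 B (path B ws)"
| "paste B ws ((i, (us, \<theta>, vs)) # steps) =
     paste B (take i ws @ vs @ drop (i + length us) ws) steps
       \<cdot>\<^bsub>B\<^esub> whisk B (take i ws) (us, \<theta>, vs) (drop (i + length us) ws)"

definition invR :: "('o, 'm, 'c) bicat \<Rightarrow> ('m, 'c) rewrite \<Rightarrow> ('m, 'c) rewrite" where
  "invR B r = (case r of (us, \<theta>, vs) \<Rightarrow> (vs, inv2 B \<theta>, us))"

definition lunR :: "('o, 'm, 'c) bicat \<Rightarrow> 'm \<Rightarrow> ('m, 'c) rewrite" where
  "lunR B f = ([Id1 B (trg B f), f], lun B f, [f])"

definition runR :: "('o, 'm, 'c) bicat \<Rightarrow> 'm \<Rightarrow> ('m, 'c) rewrite" where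
  "runR B f = ([f, Id1 B (src B f)], run B f, [f])"

text \<open>The constraint \<open>path (map F us) \<Rightarrow> F (path us)\<close> and the image of a rewrite under \<open>F\<close>.\<close>

fun pflist :: "('o, 'm, 'c, 'o2, 'm2, 'c2) psf \<Rightarrow> 'm list \<Rightarrow> 'c2" where
  "pflist F [] = undefined"
| "pflist F [u] = Id2 (PCod F) (pf1 F u)"
| "pflist F (u # v # us) = pfc F u (path (PDom F) (v # us))
     \<cdot>\<^bsub>PCod F\<^esub> (Id2 (PCod F) (pf1 F u) \<star>\<^bsub>PCod F\<^esub> pflist F (v # us))"

definition imgR ::
  "('o, 'm, 'c, 'o2, 'm2, 'c2) psf \<Rightarrow> ('m, 'c) rewrite \<Rightarrow> ('m2, 'c2) rewrite" where
  "imgR F r = (case r of (us, \<theta>, vs) \<Rightarrow>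
     (map (pf1 F) us,
      inv2 (PCod F) (pflist F vs) \<cdot>\<^bsub>PCod F\<^esub> pf2 F \<theta> \<cdot>\<^bsub>PCod F\<^esub> pflist F us,
      map (pf1 F) vs))"

definition cellR :: "('o, 'm, 'c, 'o2, 'm2, 'c2) psf \<Rightarrow> 'c \<Rightarrow> ('m2, 'c2) rewrite" where
  "cellR F \<alpha> = ([pf1 F (Dom (PDom F) \<alpha>)], pf2 F \<alpha>, [pf1 F (Cod (PDom F) \<alpha>)])"

definition pfuR :: "('o, 'm, 'c, 'o2, 'm2, 'c2) psf \<Rightarrow> 'o \<Rightarrow> ('m2, 'c2) rewrite" where
  "pfuR F a = ([Id1 (PCod F) (pf0 F a)], pfu F a, [pf1 F (Id1 (PDom F) a)])"

definition pfcR :: "('o, 'm, 'c, 'o2, 'm2, 'c2) psf \<Rightarrow> 'm \<Rightarrow> 'm \<Rightarrow> ('m2, 'c2) rewrite" where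
  "pfcR F g f = ([pf1 F g, pf1 F f], pfc F g f, [pf1 F (comp1 (PDom F) g f)])"

definition natR :: "('o, 'm, 'c, 'o2, 'm2, 'c2) trans \<Rightarrow> 'm \<Rightarrow> ('m2, 'c2) rewrite" where
  "natR \<sigma> f = (let D = PDom (TSrc \<sigma>) in
     ([pf1 (TTrg \<sigma>) f, t1 \<sigma> (src D f)], t2 \<sigma> f, [t1 \<sigma> (trg D f), pf1 (TSrc \<sigma>) f]))"

definition unitR :: "('o, 'm, 'c, 'o2, 'm2, 'c2) adjeq \<Rightarrow> 'o \<Rightarrow> ('m2, 'c2) rewrite" where
  "unitR e x = ([t1 (tid (TSrc (fwd e))) x], adjunit e x, [t1 (bwd e) x, t1 (fwd e) x])"

definition counitR :: "('o, 'm, 'c, 'o2, 'm2, 'c2) adjeq \<Rightarrow> 'o \<Rightarrow> ('m2, 'c2) rewrite" where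
  "counitR e x = ([t1 (fwd e) x, t1 (bwd e) x], adjcounit e x, [t1 (tid (TTrg (fwd e))) x])"


section \<open>Tricategories\<close>

text \<open>\<open>Tn T a b c : Hom b c \<times> Hom a b \<rightarrow> Hom a c\<close> is the composition functor and
  \<open>Uf T a : 1 \<rightarrow> Hom a a\<close> the unit functor.  The components of the remaining data are
  \<^item> \<open>As\<close>: \<open>a : (h \<otimes> g) \<otimes> f \<rightarrow> h \<otimes> (g \<otimes> f)\<close>, \<open>Le\<close>: \<open>l : I \<otimes> f \<rightarrow> f\<close>, \<open>Ri\<close>: \<open>r : f \<otimes> I \<rightarrow> f\<close>;
  \<^item> \<open>Tpi : (1\<^sub>k \<otimes> a\<^sub>h\<^sub>g\<^sub>f) \<odot> (a \<odot> (a\<^sub>k\<^sub>h\<^sub>g \<otimes> 1\<^sub>f)) \<Rightarrow> a \<odot> a\<close>;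
  \<^item> \<open>Tmu : (1\<^sub>g \<otimes> l\<^sub>f) \<odot> (a \<odot> (r\<^sup>\<bullet>\<^sub>g \<otimes> 1\<^sub>f)) \<Rightarrow> 1\<close>;
  \<^item> \<open>Tlam : l\<^sub>g \<otimes> 1\<^sub>f \<Rightarrow> l \<odot> a\<close> and \<open>Trho : 1\<^sub>g \<otimes> r\<^sup>\<bullet>\<^sub>f \<Rightarrow> a \<odot> r\<^sup>\<bullet>\<close>.\<close>

record ('o, 'm, 'n, 'p) tricat =
  T0 :: "'o set"
  Hom :: "'o \<Rightarrow> 'o \<Rightarrow> ('m, 'n, 'p) bicat"
  Tn :: "'o \<Rightarrow> 'o \<Rightarrow> 'o \<Rightarrow> ('m \<times> 'm, 'n \<times> 'n, 'p \<times> 'p, 'm, 'n, 'p) psf"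
  Uf :: "'o \<Rightarrow> (unit, unit, unit, 'm, 'n, 'p) psf"
  As :: "'o \<Rightarrow> 'o \<Rightarrow> 'o \<Rightarrow> 'o
    \<Rightarrow> ('m \<times> 'm \<times> 'm, 'n \<times> 'n \<times> 'n, 'p \<times> 'p \<times> 'p, 'm, 'n, 'p) adjeq"
  Le :: "'o \<Rightarrow> 'o \<Rightarrow> ('m, 'n, 'p, 'm, 'n, 'p) adjeq"
  Ri :: "'o \<Rightarrow> 'o \<Rightarrow> ('m, 'n, 'p, 'm, 'n, 'p) adjeq"
  Tpi :: "'o \<Rightarrow> 'o \<Rightarrow> 'o \<Rightarrow> 'o \<Rightarrow> 'o \<Rightarrow> 'm \<times> 'm \<times> 'm \<times> 'm \<Rightarrow> 'p"
  Tmu :: "'o \<Rightarrow> 'o \<Rightarrow> 'o \<Rightarrow> 'm \<times> 'm \<Rightarrow> 'p"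
  Tlam :: "'o \<Rightarrow> 'o \<Rightarrow> 'o \<Rightarrow> 'm \<times> 'm \<Rightarrow> 'p"
  Trho :: "'o \<Rightarrow> 'o \<Rightarrow> 'o \<Rightarrow> 'm \<times> 'm \<Rightarrow> 'p"

subsection \<open>The functors and transformations between which the data live\<close>

definition tens where
  "tens T a b c G F = Tn T a b c \<circ>\<^sub>p ppair G F"

definition ttens where
  "ttens T a b c \<tau> \<sigma> = twl (Tn T a b c) (tpair \<tau> \<sigma>)"

definition unitf where
  "unitf T a A = Uf T a \<circ>\<^sub>p pbang A"

definition ppair3 where
  "ppair3 F G H = ppair F (ppair G H)"

definition Hom2 where
  "Hom2 T a b c = Hom T b c \<times>\<^sub>b Hom T a b"

definition Hom3 where
  "Hom3 T a b c d = Hom T c d \<times>\<^sub>b Hom2 T a b c"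

definition Hom4 where
  "Hom4 T a b c d e = Hom T d e \<times>\<^sub>b Hom3 T a b c d"

definition proj2_1 where "proj2_1 T a b c = pfst (Hom T b c) (Hom T a b)"
definition proj2_2 where "proj2_2 T a b c = psnd (Hom T b c) (Hom T a b)"

definition proj3_1 where "proj3_1 T a b c d = pfst (Hom T c d) (Hom2 T a b c)"
definition proj3_2 where "proj3_2 T a b c d = proj2_1 T a b c \<circ>\<^sub>p psnd (Hom T c d) (Hom2 T a b c)"
definition proj3_3 where "proj3_3 T a b c d = proj2_2 T a b c \<circ>\<^sub>p psnd (Hom T c d) (Hom2 T a b c)"

definition proj4_1 where "proj4_1 T a b c d e = pfst (Hom T d e) (Hom3 T a b c d)"
definition proj4_2 where
  "proj4_2 T a b c d e = proj3_1 T a b c d \<circ>\<^sub>p psnd (Hom T d e) (Hom3 T a b c d)"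
definition proj4_3 where
  "proj4_3 T a b c d e = proj3_2 T a b c d \<circ>\<^sub>p psnd (Hom T d e) (Hom3 T a b c d)"
definition proj4_4 where
  "proj4_4 T a b c d e = proj3_3 T a b c d \<circ>\<^sub>p psnd (Hom T d e) (Hom3 T a b c d)"

definition As_src where
  "As_src T a b c d =
     tens T a b d (tens T b c d (proj3_1 T a b c d) (proj3_2 T a b c d)) (proj3_3 T a b c d)"

definition As_trg where
  "As_trg T a b c d =
     tens T a c d (proj3_1 T a b c d) (tens T a b c (proj3_2 T a b c d) (proj3_3 T a b c d))"

definition pi_src where
  "pi_src T a b c d e =
    (let p = proj4_1 T a b c d e; q = proj4_2 T a b c d e;
         r = proj4_3 T a b c d e; s = proj4_4 T a b c d e
     in ttens T a d e (tid p) (twr (fwd (As T a b c d)) (ppair3 q r s))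
        \<bullet>\<^sub>t twr (fwd (As T a b d e)) (ppair3 p (tens T b c d q r) s)
        \<bullet>\<^sub>t ttens T a b e (twr (fwd (As T b c d e)) (ppair3 p q r)) (tid s))"

definition pi_trg where
  "pi_trg T a b c d e =
    (let p = proj4_1 T a b c d e; q = proj4_2 T a b c d e;
         r = proj4_3 T a b c d e; s = proj4_4 T a b c d e
     in twr (fwd (As T a c d e)) (ppair3 p q (tens T a b c r s))
        \<bullet>\<^sub>t twr (fwd (As T a b c e)) (ppair3 (tens T c d e p q) r s))"

definition mu_src where
  "mu_src T a b c =
    (let p = proj2_1 T a b c; q = proj2_2 T a b c
     in ttens T a b c (tid p) (twr (fwd (Le T a b)) q)
        \<bullet>\<^sub>t twr (fwd (As T a b b c)) (ppair3 p (unitf T b (Hom2 T a b c)) q)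
        \<bullet>\<^sub>t ttens T a b c (twr (bwd (Ri T b c)) p) (tid q))"

definition lam_src where
  "lam_src T a b c =
     ttens T a b c (twr (fwd (Le T b c)) (proj2_1 T a b c)) (tid (proj2_2 T a b c))"

definition lam_trg where
  "lam_trg T a b c =
     twr (fwd (Le T a c)) (Tn T a b c)
     \<bullet>\<^sub>t twr (fwd (As T a b c c))
          (ppair3 (unitf T c (Hom2 T a b c)) (proj2_1 T a b c) (proj2_2 T a b c))"

definition rho_src where
  "rho_src T a b c =
     ttens T a b c (tid (proj2_1 T a b c)) (twr (bwd (Ri T a b)) (proj2_2 T a b c))"

definition rho_trg where
  "rho_trg T a b c =
     twr (fwd (As T a a b c))
       (ppair3 (proj2_1 T a b c) (proj2_2 T a b c) (unitf T a (Hom2 T a b c)))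
     \<bullet>\<^sub>t twr (bwd (Ri T a c)) (Tn T a b c)"

subsection \<open>Components, indexed by 1-cells with their endpoints\<close>

datatype ('o, 'm) arr = Arr (dm: 'o) (cl: 'm) (cd: 'o)

definition arrs :: "('o, 'm, 'n, 'p) tricat \<Rightarrow> 'o \<Rightarrow> 'o \<Rightarrow> ('o, 'm) arr set" where
  "arrs T a b = {Arr a f b | f. a \<in> T0 T \<and> b \<in> T0 T \<and> f \<in> Obj (Hom T a b)}"

definition tn :: "('o, 'm, 'n, 'p) tricat \<Rightarrow> ('o, 'm) arr \<Rightarrow> ('o, 'm) arr \<Rightarrow> ('o, 'm) arr" where
  "tn T g f = Arr (dm f) (pf0 (Tn T (dm f) (cd f) (cd g)) (cl g, cl f)) (cd g)"

definition un :: "('o, 'm, 'n, 'p) tricat \<Rightarrow> 'o \<Rightarrow> ('o, 'm) arr" where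
  "un T a = Arr a (pf0 (Uf T a) ()) a"

definition one :: "('o, 'm, 'n, 'p) tricat \<Rightarrow> ('o, 'm) arr \<Rightarrow> 'n" where
  "one T f = Id1 (Hom T (dm f) (cd f)) (cl f)"

definition AsT where "AsT T h g f = fwd (As T (dm f) (cd f) (cd g) (cd h))"

definition a1 where "a1 T h g f = t1 (AsT T h g f) (cl h, cl g, cl f)"
definition l1 where "l1 T f = t1 (fwd (Le T (dm f) (cd f))) (cl f)"
definition rb1 where "rb1 T f = t1 (bwd (Ri T (dm f) (cd f))) (cl f)"

text \<open>The pseudofunctors \<open>k \<otimes> -\<close> on \<open>Hom a (dm k)\<close> and \<open>- \<otimes> f\<close> on \<open>Hom (cd f) c\<close>.\<close>

definition lten where
  "lten T k a = tens T a (dm k) (cd k)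
     (pconst (Hom T a (dm k)) (Hom T (dm k) (cd k)) (cl k)) (pid (Hom T a (dm k)))"

definition rten where
  "rten T f c = tens T (dm f) (cd f) c
     (pid (Hom T (cd f) c)) (pconst (Hom T (cd f) c) (Hom T (dm f) (cd f)) (cl f))"

definition lw where "lw T k a \<theta> = pf1 (lten T k a) \<theta>"
definition rw where "rw T f c \<theta> = pf1 (rten T f c) \<theta>"

text \<open>\<open>onesR T g f\<close> is the unit constraint \<open>1\<^bsub>g \<otimes> f\<^esub> \<Rightarrow> 1\<^sub>g \<otimes> 1\<^sub>f\<close>; the rewrites \<open>onelR\<close> and
  \<open>onerR\<close> go from \<open>1\<^bsub>g \<otimes> f\<^esub> \<otimes> \<theta>\<close> to \<open>(1\<^sub>g \<otimes> 1\<^sub>f) \<otimes> \<theta>\<close> and from \<open>\<theta> \<otimes> 1\<^bsub>g \<otimes> f\<^esub>\<close> to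
  \<open>\<theta> \<otimes> (1\<^sub>g \<otimes> 1\<^sub>f)\<close>.\<close>

definition onesR where
  "onesR T g f = pfuR (Tn T (dm f) (cd f) (cd g)) (cl g, cl f)"

definition onelR where
  "onelR T g f a \<theta> = cellR (Tn T a (dm f) (cd g))
     (pfu (Tn T (dm f) (cd f) (cd g)) (cl g, cl f), Id2 (Hom T a (dm f)) \<theta>)"

definition onerR where
  "onerR T g f c \<theta> = cellR (Tn T (dm f) (cd g) c)
     (Id2 (Hom T (cd g) c) \<theta>, pfu (Tn T (dm f) (cd f) (cd g)) (cl g, cl f))"

definition piR where
  "piR T k h g f =
     ([lw T k (dm f) (a1 T h g f), a1 T k (tn T h g) f, rw T f (cd k) (a1 T k h g)],
      Tpi T (dm f) (cd f) (cd g) (cd h) (cd k) (cl k, cl h, cl g, cl f),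
      [a1 T k h (tn T g f), a1 T (tn T k h) g f])"

definition muR where
  "muR T g f =
     ([lw T g (dm f) (l1 T f), a1 T g (un T (cd f)) f, rw T f (cd g) (rb1 T g)],
      Tmu T (dm f) (cd f) (cd g) (cl g, cl f),
      [one T (tn T g f)])"

definition lamR where
  "lamR T g f =
     ([rw T f (cd g) (l1 T g)],
      Tlam T (dm f) (cd f) (cd g) (cl g, cl f),
      [l1 T (tn T g f), a1 T (un T (cd g)) g f])"

definition rhoR where
  "rhoR T g f =
     ([lw T g (dm f) (rb1 T f)],
      Trho T (dm f) (cd f) (cd g) (cl g, cl f),
      [a1 T g f (un T (dm f)), rb1 T (tn T g f)])"

subsection \<open>The definition\<close>

text \<open>\<open>nonabelian_cocycle\<close> equates the two ways of pasting the associahedron \<open>K\<^sub>5\<close>;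
  \<open>left_normalization\<close> and \<open>right_normalization\<close> are the two unit axioms.\<close>

locale tricategory =
  fixes T :: "('o, 'm, 'n, 'p) tricat"
  assumes Hom_bicategory: "\<lbrakk>a \<in> T0 T; b \<in> T0 T\<rbrakk> \<Longrightarrow> bicategory (Hom T a b)"
    and Tn_psf: "\<lbrakk>a \<in> T0 T; b \<in> T0 T; c \<in> T0 T\<rbrakk>
          \<Longrightarrow> pseudofunctor (Tn T a b c) (Hom T b c \<times>\<^sub>b Hom T a b) (Hom T a c)"
    and Uf_psf: "a \<in> T0 T \<Longrightarrow> pseudofunctor (Uf T a) unit_bicat (Hom T a a)"
    and As_adjeq: "\<lbrakk>a \<in> T0 T; b \<in> T0 T; c \<in> T0 T; d \<in> T0 T\<rbrakk>
          \<Longrightarrow> adjoint_equivalence (As_src T a b c d) (As_trg T a b c d) (As T a b c d)"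
    and Le_adjeq: "\<lbrakk>a \<in> T0 T; b \<in> T0 T\<rbrakk>
          \<Longrightarrow> adjoint_equivalence (tens T a b b (unitf T b (Hom T a b)) (pid (Hom T a b)))
                (pid (Hom T a b)) (Le T a b)"
    and Ri_adjeq: "\<lbrakk>a \<in> T0 T; b \<in> T0 T\<rbrakk>
          \<Longrightarrow> adjoint_equivalence (tens T a a b (pid (Hom T a b)) (unitf T a (Hom T a b)))
                (pid (Hom T a b)) (Ri T a b)"
    and Tpi_modification: "\<lbrakk>a \<in> T0 T; b \<in> T0 T; c \<in> T0 T; d \<in> T0 T; e \<in> T0 T\<rbrakk>
          \<Longrightarrow> invertible_modification (pi_src T a b c d e) (pi_trg T a b c d e) (Tpi T a b c d e)"
    and Tmu_modification: "\<lbrakk>a \<in> T0 T; b \<in> T0 T; c \<in> T0 T\<rbrakk>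
          \<Longrightarrow> invertible_modification (mu_src T a b c) (tid (Tn T a b c)) (Tmu T a b c)"
    and Tlam_modification: "\<lbrakk>a \<in> T0 T; b \<in> T0 T; c \<in> T0 T\<rbrakk>
          \<Longrightarrow> invertible_modification (lam_src T a b c) (lam_trg T a b c) (Tlam T a b c)"
    and Trho_modification: "\<lbrakk>a \<in> T0 T; b \<in> T0 T; c \<in> T0 T\<rbrakk>
          \<Longrightarrow> invertible_modification (rho_src T a b c) (rho_trg T a b c) (Trho T a b c)"
    and nonabelian_cocycle:
      "\<lbrakk>f \<in> arrs T u v; g \<in> arrs T v w; h \<in> arrs T w x; j \<in> arrs T x y; k \<in> arrs T y z\<rbrakk>
       \<Longrightarrow> let H = Hom T u z;
               start = [lw T k u (lw T j u (a1 T h g f)),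
                        lw T k u (a1 T j (tn T h g) f),
                        a1 T k (tn T j (tn T h g)) f,
                        rw T f z (lw T k v (a1 T j h g)),
                        rw T f z (a1 T k (tn T j h) g),
                        rw T f z (rw T g z (a1 T k j h))]
           in paste H start
                [(3, imgR (rten T f z) (piR T k j h g)),
                 (1, piR T k j (tn T h g) f),
                 (0, natR (AsT T k j (tn T h (tn T g f))) (one T k, one T j, a1 T h g f)),
                 (1, invR H (onelR T k j u (a1 T h g f))),
                 (1, piR T (tn T k j) h g f)]
            = paste H start
                [(2, invR H (natR (AsT T k (tn T j (tn T h g)) f) (one T k, a1 T j h g, one T f))),
                 (0, imgR (lten T k u) (piR T j h g f)),
                 (1, piR T k (tn T j h) g f),
                 (2, invR H (natR (AsT T (tn T k (tn T j h)) g f) (a1 T k j h, one T g, one T f))),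
                 (2, invR H (onerR T g f z (a1 T k j h))),
                 (0, piR T k j h (tn T g f))]"
    and left_normalization:
      "\<lbrakk>f \<in> arrs T u v; g \<in> arrs T v w; h \<in> arrs T w x\<rbrakk>
       \<Longrightarrow> let H = Hom T u x;
               start = [a1 T h g f,
                        rw T f x (lw T h v (l1 T g)),
                        rw T f x (a1 T h (un T w) g),
                        rw T f x (rw T g x (rb1 T h))]
           in paste H start
                [(1, imgR (rten T f x) (muR T h g)),
                 (1, invR H (onesR T (tn T h g) f)),
                 (0, runR H (a1 T h g f))]
            = paste H start
                [(0, invR H (natR (AsT T h g f) (one T h, l1 T g, one T f))),
                 (0, imgR (lten T h u) (lamR T g f)),
                 (1, piR T h (un T w) g f),
                 (2, invR H (natR (AsT T h g f) (rb1 T h, one T g, one T f))),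
                 (2, invR H (onerR T g f x (rb1 T h))),
                 (0, muR T h (tn T g f)),
                 (0, lunR H (a1 T h g f))]"
    and right_normalization:
      "\<lbrakk>f \<in> arrs T u v; g \<in> arrs T v w; h \<in> arrs T w x\<rbrakk>
       \<Longrightarrow> let H = Hom T u x;
               start = [lw T h u (lw T g u (l1 T f)),
                        lw T h u (a1 T g (un T v) f),
                        lw T h u (rw T f w (rb1 T g)),
                        a1 T h g f]
           in paste H start
                [(0, imgR (lten T h u) (muR T g f)),
                 (0, invR H (onesR T h (tn T g f))),
                 (0, lunR H (a1 T h g f))]
            = paste H start
                [(2, natR (AsT T h g f) (one T h, rb1 T g, one T f)),
                 (3, imgR (rten T f x) (rhoR T h g)),
                 (1, piR T h g (un T v) f),
                 (0, natR (AsT T h g f) (one T h, one T g, l1 T f)),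
                 (1, invR H (onelR T h g u (l1 T f))),
                 (1, muR T (tn T h g) f),
                 (0, runR H (a1 T h g f))]"


section \<open>Weak functors of tricategories\<close>

text \<open>\<open>Chi\<close> and \<open>Iot\<close> have components \<open>\<chi> : F g \<otimes>' F f \<rightarrow> F (g \<otimes> f)\<close> and \<open>\<iota> : I' \<rightarrow> F I\<close>;
  the modifications are
  \<^item> \<open>Omg : F a \<odot> (\<chi> \<odot> (\<chi> \<otimes>' 1)) \<Rightarrow> \<chi> \<odot> ((1 \<otimes>' \<chi>) \<odot> a')\<close>,
  \<^item> \<open>Gam : F l \<odot> (\<chi> \<odot> (\<iota> \<otimes>' 1)) \<Rightarrow> l'\<close>,
  \<^item> \<open>Del : F r\<^sup>\<bullet> \<Rightarrow> \<chi> \<odot> ((1 \<otimes>' \<iota>) \<odot> r'\<^sup>\<bullet>)\<close>.\<close>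

record ('o, 'm, 'n, 'p, 'o2, 'm2, 'n2, 'p2) trifun =
  F0 :: "'o \<Rightarrow> 'o2"
  Fl :: "'o \<Rightarrow> 'o \<Rightarrow> ('m, 'n, 'p, 'm2, 'n2, 'p2) psf"
  Chi :: "'o \<Rightarrow> 'o \<Rightarrow> 'o \<Rightarrow> ('m \<times> 'm, 'n \<times> 'n, 'p \<times> 'p, 'm2, 'n2, 'p2) adjeq"
  Iot :: "'o \<Rightarrow> (unit, unit, unit, 'm2, 'n2, 'p2) adjeq"
  Omg :: "'o \<Rightarrow> 'o \<Rightarrow> 'o \<Rightarrow> 'o \<Rightarrow> 'm \<times> 'm \<times> 'm \<Rightarrow> 'p2"
  Gam :: "'o \<Rightarrow> 'o \<Rightarrow> 'm \<Rightarrow> 'p2"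
  Del :: "'o \<Rightarrow> 'o \<Rightarrow> 'm \<Rightarrow> 'p2"

definition Chi_src where
  "Chi_src T T' F a b c = tens T' (F0 F a) (F0 F b) (F0 F c)
     (Fl F b c \<circ>\<^sub>p proj2_1 T a b c) (Fl F a b \<circ>\<^sub>p proj2_2 T a b c)"

definition omg_src where
  "omg_src T T' F a b c d =
    (let p = proj3_1 T a b c d; q = proj3_2 T a b c d; r = proj3_3 T a b c d
     in twl (Fl F a d) (fwd (As T a b c d))
        \<bullet>\<^sub>t twr (fwd (Chi F a b d)) (ppair (tens T b c d p q) r)
        \<bullet>\<^sub>t ttens T' (F0 F a) (F0 F b) (F0 F d)
             (twr (fwd (Chi F b c d)) (ppair p q)) (tid (Fl F a b \<circ>\<^sub>p r)))"

definition omg_trg where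
  "omg_trg T T' F a b c d =
    (let p = proj3_1 T a b c d; q = proj3_2 T a b c d; r = proj3_3 T a b c d
     in twr (fwd (Chi F a c d)) (ppair p (tens T a b c q r))
        \<bullet>\<^sub>t ttens T' (F0 F a) (F0 F c) (F0 F d)
             (tid (Fl F c d \<circ>\<^sub>p p)) (twr (fwd (Chi F a b c)) (ppair q r))
        \<bullet>\<^sub>t twr (fwd (As T' (F0 F a) (F0 F b) (F0 F c) (F0 F d)))
             (ppair3 (Fl F c d \<circ>\<^sub>p p) (Fl F b c \<circ>\<^sub>p q) (Fl F a b \<circ>\<^sub>p r)))"

definition gam_src where
  "gam_src T T' F a b =
     twl (Fl F a b) (fwd (Le T a b))
     \<bullet>\<^sub>t twr (fwd (Chi F a b b)) (ppair (unitf T b (Hom T a b)) (pid (Hom T a b)))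
     \<bullet>\<^sub>t ttens T' (F0 F a) (F0 F b) (F0 F b)
          (twr (fwd (Iot F b)) (pbang (Hom T a b))) (tid (Fl F a b))"

definition gam_trg where
  "gam_trg T T' F a b = twr (fwd (Le T' (F0 F a) (F0 F b))) (Fl F a b)"

definition del_src where
  "del_src T T' F a b = twl (Fl F a b) (bwd (Ri T a b))"

definition del_trg where
  "del_trg T T' F a b =
     twr (fwd (Chi F a a b)) (ppair (pid (Hom T a b)) (unitf T a (Hom T a b)))
     \<bullet>\<^sub>t ttens T' (F0 F a) (F0 F a) (F0 F b)
          (tid (Fl F a b)) (twr (fwd (Iot F a)) (pbang (Hom T a b)))
     \<bullet>\<^sub>t twr (bwd (Ri T' (F0 F a) (F0 F b))) (Fl F a b)"

definition Farr ::
  "('o, 'm, 'n, 'p, 'o2, 'm2, 'n2, 'p2) trifun \<Rightarrow> ('o, 'm) arr \<Rightarrow> ('o2, 'm2) arr" where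
  "Farr F f = Arr (F0 F (dm f)) (pf0 (Fl F (dm f) (cd f)) (cl f)) (F0 F (cd f))"

definition ChiT where "ChiT F g f = fwd (Chi F (dm f) (cd f) (cd g))"
definition c1 where "c1 F g f = t1 (ChiT F g f) (cl g, cl f)"
definition i1 where "i1 F a = t1 (fwd (Iot F a)) ()"

definition omgR where
  "omgR T T' F h g f =
    (let F1 = pf1 (Fl F (dm f) (cd h)); fa = F0 F (dm f); fd = F0 F (cd h) in
     ([F1 (a1 T h g f), c1 F (tn T h g) f, rw T' (Farr F f) fd (c1 F h g)],
      Omg F (dm f) (cd f) (cd g) (cd h) (cl h, cl g, cl f),
      [c1 F h (tn T g f), lw T' (Farr F h) fa (c1 F g f), a1 T' (Farr F h) (Farr F g) (Farr F f)]))"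

definition gamR where
  "gamR T T' F f =
     ([pf1 (Fl F (dm f) (cd f)) (l1 T f), c1 F (un T (cd f)) f,
       rw T' (Farr F f) (F0 F (cd f)) (i1 F (cd f))],
      Gam F (dm f) (cd f) (cl f),
      [l1 T' (Farr F f)])"

definition delR where
  "delR T T' F f =
     ([pf1 (Fl F (dm f) (cd f)) (rb1 T f)],
      Del F (dm f) (cd f) (cl f),
      [c1 F f (un T (dm f)), lw T' (Farr F f) (F0 F (dm f)) (i1 F (dm f)), rb1 T' (Farr F f)])"

text \<open>The unit constraint of the local functor inside a tensor product:
  \<open>\<theta> \<otimes>' 1\<^bsub>F f\<^esub>\<close> to \<open>\<theta> \<otimes>' F 1\<^sub>f\<close>, and \<open>1\<^bsub>F f\<^esub> \<otimes>' \<theta>\<close> to \<open>F 1\<^sub>f \<otimes>' \<theta>\<close>.\<close>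

definition FonerR where
  "FonerR T' F f c \<theta> = cellR (Tn T' (F0 F (dm f)) (F0 F (cd f)) c)
     (Id2 (Hom T' (F0 F (cd f)) c) \<theta>, pfu (Fl F (dm f) (cd f)) (cl f))"

definition FonelR where
  "FonelR T' F f a \<theta> = cellR (Tn T' a (F0 F (dm f)) (F0 F (cd f)))
     (pfu (Fl F (dm f) (cd f)) (cl f), Id2 (Hom T' a (F0 F (dm f))) \<theta>)"

text \<open>For \<open>\<alpha> : g \<rightarrow> g'\<close> in \<open>Hom b c\<close> and \<open>\<beta> : f \<rightarrow> f'\<close> in \<open>Hom a b\<close>, the two rewrites
  \<open>(1\<^bsub>g'\<^esub> \<otimes> \<beta>) \<odot> (\<alpha> \<otimes> 1\<^sub>f) \<Rightarrow> \<alpha> \<otimes> \<beta>\<close> and \<open>(\<alpha> \<otimes> 1\<^bsub>f'\<^esub>) \<odot> (1\<^sub>g \<otimes> \<beta>) \<Rightarrow> \<alpha> \<otimes> \<beta>\<close>.\<close>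

definition exlR where
  "exlR T a b c \<alpha> \<beta> =
    (let M = Tn T a b c; G = Hom T b c; K = Hom T a b;
         p = (Id1 G (trg G \<alpha>), \<beta>); q = (\<alpha>, Id1 K (src K \<beta>))
     in ([pf1 M p, pf1 M q], pf2 M (lun G \<alpha>, run K \<beta>) \<cdot>\<^bsub>Hom T a c\<^esub> pfc M p q, [pf1 M (\<alpha>, \<beta>)]))"

definition exrR where
  "exrR T a b c \<alpha> \<beta> =
    (let M = Tn T a b c; G = Hom T b c; K = Hom T a b;
         p = (\<alpha>, Id1 K (trg K \<beta>)); q = (Id1 G (src G \<alpha>), \<beta>)
     in ([pf1 M p, pf1 M q], pf2 M (run G \<alpha>, lun K \<beta>) \<cdot>\<^bsub>Hom T a c\<^esub> pfc M p q, [pf1 M (\<alpha>, \<beta>)]))"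

locale weak_functor =
  fixes T :: "('o, 'm, 'n, 'p) tricat"
    and T' :: "('o2, 'm2, 'n2, 'p2) tricat"
    and F :: "('o, 'm, 'n, 'p, 'o2, 'm2, 'n2, 'p2) trifun"
  assumes dom_tricategory: "tricategory T"
    and cod_tricategory: "tricategory T'"
    and F0_type: "a \<in> T0 T \<Longrightarrow> F0 F a \<in> T0 T'"
    and Fl_psf: "\<lbrakk>a \<in> T0 T; b \<in> T0 T\<rbrakk>
          \<Longrightarrow> pseudofunctor (Fl F a b) (Hom T a b) (Hom T' (F0 F a) (F0 F b))"
    and Chi_adjeq: "\<lbrakk>a \<in> T0 T; b \<in> T0 T; c \<in> T0 T\<rbrakk>
          \<Longrightarrow> adjoint_equivalence (Chi_src T T' F a b c) (Fl F a c \<circ>\<^sub>p Tn T a b c) (Chi F a b c)"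
    and Iot_adjeq: "a \<in> T0 T
          \<Longrightarrow> adjoint_equivalence (Uf T' (F0 F a)) (Fl F a a \<circ>\<^sub>p Uf T a) (Iot F a)"
    and Omg_modification: "\<lbrakk>a \<in> T0 T; b \<in> T0 T; c \<in> T0 T; d \<in> T0 T\<rbrakk>
          \<Longrightarrow> invertible_modification (omg_src T T' F a b c d) (omg_trg T T' F a b c d)
                (Omg F a b c d)"
    and Gam_modification: "\<lbrakk>a \<in> T0 T; b \<in> T0 T\<rbrakk>
          \<Longrightarrow> invertible_modification (gam_src T T' F a b) (gam_trg T T' F a b) (Gam F a b)"
    and Del_modification: "\<lbrakk>a \<in> T0 T; b \<in> T0 T\<rbrakk>
          \<Longrightarrow> invertible_modification (del_src T T' F a b) (del_trg T T' F a b) (Del F a b)"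
    and associativity_axiom:
      "\<lbrakk>f \<in> arrs T u v; g \<in> arrs T v w; h \<in> arrs T w x; k \<in> arrs T x y\<rbrakk>
       \<Longrightarrow> let fu = F0 F u; fv = F0 F v; fw = F0 F w; fy = F0 F y;
               H = Hom T' fu fy; F1 = pf1 (Fl F u y);
               f' = Farr F f; g' = Farr F g; h' = Farr F h; k' = Farr F k;
               start = [F1 (lw T k u (a1 T h g f)),
                        F1 (a1 T k (tn T h g) f),
                        F1 (rw T f y (a1 T k h g)),
                        c1 F (tn T (tn T k h) g) f,
                        rw T' f' fy (c1 F (tn T k h) g),
                        rw T' f' fy (rw T' g' fy (c1 F k h))]
           in paste H start
                [(0, imgR (Fl F u y) (piR T k h g f)),
                 (1, omgR T T' F (tn T k h) g f),
                 (3, invR H (natR (AsT T' (Farr F (tn T k h)) g' f') (c1 F k h, one T' g', one T' f'))),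
                 (3, invR H (onerR T' g' f' fy (c1 F k h))),
                 (2, exlR T' fu fw fy (c1 F k h) (c1 F g f)),
                 (2, invR H (exrR T' fu fw fy (c1 F k h) (c1 F g f))),
                 (0, omgR T T' F k h (tn T g f)),
                 (3, onelR T' k' h' fu (c1 F g f)),
                 (2, invR H (natR (AsT T' k' h' (Farr F (tn T g f)))
                       (one T' k', one T' h', c1 F g f)))]
            = paste H start
                [(2, natR (ChiT F (tn T k (tn T h g)) f) (a1 T k h g, one T f)),
                 (3, invR H (FonerR T' F f fy (pf1 (Fl F v y) (a1 T k h g)))),
                 (3, imgR (rten T' f' fy) (omgR T T' F k h g)),
                 (1, omgR T T' F k (tn T h g) f),
                 (3, invR H (natR (AsT T' k' (Farr F (tn T h g)) f') (one T' k', c1 F h g, one T' f'))),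
                 (0, natR (ChiT F k (tn T h (tn T g f))) (one T k, a1 T h g f)),
                 (1, invR H (FonelR T' F k fu (pf1 (Fl F u x) (a1 T h g f)))),
                 (1, imgR (lten T' k' fu) (omgR T T' F h g f)),
                 (3, piR T' k' h' g' f')]"
    and unit_axiom:
      "\<lbrakk>f \<in> arrs T u v; g \<in> arrs T v w\<rbrakk>
       \<Longrightarrow> let fu = F0 F u; fv = F0 F v; fw = F0 F w;
               H = Hom T' fu fw; F1 = pf1 (Fl F u w);
               f' = Farr F f; g' = Farr F g;
               start = [F1 (lw T g u (l1 T f)),
                        F1 (a1 T g (un T v) f),
                        c1 F (tn T g (un T v)) f,
                        rw T' f' fw (c1 F g (un T v)),
                        rw T' f' fw (lw T' g' fv (i1 F v)),
                        rw T' f' fw (rb1 T' g')]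
           in paste H start
                [(3, imgR (rten T' f' fw) (invR (Hom T' fv fw) (delR T T' F g))),
                 (3, FonerR T' F f fw (pf1 (Fl F v w) (rb1 T g))),
                 (2, invR H (natR (ChiT F g f) (rb1 T g, one T f))),
                 (0, imgR (Fl F u w) (muR T g f)),
                 (0, invR H (pfuR (Fl F u w) (cl (tn T g f)))),
                 (0, lunR H (c1 F g f))]
            = paste H start
                [(1, omgR T T' F g (un T v) f),
                 (3, invR H (natR (AsT T' g' (Farr F (un T v)) f') (one T' g', i1 F v, one T' f'))),
                 (0, natR (ChiT F g f) (one T g, l1 T f)),
                 (1, invR H (FonelR T' F g fu (pf1 (Fl F u v) (l1 T f)))),
                 (1, imgR (lten T' g' fu) (gamR T T' F f)),
                 (1, muR T' g' f'),
                 (0, runR H (c1 F g f))]"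


section \<open>Monoidal categories, multiplications and braidings\<close>

text \<open>A monoidal category is a bicategory with one object: its objects are the 1-cells, its
  morphisms the 2-cells, and \<open>\<odot>\<close> is the tensor product.  Monoidal functors have invertible constraints.\<close>

definition monoidal_category :: "('o, 'm, 'c) bicat \<Rightarrow> bool" where
  "monoidal_category M \<longleftrightarrow> bicategory M \<and> (\<exists>!x. x \<in> Obj M)"

definition monoidal_functor ::
  "('o, 'm, 'c) bicat \<Rightarrow> ('o2, 'm2, 'c2) bicat \<Rightarrow> ('o, 'm, 'c, 'o2, 'm2, 'c2) psf \<Rightarrow> bool" where
  "monoidal_functor M M' F \<longleftrightarrow> monoidal_category M \<and> monoidal_category M' \<and> pseudofunctor F M M'"

definition mon_unit :: "('o, 'm, 'c) bicat \<Rightarrow> 'm" where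
  "mon_unit M = Id1 M (the_elem (Obj M))"

text \<open>Compatibility of a monoidal functor with the braidings \<open>c\<close> and \<open>c'\<close>.  That these families satisfy the
  hexagon identities is a property of \<open>(M, c)\<close> and \<open>(M', c')\<close> and not part of the condition on \<open>F\<close>.\<close>

definition braided_monoidal_functor ::
  "('o, 'm, 'c) bicat \<Rightarrow> ('m \<Rightarrow> 'm \<Rightarrow> 'c) \<Rightarrow> ('o2, 'm2, 'c2) bicat \<Rightarrow> ('m2 \<Rightarrow> 'm2 \<Rightarrow> 'c2)
    \<Rightarrow> ('o, 'm, 'c, 'o2, 'm2, 'c2) psf \<Rightarrow> bool" where
  "braided_monoidal_functor M c M' c' F \<longleftrightarrow>
     monoidal_functor M M' F \<and>
     (\<forall>X \<in> Mor M. \<forall>Y \<in> Mor M.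
        pfc F Y X \<cdot>\<^bsub>M'\<^esub> c' (pf1 F X) (pf1 F Y) = pf2 F (c X Y) \<cdot>\<^bsub>M'\<^esub> pfc F X Y)"

text \<open>The data of a multiplication: \<open>\<phi> : M \<times> M \<rightarrow> M\<close>, \<open>\<rho>\<^sub>X : \<phi>(X, E) \<Rightarrow> X\<close> and
  \<open>\<lambda>\<^sub>X : \<phi>(E, X) \<Rightarrow> X\<close>.\<close>

record ('o, 'm, 'c) mult =
  mphi :: "('o \<times> 'o, 'm \<times> 'm, 'c \<times> 'c, 'o, 'm, 'c) psf"
  mrho :: "'m \<Rightarrow> 'c"
  mlam :: "'m \<Rightarrow> 'c"

definition induced_braiding :: "('o, 'm, 'c) mult \<Rightarrow> 'm \<Rightarrow> 'm \<Rightarrow> 'c" where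
  "induced_braiding K a b =
    (let \<phi> = mphi K; M = PCod \<phi>; E = mon_unit M in
       (mrho K b \<star>\<^bsub>M\<^esub> mlam K a)
       \<cdot>\<^bsub>M\<^esub> inv2 M (pfc \<phi> (b, E) (E, a))
       \<cdot>\<^bsub>M\<^esub> pf2 \<phi> (inv2 M (run M b), inv2 M (lun M a))
       \<cdot>\<^bsub>M\<^esub> pf2 \<phi> (lun M b, run M a)
       \<cdot>\<^bsub>M\<^esub> pfc \<phi> (E, a) (b, E)
       \<cdot>\<^bsub>M\<^esub> (inv2 M (mlam K a) \<star>\<^bsub>M\<^esub> inv2 M (mrho K b)))"


section \<open>Doubly degenerate tricategories\<close>

definition doubly_degenerate :: "('o, 'm, 'n, 'p) tricat \<Rightarrow> bool" where
  "doubly_degenerate T \<longleftrightarrow> (\<exists>!a. a \<in> T0 T) \<and> (\<forall>a \<in> T0 T. \<exists>!f. f \<in> Obj (Hom T a a))"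

definition pt :: "('o, 'm, 'n, 'p) tricat \<Rightarrow> 'o" where
  "pt T = the_elem (T0 T)"

definition monB :: "('o, 'm, 'n, 'p) tricat \<Rightarrow> ('m, 'n, 'p) bicat" where
  "monB T = Hom T (pt T) (pt T)"

definition pt1 :: "('o, 'm, 'n, 'p) tricat \<Rightarrow> 'm" where
  "pt1 T = the_elem (Obj (monB T))"

definition ptarr :: "('o, 'm, 'n, 'p) tricat \<Rightarrow> ('o, 'm) arr" where
  "ptarr T = Arr (pt T) (pt1 T) (pt T)"

definition ddTn where "ddTn T = Tn T (pt T) (pt T) (pt T)"
definition ddLe where "ddLe T = Le T (pt T) (pt T)"
definition ddRi where "ddRi T = Ri T (pt T) (pt T)"

definition ddL where "ddL T = t1 (fwd (ddLe T)) (pt1 T)"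
definition ddLd where "ddLd T = t1 (bwd (ddLe T)) (pt1 T)"
definition ddR where "ddR T = t1 (fwd (ddRi T)) (pt1 T)"
definition ddRd where "ddRd T = t1 (bwd (ddRi T)) (pt1 T)"

definition ddbox :: "('o, 'm, 'n, 'p) tricat \<Rightarrow> 'n \<Rightarrow> 'n \<Rightarrow> 'n" where
  "ddbox T X Y = pf1 (ddTn T) (X, Y)"

text \<open>The isomorphism \<open>U \<cong> I\<close>, with \<open>I\<close> the image of the 1-cell of the unit bicategory, on either
  side of a tensor product.\<close>

definition ddu :: "('o, 'm, 'n, 'p) tricat \<Rightarrow> 'p" where
  "ddu T = pfu (Uf T (pt T)) ()"

definition ddIr where "ddIr T X = cellR (ddTn T) (Id2 (monB T) X, ddu T)"
definition ddIl where "ddIl T X = cellR (ddTn T) (ddu T, Id2 (monB T) X)"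

text \<open>The coherence isomorphism \<open>R \<cong> L\<close>.  It is the analogue of Kelly's derivation of \<open>l\<^sub>I = r\<^sub>I\<close>
  in a monoidal category:
  \<open>R \<boxtimes> U \<cong> (U \<boxtimes> L) \<odot> A\<close> by \<open>\<mu>\<close> and the unit of \<open>R \<stileturn> R\<^sup>\<bullet>\<close>, \<open>U \<boxtimes> L \<cong> L\<close> by naturality of \<open>l\<close> at \<open>L\<close>,
  and \<open>L \<odot> A \<cong> L \<boxtimes> U\<close> by \<open>\<lambda>\<close>; the resulting \<open>R \<boxtimes> U \<cong> L \<boxtimes> U\<close> is then transported to \<open>R \<cong> L\<close>
  by naturality of \<open>r\<close> at \<open>R\<close> and at \<open>L\<close>.  By coherence for tricategories any other composite of
  constraint cells \<open>R \<cong> L\<close> is equal to this one.\<close>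

definition ddkappa :: "('o, 'm, 'n, 'p) tricat \<Rightarrow> 'p" where
  "ddkappa T =
    (let B = monB T; x = pt1 T; U = Id1 B x; s = ptarr T; r = ddRi T; l = ddLe T;
         R = ddR T; L = ddL T; Rd = ddRd T; Ld = ddLd T; A = a1 T s s s
     in paste B [R]
          [(0, invR B (runR B R)),
           (1, invR B (counitR r (pt1 T))),
           (0, natR (fwd r) R),
           (1, invR B (ddIr T R)),
           \<comment> \<open>\<open>[R, R \<boxtimes> U, R\<^sup>\<bullet>]\<close>\<close>
           (1, invR B (lunR B (ddbox T R U))),
           (1, invR B (muR T s s)),
           (3, imgR (rten T s (pt T)) (invR B (unitR r x))),
           (3, invR B (pfuR (ddTn T) (x, x))),
           (2, runR B A),
           \<comment> \<open>\<open>[R, U \<boxtimes> L, A, R\<^sup>\<bullet>]\<close>\<close>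
           (1, ddIl T L),
           (1, invR B (lunR B (pf1 (ddTn T) (pf1 (Uf T (pt T)) (), L)))),
           (1, unitR l x),
           (2, invR B (natR (fwd l) L)),
           (1, invR B (unitR l x)),
           (1, lunR B L),
           \<comment> \<open>\<open>[R, L, A, R\<^sup>\<bullet>]\<close>\<close>
           (1, invR B (lamR T s s)),
           (1, ddIr T L),
           (0, invR B (natR (fwd r) L)),
           \<comment> \<open>\<open>[L, R, R\<^sup>\<bullet>]\<close>\<close>
           (1, counitR r x),
           (0, runR B L)])"

definition ddkappaR where "ddkappaR T = ([ddR T], ddkappa T, [ddL T])"

text \<open>\<open>\<phi>(X, Y) = R \<odot> ((X \<boxtimes> Y) \<odot> L\<^sup>\<bullet>)\<close>.  The constraint \<open>\<phi>(X, Y) \<odot> \<phi>(X', Y') \<Rightarrow> \<phi>(X \<odot> X', Y \<odot> Y')\<close>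
  cancels the inner \<open>L\<^sup>\<bullet> \<odot> R \<cong> L\<^sup>\<bullet> \<odot> L \<cong> U\<close> and applies the constraint of \<open>\<boxtimes>\<close>.\<close>

definition dd_list :: "('o, 'm, 'n, 'p) tricat \<Rightarrow> 'n \<times> 'n \<Rightarrow> 'n list" where
  "dd_list T XY = [ddR T, pf1 (ddTn T) XY, ddLd T]"

definition dd_phi ::
  "('o, 'm, 'n, 'p) tricat \<Rightarrow> ('m \<times> 'm, 'n \<times> 'n, 'p \<times> 'p, 'm, 'n, 'p) psf" where
  "dd_phi T =
    (let B = monB T; x = pt1 T; l = ddLe T; M = ddTn T
     in \<lparr> PDom = B \<times>\<^sub>b B, PCod = B,
          pf0 = (\<lambda>_. x),
          pf1 = (\<lambda>XY. path B (dd_list T XY)),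
          pf2 = (\<lambda>\<alpha>. Id2 B (ddR T) \<star>\<^bsub>B\<^esub> (pf2 M \<alpha> \<star>\<^bsub>B\<^esub> Id2 B (ddLd T))),
          pfc = (\<lambda>XY XY'.
            paste B (dd_list T XY @ dd_list T XY')
              [(3, ddkappaR T),
               (2, invR B (unitR l x)),
               (2, lunR B (pf1 M XY')),
               (1, pfcR M XY XY')]
            \<cdot>\<^bsub>B\<^esub> glue B (dd_list T XY) (dd_list T XY')),
          pfu = (\<lambda>_.
            paste B [Id1 B x]
              [(0, invR B (counitR l x)),
               (0, invR B (ddkappaR T)),
               (1, invR B (lunR B (ddLd T))),
               (1, pfuR M (x, x))]) \<rparr>)"

definition dd_rho :: "('o, 'm, 'n, 'p) tricat \<Rightarrow> 'n \<Rightarrow> 'p" where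
  "dd_rho T X =
    (let B = monB T; x = pt1 T
     in paste B (dd_list T (X, Id1 B x))
          [(1, ddIr T X),
           (0, invR B (natR (fwd (ddRi T)) X)),
           (1, ddkappaR T),
           (1, counitR (ddLe T) x),
           (0, runR B X)])"

definition dd_lam :: "('o, 'm, 'n, 'p) tricat \<Rightarrow> 'n \<Rightarrow> 'p" where
  "dd_lam T Y =
    (let B = monB T; x = pt1 T
     in paste B (dd_list T (Id1 B x, Y))
          [(0, ddkappaR T),
           (1, ddIl T Y),
           (0, invR B (natR (fwd (ddLe T)) Y)),
           (1, counitR (ddLe T) x),
           (0, runR B Y)])"

definition dd_mult :: "('o, 'm, 'n, 'p) tricat \<Rightarrow> ('m, 'n, 'p) mult" where
  "dd_mult T = \<lparr> mphi = dd_phi T, mrho = dd_rho T, mlam = dd_lam T \<rparr>"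

definition dd_braiding :: "('o, 'm, 'n, 'p) tricat \<Rightarrow> 'n \<Rightarrow> 'n \<Rightarrow> 'p" where
  "dd_braiding T = induced_braiding (dd_mult T)"

end

theory Submission
  imports Defs
begin

text \<open>
  A cell of a monoidal category between iterated products becomes, after
  bracketings and units have been absorbed, a diagram between two lists of
  objects. Diagrams form a strict monoidal category, in which the composites that
  define the constraint cells are composites of whiskered cells.

  Write \<open>a\<^sub>l = I \<boxtimes> a\<close> and \<open>a\<^sub>r = a \<boxtimes> I\<close>. The unit equivalences and \<open>R \<cong> L\<close> give
  \<open>\<lambda>\<^sub>a: L a\<^sub>l \<rightarrow> a L\<close> and \<open>p\<^sub>b: L b\<^sub>r \<rightarrow> b L\<close>, and the monoidal constraint of \<open>\<boxtimes>\<close> gives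
  an interchange \<open>x\<^sub>a\<^sub>b: a\<^sub>l b\<^sub>r \<rightarrow> b\<^sub>r a\<^sub>l\<close>. Since \<open>L\<close> is invertible, the braiding \<open>c\<close> of \<open>a\<close>
  and \<open>b\<close> is the only cell for which the two ways \<open>L a\<^sub>l b\<^sub>r \<rightarrow> b a L\<close> agree:
  \<open>\<lambda>\<^sub>a\<close>, then \<open>p\<^sub>b\<close>, then \<open>c L\<close>; and \<open>L x\<^sub>a\<^sub>b\<close>, then \<open>p\<^sub>b\<close>, then \<open>\<lambda>\<^sub>a\<close>.

  The image \<open>F c\<close> satisfies the same equation with \<open>L\<close> replaced by \<open>V = F L \<otimes> W\<close>, where \<open>W\<close>
  is the object of the constraint \<open>\<chi>\<close>. The modifications \<open>\<gamma>\<close> and \<open>\<delta>\<close> compare \<open>V\<close> with \<open>L'\<close>: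
  if \<open>J\<close> is the object of \<open>\<iota>\<close> and \<open>K\<close> its dual, they give two isomorphisms \<open>V \<cong> K L'\<close>,
  one compatible with the cells \<open>\<lambda>\<close> and one with the cells \<open>p\<close>, up to crossings with \<open>K\<close>.
  The two isomorphisms differ by a scalar, and scalars are central, so that one
  isomorphism serves for both. Then \<open>F c\<close> is \<open>c'\<close> conjugated by crossings with \<open>K\<close>, and
  the Yang-Baxter equation removes the crossings.
\<close>

section \<open>Strict diagrams in a one-object bicategory\<close>

text \<open>The braiding is defined by a long composite through the multiplication, and F respects
  its parts only up to constraint cells. Since whiskering with an invertible object is faithful, the
  composite can be traded for the equation that characterises it, in which R \<cong> L and the
  counits have already cancelled. The obstacle is that \<gamma> and \<delta> do not compare V with
  L' itself: \<iota> enters them inside \<boxtimes>', as J \<boxtimes>' U' or U' \<boxtimes>' J. The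
  way out is to create J K from the empty list inside \<boxtimes>': V \<cong> V (J \<boxtimes>' I')
  (K \<boxtimes>' I') \<cong> L' (K \<boxtimes>' I') \<cong> K L', and similarly with I' on the left
  for \<delta>. The factor K left over is the source of the crossings. A second asymmetry: \<delta>
  is stated for the right adjoint of r, while the braiding uses r itself, so the mate of \<delta>
  has to be formed. Finally, a scalar is a diagram from the empty list to itself; lists may be empty
  throughout so that naturality applies to scalars too.\<close>

definition isoc :: "('o, 'm, 'c) bicat \<Rightarrow> 'c \<Rightarrow> bool" where
  "isoc B \<alpha> \<longleftrightarrow> (\<exists>\<beta>. inverse2 B \<alpha> \<beta>)"

locale monoidal_bicat = bicategory B for B :: "('o, 'm, 'c) bicat" (structure) +
  assumes one_object: "\<exists>!a. a \<in> Obj B"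
begin

abbreviation U where "U \<equiv> mon_unit B"

lemma Obj_eq: "Obj B = {the_elem (Obj B)}"
  using one_object by (metis empty_iff is_singletonI' is_singleton_the_elem)

lemma hom1_eq: "a \<in> Obj B \<Longrightarrow> b \<in> Obj B \<Longrightarrow> hom1 B a b = Mor B"
  unfolding hom1_def using src_trg one_object by blast

lemma Mor_hom1: "f \<in> Mor B \<Longrightarrow> f \<in> hom1 B (the_elem (Obj B)) (the_elem (Obj B))"
  using hom1_eq Obj_eq by blast

lemma src_eq [simp]: "f \<in> Mor B \<Longrightarrow> src B f = the_elem (Obj B)"
  and trg_eq [simp]: "f \<in> Mor B \<Longrightarrow> trg B f = the_elem (Obj B)"
  using Mor_hom1 unfolding hom1_def by auto

lemma hom1_Mor: "f \<in> hom1 B a b \<Longrightarrow> f \<in> Mor B"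
  unfolding hom1_def by auto

lemma comp1_Mor [simp]: "f \<in> Mor B \<Longrightarrow> g \<in> Mor B \<Longrightarrow> g \<odot> f \<in> Mor B"
  using comp1_type Mor_hom1 hom1_Mor by blast

lemma U_Mor [simp]: "U \<in> Mor B"
  unfolding mon_unit_def using Id1_type Obj_eq hom1_Mor by blast

lemma hom2_iff: "\<alpha> \<in> hom2 B f g \<longleftrightarrow> \<alpha> \<in> Cel B \<and> Dom B \<alpha> = f \<and> Cod B \<alpha> = g"
  unfolding hom2_def by auto

lemma Dom_Mor [simp]: "\<alpha> \<in> Cel B \<Longrightarrow> Dom B \<alpha> \<in> Mor B"
  and Cod_Mor [simp]: "\<alpha> \<in> Cel B \<Longrightarrow> Cod B \<alpha> \<in> Mor B"
  using Dom_Cod by auto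

lemma Id2_Cel [simp]: "f \<in> Mor B \<Longrightarrow> Id2 B f \<in> Cel B"
  and Id2_Dom [simp]: "f \<in> Mor B \<Longrightarrow> Dom B (Id2 B f) = f"
  and Id2_Cod [simp]: "f \<in> Mor B \<Longrightarrow> Cod B (Id2 B f) = f"
  using Id2_type hom2_iff by auto

lemma vcomp_Cel [simp]: "\<alpha> \<in> Cel B \<Longrightarrow> \<beta> \<in> Cel B \<Longrightarrow> Dom B \<beta> = Cod B \<alpha> \<Longrightarrow> \<beta> \<cdot> \<alpha> \<in> Cel B"
  and vcomp_Dom [simp]: "\<alpha> \<in> Cel B \<Longrightarrow> \<beta> \<in> Cel B \<Longrightarrow> Dom B \<beta> = Cod B \<alpha> \<Longrightarrow> Dom B (\<beta> \<cdot> \<alpha>) = Dom B \<alpha>"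
  and vcomp_Cod [simp]: "\<alpha> \<in> Cel B \<Longrightarrow> \<beta> \<in> Cel B \<Longrightarrow> Dom B \<beta> = Cod B \<alpha> \<Longrightarrow> Cod B (\<beta> \<cdot> \<alpha>) = Cod B \<beta>"
  using vcomp_type[of \<alpha> "Dom B \<alpha>" "Cod B \<alpha>" \<beta> "Cod B \<beta>"] hom2_iff by auto

lemma vassoc [simp]: "\<alpha> \<in> Cel B \<Longrightarrow> \<beta> \<in> Cel B \<Longrightarrow> \<gamma> \<in> Cel B \<Longrightarrow> Dom B \<beta> = Cod B \<alpha> \<Longrightarrow> Dom B \<gamma> = Cod B \<beta>
    \<Longrightarrow> (\<gamma> \<cdot> \<beta>) \<cdot> \<alpha> = \<gamma> \<cdot> (\<beta> \<cdot> \<alpha>)"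
  using vcomp_assoc[of \<alpha> "Dom B \<alpha>" "Cod B \<alpha>" \<beta> "Cod B \<beta>" \<gamma> "Cod B \<gamma>"] hom2_iff by auto

lemma vcomp_Id_left [simp]: "\<alpha> \<in> Cel B \<Longrightarrow> Cod B \<alpha> = f \<Longrightarrow> Id2 B f \<cdot> \<alpha> = \<alpha>"
  and vcomp_Id_right [simp]: "\<alpha> \<in> Cel B \<Longrightarrow> Dom B \<alpha> = f \<Longrightarrow> \<alpha> \<cdot> Id2 B f = \<alpha>"
  using vcomp_Id2[of \<alpha> "Dom B \<alpha>" "Cod B \<alpha>"] hom2_iff by auto

lemma hcomp_Cel [simp]: "\<alpha> \<in> Cel B \<Longrightarrow> \<beta> \<in> Cel B \<Longrightarrow> \<beta> \<star> \<alpha> \<in> Cel B"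
  and hcomp_Dom [simp]: "\<alpha> \<in> Cel B \<Longrightarrow> \<beta> \<in> Cel B \<Longrightarrow> Dom B (\<beta> \<star> \<alpha>) = Dom B \<beta> \<odot> Dom B \<alpha>"
  and hcomp_Cod [simp]: "\<alpha> \<in> Cel B \<Longrightarrow> \<beta> \<in> Cel B \<Longrightarrow> Cod B (\<beta> \<star> \<alpha>) = Cod B \<beta> \<odot> Cod B \<alpha>"
  using hcomp_type[of \<alpha> "Dom B \<alpha>" "Cod B \<alpha>" \<beta> "Dom B \<beta>" "Cod B \<beta>"] hom2_iff by auto

lemma hcomp_Id [simp]: "f \<in> Mor B \<Longrightarrow> g \<in> Mor B \<Longrightarrow> Id2 B g \<star> Id2 B f = Id2 B (g \<odot> f)"
  using hcomp_Id2 Mor_hom1 by blast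

lemma interch: "\<lbrakk>\<alpha> \<in> Cel B; \<alpha>' \<in> Cel B; \<beta> \<in> Cel B; \<beta>' \<in> Cel B; Dom B \<alpha>' = Cod B \<alpha>; Dom B \<beta>' = Cod B \<beta>\<rbrakk>
    \<Longrightarrow> (\<beta>' \<cdot> \<beta>) \<star> (\<alpha>' \<cdot> \<alpha>) = (\<beta>' \<star> \<alpha>') \<cdot> (\<beta> \<star> \<alpha>)"
  using interchange[of \<alpha> "Dom B \<alpha>" "Cod B \<alpha>" \<alpha>' "Cod B \<alpha>'" \<beta> "Dom B \<beta>" "Cod B \<beta>" \<beta>' "Cod B \<beta>'"] hom2_iff
  by auto

subsection \<open>Isomorphisms\<close>

lemma inverse2_unique: "inverse2 B \<alpha> \<beta> \<Longrightarrow> inverse2 B \<alpha> \<gamma> \<Longrightarrow> \<beta> = \<gamma>"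
  unfolding inverse2_def hom2_iff
  by (metis vassoc vcomp_Id_left vcomp_Id_right)

lemma inv2_inverse: "inverse2 B \<alpha> \<beta> \<Longrightarrow> inv2 B \<alpha> = \<beta>"
  unfolding inv2_def using inverse2_unique by blast

lemma inverse2_inv2: "isoc B \<alpha> \<Longrightarrow> inverse2 B \<alpha> (inv2 B \<alpha>)"
  unfolding isoc_def using inv2_inverse by metis

lemma isoc_Cel [simp]: "isoc B \<alpha> \<Longrightarrow> \<alpha> \<in> Cel B"
  and inv2_Cel [simp]: "isoc B \<alpha> \<Longrightarrow> inv2 B \<alpha> \<in> Cel B"
  and inv2_Dom [simp]: "isoc B \<alpha> \<Longrightarrow> Dom B (inv2 B \<alpha>) = Cod B \<alpha>"
  and inv2_Cod [simp]: "isoc B \<alpha> \<Longrightarrow> Cod B (inv2 B \<alpha>) = Dom B \<alpha>"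
  and inv2_left [simp]: "isoc B \<alpha> \<Longrightarrow> inv2 B \<alpha> \<cdot> \<alpha> = Id2 B (Dom B \<alpha>)"
  and inv2_right [simp]: "isoc B \<alpha> \<Longrightarrow> \<alpha> \<cdot> inv2 B \<alpha> = Id2 B (Cod B \<alpha>)"
  using inverse2_inv2 unfolding inverse2_def hom2_iff by auto

lemma inv2_left' [simp]: "isoc B \<alpha> \<Longrightarrow> \<beta> \<in> Cel B \<Longrightarrow> Cod B \<beta> = Dom B \<alpha> \<Longrightarrow> inv2 B \<alpha> \<cdot> (\<alpha> \<cdot> \<beta>) = \<beta>"
  and inv2_right' [simp]: "isoc B \<alpha> \<Longrightarrow> \<beta> \<in> Cel B \<Longrightarrow> Cod B \<beta> = Cod B \<alpha> \<Longrightarrow> \<alpha> \<cdot> (inv2 B \<alpha> \<cdot> \<beta>) = \<beta>"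
  by (simp_all flip: vassoc)

lemma isoI: "\<lbrakk>\<alpha> \<in> Cel B; \<beta> \<in> Cel B; Dom B \<beta> = Cod B \<alpha>; Cod B \<beta> = Dom B \<alpha>;
    \<beta> \<cdot> \<alpha> = Id2 B (Dom B \<alpha>); \<alpha> \<cdot> \<beta> = Id2 B (Cod B \<alpha>)\<rbrakk> \<Longrightarrow> isoc B \<alpha> \<and> inv2 B \<alpha> = \<beta>"
proof -
  assume "\<alpha> \<in> Cel B" "\<beta> \<in> Cel B" "Dom B \<beta> = Cod B \<alpha>" "Cod B \<beta> = Dom B \<alpha>"
    "\<beta> \<cdot> \<alpha> = Id2 B (Dom B \<alpha>)" "\<alpha> \<cdot> \<beta> = Id2 B (Cod B \<alpha>)"
  then have "inverse2 B \<alpha> \<beta>" unfolding inverse2_def hom2_iff by simp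
  then show ?thesis unfolding isoc_def using inv2_inverse[of \<alpha> \<beta>] by blast
qed

lemma iso2_iff: "\<alpha> \<in> iso2 B f g \<longleftrightarrow> isoc B \<alpha> \<and> Dom B \<alpha> = f \<and> Cod B \<alpha> = g"
  unfolding iso2_def hom2_iff isoc_def inverse2_def by auto

lemma isoc_Id [simp]: "f \<in> Mor B \<Longrightarrow> isoc B (Id2 B f)"
  and inv2_Id [simp]: "f \<in> Mor B \<Longrightarrow> inv2 B (Id2 B f) = Id2 B f"
  using isoI[of "Id2 B f" "Id2 B f"] by auto

lemma isoc_inv2 [simp]: "isoc B \<alpha> \<Longrightarrow> isoc B (inv2 B \<alpha>)"
  and inv2_inv2 [simp]: "isoc B \<alpha> \<Longrightarrow> inv2 B (inv2 B \<alpha>) = \<alpha>"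
  using isoI[of "inv2 B \<alpha>" \<alpha>] by auto

lemma isoc_vcomp [simp]: "isoc B \<alpha> \<Longrightarrow> isoc B \<beta> \<Longrightarrow> Dom B \<beta> = Cod B \<alpha> \<Longrightarrow> isoc B (\<beta> \<cdot> \<alpha>)"
  and inv2_vcomp [simp]: "isoc B \<alpha> \<Longrightarrow> isoc B \<beta> \<Longrightarrow> Dom B \<beta> = Cod B \<alpha>
     \<Longrightarrow> inv2 B (\<beta> \<cdot> \<alpha>) = inv2 B \<alpha> \<cdot> inv2 B \<beta>"
  using isoI[of "\<beta> \<cdot> \<alpha>" "inv2 B \<alpha> \<cdot> inv2 B \<beta>"] by auto

lemma isoc_hcomp [simp]: "isoc B \<alpha> \<Longrightarrow> isoc B \<beta> \<Longrightarrow> isoc B (\<beta> \<star> \<alpha>)"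
  and inv2_hcomp [simp]: "isoc B \<alpha> \<Longrightarrow> isoc B \<beta> \<Longrightarrow> inv2 B (\<beta> \<star> \<alpha>) = inv2 B \<beta> \<star> inv2 B \<alpha>"
  using isoI[of "\<beta> \<star> \<alpha>" "inv2 B \<beta> \<star> inv2 B \<alpha>"] by (auto simp flip: interch)

lemma iso_cancel_left: "isoc B \<gamma> \<Longrightarrow> \<alpha> \<in> Cel B \<Longrightarrow> \<beta> \<in> Cel B \<Longrightarrow> Cod B \<alpha> = Dom B \<gamma> \<Longrightarrow> Cod B \<beta> = Dom B \<gamma>
    \<Longrightarrow> \<gamma> \<cdot> \<alpha> = \<gamma> \<cdot> \<beta> \<Longrightarrow> \<alpha> = \<beta>"
  by (metis inv2_left')

lemma iso_cancel_right: "isoc B \<gamma> \<Longrightarrow> \<alpha> \<in> Cel B \<Longrightarrow> \<beta> \<in> Cel B \<Longrightarrow> Dom B \<alpha> = Cod B \<gamma> \<Longrightarrow> Dom B \<beta> = Cod B \<gamma>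
    \<Longrightarrow> \<alpha> \<cdot> \<gamma> = \<beta> \<cdot> \<gamma> \<Longrightarrow> \<alpha> = \<beta>"
  by (metis inv2_right isoc_Cel isoc_inv2 vassoc inv2_Cel inv2_Cod vcomp_Id_right)

subsection \<open>Associators and unitors\<close>

lemma asc_iso [simp]: "f \<in> Mor B \<Longrightarrow> g \<in> Mor B \<Longrightarrow> h \<in> Mor B \<Longrightarrow> isoc B (asc B h g f)"
  and asc_Dom [simp]: "f \<in> Mor B \<Longrightarrow> g \<in> Mor B \<Longrightarrow> h \<in> Mor B \<Longrightarrow> Dom B (asc B h g f) = (h \<odot> g) \<odot> f"
  and asc_Cod [simp]: "f \<in> Mor B \<Longrightarrow> g \<in> Mor B \<Longrightarrow> h \<in> Mor B \<Longrightarrow> Cod B (asc B h g f) = h \<odot> (g \<odot> f)"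
  using asc_type[OF Mor_hom1 Mor_hom1 Mor_hom1] iso2_iff by auto

lemma lun_iso [simp]: "f \<in> Mor B \<Longrightarrow> isoc B (lun B f)"
  and lun_Dom [simp]: "f \<in> Mor B \<Longrightarrow> Dom B (lun B f) = U \<odot> f"
  and lun_Cod [simp]: "f \<in> Mor B \<Longrightarrow> Cod B (lun B f) = f"
  and run_iso [simp]: "f \<in> Mor B \<Longrightarrow> isoc B (run B f)"
  and run_Dom [simp]: "f \<in> Mor B \<Longrightarrow> Dom B (run B f) = f \<odot> U"
  and run_Cod [simp]: "f \<in> Mor B \<Longrightarrow> Cod B (run B f) = f"
  using lun_type[OF Mor_hom1] run_type[OF Mor_hom1] iso2_iff unfolding mon_unit_def by auto

lemma asc_nat: "\<lbrakk>\<alpha> \<in> Cel B; \<beta> \<in> Cel B; \<gamma> \<in> Cel B\<rbrakk> \<Longrightarrow>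
    asc B (Cod B \<gamma>) (Cod B \<beta>) (Cod B \<alpha>) \<cdot> ((\<gamma> \<star> \<beta>) \<star> \<alpha>) =
    (\<gamma> \<star> (\<beta> \<star> \<alpha>)) \<cdot> asc B (Dom B \<gamma>) (Dom B \<beta>) (Dom B \<alpha>)"
  using asc_natural[of \<alpha> "Dom B \<alpha>" "Cod B \<alpha>" \<beta> "Dom B \<beta>" "Cod B \<beta>" \<gamma> "Dom B \<gamma>" "Cod B \<gamma>"] hom2_iff
  by auto

lemma lun_nat: "\<alpha> \<in> Cel B \<Longrightarrow> lun B (Cod B \<alpha>) \<cdot> (Id2 B U \<star> \<alpha>) = \<alpha> \<cdot> lun B (Dom B \<alpha>)"
  and run_nat: "\<alpha> \<in> Cel B \<Longrightarrow> run B (Cod B \<alpha>) \<cdot> (\<alpha> \<star> Id2 B U) = \<alpha> \<cdot> run B (Dom B \<alpha>)"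
  using lun_natural[OF Mor_hom1, of "Dom B \<alpha>" \<alpha> "Cod B \<alpha>"] run_natural[OF Mor_hom1, of "Dom B \<alpha>" \<alpha> "Cod B \<alpha>"]
    hom2_iff unfolding mon_unit_def by auto

lemma pent: "\<lbrakk>f \<in> Mor B; g \<in> Mor B; h \<in> Mor B; k \<in> Mor B\<rbrakk> \<Longrightarrow>
    (Id2 B k \<star> asc B h g f) \<cdot> asc B k (h \<odot> g) f \<cdot> (asc B k h g \<star> Id2 B f)
              = asc B k h (g \<odot> f) \<cdot> asc B (k \<odot> h) g f"
  using pentagon Mor_hom1 by blast

lemma tri: "\<lbrakk>f \<in> Mor B; g \<in> Mor B\<rbrakk> \<Longrightarrow>
    (Id2 B g \<star> lun B f) \<cdot> asc B g U f = run B g \<star> Id2 B f"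
  using triangle Mor_hom1 unfolding mon_unit_def by blast

text \<open>Naturality of the unitor makes \<alpha> a conjugate, by invertible cells, of its
  whiskering with the unit.\<close>

lemma U_left_faithful: "\<lbrakk>\<alpha> \<in> Cel B; \<beta> \<in> Cel B; Dom B \<alpha> = Dom B \<beta>; Cod B \<alpha> = Cod B \<beta>;
    Id2 B U \<star> \<alpha> = Id2 B U \<star> \<beta>\<rbrakk> \<Longrightarrow> \<alpha> = \<beta>"
  by (rule iso_cancel_right[of "lun B (Dom B \<alpha>)"]) (simp, simp, simp, simp, simp, metis lun_nat)

lemma U_right_faithful: "\<lbrakk>\<alpha> \<in> Cel B; \<beta> \<in> Cel B; Dom B \<alpha> = Dom B \<beta>; Cod B \<alpha> = Cod B \<beta>;
    \<alpha> \<star> Id2 B U = \<beta> \<star> Id2 B U\<rbrakk> \<Longrightarrow> \<alpha> = \<beta>"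
  by (rule iso_cancel_right[of "run B (Dom B \<alpha>)"]) (simp, simp, simp, simp, simp, metis run_nat)

text \<open>Kelly's argument for a unit law that is not among the axioms: after whiskering with one
  more unit, pentagon and triangle apply, and faithfulness takes the unit away again.\<close>

lemma lun_comp: assumes [simp]: "f \<in> Mor B" "g \<in> Mor B"
  shows "lun B (g \<odot> f) \<cdot> asc B U g f = lun B g \<star> Id2 B f"
proof (rule U_left_faithful)
  \<comment> \<open>These two associators complete the three-edge side of the pentagon for U, U, g,
    f; being invertible, they are cancelled at the end.\<close>
  let ?A = "asc B U (U \<odot> g) f \<cdot> (asc B U U g \<star> Id2 B f)"
  have "(Id2 B U \<star> (lun B (g \<odot> f) \<cdot> asc B U g f)) \<cdot> ?A
      = (Id2 B U \<star> lun B (g \<odot> f)) \<cdot> (Id2 B U \<star> asc B U g f) \<cdot> ?A"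
    by (simp add: interch[of "asc B U g f" "lun B (g \<odot> f)" "Id2 B U" "Id2 B U", simplified])
  also have "\<dots> = (Id2 B U \<star> lun B (g \<odot> f)) \<cdot> asc B U U (g \<odot> f) \<cdot> asc B (U \<odot> U) g f"
    using pent[of f g U U] by simp
  also have "\<dots> = (run B U \<star> Id2 B (g \<odot> f)) \<cdot> asc B (U \<odot> U) g f"
    using tri[of "g \<odot> f" U] by (simp flip: vassoc)
  also have "\<dots> = asc B U g f \<cdot> ((run B U \<star> Id2 B g) \<star> Id2 B f)"
    using asc_nat[of "Id2 B f" "Id2 B g" "run B U"] by simp
  also have "\<dots> = asc B U g f \<cdot> (((Id2 B U \<star> lun B g) \<cdot> asc B U U g) \<star> Id2 B f)"
    using tri[of g U] by simp
  also have "\<dots> = asc B U g f \<cdot> ((Id2 B U \<star> lun B g) \<star> Id2 B f) \<cdot> (asc B U U g \<star> Id2 B f)"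
    by (simp add: interch[of "Id2 B f" "Id2 B f" "asc B U U g" "Id2 B U \<star> lun B g", simplified])
  also have "\<dots> = (Id2 B U \<star> (lun B g \<star> Id2 B f)) \<cdot> ?A"
    using asc_nat[of "Id2 B f" "lun B g" "Id2 B U"] by (simp flip: vassoc)
  finally show "Id2 B U \<star> (lun B (g \<odot> f) \<cdot> asc B U g f) = Id2 B U \<star> (lun B g \<star> Id2 B f)"
    using iso_cancel_right[of ?A "Id2 B U \<star> (lun B (g \<odot> f) \<cdot> asc B U g f)" "Id2 B U \<star> (lun B g \<star> Id2 B f)"]
    by simp
qed simp_all

text \<open>The mirror image of \<open>lun_comp\<close>, with the additional unit on the
  right.\<close>

lemma run_comp: assumes [simp]: "f \<in> Mor B" "g \<in> Mor B"
  shows "(Id2 B g \<star> run B f) \<cdot> asc B g f U = run B (g \<odot> f)"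
proof (rule U_right_faithful)
  have "((Id2 B g \<star> lun B U) \<cdot> asc B g U U) = run B g \<star> Id2 B U" using tri[of U g] by simp
  let ?A = "asc B g (f \<odot> U) U \<cdot> (asc B g f U \<star> Id2 B U)"
  let ?R = "Id2 B g \<star> run B f"
  have "asc B g f U \<cdot> ((?R \<cdot> asc B g f U) \<star> Id2 B U) = asc B g f U \<cdot> (?R \<star> Id2 B U) \<cdot> (asc B g f U \<star> Id2 B U)"
    using interch[of "Id2 B U" "Id2 B U" "asc B g f U" ?R] by simp
  also have "\<dots> = (Id2 B g \<star> (run B f \<star> Id2 B U)) \<cdot> ?A"
    using asc_nat[of "Id2 B U" "run B f" "Id2 B g"] by (simp flip: vassoc)
  also have "\<dots> = (Id2 B g \<star> ((Id2 B f \<star> lun B U) \<cdot> asc B f U U)) \<cdot> ?A"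
    using tri[of U f] by simp
  also have "\<dots> = (Id2 B g \<star> (Id2 B f \<star> lun B U)) \<cdot> (Id2 B g \<star> asc B f U U) \<cdot> ?A"
    using interch[of "asc B f U U" "Id2 B f \<star> lun B U" "Id2 B g" "Id2 B g"] by simp
  also have "\<dots> = (Id2 B g \<star> (Id2 B f \<star> lun B U)) \<cdot> asc B g f (U \<odot> U) \<cdot> asc B (g \<odot> f) U U"
    using pent[of U U f g] by simp
  also have "\<dots> = asc B g f U \<cdot> (Id2 B (g \<odot> f) \<star> lun B U) \<cdot> asc B (g \<odot> f) U U"
    using asc_nat[of "lun B U" "Id2 B f" "Id2 B g"] by (simp flip: vassoc)
  also have "\<dots> = asc B g f U \<cdot> (run B (g \<odot> f) \<star> Id2 B U)"
    using tri[of U "g \<odot> f"] by simp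
  finally show "(?R \<cdot> asc B g f U) \<star> Id2 B U = run B (g \<odot> f) \<star> Id2 B U"
    using iso_cancel_left[of "asc B g f U" "(?R \<cdot> asc B g f U) \<star> Id2 B U" "run B (g \<odot> f) \<star> Id2 B U"] by simp
qed simp_all

text \<open>Naturality of the left unitor at itself identifies the unitor of U U with a whiskered
  unitor; then \<open>lun_comp\<close> and the triangle have a side in common. The equality is what
  makes gluing two empty lists unambiguous.\<close>

lemma lun_U_eq_run_U: "lun B U = run B U"
proof (rule U_left_faithful)
  have lunUU: "lun B (U \<odot> U) = Id2 B U \<star> lun B U"
    using lun_nat[of "lun B U"] iso_cancel_left[of "lun B U" "Id2 B U \<star> lun B U" "lun B (U \<odot> U)"] by simp
  have "(Id2 B U \<star> lun B U) \<cdot> asc B U U U = lun B U \<star> Id2 B U" 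
    using lun_comp[of U U] lunUU by simp
  then have "lun B U \<star> Id2 B U = run B U \<star> Id2 B U" using tri[of U U] by simp
  then have "lun B U = run B U" using U_right_faithful[of "lun B U" "run B U"] by simp
  then show "Id2 B U \<star> lun B U = Id2 B U \<star> run B U" by simp
qed simp_all

end

text \<open>
  Unlike \<^const>\<open>path\<close> and \<^const>\<open>glue\<close>, the following also treat the empty list, as the
  unit. Ill-typed composites are sent to an absorbing value \<open>Null\<close>, which makes
  associativity of both products unconditional.
\<close>

definition pth :: "('o, 'm, 'c) bicat \<Rightarrow> 'm list \<Rightarrow> 'm" where
  "pth B us = (if us = [] then mon_unit B else path B us)"

definition glu :: "('o, 'm, 'c) bicat \<Rightarrow> 'm list \<Rightarrow> 'm list \<Rightarrow> 'c" where
  "glu B us vs = (if us = [] then lun B (pth B vs) else if vs = [] then run B (pth B us) else glue B us vs)"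

datatype ('m, 'c) dia = Null | Dia "'m list" 'c "'m list"

fun dsrc :: "('m, 'c) dia \<Rightarrow> 'm list" where
  "dsrc Null = []" | "dsrc (Dia us \<alpha> vs) = us"

fun dtrg :: "('m, 'c) dia \<Rightarrow> 'm list" where
  "dtrg Null = []" | "dtrg (Dia us \<alpha> vs) = vs"

fun cell :: "('m, 'c) dia \<Rightarrow> 'c" where
  "cell Null = undefined" | "cell (Dia us \<alpha> vs) = \<alpha>"

fun valid :: "('o, 'm, 'c) bicat \<Rightarrow> ('m, 'c) dia \<Rightarrow> bool" where
  "valid B Null \<longleftrightarrow> False"
| "valid B (Dia us \<alpha> vs) \<longleftrightarrow> set us \<subseteq> Mor B \<and> set vs \<subseteq> Mor B \<and> \<alpha> \<in> hom2 B (pth B us) (pth B vs)"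

definition seq :: "('o, 'm, 'c) bicat \<Rightarrow> ('m, 'c) dia \<Rightarrow> ('m, 'c) dia \<Rightarrow> ('m, 'c) dia"
  (infixr ";;\<index>" 55) where
  "f ;;\<^bsub>B\<^esub> g = (if valid B f \<and> valid B g \<and> dtrg f = dsrc g
     then Dia (dsrc f) (cell g \<cdot>\<^bsub>B\<^esub> cell f) (dtrg g) else Null)"

definition ten :: "('o, 'm, 'c) bicat \<Rightarrow> ('m, 'c) dia \<Rightarrow> ('m, 'c) dia \<Rightarrow> ('m, 'c) dia"
  (infixr "\<otimes>\<index>" 70) where
  "f \<otimes>\<^bsub>B\<^esub> g = (if valid B f \<and> valid B g
     then Dia (dsrc f @ dsrc g) (glu B (dtrg f) (dtrg g) \<cdot>\<^bsub>B\<^esub> (cell f \<star>\<^bsub>B\<^esub> cell g)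
            \<cdot>\<^bsub>B\<^esub> inv2 B (glu B (dsrc f) (dsrc g))) (dtrg f @ dtrg g) else Null)"

definition idd :: "('o, 'm, 'c) bicat \<Rightarrow> 'm list \<Rightarrow> ('m, 'c) dia" where
  "idd B us = (if set us \<subseteq> Mor B then Dia us (Id2 B (pth B us)) us else Null)"

definition wh :: "('o, 'm, 'c) bicat \<Rightarrow> 'm list \<Rightarrow> ('m, 'c) dia \<Rightarrow> 'm list \<Rightarrow> ('m, 'c) dia" where
  "wh B us f vs = idd B us \<otimes>\<^bsub>B\<^esub> f \<otimes>\<^bsub>B\<^esub> idd B vs"

text \<open>Not sent to \<open>Null\<close> when f fails to be invertible, so that the endpoints of
  an inverse hold without a side condition.\<close>

definition dinv :: "('o, 'm, 'c) bicat \<Rightarrow> ('m, 'c) dia \<Rightarrow> ('m, 'c) dia" where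
  "dinv B f = Dia (dtrg f) (inv2 B (cell f)) (dsrc f)"

definition diso :: "('o, 'm, 'c) bicat \<Rightarrow> ('m, 'c) dia \<Rightarrow> bool" where
  "diso B f \<longleftrightarrow> valid B f \<and> isoc B (cell f)"

section \<open>Products of lists and coherence of rebracketing\<close>

context monoidal_bicat begin

lemma pth_Nil [simp]: "pth B [] = U"
  and pth_single [simp]: "pth B [u] = u"
  and pth_Cons: "us \<noteq> [] \<Longrightarrow> pth B (u # us) = u \<odot> pth B us"
  unfolding pth_def by (auto simp: neq_Nil_conv)

lemma pth_Mor [simp]: "set us \<subseteq> Mor B \<Longrightarrow> pth B us \<in> Mor B"
proof (induction us)
  case (Cons u us)
  then show ?case by (cases "us = []") (auto simp: pth_Cons)
qed simp

lemma glu_Nil_left [simp]: "glu B [] vs = lun B (pth B vs)"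
  and glu_Nil_right [simp]: "glu B us [] = run B (pth B us)"
  unfolding glu_def by (auto simp: lun_U_eq_run_U)

lemma glu_Cons: "us \<noteq> [] \<Longrightarrow> vs \<noteq> [] \<Longrightarrow>
    glu B (u # us) vs = (Id2 B u \<star> glu B us vs) \<cdot> asc B u (pth B us) (pth B vs)"
  by (cases us) (auto simp: glu_def pth_def)

lemma glu_single: "vs \<noteq> [] \<Longrightarrow> glu B [u] vs = Id2 B (u \<odot> pth B vs)"
  unfolding glu_def pth_def by auto

lemma glu_typed: "set us \<subseteq> Mor B \<Longrightarrow> set vs \<subseteq> Mor B \<Longrightarrow>
   isoc B (glu B us vs) \<and> Dom B (glu B us vs) = pth B us \<odot> pth B vs \<and> Cod B (glu B us vs) = pth B (us @ vs)"
proof (induction us)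
  case Nil then show ?case by (simp add: glu_def)
next
  case (Cons u us)
  show ?case
  proof (cases "vs = [] \<or> us = []")
    case True
    then show ?thesis
    proof (cases "vs = []")
      case True then show ?thesis using Cons.prems pth_Mor[of "u # us"] by (simp add: glu_def del: pth_Mor)
    next
      case False then show ?thesis using True Cons.prems by (auto simp: glu_single pth_Cons)
    qed
  next
    case False
    then show ?thesis using Cons by (auto simp: glu_Cons pth_Cons)
  qed
qed

lemma glu_iso [simp]: "set us \<subseteq> Mor B \<Longrightarrow> set vs \<subseteq> Mor B \<Longrightarrow> isoc B (glu B us vs)"
  and glu_Dom [simp]: "set us \<subseteq> Mor B \<Longrightarrow> set vs \<subseteq> Mor B \<Longrightarrow> Dom B (glu B us vs) = pth B us \<odot> pth B vs"
  and glu_Cod [simp]: "set us \<subseteq> Mor B \<Longrightarrow> set vs \<subseteq> Mor B \<Longrightarrow> Cod B (glu B us vs) = pth B (us @ vs)"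
  using glu_typed by blast+

lemma hcomp_Id_left: "\<alpha> \<in> Cel B \<Longrightarrow> \<beta> \<in> Cel B \<Longrightarrow> Dom B \<beta> = Cod B \<alpha> \<Longrightarrow> f \<in> Mor B
    \<Longrightarrow> Id2 B f \<star> (\<beta> \<cdot> \<alpha>) = (Id2 B f \<star> \<beta>) \<cdot> (Id2 B f \<star> \<alpha>)"
  and hcomp_Id_right: "\<alpha> \<in> Cel B \<Longrightarrow> \<beta> \<in> Cel B \<Longrightarrow> Dom B \<beta> = Cod B \<alpha> \<Longrightarrow> f \<in> Mor B
    \<Longrightarrow> (\<beta> \<cdot> \<alpha>) \<star> Id2 B f = (\<beta> \<star> Id2 B f) \<cdot> (\<alpha> \<star> Id2 B f)"
  using interch[of \<alpha> \<beta> "Id2 B f" "Id2 B f"] interch[of "Id2 B f" "Id2 B f" \<alpha> \<beta>] by auto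

text \<open>Gluing three lists does not depend on the order. In the induction the head u is carried
  across by naturality of the associator, and each head costs one pentagon.\<close>

lemma glu_coherence_ne:
  assumes "us \<noteq> []" and ne [simp]: "vs \<noteq> []" "ws \<noteq> []"
    and us: "set us \<subseteq> Mor B" and M [simp]: "set vs \<subseteq> Mor B" "set ws \<subseteq> Mor B"
  shows "glu B (us @ vs) ws \<cdot> (glu B us vs \<star> Id2 B (pth B ws)) =
     glu B us (vs @ ws) \<cdot> (Id2 B (pth B us) \<star> glu B vs ws) \<cdot> asc B (pth B us) (pth B vs) (pth B ws)"
  using assms(1) us
proof (induction us rule: list_nonempty_induct)
  case (single u)
  then show ?case by (simp add: glu_single glu_Cons)
next
  case (cons u us)
  have [simp]: "u \<in> Mor B" "set us \<subseteq> Mor B" and ne' [simp]: "us \<noteq> []" using cons by auto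
  let ?p = "pth B us" and ?v = "pth B vs" and ?w = "pth B ws"
  have "glu B ((u # us) @ vs) ws \<cdot> (glu B (u # us) vs \<star> Id2 B ?w)
     = (Id2 B u \<star> glu B (us @ vs) ws) \<cdot> (asc B u (pth B (us @ vs)) ?w
        \<cdot> ((Id2 B u \<star> glu B us vs) \<star> Id2 B ?w)) \<cdot> (asc B u ?p ?v \<star> Id2 B ?w)"
    by (simp add: glu_Cons hcomp_Id_right)
  also have "asc B u (pth B (us @ vs)) ?w \<cdot> ((Id2 B u \<star> glu B us vs) \<star> Id2 B ?w)
      = (Id2 B u \<star> (glu B us vs \<star> Id2 B ?w)) \<cdot> asc B u (?p \<odot> ?v) ?w"
    using asc_nat[of "Id2 B ?w" "glu B us vs" "Id2 B u"] by simp
  also have "(Id2 B u \<star> glu B (us @ vs) ws) \<cdot> ((Id2 B u \<star> (glu B us vs \<star> Id2 B ?w)) \<cdot> asc B u (?p \<odot> ?v) ?w)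
        \<cdot> (asc B u ?p ?v \<star> Id2 B ?w)
      = (Id2 B u \<star> (glu B (us @ vs) ws \<cdot> (glu B us vs \<star> Id2 B ?w))) \<cdot> asc B u (?p \<odot> ?v) ?w
        \<cdot> (asc B u ?p ?v \<star> Id2 B ?w)"
    by (simp add: hcomp_Id_left)
  also have "glu B (us @ vs) ws \<cdot> (glu B us vs \<star> Id2 B ?w) =
     glu B us (vs @ ws) \<cdot> (Id2 B ?p \<star> glu B vs ws) \<cdot> asc B ?p ?v ?w"
    using cons.IH by simp
  also have "(Id2 B u \<star> (glu B us (vs @ ws) \<cdot> (Id2 B ?p \<star> glu B vs ws) \<cdot> asc B ?p ?v ?w))
        \<cdot> asc B u (?p \<odot> ?v) ?w \<cdot> (asc B u ?p ?v \<star> Id2 B ?w)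
      = (Id2 B u \<star> glu B us (vs @ ws)) \<cdot> (Id2 B u \<star> (Id2 B ?p \<star> glu B vs ws))
        \<cdot> (Id2 B u \<star> asc B ?p ?v ?w) \<cdot> asc B u (?p \<odot> ?v) ?w \<cdot> (asc B u ?p ?v \<star> Id2 B ?w)"
    by (simp add: hcomp_Id_left)
  also have "\<dots> = (Id2 B u \<star> glu B us (vs @ ws)) \<cdot> ((Id2 B u \<star> (Id2 B ?p \<star> glu B vs ws))
        \<cdot> asc B u ?p (?v \<odot> ?w)) \<cdot> asc B (u \<odot> ?p) ?v ?w"
    using pent[of ?w ?v ?p u] by simp
  also have "(Id2 B u \<star> (Id2 B ?p \<star> glu B vs ws)) \<cdot> asc B u ?p (?v \<odot> ?w)
      = asc B u ?p (pth B (vs @ ws)) \<cdot> (Id2 B (u \<odot> ?p) \<star> glu B vs ws)"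
    using asc_nat[of "glu B vs ws" "Id2 B ?p" "Id2 B u"] by simp
  finally show ?case by (simp add: glu_Cons pth_Cons)
qed

text \<open>An empty list brings in a unitor. Depending on whether it is the first, the second or
  the third, the claim becomes \<open>lun_comp\<close>, the triangle or
  \<open>run_comp\<close>.\<close>

lemma glu_coherence:
  assumes M [simp]: "set us \<subseteq> Mor B" "set vs \<subseteq> Mor B" "set ws \<subseteq> Mor B"
  shows "glu B (us @ vs) ws \<cdot> (glu B us vs \<star> Id2 B (pth B ws)) =
     glu B us (vs @ ws) \<cdot> (Id2 B (pth B us) \<star> glu B vs ws) \<cdot> asc B (pth B us) (pth B vs) (pth B ws)"
proof -
  consider "us = []" | "us \<noteq> []" "vs = []" | "us \<noteq> []" "vs \<noteq> []" "ws = []" | "us \<noteq> []" "vs \<noteq> []" "ws \<noteq> []"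
    by blast
  then show ?thesis
  proof cases
    case 1
    have "lun B (pth B (vs @ ws)) \<cdot> (Id2 B U \<star> glu B vs ws) \<cdot> asc B U (pth B vs) (pth B ws)
        = glu B vs ws \<cdot> lun B (pth B vs \<odot> pth B ws) \<cdot> asc B U (pth B vs) (pth B ws)"
      using lun_nat[of "glu B vs ws"] by (simp flip: vassoc)
    also have "\<dots> = glu B vs ws \<cdot> (lun B (pth B vs) \<star> Id2 B (pth B ws))"
      by (simp add: lun_comp)
    finally show ?thesis using 1 by (simp add: glu_def[of _ "[]"])
  next
    case 2
    then show ?thesis
      using tri[of "pth B ws" "pth B us"] by (simp add: glu_def[of _ "[]"] glu_def[of _ _ "[]"])
  next
    case 3
    have "run B (pth B (us @ vs)) \<cdot> (glu B us vs \<star> Id2 B U) = glu B us vs \<cdot> run B (pth B us \<odot> pth B vs)"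
      using run_nat[of "glu B us vs"] by simp
    also have "\<dots> = glu B us vs \<cdot> (Id2 B (pth B us) \<star> run B (pth B vs)) \<cdot> asc B (pth B us) (pth B vs) U"
      by (simp add: run_comp)
    finally show ?thesis using 3 by (simp add: glu_def[of _ _ "[]"])
  qed (simp add: glu_coherence_ne)
qed

text \<open>The form taken by coherence at the source of a tensor product, where gluing is undone;
  there the associator arrives from the target.\<close>

lemma glu_coherence_inv:
  assumes [simp]: "set us \<subseteq> Mor B" "set vs \<subseteq> Mor B" "set ws \<subseteq> Mor B"
  shows "asc B (pth B us) (pth B vs) (pth B ws) \<cdot> (inv2 B (glu B us vs) \<star> Id2 B (pth B ws)) \<cdot> inv2 B (glu B (us @ vs) ws)
    = (Id2 B (pth B us) \<star> inv2 B (glu B vs ws)) \<cdot> inv2 B (glu B us (vs @ ws))"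
proof -
  let ?a = "asc B (pth B us) (pth B vs) (pth B ws)"
  let ?x = "glu B us (vs @ ws) \<cdot> (Id2 B (pth B us) \<star> glu B vs ws)"
  have "inv2 B (?x \<cdot> ?a) = (inv2 B (glu B us vs) \<star> Id2 B (pth B ws)) \<cdot> inv2 B (glu B (us @ vs) ws)"
    using glu_coherence[of us vs ws] by (simp flip: glu_coherence)
  then have "?a \<cdot> inv2 B ?a \<cdot> inv2 B ?x
      = ?a \<cdot> (inv2 B (glu B us vs) \<star> Id2 B (pth B ws)) \<cdot> inv2 B (glu B (us @ vs) ws)"
    by simp
  then show ?thesis by simp
qed

subsection \<open>The strict monoidal category of diagrams\<close>

lemma valid_Dia: "valid B (Dia us \<alpha> vs) \<longleftrightarrow> set us \<subseteq> Mor B \<and> set vs \<subseteq> Mor B \<and> \<alpha> \<in> Cel B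
    \<and> Dom B \<alpha> = pth B us \<and> Cod B \<alpha> = pth B vs"
  by (simp add: hom2_iff)

declare valid.simps(2) [simp del]

lemma validD: assumes "valid B f"
  shows valid_cell: "cell f \<in> Cel B" and valid_Dom: "Dom B (cell f) = pth B (dsrc f)"
    and valid_Cod: "Cod B (cell f) = pth B (dtrg f)" and valid_dsrc: "set (dsrc f) \<subseteq> Mor B"
    and valid_dtrg: "set (dtrg f) \<subseteq> Mor B" and valid_eq: "f = Dia (dsrc f) (cell f) (dtrg f)"
  using assms by (cases f; auto simp: valid_Dia)+

lemmas valids = valid_cell valid_Dom valid_Cod valid_dsrc valid_dtrg

lemma Null_valid: "\<not> valid B f \<Longrightarrow> f ;;g = Null" "\<not> valid B f \<Longrightarrow> g ;; f = Null"
  "\<not> valid B f \<Longrightarrow> f \<otimes> g = Null" "\<not> valid B f \<Longrightarrow> g \<otimes> f = Null"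
  unfolding seq_def ten_def by auto

lemma valid_seq [simp]: "valid B (f ;; g) \<longleftrightarrow> valid B f \<and> valid B g \<and> dtrg f = dsrc g"
  by (auto simp: seq_def valid_Dia valids)

lemma dsrc_seq [simp]: "valid B f \<Longrightarrow> valid B g \<Longrightarrow> dtrg f = dsrc g \<Longrightarrow> dsrc (f ;; g) = dsrc f"
  and dtrg_seq [simp]: "valid B f \<Longrightarrow> valid B g \<Longrightarrow> dtrg f = dsrc g \<Longrightarrow> dtrg (f ;; g) = dtrg g"
  and cell_seq: "valid B f \<Longrightarrow> valid B g \<Longrightarrow> dtrg f = dsrc g \<Longrightarrow> cell (f ;; g) = cell g \<cdot> cell f"
  by (auto simp: seq_def)

lemma valid_ten [simp]: "valid B (f \<otimes> g) \<longleftrightarrow> valid B f \<and> valid B g"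
  by (auto simp: ten_def valid_Dia valids)

lemma dsrc_ten [simp]: "valid B f \<Longrightarrow> valid B g \<Longrightarrow> dsrc (f \<otimes> g) = dsrc f @ dsrc g"
  and dtrg_ten [simp]: "valid B f \<Longrightarrow> valid B g \<Longrightarrow> dtrg (f \<otimes> g) = dtrg f @ dtrg g"
  and cell_ten: "valid B f \<Longrightarrow> valid B g \<Longrightarrow>
    cell (f \<otimes> g) = glu B (dtrg f) (dtrg g) \<cdot> (cell f \<star> cell g) \<cdot> inv2 B (glu B (dsrc f) (dsrc g))"
  by (auto simp: ten_def)

lemma valid_idd [simp]: "valid B (idd B us) \<longleftrightarrow> set us \<subseteq> Mor B"
  by (auto simp: idd_def valid_Dia)

lemma dsrc_idd [simp]: "set us \<subseteq> Mor B \<Longrightarrow> dsrc (idd B us) = us"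
  and dtrg_idd [simp]: "set us \<subseteq> Mor B \<Longrightarrow> dtrg (idd B us) = us"
  and cell_idd [simp]: "set us \<subseteq> Mor B \<Longrightarrow> cell (idd B us) = Id2 B (pth B us)"
  by (auto simp: idd_def)

lemma dia_eqI: "valid B f \<Longrightarrow> valid B g \<Longrightarrow> dsrc f = dsrc g \<Longrightarrow> dtrg f = dtrg g \<Longrightarrow> cell f = cell g \<Longrightarrow> f = g"
  using valid_eq by metis

lemma seq_assoc [simp]: "(f ;; g) ;; h = f ;; (g ;; h)"
proof (cases "valid B f \<and> valid B g \<and> valid B h \<and> dtrg f = dsrc g \<and> dtrg g = dsrc h")
  case True
  then show ?thesis by (intro dia_eqI) (auto simp: cell_seq valids)
next
  case False
  have "\<not> (valid B (f ;; g) \<and> valid B h \<and> dtrg (f ;; g) = dsrc h)"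
    "\<not> (valid B f \<and> valid B (g ;; h) \<and> dtrg f = dsrc (g ;; h))"
    using False by (metis valid_seq dsrc_seq dtrg_seq)+
  then have "(f ;; g) ;; h = Null" "f ;; (g ;; h) = Null"
    unfolding seq_def[of _ "f ;; g"] seq_def[of _ _ "g ;; h"] by (simp_all only: if_False)
  then show ?thesis by simp
qed

lemma seq_idd_left [simp]: "valid B f \<Longrightarrow> dsrc f = us \<Longrightarrow> idd B us ;; f = f"
  and seq_idd_right [simp]: "valid B f \<Longrightarrow> dtrg f = us \<Longrightarrow> f ;; idd B us = f"
  by (rule dia_eqI; force simp: cell_seq valids)+

text \<open>Strict although \<odot> is not: coherence of gluing at the target produces an
  associator, naturality moves it past the three cells, and coherence at the source absorbs
  it.\<close>

lemma ten_assoc: "(f \<otimes> g) \<otimes> h = f \<otimes> (g \<otimes> h)"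
proof (cases "valid B f \<and> valid B g \<and> valid B h")
  case True
  note [simp] = valids
  have [simp]: "valid B f" "valid B g" "valid B h" using True by auto
  let ?\<alpha> = "cell f" and ?\<beta> = "cell g" and ?\<gamma> = "cell h"
  let ?u = "dsrc f" and ?v = "dsrc g" and ?w = "dsrc h"
  let ?u' = "dtrg f" and ?v' = "dtrg g" and ?w' = "dtrg h"
  have "cell ((f \<otimes> g) \<otimes> h) = (glu B (?u' @ ?v') ?w' \<cdot> (glu B ?u' ?v' \<star> Id2 B (pth B ?w')))
      \<cdot> ((?\<alpha> \<star> ?\<beta>) \<star> ?\<gamma>) \<cdot> (inv2 B (glu B ?u ?v) \<star> Id2 B (pth B ?w)) \<cdot> inv2 B (glu B (?u @ ?v) ?w)"
  proof -
    have "(glu B ?u' ?v' \<cdot> (?\<alpha> \<star> ?\<beta>) \<cdot> inv2 B (glu B ?u ?v)) \<star> ?\<gamma>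
       = (glu B ?u' ?v' \<star> Id2 B (pth B ?w')) \<cdot> ((?\<alpha> \<star> ?\<beta>) \<star> ?\<gamma>) \<cdot> (inv2 B (glu B ?u ?v) \<star> Id2 B (pth B ?w))"
      by (simp flip: interch)
    then show ?thesis by (simp add: cell_ten)
  qed
  also have "\<dots> = glu B ?u' (?v' @ ?w') \<cdot> (Id2 B (pth B ?u') \<star> glu B ?v' ?w') \<cdot>
     (asc B (pth B ?u') (pth B ?v') (pth B ?w') \<cdot> ((?\<alpha> \<star> ?\<beta>) \<star> ?\<gamma>))
      \<cdot> (inv2 B (glu B ?u ?v) \<star> Id2 B (pth B ?w)) \<cdot> inv2 B (glu B (?u @ ?v) ?w)"
    by (subst glu_coherence) simp_all
  also have "asc B (pth B ?u') (pth B ?v') (pth B ?w') \<cdot> ((?\<alpha> \<star> ?\<beta>) \<star> ?\<gamma>)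
     = (?\<alpha> \<star> (?\<beta> \<star> ?\<gamma>)) \<cdot> asc B (pth B ?u) (pth B ?v) (pth B ?w)"
    using asc_nat[of ?\<gamma> ?\<beta> ?\<alpha>] by simp
  also have "glu B ?u' (?v' @ ?w') \<cdot> (Id2 B (pth B ?u') \<star> glu B ?v' ?w') \<cdot>
     ((?\<alpha> \<star> (?\<beta> \<star> ?\<gamma>)) \<cdot> asc B (pth B ?u) (pth B ?v) (pth B ?w))
      \<cdot> (inv2 B (glu B ?u ?v) \<star> Id2 B (pth B ?w)) \<cdot> inv2 B (glu B (?u @ ?v) ?w)
    = glu B ?u' (?v' @ ?w') \<cdot> (Id2 B (pth B ?u') \<star> glu B ?v' ?w') \<cdot>
     (?\<alpha> \<star> (?\<beta> \<star> ?\<gamma>)) \<cdot> (asc B (pth B ?u) (pth B ?v) (pth B ?w)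
      \<cdot> (inv2 B (glu B ?u ?v) \<star> Id2 B (pth B ?w)) \<cdot> inv2 B (glu B (?u @ ?v) ?w))"
    by simp
  also have "\<dots> = glu B ?u' (?v' @ ?w') \<cdot> (Id2 B (pth B ?u') \<star> glu B ?v' ?w') \<cdot>
     (?\<alpha> \<star> (?\<beta> \<star> ?\<gamma>)) \<cdot> (Id2 B (pth B ?u) \<star> inv2 B (glu B ?v ?w)) \<cdot> inv2 B (glu B ?u (?v @ ?w))"
    by (subst glu_coherence_inv) simp_all
  also have "\<dots> = cell (f \<otimes> (g \<otimes> h))"
  proof -
    have "?\<alpha> \<star> (glu B ?v' ?w' \<cdot> (?\<beta> \<star> ?\<gamma>) \<cdot> inv2 B (glu B ?v ?w))
       = (Id2 B (pth B ?u') \<star> glu B ?v' ?w') \<cdot> (?\<alpha> \<star> (?\<beta> \<star> ?\<gamma>)) \<cdot> (Id2 B (pth B ?u) \<star> inv2 B (glu B ?v ?w))"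
      by (simp flip: interch)
    then show ?thesis by (simp add: cell_ten)
  qed
  finally show ?thesis by (intro dia_eqI) simp_all
next
  case False
  then show ?thesis by (auto simp: ten_def[of _ f] ten_def[of _ _ h])
qed

lemma ten_seq: assumes "valid B (f ;; g)" "valid B (h ;; k)"
  shows "(f ;; g) \<otimes> (h ;; k) = (f \<otimes> h) ;; (g \<otimes> k)"
proof -
  note [simp] = valids
  have [simp]: "valid B f" "valid B g" "valid B h" "valid B k" "dtrg f = dsrc g" "dtrg h = dsrc k" using assms by auto
  show ?thesis by (intro dia_eqI) (simp_all add: cell_ten cell_seq interch)
qed

lemma ten_idd [simp]: "idd B us \<otimes> idd B vs = idd B (us @ vs)"
proof (cases "set us \<subseteq> Mor B \<and> set vs \<subseteq> Mor B")
  case True then show ?thesis by (intro dia_eqI) (simp_all add: cell_ten)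
qed (auto simp: ten_def idd_def)

text \<open>Gluing with the empty list is a unitor, so naturality of the unitors turns them into
  strict units.\<close>

lemma idd_Nil_ten [simp]: "valid B f \<Longrightarrow> idd B [] \<otimes> f = f"
  and ten_idd_Nil [simp]: "valid B f \<Longrightarrow> f \<otimes> idd B [] = f"
proof -
  assume [simp]: "valid B f"
  note [simp] = valids
  have "lun B (pth B (dtrg f)) \<cdot> (Id2 B U \<star> cell f) \<cdot> inv2 B (lun B (pth B (dsrc f))) = cell f"
    "run B (pth B (dtrg f)) \<cdot> (cell f \<star> Id2 B U) \<cdot> inv2 B (run B (pth B (dsrc f))) = cell f"
    using lun_nat[of "cell f"] run_nat[of "cell f"] by (simp_all flip: vassoc, simp_all)
  then show "idd B [] \<otimes> f = f" "f \<otimes> idd B [] = f"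
    by (intro dia_eqI; simp add: cell_ten)+
qed

end

text \<open>With the unit constraint at the empty list, the image of a diagram that starts at the
  empty list starts there again.\<close>

definition pfl :: "('o, 'm, 'c, 'o2, 'm2, 'c2) psf \<Rightarrow> 'm list \<Rightarrow> 'c2" where
  "pfl F us = (if us = [] then pfu F (the_elem (Obj (PDom F))) else pflist F us)"

fun img :: "('o, 'm, 'c, 'o2, 'm2, 'c2) psf \<Rightarrow> ('m, 'c) dia \<Rightarrow> ('m2, 'c2) dia" where
  "img F Null = Null"
| "img F (Dia us \<alpha> vs) = Dia (map (pf1 F) us)
     (inv2 (PCod F) (pfl F vs) \<cdot>\<^bsub>PCod F\<^esub> pf2 F \<alpha> \<cdot>\<^bsub>PCod F\<^esub> pfl F us) (map (pf1 F) vs)"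

lemma dsrc_img [simp]: "dsrc (img F f) = map (pf1 F) (dsrc f)"
  and dtrg_img [simp]: "dtrg (img F f) = map (pf1 F) (dtrg f)"
  by (cases f; simp)+

definition dhom :: "('o, 'm, 'c) bicat \<Rightarrow> 'm list \<Rightarrow> 'm list \<Rightarrow> ('m, 'c) dia set" where
  "dhom B us vs = {f. valid B f \<and> dsrc f = us \<and> dtrg f = vs}"

text \<open>An identity cell regarded as a change of bracketing: it collapses a list to its product
  and, for the empty list, creates the unit object.\<close>

definition dfold :: "('o, 'm, 'c) bicat \<Rightarrow> 'm list \<Rightarrow> ('m, 'c) dia" where
  "dfold B us = Dia us (Id2 B (pth B us)) [pth B us]"

context monoidal_bicat begin

lemma homI: "valid B f \<Longrightarrow> dsrc f = us \<Longrightarrow> dtrg f = vs \<Longrightarrow> f \<in> dhom B us vs"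
  unfolding dhom_def by simp

lemma homD: assumes "f \<in> dhom B us vs" shows "valid B f" "dsrc f = us" "dtrg f = vs"
  using assms unfolding dhom_def by auto

lemma valid_wh [simp]: "valid B (wh B us f vs) \<longleftrightarrow> set us \<subseteq> Mor B \<and> valid B f \<and> set vs \<subseteq> Mor B"
  unfolding wh_def by simp

lemma dsrc_wh [simp]: "set us \<subseteq> Mor B \<Longrightarrow> valid B f \<Longrightarrow> set vs \<subseteq> Mor B \<Longrightarrow> dsrc (wh B us f vs) = us @ dsrc f @ vs"
  and dtrg_wh [simp]: "set us \<subseteq> Mor B \<Longrightarrow> valid B f \<Longrightarrow> set vs \<subseteq> Mor B \<Longrightarrow> dtrg (wh B us f vs) = us @ dtrg f @ vs"
  unfolding wh_def by simp_all

lemma wh_Null: "\<not> (set us \<subseteq> Mor B \<and> valid B f \<and> set vs \<subseteq> Mor B) \<Longrightarrow> wh B us f vs = Null"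
  unfolding wh_def idd_def ten_def by auto

lemma seq_Null: "\<not> (valid B f \<and> valid B g \<and> dtrg f = dsrc g) \<Longrightarrow> f ;; g = Null"
  unfolding seq_def by (simp only: if_False)

lemma wh_seq: "wh B us (f ;; g) vs = wh B us f vs ;; wh B us g vs"
proof (cases "set us \<subseteq> Mor B \<and> set vs \<subseteq> Mor B \<and> valid B f \<and> valid B g \<and> dtrg f = dsrc g")
  case True
  then have "idd B us \<otimes> ((f ;; g) \<otimes> (idd B vs ;; idd B vs)) = (idd B us ;; idd B us) \<otimes> ((f \<otimes> idd B vs) ;; (g \<otimes> idd B vs))"
    by (subst ten_seq) simp_all
  also have "\<dots> = (idd B us \<otimes> (f \<otimes> idd B vs)) ;; (idd B us \<otimes> (g \<otimes> idd B vs))"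
    using True by (subst ten_seq) simp_all
  finally show ?thesis unfolding wh_def using True by simp
next
  case False
  then have "wh B us (f ;; g) vs = Null" by (intro wh_Null) auto
  moreover have "\<not> (valid B (wh B us f vs) \<and> valid B (wh B us g vs) \<and> dtrg (wh B us f vs) = dsrc (wh B us g vs))"
    using False by auto
  ultimately show ?thesis using seq_Null by metis
qed

lemma wh_wh [simp]: "wh B us (wh B us' f vs') vs = wh B (us @ us') f (vs' @ vs)"
proof -
  have "idd B us \<otimes> ((idd B us' \<otimes> (f \<otimes> idd B vs')) \<otimes> idd B vs)
     = (idd B us \<otimes> idd B us') \<otimes> (f \<otimes> (idd B vs' \<otimes> idd B vs))"
    by (simp only: ten_assoc)
  then show ?thesis unfolding wh_def by simp
qed

lemma wh_idd [simp]: "wh B us (idd B ws) vs = idd B (us @ ws @ vs)"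
  unfolding wh_def by simp

lemma wh_Nil [simp]: "valid B f \<Longrightarrow> wh B [] f [] = f"
  unfolding wh_def by simp

text \<open>Both orders compute the same tensor product of the two cells, with ws counted to the
  second factor.\<close>

lemma interchange_wh:
  assumes "f \<in> dhom B a a'" "g \<in> dhom B b b'"
  shows "wh B us f (ws @ b @ vs) ;; wh B (us @ a' @ ws) g vs = wh B (us @ a @ ws) g vs ;; wh B us f (ws @ b' @ vs)"
proof (cases "set us \<subseteq> Mor B \<and> set ws \<subseteq> Mor B \<and> set vs \<subseteq> Mor B")
  case True
  note [simp] = homD[OF assms(1)] homD[OF assms(2)] 
  have [simp]: "set a \<subseteq> Mor B" "set a' \<subseteq> Mor B" "set b \<subseteq> Mor B" "set b' \<subseteq> Mor B"
    using valid_dsrc[of f] valid_dtrg[of f] valid_dsrc[of g] valid_dtrg[of g] by auto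
  have [simp]: "set us \<subseteq> Mor B" "set ws \<subseteq> Mor B" "set vs \<subseteq> Mor B" using True by auto
  let ?g = "wh B ws g vs" let ?f = "wh B us f []"
  have "(?f \<otimes> idd B (ws @ b @ vs)) ;; (idd B (us @ a') \<otimes> ?g) = ?f \<otimes> ?g"
    by (subst ten_seq[symmetric]) simp_all
  also have "\<dots> = (idd B (us @ a) \<otimes> ?g) ;; (?f \<otimes> idd B (ws @ b' @ vs))"
    by (subst ten_seq[symmetric]) simp_all
  finally have "(?f \<otimes> idd B (ws @ b @ vs)) ;; (idd B (us @ a') \<otimes> ?g) = (idd B (us @ a) \<otimes> ?g) ;; (?f \<otimes> idd B (ws @ b' @ vs))" .
  moreover have "?f \<otimes> idd B xs = wh B us f xs" "idd B xs \<otimes> ?g = wh B (xs @ ws) g vs" for xs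
    unfolding wh_def by (simp_all add: ten_assoc flip: ten_assoc[of "idd B xs"])
  ultimately show ?thesis by simp
next
  case False
  then have "\<not> valid B (wh B us f (ws @ b @ vs))" "\<not> valid B (wh B (us @ a @ ws) g vs)" by auto
  then show ?thesis by (simp add: Null_valid)
qed

lemma ten_wh: assumes "f \<in> dhom B a a'" "g \<in> dhom B b b'"
  shows "f \<otimes> g = wh B [] f b ;; wh B a' g []"
proof -
  note [simp] = homD[OF assms(1)] homD[OF assms(2)] 
  have [simp]: "set a \<subseteq> Mor B" "set a' \<subseteq> Mor B" "set b \<subseteq> Mor B" "set b' \<subseteq> Mor B"
    using valid_dsrc[of f] valid_dtrg[of f] valid_dsrc[of g] valid_dtrg[of g] by auto
  have "(f \<otimes> idd B b) ;; (idd B a' \<otimes> g) = (f ;; idd B a') \<otimes> (idd B b ;; g)"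
    by (subst ten_seq) simp_all
  then show ?thesis by (simp add: wh_def)
qed

lemma seq_cong_right: "f = g \<Longrightarrow> f ;; h = g ;; h" by simp
lemma wh_cong: "f = g \<Longrightarrow> wh B us f vs = wh B us g vs" by simp

subsection \<open>Isomorphisms of diagrams\<close>

lemma iso_valid [simp]: "diso B f \<Longrightarrow> valid B f"
  unfolding diso_def by simp

lemma valid_inv [simp]: "diso B f \<Longrightarrow> valid B (dinv B f)"
  and dsrc_inv [simp]: "dsrc (dinv B f) = dtrg f"
  and dtrg_inv [simp]: "dtrg (dinv B f) = dsrc f"
  and cell_inv [simp]: "cell (dinv B f) = inv2 B (cell f)"
  unfolding diso_def dinv_def by (auto simp: valid_Dia valids)

lemma iso_inv [simp]: "diso B f \<Longrightarrow> diso B (dinv B f)"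
  using valid_inv[of f] unfolding diso_def by simp

lemma inv_inv [simp]: "diso B f \<Longrightarrow> dinv B (dinv B f) = f"
  by (rule dia_eqI) (auto simp: diso_def)

lemma seq_inv [simp]: "diso B f \<Longrightarrow> f ;; dinv B f = idd B (dsrc f)"
  and inv_seq [simp]: "diso B f \<Longrightarrow> dinv B f ;; f = idd B (dtrg f)"
proof -
  assume f: "diso B f"
  then have [simp]: "valid B f" "isoc B (cell f)" unfolding diso_def by auto
  note [simp] = valids f
  show "f ;; dinv B f = idd B (dsrc f)" "dinv B f ;; f = idd B (dtrg f)"
    by (intro dia_eqI; simp add: cell_seq)+
qed

lemma seq_inv' [simp]: "diso B f \<Longrightarrow> valid B g \<Longrightarrow> dsrc f = dsrc g \<Longrightarrow> f ;; (dinv B f ;; g) = g"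
  and inv_seq' [simp]: "diso B f \<Longrightarrow> valid B g \<Longrightarrow> dtrg f = dsrc g \<Longrightarrow> dinv B f ;; (f ;; g) = g"
  by (simp_all add: seq_assoc[symmetric] del: seq_assoc)

lemma iso_cell: assumes "diso B f" shows "isoc B (cell f)"
  using assms unfolding diso_def by simp

lemma iso_idd [simp]: "diso B (idd B us) \<longleftrightarrow> set us \<subseteq> Mor B"
  unfolding diso_def by auto

lemma inv_idd [simp]: "set us \<subseteq> Mor B \<Longrightarrow> dinv B (idd B us) = idd B us"
  by (rule dia_eqI) auto

lemma iso_seq [simp]: "diso B f \<Longrightarrow> diso B g \<Longrightarrow> dtrg f = dsrc g \<Longrightarrow> diso B (f ;; g)"
  unfolding diso_def by (auto simp: cell_seq valids)

lemma iso_ten [simp]: "diso B f \<Longrightarrow> diso B g \<Longrightarrow> diso B (f \<otimes> g)"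
  unfolding diso_def by (auto simp: cell_ten valids)

lemma iso_wh [simp]: "set us \<subseteq> Mor B \<Longrightarrow> set vs \<subseteq> Mor B \<Longrightarrow> diso B f \<Longrightarrow> diso B (wh B us f vs)"
  unfolding wh_def by simp

lemma iso_cancel: "diso B f \<Longrightarrow> valid B g \<Longrightarrow> valid B h \<Longrightarrow> dtrg f = dsrc g \<Longrightarrow> dtrg f = dsrc h
   \<Longrightarrow> f ;; g = f ;; h \<Longrightarrow> g = h"
  using inv_seq' by metis

lemma iso_cancel_post: "diso B f \<Longrightarrow> valid B g \<Longrightarrow> valid B h \<Longrightarrow> dtrg g = dsrc f \<Longrightarrow> dtrg h = dsrc f
   \<Longrightarrow> g ;; f = h ;; f \<Longrightarrow> g = h"
proof -
  assume a: "diso B f" "valid B g" "valid B h" "dtrg g = dsrc f" "dtrg h = dsrc f" "g ;; f = h ;; f"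
  then have "(g ;; f) ;; dinv B f = (h ;; f) ;; dinv B f" by simp
  then show ?thesis using a(1-5) by simp
qed

lemma inv_unique: "diso B f \<Longrightarrow> valid B g \<Longrightarrow> f ;; g = idd B (dsrc f) \<Longrightarrow> dtrg f = dsrc g \<Longrightarrow> dinv B f = g"
  using inv_seq'[of f g] by (metis dsrc_inv dtrg_inv seq_idd_right valid_inv)

lemma inv_seq_eq: "diso B f \<Longrightarrow> diso B g \<Longrightarrow> dtrg f = dsrc g \<Longrightarrow> dinv B (f ;; g) = dinv B g ;; dinv B f"
  by (rule inv_unique) simp_all

lemma inv_wh: "set us \<subseteq> Mor B \<Longrightarrow> set vs \<subseteq> Mor B \<Longrightarrow> diso B f \<Longrightarrow> dinv B (wh B us f vs) = wh B us (dinv B f) vs"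
  using valid_dsrc[of f] by (intro inv_unique) (simp_all flip: wh_seq)

lemma inv_commute:
  assumes "diso B f" "diso B k" "valid B g" "valid B h" "dtrg f = dsrc g" "dtrg h = dsrc k" "f ;; g = h ;; k"
  shows "g ;; dinv B k = dinv B f ;; h"
proof -
  have "dinv B f ;; (f ;; g) ;; dinv B k = dinv B f ;; (h ;; k) ;; dinv B k" using assms(7) by simp
  moreover have "dtrg g = dtrg k" using assms by (metis dtrg_seq iso_valid)
  moreover have "dsrc h = dsrc f" using assms by (metis dsrc_seq iso_valid)
  ultimately show ?thesis using assms(1-6) by simp
qed

subsection \<open>Cells of diagrams on nonempty lists\<close>

text \<open>Products are bracketed to the right, so that a single object in front is glued by an
  identity.\<close>

lemma cell_ten_single: "valid B f \<Longrightarrow> valid B g \<Longrightarrow> dsrc f = [a] \<Longrightarrow> dtrg f = [a'] \<Longrightarrow> dsrc g \<noteq> [] \<Longrightarrow> dtrg g \<noteq> [] \<Longrightarrow>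
    cell (f \<otimes> g) = cell f \<star> cell g"
  using valids[of f] valids[of g] by (simp add: cell_ten glu_single)

lemma cell_wh_Cons:
  assumes [simp]: "valid B f" "set us \<subseteq> Mor B" "set vs \<subseteq> Mor B" "u \<in> Mor B" and "dsrc f \<noteq> []" "dtrg f \<noteq> []"
  shows "cell (wh B (u # us) f vs) = Id2 B u \<star> cell (wh B us f vs)"
proof -
  have "wh B (u # us) f vs = idd B [u] \<otimes> wh B us f vs" unfolding wh_def by (simp flip: ten_assoc)
  then show ?thesis using assms by (simp add: cell_ten_single)
qed

lemma cell_wh_right:
  assumes [simp]: "valid B f" "set vs \<subseteq> Mor B" and "vs \<noteq> []"
  shows "cell (wh B [] f vs) = glu B (dtrg f) vs \<cdot> (cell f \<star> Id2 B (pth B vs)) \<cdot> inv2 B (glu B (dsrc f) vs)"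
  unfolding wh_def by (simp add: cell_ten valids)

lemma valid_single: "valid B (Dia [f] \<alpha> [g]) \<longleftrightarrow> \<alpha> \<in> Cel B \<and> Dom B \<alpha> = f \<and> Cod B \<alpha> = g"
  by (auto simp: valid_Dia)

lemma iso_Dia: "diso B (Dia us \<alpha> vs) \<longleftrightarrow> set us \<subseteq> Mor B \<and> set vs \<subseteq> Mor B \<and> isoc B \<alpha> \<and> Dom B \<alpha> = pth B us \<and> Cod B \<alpha> = pth B vs"
  unfolding diso_def by (auto simp: valid_Dia)

lemma iso_fold [simp]: "diso B (dfold B us) \<longleftrightarrow> set us \<subseteq> Mor B"
  by (auto simp: iso_Dia dfold_def)

lemma valid_fold [simp]: "valid B (dfold B us) \<longleftrightarrow> set us \<subseteq> Mor B"
  by (auto simp: valid_Dia dfold_def)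

lemma dsrc_fold [simp]: "dsrc (dfold B us) = us"
  and dtrg_fold [simp]: "dtrg (dfold B us) = [pth B us]"
  and cell_fold [simp]: "cell (dfold B us) = Id2 B (pth B us)"
  unfolding dfold_def by simp_all

text \<open>Reduces properties of arbitrary diagrams to two cases, bracketings and cells between
  single objects; the axioms of a transformation speak of just these.\<close>

lemma dia_decomp: assumes "valid B f"
  shows "f = dfold B (dsrc f) ;; Dia [pth B (dsrc f)] (cell f) [pth B (dtrg f)] ;; dinv B (dfold B (dtrg f))"
  using valids[OF assms] by (intro dia_eqI) (simp_all add: assms cell_seq valid_single)

lemma fold_single [simp]: "u \<in> Mor B \<Longrightarrow> dfold B [u] = idd B [u]"
  by (rule dia_eqI) auto

lemma fold_Cons: "u \<in> Mor B \<Longrightarrow> set us \<subseteq> Mor B \<Longrightarrow> us \<noteq> [] \<Longrightarrow>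
   dfold B (u # us) = wh B [u] (dfold B us) [] ;; dfold B [u, pth B us]"
  by (rule dia_eqI) (simp_all add: cell_seq cell_wh_Cons pth_Cons)

end

subsection \<open>Images of diagrams under pseudofunctors\<close>

text \<open>The typing of a pseudofunctor without its equations. This is all that
  \<open>img_pcomp\<close> asks of the inner functor and \<open>img_ppair\<close> of both, so
  composites and pairings require no coherence proof.\<close>

locale pre_psf = D: monoidal_bicat D + C: monoidal_bicat C
  for F :: "('o, 'm, 'c, 'o2, 'm2, 'c2) psf" and D :: "('o, 'm, 'c) bicat"
    and C :: "('o2, 'm2, 'c2) bicat" (structure) +
  assumes PDom_is [simp]: "PDom F = D" and PCod_is [simp]: "PCod F = C"
    and pf1_Mor [simp]: "f \<in> Mor D \<Longrightarrow> pf1 F f \<in> Mor C"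
    and pf0_pt: "pf0 F (the_elem (Obj D)) = the_elem (Obj C)"
    and pf2_iso2: "\<alpha> \<in> Cel D \<Longrightarrow> pf2 F \<alpha> \<in> hom2 C (pf1 F (Dom D \<alpha>)) (pf1 F (Cod D \<alpha>))"
    and pfc_iso2: "f \<in> Mor D \<Longrightarrow> g \<in> Mor D \<Longrightarrow> pfc F g f \<in> iso2 C (pf1 F g \<odot> pf1 F f) (pf1 F (g \<odot>\<^bsub>D\<^esub> f))"
    and pfu_iso2: "pfu F (the_elem (Obj D)) \<in> iso2 C (mon_unit C) (pf1 F (mon_unit D))"
begin

lemma map_pf1_Mor [simp]: "set us \<subseteq> Mor D \<Longrightarrow> pf1 F ` set us \<subseteq> Mor C"
  by auto

lemma pf2_Cel [simp]: "\<alpha> \<in> Cel D \<Longrightarrow> pf2 F \<alpha> \<in> Cel C"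
  and pf2_Dom [simp]: "\<alpha> \<in> Cel D \<Longrightarrow> Dom C (pf2 F \<alpha>) = pf1 F (Dom D \<alpha>)"
  and pf2_Cod [simp]: "\<alpha> \<in> Cel D \<Longrightarrow> Cod C (pf2 F \<alpha>) = pf1 F (Cod D \<alpha>)"
  using pf2_iso2[of \<alpha>] C.hom2_iff by auto

lemma pfc_iso [simp]: "f \<in> Mor D \<Longrightarrow> g \<in> Mor D \<Longrightarrow> isoc C (pfc F g f)"
  and pfc_Dom [simp]: "f \<in> Mor D \<Longrightarrow> g \<in> Mor D \<Longrightarrow> Dom C (pfc F g f) = pf1 F g \<odot> pf1 F f"
  and pfc_Cod [simp]: "f \<in> Mor D \<Longrightarrow> g \<in> Mor D \<Longrightarrow> Cod C (pfc F g f) = pf1 F (g \<odot>\<^bsub>D\<^esub> f)"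
  using pfc_iso2[of f g] C.iso2_iff by auto

abbreviation pu where "pu \<equiv> pfu F (the_elem (Obj D))"

lemma pfu_iso [simp]: "isoc C pu"
  and pfu_Dom [simp]: "Dom C pu = mon_unit C"
  and pfu_Cod [simp]: "Cod C pu = pf1 F (mon_unit D)"
  using pfu_iso2 C.iso2_iff by auto

lemma pfl_Nil [simp]: "pfl F [] = pu"
  and pfl_single [simp]: "pfl F [u] = Id2 C (pf1 F u)"
  and pfl_Cons: "us \<noteq> [] \<Longrightarrow> pfl F (u # us) = pfc F u (pth D us) \<cdot> (Id2 C (pf1 F u) \<star> pfl F us)"
  unfolding pfl_def by (auto simp: neq_Nil_conv pth_def)

lemma pfl_typed: "set us \<subseteq> Mor D \<Longrightarrow> isoc C (pfl F us) \<and> Dom C (pfl F us) = pth C (map (pf1 F) us)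
   \<and> Cod C (pfl F us) = pf1 F (pth D us)"
proof (induction us)
  case (Cons u us)
  then show ?case by (cases "us = []") (auto simp: pfl_Cons C.pth_Cons D.pth_Cons)
qed simp

lemma pfl_iso [simp]: "set us \<subseteq> Mor D \<Longrightarrow> isoc C (pfl F us)"
  and pfl_Dom [simp]: "set us \<subseteq> Mor D \<Longrightarrow> Dom C (pfl F us) = pth C (map (pf1 F) us)"
  and pfl_Cod [simp]: "set us \<subseteq> Mor D \<Longrightarrow> Cod C (pfl F us) = pf1 F (pth D us)"
  using pfl_typed by auto

lemma cell_img: "valid D f \<Longrightarrow> cell (img F f) = inv2 C (pfl F (dtrg f)) \<cdot> pf2 F (cell f) \<cdot> pfl F (dsrc f)"
  by (cases f) simp_all

lemma valid_img [simp]: "valid D f \<Longrightarrow> valid C (img F f)"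
  by (cases f) (auto simp: C.valid_Dia D.valid_Dia)

lemma img_single: "valid D (Dia [f] \<alpha> [g]) \<Longrightarrow> img F (Dia [f] \<alpha> [g]) = Dia [pf1 F f] (pf2 F \<alpha>) [pf1 F g]"
  by (auto simp: D.valid_Dia)

end

locale monoidal_psf = pseudofunctor F D C + D: monoidal_bicat D + C: monoidal_bicat C
  for F :: "('o, 'm, 'c, 'o2, 'm2, 'c2) psf" and D :: "('o, 'm, 'c) bicat"
    and C :: "('o2, 'm2, 'c2) bicat" (structure)
begin

lemma pf0_eq: "pf0 F (the_elem (Obj D)) = the_elem (Obj C)"
  using pf0_type[of "the_elem (Obj D)"] C.Obj_eq D.Obj_eq by blast

sublocale pre_psf F D C
proof unfold_locales
  show "pf1 F f \<in> Mor C" if "f \<in> Mor D" for f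
    using pf1_type[OF D.Mor_hom1] C.hom1_Mor that by blast
  show "pf2 F \<alpha> \<in> hom2 C (pf1 F (Dom D \<alpha>)) (pf1 F (Cod D \<alpha>))" if "\<alpha> \<in> Cel D" for \<alpha>
    using pf2_type[of \<alpha> "Dom D \<alpha>" "Cod D \<alpha>"] that D.hom2_iff by auto
  show "pfc F g f \<in> iso2 C (pf1 F g \<odot> pf1 F f) (pf1 F (g \<odot>\<^bsub>D\<^esub> f))" if "f \<in> Mor D" "g \<in> Mor D" for f g
    using pfc_type[OF D.Mor_hom1 D.Mor_hom1] that by blast
  show "pfu F (the_elem (Obj D)) \<in> iso2 C (mon_unit C) (pf1 F (mon_unit D))"
    using pfu_type[of "the_elem (Obj D)"] D.Obj_eq pf0_eq unfolding mon_unit_def by auto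
qed (simp_all add: PDom_eq PCod_eq pf0_eq)

lemma pf2_vcomp' [simp]: "\<alpha> \<in> Cel D \<Longrightarrow> \<beta> \<in> Cel D \<Longrightarrow> Dom D \<beta> = Cod D \<alpha> \<Longrightarrow>
   pf2 F (\<beta> \<cdot>\<^bsub>D\<^esub> \<alpha>) = pf2 F \<beta> \<cdot> pf2 F \<alpha>"
  using pf2_vcomp[of \<alpha> "Dom D \<alpha>" "Cod D \<alpha>" \<beta> "Cod D \<beta>"] D.hom2_iff by auto

declare pf2_Id2 [simp]

lemma pf2_iso [simp]: "isoc D \<alpha> \<Longrightarrow> isoc C (pf2 F \<alpha>)"
  and pf2_inv [simp]: "isoc D \<alpha> \<Longrightarrow> pf2 F (inv2 D \<alpha>) = inv2 C (pf2 F \<alpha>)"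
  using C.isoI[of "pf2 F \<alpha>" "pf2 F (inv2 D \<alpha>)"] by (auto simp flip: pf2_vcomp')

lemma pfc_nat: "\<alpha> \<in> Cel D \<Longrightarrow> \<beta> \<in> Cel D \<Longrightarrow>
   pfc F (Cod D \<beta>) (Cod D \<alpha>) \<cdot> (pf2 F \<beta> \<star> pf2 F \<alpha>) = pf2 F (\<beta> \<star>\<^bsub>D\<^esub> \<alpha>) \<cdot> pfc F (Dom D \<beta>) (Dom D \<alpha>)"
  using pfc_natural[of \<alpha> "Dom D \<alpha>" "Cod D \<alpha>" \<beta> "Dom D \<beta>" "Cod D \<beta>"] D.hom2_iff by auto

lemma pf_asc': "f \<in> Mor D \<Longrightarrow> g \<in> Mor D \<Longrightarrow> h \<in> Mor D \<Longrightarrow>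
   pf2 F (asc D h g f) \<cdot> pfc F (h \<odot>\<^bsub>D\<^esub> g) f \<cdot> (pfc F h g \<star> Id2 C (pf1 F f))
              = pfc F h (g \<odot>\<^bsub>D\<^esub> f) \<cdot> (Id2 C (pf1 F h) \<star> pfc F g f)
                  \<cdot> asc C (pf1 F h) (pf1 F g) (pf1 F f)"
  using pf_asc[OF D.Mor_hom1 D.Mor_hom1 D.Mor_hom1] by blast

lemma pf_lun': "f \<in> Mor D \<Longrightarrow> pf2 F (lun D f) \<cdot> pfc F (mon_unit D) f \<cdot> (pu \<star> Id2 C (pf1 F f)) = lun C (pf1 F f)"
  and pf_run': "f \<in> Mor D \<Longrightarrow> pf2 F (run D f) \<cdot> pfc F f (mon_unit D) \<cdot> (Id2 C (pf1 F f) \<star> pu) = run C (pf1 F f)"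
  using pf_lun[OF D.Mor_hom1] pf_run[OF D.Mor_hom1] unfolding mon_unit_def by auto

text \<open>Iterated constraints are compatible with concatenation. Each head uses the associativity
  axiom of the pseudofunctor once, together with naturality of its constraint.\<close>

lemma pfl_append_ne:
  assumes "us \<noteq> []" and us: "set us \<subseteq> Mor D" and [simp]: "vs \<noteq> []" "set vs \<subseteq> Mor D"
  shows "pf2 F (glu D us vs) \<cdot> pfc F (pth D us) (pth D vs) \<cdot> (pfl F us \<star> pfl F vs)
       = pfl F (us @ vs) \<cdot> glu C (map (pf1 F) us) (map (pf1 F) vs)"
  using assms(1) us
proof (induction us rule: list_nonempty_induct)
  case (single u)
  then show ?case by (simp add: D.glu_single C.glu_single pfl_Cons)
next
  case (cons u us)
  have [simp]: "u \<in> Mor D" "set us \<subseteq> Mor D" and ne' [simp]: "us \<noteq> []" using cons by auto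
  let ?p = "pth D us" and ?v = "pth D vs" and ?F = "pf1 F" and ?m = "map (pf1 F)"
  have "pf2 F (glu D (u # us) vs) \<cdot> pfc F (pth D (u # us)) ?v \<cdot> (pfl F (u # us) \<star> pfl F vs)
     = pf2 F (Id2 D u \<star>\<^bsub>D\<^esub> glu D us vs) \<cdot> (pf2 F (asc D u ?p ?v) \<cdot> pfc F (u \<odot>\<^bsub>D\<^esub> ?p) ?v \<cdot> (pfc F u ?p \<star> Id2 C (?F ?v)))
        \<cdot> ((Id2 C (?F u) \<star> pfl F us) \<star> pfl F vs)"
    using C.interch[of "pfl F vs" "Id2 C (?F ?v)" "Id2 C (?F u) \<star> pfl F us" "pfc F u ?p"]
    by (simp add: D.glu_Cons pfl_Cons D.pth_Cons)
  also have "\<dots> = (pf2 F (Id2 D u \<star>\<^bsub>D\<^esub> glu D us vs) \<cdot> pfc F u (?p \<odot>\<^bsub>D\<^esub> ?v)) \<cdot> (Id2 C (?F u) \<star> pfc F ?p ?v)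
       \<cdot> (asc C (?F u) (?F ?p) (?F ?v) \<cdot> ((Id2 C (?F u) \<star> pfl F us) \<star> pfl F vs))"
    by (subst pf_asc') simp_all
  also have "asc C (?F u) (?F ?p) (?F ?v) \<cdot> ((Id2 C (?F u) \<star> pfl F us) \<star> pfl F vs)
       = (Id2 C (?F u) \<star> (pfl F us \<star> pfl F vs)) \<cdot> asc C (?F u) (pth C (?m us)) (pth C (?m vs))"
    using C.asc_nat[of "pfl F vs" "pfl F us" "Id2 C (?F u)"] by simp
  also have "pf2 F (Id2 D u \<star>\<^bsub>D\<^esub> glu D us vs) \<cdot> pfc F u (?p \<odot>\<^bsub>D\<^esub> ?v)
      = pfc F u (pth D (us @ vs)) \<cdot> (Id2 C (?F u) \<star> pf2 F (glu D us vs))"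
    using pfc_nat[of "glu D us vs" "Id2 D u"] by simp
  also have "(pfc F u (pth D (us @ vs)) \<cdot> (Id2 C (?F u) \<star> pf2 F (glu D us vs))) \<cdot> (Id2 C (?F u) \<star> pfc F ?p ?v)
       \<cdot> ((Id2 C (?F u) \<star> (pfl F us \<star> pfl F vs)) \<cdot> asc C (?F u) (pth C (?m us)) (pth C (?m vs)))
     = pfc F u (pth D (us @ vs)) \<cdot> (Id2 C (?F u) \<star> (pf2 F (glu D us vs) \<cdot> pfc F ?p ?v \<cdot> (pfl F us \<star> pfl F vs)))
        \<cdot> asc C (?F u) (pth C (?m us)) (pth C (?m vs))"
    by (simp add: C.hcomp_Id_left)
  also have "pf2 F (glu D us vs) \<cdot> pfc F ?p ?v \<cdot> (pfl F us \<star> pfl F vs) = pfl F (us @ vs) \<cdot> glu C (?m us) (?m vs)"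
    using cons.IH by simp
  finally show ?case by (simp add: pfl_Cons C.glu_Cons C.hcomp_Id_left)
qed

text \<open>The two cases with an empty list are the unit axioms of the pseudofunctor.\<close>

lemma pfl_append:
  assumes [simp]: "set us \<subseteq> Mor D" "set vs \<subseteq> Mor D"
  shows "pf2 F (glu D us vs) \<cdot> pfc F (pth D us) (pth D vs) \<cdot> (pfl F us \<star> pfl F vs)
       = pfl F (us @ vs) \<cdot> glu C (map (pf1 F) us) (map (pf1 F) vs)"
proof -
  consider "us = []" | "us \<noteq> []" "vs = []" | "us \<noteq> []" "vs \<noteq> []" by blast
  then show ?thesis
  proof cases
    case 1
    have "pf2 F (lun D (pth D vs)) \<cdot> pfc F (mon_unit D) (pth D vs) \<cdot> (pu \<star> pfl F vs)
      = (pf2 F (lun D (pth D vs)) \<cdot> pfc F (mon_unit D) (pth D vs) \<cdot> (pu \<star> Id2 C (pf1 F (pth D vs)))) \<cdot> (Id2 C (mon_unit C) \<star> pfl F vs)"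
      using C.interch[of "pfl F vs" "Id2 C (pf1 F (pth D vs))" "Id2 C (mon_unit C)" pu] by simp
    also have "\<dots> = pfl F vs \<cdot> lun C (pth C (map (pf1 F) vs))"
      using C.lun_nat[of "pfl F vs"] by (simp add: pf_lun')
    finally show ?thesis using 1 by simp
  next
    case 2
    have "pf2 F (run D (pth D us)) \<cdot> pfc F (pth D us) (mon_unit D) \<cdot> (pfl F us \<star> pu)
      = (pf2 F (run D (pth D us)) \<cdot> pfc F (pth D us) (mon_unit D) \<cdot> (Id2 C (pf1 F (pth D us)) \<star> pu)) \<cdot> (pfl F us \<star> Id2 C (mon_unit C))"
      using C.interch[of "Id2 C (mon_unit C)" pu "pfl F us" "Id2 C (pf1 F (pth D us))"] by simp
    also have "\<dots> = pfl F us \<cdot> run C (pth C (map (pf1 F) us))"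
      using C.run_nat[of "pfl F us"] by (simp add: pf_run')
    finally show ?thesis using 2 by simp
  qed (simp add: pfl_append_ne)
qed

lemma img_idd [simp]: "set us \<subseteq> Mor D \<Longrightarrow> img F (idd D us) = idd C (map (pf1 F) us)"
  by (rule C.dia_eqI) (simp_all add: cell_img)

lemma img_seq [simp]: "valid D (f ;;\<^bsub>D\<^esub> g) \<Longrightarrow> img F (f ;;\<^bsub>D\<^esub> g) = img F f ;; img F g"
  by (rule C.dia_eqI) (simp_all add: cell_img C.cell_seq D.cell_seq D.valids C.valids)

text \<open>With the constraints absorbed into the cells, a pseudofunctor acts on diagrams as a
  strict monoidal functor; \<open>pfl_append\<close> provides the constraint of a concatenated
  list.\<close>

lemma img_ten [simp]: assumes [simp]: "valid D f" "valid D g" shows "img F (f \<otimes>\<^bsub>D\<^esub> g) = img F f \<otimes> img F g"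
proof (rule C.dia_eqI)
  note [simp] = D.valids
  let ?a = "dsrc f" and ?b = "dsrc g" and ?a' = "dtrg f" and ?b' = "dtrg g"
  let ?P = "pfc F (pth D ?a) (pth D ?b)" and ?P' = "pfc F (pth D ?a') (pth D ?b')"
  let ?m = "map (pf1 F)"
  let ?G = "glu C (?m ?a) (?m ?b)" and ?G' = "glu C (?m ?a') (?m ?b')"
  let ?D = "glu D ?a ?b" and ?D' = "glu D ?a' ?b'"
  have 1: "pfl F (?a @ ?b) = pf2 F ?D \<cdot> ?P \<cdot> (pfl F ?a \<star> pfl F ?b) \<cdot> inv2 C ?G"
    using arg_cong[OF pfl_append[of ?a ?b], of "\<lambda>x. x \<cdot> inv2 C ?G"] by simp
  have 2: "pfl F (?a' @ ?b') = pf2 F ?D' \<cdot> ?P' \<cdot> (pfl F ?a' \<star> pfl F ?b') \<cdot> inv2 C ?G'"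
    using arg_cong[OF pfl_append[of ?a' ?b'], of "\<lambda>x. x \<cdot> inv2 C ?G'"] by simp
  have "cell (img F (f \<otimes>\<^bsub>D\<^esub> g)) = ?G' \<cdot> (inv2 C (pfl F ?a') \<star> inv2 C (pfl F ?b')) \<cdot> inv2 C ?P' \<cdot>
     (pf2 F (cell f \<star>\<^bsub>D\<^esub> cell g) \<cdot> ?P) \<cdot> (pfl F ?a \<star> pfl F ?b) \<cdot> inv2 C ?G"
    by (simp add: cell_img D.cell_ten 1 2)
  also have "pf2 F (cell f \<star>\<^bsub>D\<^esub> cell g) \<cdot> ?P = ?P' \<cdot> (pf2 F (cell f) \<star> pf2 F (cell g))"
    using pfc_nat[of "cell g" "cell f"] by simp
  also have "?G' \<cdot> (inv2 C (pfl F ?a') \<star> inv2 C (pfl F ?b')) \<cdot> inv2 C ?P' \<cdot> (?P' \<cdot> (pf2 F (cell f) \<star> pf2 F (cell g)))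
       \<cdot> (pfl F ?a \<star> pfl F ?b) \<cdot> inv2 C ?G
     = cell (img F f \<otimes> img F g)"
    by (simp add: C.cell_ten cell_img C.interch)
  finally show "cell (img F (f \<otimes>\<^bsub>D\<^esub> g)) = cell (img F f \<otimes> img F g)" .
qed simp_all

lemma img_wh [simp]: "set us \<subseteq> Mor D \<Longrightarrow> set vs \<subseteq> Mor D \<Longrightarrow> valid D f \<Longrightarrow>
   img F (wh D us f vs) = wh C (map (pf1 F) us) (img F f) (map (pf1 F) vs)"
  unfolding wh_def by simp

lemma img_iso [simp]: "diso D f \<Longrightarrow> diso C (img F f)"
  unfolding diso_def by (auto simp: cell_img D.valids)

lemma img_inv [simp]: "diso D f \<Longrightarrow> img F (dinv D f) = dinv C (img F f)"
  by (rule sym, rule C.inv_unique) (simp_all flip: img_seq add: D.valid_dsrc)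

lemma img_fold: "set us \<subseteq> Mor D \<Longrightarrow> img F (dfold D us) = Dia (map (pf1 F) us) (pfl F us) [pf1 F (pth D us)]"
  by (simp add: dfold_def)

end

subsection \<open>Transformations\<close>

fun ofR :: "('m, 'c) rewrite \<Rightarrow> ('m, 'c) dia" where
  "ofR (us, \<theta>, vs) = Dia us \<theta> vs"

text \<open>The naturality cell at a list: the object of the transformation starts at the right end
  and passes the images one at a time until it stands in front.\<close>

fun tlist :: "('o, 'm, 'c, 'o2, 'm2, 'c2) trans \<Rightarrow> 'm list \<Rightarrow> ('m2, 'c2) dia" where
  "tlist \<sigma> [] = idd (PCod (TSrc \<sigma>)) [t1 \<sigma> (the_elem (Obj (PDom (TSrc \<sigma>))))]"
| "tlist \<sigma> (u # us) = (let C = PCod (TSrc \<sigma>) in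
     wh C [pf1 (TTrg \<sigma>) u] (tlist \<sigma> us) [] ;;\<^bsub>C\<^esub> wh C [] (ofR (natR \<sigma> u)) (map (pf1 (TSrc \<sigma>)) us))"

locale monoidal_trans = transformation \<sigma> F G D C + F: monoidal_psf F D C + G: monoidal_psf G D C
  for \<sigma> :: "('o, 'm, 'c, 'o2, 'm2, 'c2) trans"
    and F G :: "('o, 'm, 'c, 'o2, 'm2, 'c2) psf"
    and D :: "('o, 'm, 'c) bicat"
    and C :: "('o2, 'm2, 'c2) bicat" (structure)
begin

abbreviation S where "S \<equiv> t1 \<sigma> (the_elem (Obj D))"

abbreviation n where "n f \<equiv> Dia [pf1 G f, S] (t2 \<sigma> f) [S, pf1 F f]"

lemma natR_eq: "f \<in> Mor D \<Longrightarrow> ofR (natR \<sigma> f) = n f"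
  unfolding natR_def by (simp add: TSrc_eq TTrg_eq)

lemma tlist_Nil [simp]: "tlist \<sigma> [] = idd C [S]"
  and tlist_Cons [simp]: "u \<in> Mor D \<Longrightarrow>
    tlist \<sigma> (u # us) = wh C [pf1 G u] (tlist \<sigma> us) [] ;; wh C [] (n u) (map (pf1 F) us)"
  by (simp_all add: natR_eq TSrc_eq TTrg_eq Let_def)

declare tlist.simps [simp del]

lemma S_Mor [simp]: "S \<in> Mor C"
  using t1_type F.D.Obj_eq F.C.hom1_Mor by blast

lemma t2_iso [simp]: "f \<in> Mor D \<Longrightarrow> isoc C (t2 \<sigma> f)"
  and t2_Dom [simp]: "f \<in> Mor D \<Longrightarrow> Dom C (t2 \<sigma> f) = pf1 G f \<odot> S"
  and t2_Cod [simp]: "f \<in> Mor D \<Longrightarrow> Cod C (t2 \<sigma> f) = S \<odot> pf1 F f"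
  using t2_type[OF F.D.Mor_hom1] F.C.iso2_iff by auto

lemma iso_n [simp]: "f \<in> Mor D \<Longrightarrow> diso C (n f)"
  by (simp add: F.C.iso_Dia F.C.pth_Cons)

lemma valid_n [simp]: "f \<in> Mor D \<Longrightarrow> valid C (n f)"
  using iso_n F.C.iso_valid by blast

lemma tlist_typed: "set us \<subseteq> Mor D \<Longrightarrow> diso C (tlist \<sigma> us) \<and> dsrc (tlist \<sigma> us) = map (pf1 G) us @ [S]
    \<and> dtrg (tlist \<sigma> us) = S # map (pf1 F) us"
  by (induction us) auto

lemma iso_tlist [simp]: "set us \<subseteq> Mor D \<Longrightarrow> diso C (tlist \<sigma> us)"
  and dsrc_tlist [simp]: "set us \<subseteq> Mor D \<Longrightarrow> dsrc (tlist \<sigma> us) = map (pf1 G) us @ [S]"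
  and dtrg_tlist [simp]: "set us \<subseteq> Mor D \<Longrightarrow> dtrg (tlist \<sigma> us) = S # map (pf1 F) us"
  using tlist_typed by auto

text \<open>The unit axiom of a transformation; its two unitors have become invisible
  bracketings.\<close>

lemma n_Id1: "wh C [] (img G (dfold D [])) [S] ;; n (mon_unit D) = wh C [S] (img F (dfold D [])) []"
proof (rule F.C.dia_eqI)
  have "t2 \<sigma> (mon_unit D) \<cdot> (G.pu \<star> Id2 C S) = (Id2 C S \<star> F.pu) \<cdot> inv2 C (run C S) \<cdot> lun C S"
    using t2_Id1[of "the_elem (Obj D)"] F.D.Obj_eq unfolding mon_unit_def by auto
  then have "(t2 \<sigma> (mon_unit D) \<cdot> (G.pu \<star> Id2 C S)) \<cdot> inv2 C (lun C S) = ((Id2 C S \<star> F.pu) \<cdot> inv2 C (run C S) \<cdot> lun C S) \<cdot> inv2 C (lun C S)"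
    by simp
  then have "t2 \<sigma> (mon_unit D) \<cdot> (G.pu \<star> Id2 C S) \<cdot> inv2 C (lun C S) = (Id2 C S \<star> F.pu) \<cdot> inv2 C (run C S)"
    by simp
  then show "cell (wh C [] (img G (dfold D [])) [S] ;; n (mon_unit D)) = cell (wh C [S] (img F (dfold D [])) [])"
    by (simp add: F.C.cell_seq F.C.cell_wh_right wh_def[of _ "[S]"] F.C.cell_ten F.img_fold G.img_fold F.C.valid_Dia F.C.glu_single F.C.pth_Cons)
qed (simp_all)

text \<open>The composition axiom of a transformation, freed from its three associators.\<close>

lemma n_comp: assumes [simp]: "f \<in> Mor D" "g \<in> Mor D"
  shows "wh C [] (img G (dfold D [g, f])) [S] ;; n (g \<odot>\<^bsub>D\<^esub> f)
     = wh C [pf1 G g] (n f) [] ;; wh C [] (n g) [pf1 F f] ;; wh C [S] (img F (dfold D [g, f])) []"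
proof (rule F.C.dia_eqI)
  let ?a = "asc C (pf1 G g) (pf1 G f) S"
  have "(t2 \<sigma> (g \<odot>\<^bsub>D\<^esub> f) \<cdot> (pfc G g f \<star> Id2 C S)) \<cdot> inv2 C ?a = ((Id2 C S \<star> pfc F g f) \<cdot> asc C S (pf1 F g) (pf1 F f)
                  \<cdot> (t2 \<sigma> g \<star> Id2 C (pf1 F f)) \<cdot> inv2 C (asc C (pf1 G g) S (pf1 F f))
                  \<cdot> (Id2 C (pf1 G g) \<star> t2 \<sigma> f) \<cdot> ?a) \<cdot> inv2 C ?a"
    by (subst t2_comp[OF F.D.Mor_hom1 F.D.Mor_hom1]) simp_all
  then have "t2 \<sigma> (g \<odot>\<^bsub>D\<^esub> f) \<cdot> (pfc G g f \<star> Id2 C S) \<cdot> inv2 C ?a = (Id2 C S \<star> pfc F g f) \<cdot> asc C S (pf1 F g) (pf1 F f)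
                  \<cdot> (t2 \<sigma> g \<star> Id2 C (pf1 F f)) \<cdot> inv2 C (asc C (pf1 G g) S (pf1 F f))
                  \<cdot> (Id2 C (pf1 G g) \<star> t2 \<sigma> f)"
    by simp
  then show "cell (wh C [] (img G (dfold D [g, f])) [S] ;; n (g \<odot>\<^bsub>D\<^esub> f))
     = cell (wh C [pf1 G g] (n f) [] ;; wh C [] (n g) [pf1 F f] ;; wh C [S] (img F (dfold D [g, f])) [])"
    by (simp add: F.C.cell_seq F.C.cell_wh_right F.C.cell_wh_Cons F.img_fold G.img_fold F.C.valid_Dia F.C.glu_single F.C.glu_Cons
        F.D.pth_Cons F.C.pth_Cons F.pfl_Cons G.pfl_Cons)
qed (simp_all add: F.D.pth_Cons)

lemma n_nat: assumes [simp]: "\<alpha> \<in> Cel D" "Dom D \<alpha> = f" "Cod D \<alpha> = g"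
  shows "wh C [] (img G (Dia [f] \<alpha> [g])) [S] ;; n g = n f ;; wh C [S] (img F (Dia [f] \<alpha> [g])) []"
proof -
  have [simp]: "f \<in> Mor D" "g \<in> Mor D" using assms(2,3) F.D.Dom_Mor F.D.Cod_Mor assms(1) by blast+
  have "t2 \<sigma> g \<cdot> (pf2 G \<alpha> \<star> Id2 C S) = (Id2 C S \<star> pf2 F \<alpha>) \<cdot> t2 \<sigma> f"
    using t2_natural[OF F.D.Mor_hom1, of f \<alpha> g] by (simp add: F.D.hom2_iff)
  then show ?thesis
    by (intro F.C.dia_eqI) (simp_all add: F.img_single G.img_single F.D.valid_single F.C.valid_single F.C.cell_seq F.C.cell_wh_right F.C.cell_wh_Cons F.C.glu_single)
qed

text \<open>The composition axiom is applied to one object at a time; the empty list is the unit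
  axiom.\<close>

lemma tlist_fold: "set us \<subseteq> Mor D \<Longrightarrow> wh C [] (img G (dfold D us)) [S] ;; n (pth D us) = tlist \<sigma> us ;; wh C [S] (img F (dfold D us)) []"
proof (induction us)
  case Nil
  then show ?case by (simp add: n_Id1)
next
  case (Cons u us)
  then have [simp]: "u \<in> Mor D" "set us \<subseteq> Mor D" by auto
  show ?case
  proof (cases "us = []")
    case True then show ?thesis by simp
  next
    case False
    let ?p = "pth D us"
    have "wh C [] (img G (dfold D (u # us))) [S] ;; n (pth D (u # us))
      = wh C [pf1 G u] (img G (dfold D us)) [S] ;; (wh C [] (img G (dfold D [u, ?p])) [S] ;; n (u \<odot>\<^bsub>D\<^esub> ?p))"
      using False by (simp add: F.D.fold_Cons[of u us] F.D.pth_Cons F.C.wh_seq)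
    also have "\<dots> = wh C [pf1 G u] (img G (dfold D us)) [S] ;;
      wh C [pf1 G u] (n ?p) [] ;; wh C [] (n u) [pf1 F ?p] ;; wh C [S] (img F (dfold D [u, ?p])) []"
      by (subst n_comp) simp_all
    also have "\<dots> = wh C [pf1 G u] (wh C [] (img G (dfold D us)) [S] ;; n ?p) [] ;; wh C [] (n u) [pf1 F ?p] ;; wh C [S] (img F (dfold D [u, ?p])) []"
      by (simp add: F.C.wh_seq)
    also have "\<dots> = wh C [pf1 G u] (tlist \<sigma> us) [] ;; (wh C [pf1 G u, S] (img F (dfold D us)) [] ;; wh C [] (n u) [pf1 F ?p]) ;; wh C [S] (img F (dfold D [u, ?p])) []"
      by (subst Cons.IH) (simp_all add: F.C.wh_seq)
    also have "wh C [pf1 G u, S] (img F (dfold D us)) [] ;; wh C [] (n u) [pf1 F ?p]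
        = wh C [] (n u) (map (pf1 F) us) ;; wh C [S, pf1 F u] (img F (dfold D us)) []"
      using F.C.interchange_wh[of "n u" "[pf1 G u, S]" "[S, pf1 F u]" "img F (dfold D us)" "map (pf1 F) us" "[pf1 F ?p]" "[]" "[]" "[]"]
      by (simp add: F.C.homI)
    finally show ?thesis
      using False by (simp add: F.D.fold_Cons[of u us] F.C.wh_seq)
  qed
qed

text \<open>Naturality at diagrams between lists of any lengths, obtained by splitting s with
  \<open>dia_decomp\<close>. The case of empty lists is the one that later moves scalars and unit
  isomorphisms.\<close>

lemma tlist_nat: assumes s: "valid D s"
  shows "wh C [] (img G s) [S] ;; tlist \<sigma> (dtrg s) = tlist \<sigma> (dsrc s) ;; wh C [S] (img F s) []"
proof -
  let ?us = "dsrc s" and ?vs = "dtrg s"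
  let ?c = "Dia [pth D ?us] (cell s) [pth D ?vs]"
  note [simp] = F.D.valids[OF s] F.D.valid_single
  have G: "img G s = img G (dfold D ?us) ;; img G ?c ;; dinv C (img G (dfold D ?vs))"
    by (subst F.D.dia_decomp[OF s]) (simp del: img.simps)
  have F: "img F s = img F (dfold D ?us) ;; img F ?c ;; dinv C (img F (dfold D ?vs))"
    by (subst F.D.dia_decomp[OF s]) (simp del: img.simps)
  have 1: "wh C [] (dinv C (img G (dfold D ?vs))) [S] ;; tlist \<sigma> ?vs = n (pth D ?vs) ;; wh C [S] (dinv C (img F (dfold D ?vs))) []"
    using F.C.inv_commute[of "wh C [] (img G (dfold D ?vs)) [S]" "wh C [S] (img F (dfold D ?vs)) []" "n (pth D ?vs)" "tlist \<sigma> ?vs"] tlist_fold[of ?vs]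
    by (simp add: F.C.inv_wh)
  have "wh C [] (img G s) [S] ;; tlist \<sigma> ?vs
     = wh C [] (img G (dfold D ?us)) [S] ;; wh C [] (img G ?c) [S] ;; (wh C [] (dinv C (img G (dfold D ?vs))) [S] ;; tlist \<sigma> ?vs)"
    by (simp only: G F.C.wh_seq F.C.seq_assoc)
  also have "\<dots> = wh C [] (img G (dfold D ?us)) [S] ;; (wh C [] (img G ?c) [S] ;; n (pth D ?vs)) ;; wh C [S] (dinv C (img F (dfold D ?vs))) []"
    by (simp only: 1 F.C.seq_assoc)
  also have "\<dots> = (wh C [] (img G (dfold D ?us)) [S] ;; n (pth D ?us)) ;; wh C [S] (img F ?c) [] ;; wh C [S] (dinv C (img F (dfold D ?vs))) []"
    by (subst n_nat) (simp_all del: img.simps)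
  also have "\<dots> = tlist \<sigma> ?us ;; wh C [S] (img F s) []"
    by (subst tlist_fold) (simp_all only: F F.C.wh_seq F.C.seq_assoc F.D.valids[OF s])
  finally show ?thesis .
qed

end

lemma monoidal_transI: assumes "transformation \<sigma> F G D C" "monoidal_bicat D" "monoidal_bicat C" shows "monoidal_trans \<sigma> F G D C"
proof -
  interpret transformation \<sigma> F G D C by fact
  show ?thesis
    unfolding monoidal_trans_def monoidal_psf_def using assms src_functor trg_functor by blast
qed

subsection \<open>Pasting composites\<close>

text \<open>The identity in front of each step is a test: if the rewrite does not fit the list at
  its position, the composite is \<open>Null\<close>. Validity therefore certifies the whole
  sequence of rewrites.\<close>

fun steps :: "('o, 'm, 'c) bicat \<Rightarrow> 'm list \<Rightarrow> (nat \<times> ('m, 'c) rewrite) list \<Rightarrow> ('m, 'c) dia" where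
  "steps B ws [] = idd B ws"
| "steps B ws ((i, r) # ss) = idd B ws ;;\<^bsub>B\<^esub> wh B (take i ws) (ofR r) (drop (i + length (fst r)) ws)
     ;;\<^bsub>B\<^esub> steps B (take i ws @ snd (snd r) @ drop (i + length (fst r)) ws) ss"

context monoidal_bicat begin

lemma glue_eq: "us \<noteq> [] \<Longrightarrow> vs \<noteq> [] \<Longrightarrow> glue B us vs = glu B us vs"
  by (simp add: glu_def)

lemma whisk_cell: "valid B (Dia us \<theta> vs) \<Longrightarrow> us \<noteq> [] \<Longrightarrow> vs \<noteq> [] \<Longrightarrow> set fs \<subseteq> Mor B \<Longrightarrow> set hs \<subseteq> Mor B \<Longrightarrow>
   whisk B fs (us, \<theta>, vs) hs = cell (wh B fs (Dia us \<theta> vs) hs)"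
proof (induction fs)
  case Nil
  then show ?case
    by (cases "hs = []") (simp_all add: whisk_def cell_wh_right glue_eq pth_def)
next
  case (Cons f fs)
  then show ?case by (simp add: cell_wh_Cons) (simp add: whisk_def)
qed

text \<open>The bridge to the pasting composites in which the tricategorical data are given. Both
  sides of a rewrite have to be nonempty because \<open>path\<close> and \<open>glue\<close> have no
  meaning on the empty list.\<close>

lemma steps_paste: "valid B (steps B ws ss) \<Longrightarrow> ws \<noteq> [] \<Longrightarrow> \<forall>(i, r) \<in> set ss. fst r \<noteq> [] \<and> snd (snd r) \<noteq> []
   \<Longrightarrow> dsrc (steps B ws ss) = ws \<and> cell (steps B ws ss) = paste B ws ss"
proof (induction ss arbitrary: ws)
  case Nil
  then show ?case by (simp add: pth_def)
next
  case (Cons s ss)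
  obtain i us \<theta> vs where s: "s = (i, (us, \<theta>, vs))" by (cases s) auto
  let ?w = "wh B (take i ws) (Dia us \<theta> vs) (drop (i + length us) ws)"
  let ?ws = "take i ws @ vs @ drop (i + length us) ws"
  have v: "valid B ?w" "valid B (steps B ?ws ss)" and tg: "dtrg ?w = dsrc (steps B ?ws ss)"
    and ws: "set ws \<subseteq> Mor B" and "ws = dsrc ?w"
    using Cons.prems(1) s by (auto simp del: valid_wh seq_idd_left)
  then have sr: "take i ws @ us @ drop (i + length us) ws = ws"
    by (metis dsrc_wh dsrc.simps(2) valid_wh)
  have ne: "us \<noteq> []" "vs \<noteq> []" using Cons.prems s by auto
  have IH: "dsrc (steps B ?ws ss) = ?ws \<and> cell (steps B ?ws ss) = paste B ?ws ss"
    using Cons.IH[of ?ws] v ne Cons.prems by auto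
  show ?case using v tg IH s ne ws sr by (simp add: cell_seq whisk_cell)
qed

end

subsection \<open>Identity, composite and pairing of pseudofunctors\<close>

lemma monoidal_psfI:
  fixes F :: "('o, 'm, 'c, 'o2, 'm2, 'c2) psf" and C :: "('o2, 'm2, 'c2) bicat" (structure)
  assumes pre: "pre_psf F D C"
    and "\<And>f. f \<in> Mor D \<Longrightarrow> pf2 F (Id2 D f) = Id2 C (pf1 F f)"
    and "\<And>\<alpha> \<beta>. \<alpha> \<in> Cel D \<Longrightarrow> \<beta> \<in> Cel D \<Longrightarrow> Dom D \<beta> = Cod D \<alpha> \<Longrightarrow>
          pf2 F (\<beta> \<cdot>\<^bsub>D\<^esub> \<alpha>) = pf2 F \<beta> \<cdot> pf2 F \<alpha>"
    and "\<And>\<alpha> \<beta>. \<alpha> \<in> Cel D \<Longrightarrow> \<beta> \<in> Cel D \<Longrightarrow>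
          pfc F (Cod D \<beta>) (Cod D \<alpha>) \<cdot> (pf2 F \<beta> \<star> pf2 F \<alpha>) = pf2 F (\<beta> \<star>\<^bsub>D\<^esub> \<alpha>) \<cdot> pfc F (Dom D \<beta>) (Dom D \<alpha>)"
    and "\<And>f g h. f \<in> Mor D \<Longrightarrow> g \<in> Mor D \<Longrightarrow> h \<in> Mor D \<Longrightarrow>
          pf2 F (asc D h g f) \<cdot> pfc F (h \<odot>\<^bsub>D\<^esub> g) f \<cdot> (pfc F h g \<star> Id2 C (pf1 F f))
              = pfc F h (g \<odot>\<^bsub>D\<^esub> f) \<cdot> (Id2 C (pf1 F h) \<star> pfc F g f) \<cdot> asc C (pf1 F h) (pf1 F g) (pf1 F f)"
    and "\<And>f. f \<in> Mor D \<Longrightarrow> pf2 F (lun D f) \<cdot> pfc F (mon_unit D) f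
            \<cdot> (pfu F (the_elem (Obj D)) \<star> Id2 C (pf1 F f)) = lun C (pf1 F f)"
    and "\<And>f. f \<in> Mor D \<Longrightarrow> pf2 F (run D f) \<cdot> pfc F f (mon_unit D)
            \<cdot> (Id2 C (pf1 F f) \<star> pfu F (the_elem (Obj D))) = run C (pf1 F f)"
  shows "monoidal_psf F D C"
proof -
  interpret F: pre_psf F D C by fact
  have obj: "a = the_elem (Obj D)" if "a \<in> Obj D" for a using that F.D.Obj_eq by blast
  have objC: "the_elem (Obj C) \<in> Obj C" using F.C.Obj_eq by blast
  have dhom: "a = the_elem (Obj D)" "b = the_elem (Obj D)" "f \<in> Mor D" if "f \<in> hom1 D a b" for f a b
    using that unfolding hom1_def by auto
  show ?thesis
  proof unfold_locales
    show "pf1 F f \<in> hom1 C (pf0 F a) (pf0 F b)" if "f \<in> hom1 D a b" for f a b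
      using dhom[OF that] F.C.Mor_hom1 F.pf0_pt by simp
    show "pf2 F \<alpha> \<in> hom2 C (pf1 F f) (pf1 F g)" if "\<alpha> \<in> hom2 D f g" for \<alpha> f g
      using that F.pf2_iso2 F.D.hom2_iff by auto
    show "pfc F g f \<in> iso2 C (pf1 F g \<odot> pf1 F f) (pf1 F (g \<odot>\<^bsub>D\<^esub> f))"
      if "f \<in> hom1 D a b" "g \<in> hom1 D b c" for f g a b c
      using dhom(3)[OF that(1)] dhom(3)[OF that(2)] F.pfc_iso2 by simp
    show "pfu F a \<in> iso2 C (Id1 C (pf0 F a)) (pf1 F (Id1 D a))" if "a \<in> Obj D" for a
      using F.pfu_iso2 F.pf0_pt obj[OF that] unfolding mon_unit_def by simp
    show "pfc F g' f' \<cdot> (pf2 F \<beta> \<star> pf2 F \<alpha>) = pf2 F (\<beta> \<star>\<^bsub>D\<^esub> \<alpha>) \<cdot> pfc F g f"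
      if "\<alpha> \<in> hom2 D f f'" "\<beta> \<in> hom2 D g g'" "src D g = trg D f" for \<alpha> \<beta> f f' g g'
      using that assms(4) F.D.hom2_iff by auto
    show "pf2 F (\<beta> \<cdot>\<^bsub>D\<^esub> \<alpha>) = pf2 F \<beta> \<cdot> pf2 F \<alpha>" if "\<alpha> \<in> hom2 D f g" "\<beta> \<in> hom2 D g h" for \<alpha> \<beta> f g h
      using that assms(3) F.D.hom2_iff by auto
    show "pf2 F (asc D h g f) \<cdot> pfc F (h \<odot>\<^bsub>D\<^esub> g) f \<cdot> (pfc F h g \<star> Id2 C (pf1 F f))
              = pfc F h (g \<odot>\<^bsub>D\<^esub> f) \<cdot> (Id2 C (pf1 F h) \<star> pfc F g f) \<cdot> asc C (pf1 F h) (pf1 F g) (pf1 F f)"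
      if "f \<in> hom1 D a b" "g \<in> hom1 D b c" "h \<in> hom1 D c d" for f g h a b c d
      using dhom(3)[OF that(1)] dhom(3)[OF that(2)] dhom(3)[OF that(3)] assms(5) by simp
    show "pf2 F (lun D f) \<cdot> pfc F (Id1 D b) f \<cdot> (pfu F b \<star> Id2 C (pf1 F f)) = lun C (pf1 F f)"
      "pf2 F (run D f) \<cdot> pfc F f (Id1 D a) \<cdot> (Id2 C (pf1 F f) \<star> pfu F a) = run C (pf1 F f)"
      if "f \<in> hom1 D a b" for f a b
      using dhom[OF that] assms(6,7)[of f] unfolding mon_unit_def by simp_all
    show "pf0 F a \<in> Obj C" if "a \<in> Obj D" for a
      unfolding obj[OF that] F.pf0_pt by (rule objC)
  qed (simp_all add: assms(2))
qed

lemma monoidal_psf_pid: assumes "monoidal_bicat B" shows "monoidal_psf (pid B) B B"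
proof -
  interpret monoidal_bicat B by fact
  interpret pre_psf "pid B" B B
    by unfold_locales (auto simp: pid_def hom2_iff iso2_iff simp flip: mon_unit_def)
  show ?thesis
    by (rule monoidal_psfI, unfold_locales) (simp_all add: pid_def flip: mon_unit_def)
qed

lemma img_pid: assumes "monoidal_bicat B" "valid B f" shows "img (pid B) f = f"
proof -
  interpret monoidal_bicat B by fact
  interpret I: monoidal_psf "pid B" B B by (rule monoidal_psf_pid) fact
  have s [simp]: "pf1 (pid B) = id" "pf2 (pid B) = id" "pfc (pid B) = (\<lambda>g f. Id2 B (g \<odot>\<^bsub>B\<^esub> f))" by (simp_all add: pid_def)
  have pu: "pfu (pid B) (the_elem (Obj B)) = Id2 B U" by (simp add: pid_def mon_unit_def)
  have "pfl (pid B) us = Id2 B (pth B us)" if "set us \<subseteq> Mor B" for us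
    using that
  proof (induction us)
    case (Cons u us)
    then show ?case by (cases "us = []") (simp_all add: I.pfl_Cons pth_Cons)
  qed (simp add: pu)
  then show ?thesis using assms(2) valids[OF assms(2)]
    by (intro dia_eqI) (simp_all add: I.cell_img)
qed

lemma pre_psf_pcomp:
  assumes "pre_psf F D C" "monoidal_psf G C E" shows "pre_psf (G \<circ>\<^sub>p F) D E"
proof -
  interpret F: pre_psf F D C by fact
  interpret G: monoidal_psf G C E by fact
  show ?thesis
    by unfold_locales (simp_all add: pcomp_def F.pf0_pt G.pf0_pt G.C.hom2_iff G.C.iso2_iff)
qed

text \<open>By induction on the list, the iterated constraint of the composite is that of G followed
  by the image of that of F.\<close>

lemma img_pcomp:
  assumes "pre_psf F D C" "monoidal_psf G C E" "valid D f" shows "img (G \<circ>\<^sub>p F) f = img G (img F f)"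
proof -
  interpret F: pre_psf F D C by fact
  interpret G: monoidal_psf G C E by fact
  interpret GF: pre_psf "G \<circ>\<^sub>p F" D E by (rule pre_psf_pcomp) fact+
  have s [simp]: "pf1 (G \<circ>\<^sub>p F) = pf1 G \<circ> pf1 F" "pf2 (G \<circ>\<^sub>p F) = pf2 G \<circ> pf2 F"
    "pfc (G \<circ>\<^sub>p F) = (\<lambda>g f. pf2 G (pfc F g f) \<cdot>\<^bsub>E\<^esub> pfc G (pf1 F g) (pf1 F f))" 
    "GF.pu = pf2 G F.pu \<cdot>\<^bsub>E\<^esub> G.pu"
    by (simp_all add: pcomp_def F.pf0_pt)
  have "pfl (G \<circ>\<^sub>p F) us = pf2 G (pfl F us) \<cdot>\<^bsub>E\<^esub> pfl G (map (pf1 F) us)" if "set us \<subseteq> Mor D" for us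
    using that
  proof (induction us)
    case (Cons u us)
    show ?case
    proof (cases "us = []")
      case False
      have [simp]: "u \<in> Mor D" "set us \<subseteq> Mor D" using Cons.prems by auto
      have "pfc G (pf1 F u) (pf1 F (pth D us)) \<cdot>\<^bsub>E\<^esub> (Id2 E (pf1 G (pf1 F u)) \<star>\<^bsub>E\<^esub> pf2 G (pfl F us))
          = pf2 G (Id2 C (pf1 F u) \<star>\<^bsub>C\<^esub> pfl F us) \<cdot>\<^bsub>E\<^esub> pfc G (pf1 F u) (pth C (map (pf1 F) us))"
        using G.pfc_nat[of "pfl F us" "Id2 C (pf1 F u)"] by simp
      then show ?thesis using Cons False
        by (simp add: GF.pfl_Cons G.pfl_Cons F.pfl_Cons G.C.hcomp_Id_left flip: G.C.vassoc) simp
    qed (use Cons in simp)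
  qed simp
  then show ?thesis using F.D.valids[OF assms(3)] assms(3)
    by (intro G.C.dia_eqI) (simp_all add: GF.cell_img F.cell_img G.cell_img)
qed

lemma prod_bicat_simps [simp]:
  "Obj (A \<times>\<^sub>b B) = Obj A \<times> Obj B" "Mor (A \<times>\<^sub>b B) = Mor A \<times> Mor B" "Cel (A \<times>\<^sub>b B) = Cel A \<times> Cel B"
  "Dom (A \<times>\<^sub>b B) \<alpha> = (Dom A (fst \<alpha>), Dom B (snd \<alpha>))" "Cod (A \<times>\<^sub>b B) \<alpha> = (Cod A (fst \<alpha>), Cod B (snd \<alpha>))"
  "Id1 (A \<times>\<^sub>b B) a = (Id1 A (fst a), Id1 B (snd a))"
  "comp1 (A \<times>\<^sub>b B) g f = (comp1 A (fst g) (fst f), comp1 B (snd g) (snd f))"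
  "Id2 (A \<times>\<^sub>b B) f = (Id2 A (fst f), Id2 B (snd f))"
  "vcomp (A \<times>\<^sub>b B) \<beta> \<alpha> = (vcomp A (fst \<beta>) (fst \<alpha>), vcomp B (snd \<beta>) (snd \<alpha>))"
  "hcomp (A \<times>\<^sub>b B) \<beta> \<alpha> = (hcomp A (fst \<beta>) (fst \<alpha>), hcomp B (snd \<beta>) (snd \<alpha>))"
  "asc (A \<times>\<^sub>b B) h g f = (asc A (fst h) (fst g) (fst f), asc B (snd h) (snd g) (snd f))"
  "lun (A \<times>\<^sub>b B) f = (lun A (fst f), lun B (snd f))" "run (A \<times>\<^sub>b B) f = (run A (fst f), run B (snd f))"
  by (simp_all add: prod_bicat_def map_prod_def split_beta)

locale monoidal_product = A: monoidal_bicat A + B: monoidal_bicat B + P: monoidal_bicat "A \<times>\<^sub>b B"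
  for A :: "('o, 'm, 'c) bicat" and B :: "('o2, 'm2, 'c2) bicat"
begin

lemma the_elem_prod [simp]: "the_elem (Obj A \<times> Obj B) = (the_elem (Obj A), the_elem (Obj B))"
  by (subst A.Obj_eq, subst B.Obj_eq) simp

lemma mon_unit_prod [simp]: "mon_unit (A \<times>\<^sub>b B) = (mon_unit A, mon_unit B)"
  unfolding mon_unit_def by simp

lemma isoc_prod: "isoc (A \<times>\<^sub>b B) \<alpha> \<longleftrightarrow> isoc A (fst \<alpha>) \<and> isoc B (snd \<alpha>)"
  and inv2_prod: "isoc A (fst \<alpha>) \<Longrightarrow> isoc B (snd \<alpha>) \<Longrightarrow> inv2 (A \<times>\<^sub>b B) \<alpha> = (inv2 A (fst \<alpha>), inv2 B (snd \<alpha>))"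
proof -
  have 1: "isoc (A \<times>\<^sub>b B) \<alpha> \<and> inv2 (A \<times>\<^sub>b B) \<alpha> = (inv2 A (fst \<alpha>), inv2 B (snd \<alpha>))"
    if "isoc A (fst \<alpha>)" "isoc B (snd \<alpha>)"
    using that by (intro P.isoI) (auto simp: mem_Times_iff)
  have 2: "isoc A (fst \<alpha>)" "isoc B (snd \<alpha>)" if "isoc (A \<times>\<^sub>b B) \<alpha>"
    using A.isoI[of "fst \<alpha>" "fst (inv2 (A \<times>\<^sub>b B) \<alpha>)"] B.isoI[of "snd \<alpha>" "snd (inv2 (A \<times>\<^sub>b B) \<alpha>)"]
      P.isoc_Cel[OF that] P.inv2_Cel[OF that] P.inv2_Dom[OF that] P.inv2_Cod[OF that] P.inv2_left[OF that] P.inv2_right[OF that]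
    by (auto simp: mem_Times_iff)
  show "isoc (A \<times>\<^sub>b B) \<alpha> \<longleftrightarrow> isoc A (fst \<alpha>) \<and> isoc B (snd \<alpha>)" using 1 2 by blast
  show "isoc A (fst \<alpha>) \<Longrightarrow> isoc B (snd \<alpha>) \<Longrightarrow> inv2 (A \<times>\<^sub>b B) \<alpha> = (inv2 A (fst \<alpha>), inv2 B (snd \<alpha>))"
    using 1 by blast
qed

lemma Mor_fst_snd: "set us \<subseteq> Mor A \<times> Mor B \<longleftrightarrow> set (map fst us) \<subseteq> Mor A \<and> set (map snd us) \<subseteq> Mor B"
  by (induction us) auto

lemma pth_prod: "pth (A \<times>\<^sub>b B) us = (pth A (map fst us), pth B (map snd us))"
proof (induction us)
  case (Cons u us)
  then show ?case
    by (cases "us = []") (simp_all add: P.pth_Cons A.pth_Cons B.pth_Cons)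
qed simp

lemma monoidal_psf_pfst: "monoidal_psf (pfst A B) (A \<times>\<^sub>b B) A"
proof -
  have "pre_psf (pfst A B) (A \<times>\<^sub>b B) A"
    by unfold_locales
      (auto simp: pfst_def A.hom2_iff A.iso2_iff mem_Times_iff simp flip: mon_unit_def)
  then show ?thesis
    by (rule monoidal_psfI) (auto simp: pfst_def simp flip: mon_unit_def)
qed

lemma monoidal_psf_psnd: "monoidal_psf (psnd A B) (A \<times>\<^sub>b B) B"
proof -
  have "pre_psf (psnd A B) (A \<times>\<^sub>b B) B"
    by unfold_locales
      (auto simp: psnd_def B.hom2_iff B.iso2_iff mem_Times_iff simp flip: mon_unit_def)
  then show ?thesis
    by (rule monoidal_psfI) (auto simp: psnd_def simp flip: mon_unit_def)
qed

sublocale fs: monoidal_psf "pfst A B" "A \<times>\<^sub>b B" A by (rule monoidal_psf_pfst)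
sublocale sn: monoidal_psf "psnd A B" "A \<times>\<^sub>b B" B by (rule monoidal_psf_psnd)

lemma pfst_simps [simp]: "pf1 (pfst A B) = fst" "pf2 (pfst A B) = fst"
  "pf1 (psnd A B) = snd" "pf2 (psnd A B) = snd"
  by (simp_all add: pfst_def psnd_def)

lemma pfl_proj: "set us \<subseteq> Mor (A \<times>\<^sub>b B) \<Longrightarrow> pfl (pfst A B) us = Id2 A (fst (pth (A \<times>\<^sub>b B) us)) \<and>
    pfl (psnd A B) us = Id2 B (snd (pth (A \<times>\<^sub>b B) us))"
proof (induction us)
  case Nil
  have "pfu (pfst A B) p = Id2 A (Id1 A (fst p))" "pfu (psnd A B) p = Id2 B (Id1 B (snd p))" for p
    by (simp_all add: pfst_def psnd_def)
  then show ?case by (simp add: mon_unit_def)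
next
  case (Cons u us)
  have c: "pfc (pfst A B) u v = Id2 A (comp1 A (fst u) (fst v))" 
    "pfc (psnd A B) u v = Id2 B (comp1 B (snd u) (snd v))" for u v by (simp_all add: pfst_def psnd_def)
  show ?case
    using Cons by (cases "us = []") (auto simp: fs.pfl_Cons sn.pfl_Cons P.pth_Cons A.pth_Cons B.pth_Cons c pth_prod Mor_fst_snd)
qed

lemma cell_img_proj: assumes "valid (A \<times>\<^sub>b B) f"
  shows "cell (img (pfst A B) f) = fst (cell f)" "cell (img (psnd A B) f) = snd (cell f)"
  using P.valids[OF assms] assms
  by (auto simp: fs.cell_img sn.cell_img pfl_proj pth_prod Mor_fst_snd simp del: prod_bicat_simps(4,5))
     (auto simp: mem_Times_iff)

text \<open>This is how equations about interchange are proved: they are checked in each factor of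
  the product, where they concern units only, and then carried over by the composition
  functor.\<close>

lemma prod_eqI:
  assumes "valid (A \<times>\<^sub>b B) f" "valid (A \<times>\<^sub>b B) g"
    and 1: "img (pfst A B) f = img (pfst A B) g" and 2: "img (psnd A B) f = img (psnd A B) g"
  shows "f = g"
proof -
  have "map fst (dsrc f) = map fst (dsrc g)" "map snd (dsrc f) = map snd (dsrc g)"
    "map fst (dtrg f) = map fst (dtrg g)" "map snd (dtrg f) = map snd (dtrg g)"
    using arg_cong[OF 1, of dsrc] arg_cong[OF 1, of dtrg] arg_cong[OF 2, of dsrc] arg_cong[OF 2, of dtrg] by simp_all
  then have "dsrc f = dsrc g" "dtrg f = dtrg g" by (metis zip_map_fst_snd)+
  moreover have "cell f = cell g"
    using cell_img_proj[OF assms(1)] cell_img_proj[OF assms(2)] 1 2 by (metis prod_eqI)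
  ultimately show ?thesis using P.dia_eqI assms(1,2) by blast
qed

lemma pre_psf_ppair:
  assumes "pre_psf F D A" "pre_psf G D B" shows "pre_psf (ppair F G) D (A \<times>\<^sub>b B)"
proof -
  interpret F: pre_psf F D A by fact
  interpret G: pre_psf G D B by fact
  show ?thesis
    by unfold_locales (auto simp: ppair_def F.pf0_pt G.pf0_pt P.hom2_iff P.iso2_iff isoc_prod)
qed

lemma img_ppair:
  assumes "pre_psf F D A" "pre_psf G D B" "valid D f"
  shows "img (pfst A B) (img (ppair F G) f) = img F f" "img (psnd A B) (img (ppair F G) f) = img G f"
proof -
  interpret F: pre_psf F D A by fact
  interpret G: pre_psf G D B by fact
  interpret H: pre_psf "ppair F G" D "A \<times>\<^sub>b B" by (rule pre_psf_ppair) fact+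
  have s [simp]: "pf1 (ppair F G) = (\<lambda>f. (pf1 F f, pf1 G f))" "pf2 (ppair F G) = (\<lambda>f. (pf2 F f, pf2 G f))"
    "pfc (ppair F G) = (\<lambda>g f. (pfc F g f, pfc G g f))" "H.pu = (F.pu, G.pu)"
    by (simp_all add: ppair_def)
  have pfl: "pfl (ppair F G) us = (pfl F us, pfl G us)" if "set us \<subseteq> Mor D" for us
    using that
  proof (induction us)
    case (Cons u us)
    then show ?case by (cases "us = []") (simp_all add: H.pfl_Cons F.pfl_Cons G.pfl_Cons)
  qed simp
  note v = F.D.valids[OF assms(3)]
  have c: "cell (img (ppair F G) f) = (cell (img F f), cell (img G f))"
    using v assms(3) by (simp add: H.cell_img F.cell_img G.cell_img pfl inv2_prod)
  have vH: "valid (A \<times>\<^sub>b B) (img (ppair F G) f)" using assms(3) by simp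
  show "img (pfst A B) (img (ppair F G) f) = img F f"
    using assms(3) vH cell_img_proj(1)[OF vH] c by (intro A.dia_eqI) simp_all
  show "img (psnd A B) (img (ppair F G) f) = img G f"
    using assms(3) vH cell_img_proj(2)[OF vH] c by (intro B.dia_eqI) simp_all
qed

end

text \<open>That the product is a bicategory is taken as a premise; a pseudofunctor defined on the
  product supplies it.\<close>

lemma monoidal_productI: assumes "monoidal_bicat A" "monoidal_bicat B" "bicategory (A \<times>\<^sub>b B)" shows "monoidal_product A B"
proof -
  interpret A: monoidal_bicat A by fact
  interpret B: monoidal_bicat B by fact
  interpret P: bicategory "A \<times>\<^sub>b B" by fact
  have "Obj (A \<times>\<^sub>b B) = {(the_elem (Obj A), the_elem (Obj B))}"
    unfolding prod_bicat_simps by (subst A.Obj_eq, subst B.Obj_eq) simp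
  then have "\<exists>!a. a \<in> Obj (A \<times>\<^sub>b B)" by auto
  then show ?thesis by unfold_locales
qed

section \<open>The braiding determined by an invertible object\<close>

subsection \<open>Invertible objects\<close>

context monoidal_bicat begin

lemma exchange: assumes "valid B f" "valid B g" shows
  "wh B us f (ws @ dsrc g @ vs) ;; wh B (us @ dtrg f @ ws) g vs = wh B (us @ dsrc f @ ws) g vs ;; wh B us f (ws @ dtrg g @ vs)"
  using interchange_wh[of f "dsrc f" "dtrg f" g "dsrc g" "dtrg g"] assms by (simp add: homI)

text \<open>An equation between consecutive cells, in the form in which it applies at the front of a
  longer composite that is nested to the right.\<close>

lemma seq_rewrite2: "f ;; g = h \<Longrightarrow> f ;; (g ;; k) = h ;; k" by (simp flip: seq_assoc)
lemma seq_rewrite3: "f ;; g ;; h = l \<Longrightarrow> f ;; (g ;; (h ;; k)) = l ;; k" by (simp flip: seq_assoc)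

definition dual_pair :: "'m \<Rightarrow> 'm \<Rightarrow> ('m, 'c) dia \<Rightarrow> ('m, 'c) dia \<Rightarrow> bool" where
  "dual_pair W W' \<epsilon> \<eta> \<longleftrightarrow> W \<in> Mor B \<and> W' \<in> Mor B \<and> diso B \<epsilon> \<and> dsrc \<epsilon> = [W, W'] \<and> dtrg \<epsilon> = []
     \<and> diso B \<eta> \<and> dsrc \<eta> = [] \<and> dtrg \<eta> = [W', W] \<and> wh B [W] \<eta> [] ;; wh B [] \<epsilon> [W] = idd B [W]"

text \<open>Whiskering with W and then with W' amounts to conjugation by the invertible \<epsilon>,
  so a diagram can be recovered from its whiskering with W.\<close>

lemma dual_pair_faithful:
  assumes "dual_pair W W' \<epsilon> \<eta>" and [simp]: "valid B f" "valid B g" "dsrc g = dsrc f" "dtrg g = dtrg f"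
    and eq: "wh B [] f [W] = wh B [] g [W]"
  shows "f = g"
proof -
  note d [simp] = assms(1)[unfolded dual_pair_def]
  note [simp] = valids[of f] valids[of g]
  have h: "h = wh B (dsrc h) (dinv B \<epsilon>) [] ;; wh B [] h [W, W'] ;; wh B (dtrg h) \<epsilon> []"
    if [simp]: "valid B h" for h
  proof -
    note [simp] = valids[of h]
    have "wh B [] h [W, W'] ;; wh B (dtrg h) \<epsilon> [] = wh B (dsrc h) \<epsilon> [] ;; h"
      using exchange[of h \<epsilon> "[]" "[]" "[]"] by simp
    moreover have "wh B (dsrc h) (dinv B \<epsilon>) [] ;; wh B (dsrc h) \<epsilon> [] = idd B (dsrc h)"
      by (simp flip: wh_seq)
    ultimately show ?thesis by (simp flip: seq_assoc)
  qed
  have "wh B [] f [W, W'] = wh B [] g [W, W']"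
    using arg_cong[OF eq, of "\<lambda>f. wh B [] f [W']"] by simp
  then show ?thesis using h[of f] h[of g] by simp
qed

text \<open>The preimage is f bent round: create W W' with the inverse counit, apply f, cancel W
  W'.\<close>

lemma dual_pair_full:
  assumes "dual_pair W W' \<epsilon> \<eta>" and [simp]: "valid B f" "dsrc f = us @ [W]" "dtrg f = vs @ [W]"
  obtains t where "valid B t" "dsrc t = us" "dtrg t = vs" "f = wh B [] t [W]"
proof
  note d [simp] = assms(1)[unfolded dual_pair_def]
  have [simp]: "set us \<subseteq> Mor B" "set vs \<subseteq> Mor B" using valid_dsrc[of f] valid_dtrg[of f] by auto
  define t where "t = wh B us (dinv B \<epsilon>) [] ;; wh B [] f [W'] ;; wh B vs \<epsilon> []"
  show [simp]: "valid B t" "dsrc t = us" "dtrg t = vs" unfolding t_def by simp_all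
  \<comment> \<open>The triangle identity, read as saying that the counit next to W undoes the unit;
    it lets f slide past.\<close>
  have e: "wh B [] \<epsilon> [W] = wh B [W] (dinv B \<eta>) []"
    using iso_cancel[of "wh B [W] \<eta> []" "wh B [] \<epsilon> [W]" "wh B [W] (dinv B \<eta>) []"] d by (simp flip: wh_seq)
  have e': "wh B [] (dinv B \<epsilon>) [W] = wh B [W] \<eta> []"
    using arg_cong[OF e, of "dinv B"] by (simp add: inv_wh)
  have e1: "wh B vs \<epsilon> [W] = wh B (vs @ [W]) (dinv B \<eta>) []" "wh B us (dinv B \<epsilon>) [W] = wh B (us @ [W]) \<eta> []"
    using wh_cong[OF e, of vs "[]"] wh_cong[OF e', of us "[]"] by simp_all
  have "wh B [] t [W] = wh B us (dinv B \<epsilon>) [W] ;; wh B [] f [W', W] ;; wh B vs \<epsilon> [W]"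
    unfolding t_def by (simp add: wh_seq)
  also have "\<dots> = wh B (us @ [W]) \<eta> [] ;; (wh B [] f [W', W] ;; wh B (vs @ [W]) (dinv B \<eta>) [])"
    by (simp add: e1)
  also have "wh B [] f [W', W] ;; wh B (vs @ [W]) (dinv B \<eta>) [] = wh B (us @ [W]) (dinv B \<eta>) [] ;; f"
    using exchange[of f "dinv B \<eta>" "[]" "[]" "[]"] by simp
  also have "wh B (us @ [W]) \<eta> [] ;; wh B (us @ [W]) (dinv B \<eta>) [] ;; f = f"
    by (simp flip: seq_assoc wh_seq)
  finally show "f = wh B [] t [W]" by simp
qed

end

subsection \<open>Uniqueness and transfer of the braiding\<close>

text \<open>
  \<open>lam\<close>, \<open>p\<close>, \<open>x\<close> and \<open>C\<close> are the cells \<open>\<lambda>\<^sub>a\<close>, \<open>p\<^sub>b\<close>, \<open>x\<^sub>a\<^sub>b\<close> and the braiding; \<open>gl\<close> and \<open>gr\<close> are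
  the actions of \<open>I \<boxtimes> -\<close> and \<open>- \<boxtimes> I\<close> on diagrams; \<open>plist\<close>, \<open>xr\<close> and \<open>xl\<close> extend \<open>p\<close> and \<open>x\<close>
  to lists, where \<open>p\<close> and \<open>x\<close> are natural. That \<open>f\<close> may have an empty source or target in
  these naturality conditions is what makes scalars central.
\<close>

locale braiding_data = monoidal_bicat B for B :: "('o, 'm, 'c) bicat" (structure) +
  fixes L L' :: 'm and eps eta :: "('m, 'c) dia" and al ar :: "'m \<Rightarrow> 'm"
    and gl gr :: "('m, 'c) dia \<Rightarrow> ('m, 'c) dia"
    and lam p :: "'m \<Rightarrow> ('m, 'c) dia" and x C :: "'m \<Rightarrow> 'm \<Rightarrow> ('m, 'c) dia"
    and plist :: "'m list \<Rightarrow> ('m, 'c) dia" and xr :: "'m \<Rightarrow> 'm list \<Rightarrow> ('m, 'c) dia"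
    and xl :: "'m list \<Rightarrow> 'm \<Rightarrow> ('m, 'c) dia"
  assumes L_dual: "dual_pair L L' eps eta"
    and al_Mor [simp]: "a \<in> Mor B \<Longrightarrow> al a \<in> Mor B"
    and ar_Mor [simp]: "a \<in> Mor B \<Longrightarrow> ar a \<in> Mor B"
    and gl_iso [simp]: "diso B f \<Longrightarrow> diso B (gl f)" and gr_iso [simp]: "diso B f \<Longrightarrow> diso B (gr f)"
    and gl_valid [simp]: "valid B f \<Longrightarrow> valid B (gl f)" and gr_valid [simp]: "valid B f \<Longrightarrow> valid B (gr f)"
    and gl_typ [simp]: "dsrc (gl f) = map al (dsrc f)" "dtrg (gl f) = map al (dtrg f)"
    and gr_typ [simp]: "dsrc (gr f) = map ar (dsrc f)" "dtrg (gr f) = map ar (dtrg f)"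
    and lam_iso [simp]: "a \<in> Mor B \<Longrightarrow> diso B (lam a)"
    and lam_typ [simp]: "a \<in> Mor B \<Longrightarrow> dsrc (lam a) = [L, al a]" "a \<in> Mor B \<Longrightarrow> dtrg (lam a) = [a, L]"
    and p_iso [simp]: "a \<in> Mor B \<Longrightarrow> diso B (p a)"
    and p_typ [simp]: "a \<in> Mor B \<Longrightarrow> dsrc (p a) = [L, ar a]" "a \<in> Mor B \<Longrightarrow> dtrg (p a) = [a, L]"
    and x_iso [simp]: "a \<in> Mor B \<Longrightarrow> b \<in> Mor B \<Longrightarrow> diso B (x a b)"
    and x_typ [simp]: "a \<in> Mor B \<Longrightarrow> b \<in> Mor B \<Longrightarrow> dsrc (x a b) = [al a, ar b]"
       "a \<in> Mor B \<Longrightarrow> b \<in> Mor B \<Longrightarrow> dtrg (x a b) = [ar b, al a]"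
    and C_iso [simp]: "a \<in> Mor B \<Longrightarrow> b \<in> Mor B \<Longrightarrow> diso B (C a b)"
    and C_typ [simp]: "a \<in> Mor B \<Longrightarrow> b \<in> Mor B \<Longrightarrow> dsrc (C a b) = [a, b]"
       "a \<in> Mor B \<Longrightarrow> b \<in> Mor B \<Longrightarrow> dtrg (C a b) = [b, a]"
    and hex: "a \<in> Mor B \<Longrightarrow> b \<in> Mor B \<Longrightarrow>
       wh B [] (lam a) [ar b] ;; wh B [a] (p b) [] ;; wh B [] (C a b) [L]
     = wh B [L] (x a b) [] ;; wh B [] (p b) [al a] ;; wh B [b] (lam a) []"
    and plist_Nil: "plist [] = idd B [L]"
    and plist_Cons: "u \<in> Mor B \<Longrightarrow> plist (u # us) = wh B [] (p u) (map ar us) ;; wh B [u] (plist us) []"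
    and p_nat: "valid B f \<Longrightarrow> wh B [L] (gr f) [] ;; plist (dtrg f) = plist (dsrc f) ;; wh B [] f [L]"
    and xr_Nil: "a \<in> Mor B \<Longrightarrow> xr a [] = idd B [al a]"
    and xr_Cons: "a \<in> Mor B \<Longrightarrow> u \<in> Mor B \<Longrightarrow> set us \<subseteq> Mor B \<Longrightarrow> xr a (u # us) = wh B [] (x a u) (map ar us) ;; wh B [ar u] (xr a us) []"
    and xr_nat: "a \<in> Mor B \<Longrightarrow> valid B f \<Longrightarrow>
       wh B [al a] (gr f) [] ;; xr a (dtrg f) = xr a (dsrc f) ;; wh B [] (gr f) [al a]"
    and xl_Nil: "b \<in> Mor B \<Longrightarrow> xl [] b = idd B [ar b]"
    and xl_Cons: "b \<in> Mor B \<Longrightarrow> u \<in> Mor B \<Longrightarrow> set us \<subseteq> Mor B \<Longrightarrow> xl (u # us) b = wh B [al u] (xl us b) [] ;; wh B [] (x u b) (map al us)"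
    and xl_nat: "b \<in> Mor B \<Longrightarrow> valid B f \<Longrightarrow>
       wh B [] (gl f) [ar b] ;; xl (dtrg f) b = xl (dsrc f) b ;; wh B [ar b] (gl f) []"
begin

lemma L_Mor [simp]: "L \<in> Mor B"
  using L_dual unfolding dual_pair_def by simp

text \<open>A scalar z to the left of L equals \<open>gr z\<close> to its right, by
  \<open>p_nat\<close> at the empty list; \<open>gr z\<close> commutes with \<open>al a\<close> by
  \<open>xr_nat\<close>. Carried through \<open>lam a\<close>, which puts a in front of L, z
  therefore ends on the right of a.\<close>

lemma scalar_central:
  assumes z [simp]: "valid B z" "dsrc z = []" "dtrg z = []" and [simp]: "a \<in> Mor B"
  shows "wh B [] z [a] = wh B [a] z []"
proof (rule dual_pair_faithful[OF L_dual])
  have 1: "wh B [L] (gr z) [] = wh B [] z [L]" using p_nat[of z] by (simp add: plist_Nil)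
  have 2: "wh B [al a] (gr z) [] = wh B [] (gr z) [al a]" using xr_nat[of a z] by (simp add: xr_Nil)
  have "lam a ;; wh B [] z [a, L] = wh B [] z [L, al a] ;; lam a"
    using exchange[of z "lam a" "[]" "[]" "[]"] by simp
  also have "\<dots> = wh B [L] (gr z) [al a] ;; lam a"
    using wh_cong[OF 1, of "[]" "[al a]"] by simp
  also have "\<dots> = wh B [L, al a] (gr z) [] ;; lam a"
    using wh_cong[OF 2, of "[L]" "[]"] by simp
  also have "\<dots> = lam a ;; wh B [a, L] (gr z) []"
    using exchange[of "lam a" "gr z" "[]" "[]" "[]"] by simp
  also have "\<dots> = lam a ;; wh B [a] z [L]"
    using wh_cong[OF 1, of "[a]" "[]"] by simp
  finally have "lam a ;; wh B [] z [a, L] = lam a ;; wh B [a] z [L]" .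
  then have "wh B [] z [a, L] = wh B [a] z [L]" by - (rule iso_cancel[of "lam a"]; simp)
  then show "wh B [] (wh B [] z [a]) [L] = wh B [] (wh B [a] z []) [L]" by simp
qed simp_all

text \<open>This is naturality of crossing with a at the cell \<open>C k b\<close>. Fact
  \<open>H\<close> extends the equation \<open>hex\<close> from one object to a list of two;
  \<open>p_nat\<close> and \<open>xr_nat\<close> then move \<open>C k b\<close> through it, and all
  other cells cancel.\<close>

lemma yang_baxter:
  assumes [simp]: "a \<in> Mor B" "b \<in> Mor B" "k \<in> Mor B"
  shows "wh B [] (C a k) [b] ;; wh B [k] (C a b) [] ;; wh B [] (C k b) [a]
       = wh B [a] (C k b) [] ;; wh B [] (C a b) [k] ;; wh B [b] (C a k) []"
proof -
  have H: "wh B [] (lam a) [ar u, ar w] ;; wh B [a] (plist [u, w]) [] ;; wh B [] (C a u) [w, L] ;; wh B [u] (C a w) [L]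
      = wh B [L] (xr a [u, w]) [] ;; wh B [] (plist [u, w]) [al a] ;; wh B [u, w] (lam a) []"
    if [simp]: "u \<in> Mor B" "w \<in> Mor B" for u w
  proof -
    have 1: "wh B [a, u] (p w) [] ;; wh B [] (C a u) [w, L] = wh B [] (C a u) [L, ar w] ;; wh B [u, a] (p w) []"
      using exchange[of "C a u" "p w" "[]" "[]" "[]"] by simp
    have 2: "wh B [] (lam a) [ar u, ar w] ;; wh B [a] (p u) [ar w] ;; wh B [] (C a u) [L, ar w]
     = wh B [L] (x a u) [ar w] ;; wh B [] (p u) [al a, ar w] ;; wh B [u] (lam a) [ar w]"
      using wh_cong[OF hex[of a u], of "[]" "[ar w]"] by (simp add: wh_seq)
    have 3: "wh B [u] (lam a) [ar w] ;; wh B [u, a] (p w) [] ;; wh B [u] (C a w) [L]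
     = wh B [u, L] (x a w) [] ;; wh B [u] (p w) [al a] ;; wh B [u, w] (lam a) []"
      using wh_cong[OF hex[of a w], of "[u]" "[]"] by (simp add: wh_seq)
    have 4: "wh B [] (p u) [al a, ar w] ;; wh B [u, L] (x a w) [] = wh B [L, ar u] (x a w) [] ;; wh B [] (p u) [ar w, al a]"
      using exchange[of "p u" "x a w" "[]" "[]" "[]"] by simp
    have "wh B [] (lam a) [ar u, ar w] ;; wh B [a] (plist [u, w]) [] ;; wh B [] (C a u) [w, L] ;; wh B [u] (C a w) [L]
      = wh B [] (lam a) [ar u, ar w] ;; wh B [a] (p u) [ar w] ;; wh B [a, u] (p w) [] ;; wh B [] (C a u) [w, L] ;; wh B [u] (C a w) [L]"
      by (simp add: plist_Cons plist_Nil wh_seq)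
    also have "\<dots> = wh B [L] (x a u) [ar w] ;; wh B [] (p u) [al a, ar w] ;; wh B [u] (lam a) [ar w] ;; wh B [u, a] (p w) [] ;; wh B [u] (C a w) [L]"
      by (simp only: seq_rewrite2[OF 1] seq_assoc seq_rewrite3[OF 2])
    also have "\<dots> = wh B [L] (x a u) [ar w] ;; wh B [L, ar u] (x a w) [] ;; wh B [] (p u) [ar w, al a] ;; wh B [u] (p w) [al a] ;; wh B [u, w] (lam a) []"
      by (simp only: 3 seq_assoc seq_rewrite2[OF 4])
    also have "\<dots> = wh B [L] (xr a [u, w]) [] ;; wh B [] (plist [u, w]) [al a] ;; wh B [u, w] (lam a) []"
      by (simp add: plist_Cons plist_Nil xr_Cons xr_Nil wh_seq)
    finally show ?thesis .
  qed
  let ?s = "C k b"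
  let ?q1 = "plist [k, b]" and ?q2 = "plist [b, k]"
  have plist_typing [simp]: "valid B (plist [u, w])" "dsrc (plist [u, w]) = [L, ar u, ar w]" "dtrg (plist [u, w]) = [u, w, L]" "diso B (plist [u, w])"
    if "u \<in> Mor B" "w \<in> Mor B" for u w using that by (simp_all add: plist_Cons plist_Nil)
  have xr_typing [simp]: "valid B (xr a [u, w])" "dsrc (xr a [u, w]) = [al a, ar u, ar w]" "dtrg (xr a [u, w]) = [ar u, ar w, al a]"
    if "u \<in> Mor B" "w \<in> Mor B" for u w using that by (simp_all add: xr_Cons xr_Nil)
  have P: "wh B [L] (gr ?s) [] ;; ?q2 = ?q1 ;; wh B [] ?s [L]" using p_nat[of ?s] by simp
  have X: "wh B [al a] (gr ?s) [] ;; xr a [b, k] = xr a [k, b] ;; wh B [] (gr ?s) [al a]" using xr_nat[of a ?s] by simp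
  let ?c1 = "wh B [] (C a k) [b, L] ;; wh B [k] (C a b) [L]" and ?c2 = "wh B [] (C a b) [k, L] ;; wh B [b] (C a k) [L]"
  let ?h = "wh B [] (lam a) [ar k, ar b] ;; wh B [a] ?q1 []"
  have "?h ;; ?c1 ;; wh B [] ?s [a, L] = (?h ;; ?c1) ;; wh B [] ?s [a, L]" by simp
  also have "\<dots> = (wh B [L] (xr a [k, b]) [] ;; wh B [] ?q1 [al a] ;; wh B [k, b] (lam a) []) ;; wh B [] ?s [a, L]"
    using seq_cong_right[OF H[of k b], of "wh B [] ?s [a, L]"] by simp
  also have "\<dots> = wh B [L] (xr a [k, b]) [] ;; wh B [] ?q1 [al a] ;; wh B [] ?s [L, al a] ;; wh B [b, k] (lam a) []"
    using exchange[of ?s "lam a" "[]" "[]" "[]"] by simp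
  also have "wh B [] ?q1 [al a] ;; wh B [] ?s [L, al a] ;; wh B [b, k] (lam a) []
      = wh B [L] (gr ?s) [al a] ;; wh B [] ?q2 [al a] ;; wh B [b, k] (lam a) []"
    using seq_rewrite2[OF wh_cong[OF P[symmetric], of "[]" "[al a]", unfolded wh_seq]] by simp
  also have "wh B [L] (xr a [k, b]) [] ;; wh B [L] (gr ?s) [al a] ;; wh B [] ?q2 [al a] ;; wh B [b, k] (lam a) []
      = wh B [L, al a] (gr ?s) [] ;; wh B [L] (xr a [b, k]) [] ;; wh B [] ?q2 [al a] ;; wh B [b, k] (lam a) []"
    using seq_rewrite2[OF wh_cong[OF X[symmetric], of "[L]" "[]", unfolded wh_seq]] by simp
  also have "\<dots> = wh B [L, al a] (gr ?s) [] ;; wh B [] (lam a) [ar b, ar k] ;; wh B [a] ?q2 [] ;; ?c2"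
    using H[of b k] by simp
  also have "\<dots> = wh B [] (lam a) [ar k, ar b] ;; wh B [a, L] (gr ?s) [] ;; wh B [a] ?q2 [] ;; ?c2"
    using seq_rewrite2[OF exchange[of "lam a" "gr ?s" "[]" "[]" "[]"]] by simp
  also have "wh B [a, L] (gr ?s) [] ;; wh B [a] ?q2 [] ;; ?c2 = wh B [a] ?q1 [] ;; wh B [a] ?s [L] ;; ?c2"
    using seq_rewrite2[OF wh_cong[OF P, of "[a]" "[]", unfolded wh_seq]] by simp
  finally have "?h ;; (?c1 ;; wh B [] ?s [a, L]) = ?h ;; (wh B [a] ?s [L] ;; ?c2)" by simp
  then have "?c1 ;; wh B [] ?s [a, L] = wh B [a] ?s [L] ;; ?c2"
    by - (rule iso_cancel[of ?h]; simp)
  then show ?thesis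
    by - (rule dual_pair_faithful[OF L_dual]; simp add: wh_seq)
qed

text \<open>
  \<open>e\<close> and \<open>e'\<close> differ by an automorphism of the invertible object \<open>K L\<close>, that is, by a scalar.
\<close>

lemma adjust_scalar:
  assumes dual: "dual_pair K J \<delta> \<gamma>" and [simp]: "diso B e" "dsrc e = V" "dtrg e = [K, L]" "diso B e'" "dsrc e' = V" "dtrg e' = [K, L]"
    and [simp]: "b \<in> Mor B" "valid B q" "dsrc q = V @ [ar b]" "dtrg q = b # V"
    and eq: "q ;; wh B [b] e' [] = wh B [] e' [ar b] ;; wh B [K] (p b) [] ;; wh B [] (C K b) [L]"
  shows "q ;; wh B [b] e [] = wh B [] e [ar b] ;; wh B [K] (p b) [] ;; wh B [] (C K b) [L]"
proof -
  have [simp]: "K \<in> Mor B" using dual unfolding dual_pair_def by simp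
  have [simp]: "set V \<subseteq> Mor B" using valid_dsrc[of e] by simp
  define s where "s = dinv B e ;; e'"
  have s [simp]: "diso B s" "dsrc s = [K, L]" "dtrg s = [K, L]" by (simp_all add: s_def)
  \<comment> \<open>Fullness of whiskering with L, and then with K, strips both objects off the
    automorphism s of K L and leaves the scalar z.\<close>
  obtain t where t [simp]: "valid B t" "dsrc t = [K]" "dtrg t = [K]" and st: "s = wh B [] t [L]"
    using dual_pair_full[OF L_dual, of s "[K]" "[K]"] by auto
  obtain z where z [simp]: "valid B z" "dsrc z = []" "dtrg z = []" and tz: "t = wh B [] z [K]"
    using dual_pair_full[OF dual, of t "[]" "[]"] by auto
  have sz: "s = wh B [] z [K, L]" using st tz by simp
  have e': "e' = e ;; wh B [] z [K, L]" unfolding sz[symmetric] s_def by simp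
  have c: "wh B [b] z [K, L] = wh B [] z [b, K, L]"
    using wh_cong[OF scalar_central[OF z, of b], of "[]" "[K, L]"] by simp
  have 1: "wh B [] z [K, L, ar b] ;; wh B [K] (p b) [] = wh B [K] (p b) [] ;; wh B [] z [K, b, L]"
    using exchange[of z "p b" "[]" "[K]" "[]"] by simp
  have 2: "wh B [] z [K, b, L] ;; wh B [] (C K b) [L] = wh B [] (C K b) [L] ;; wh B [] z [b, K, L]"
    using exchange[of z "C K b" "[]" "[]" "[L]"] by simp
  have "(q ;; wh B [b] e []) ;; wh B [b] s [] = q ;; wh B [b] e' []"
    by (simp add: e' sz wh_seq)
  also have "\<dots> = wh B [] e [ar b] ;; wh B [] z [K, L, ar b] ;; wh B [K] (p b) [] ;; wh B [] (C K b) [L]"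
    unfolding eq by (simp add: e' wh_seq)
  also have "\<dots> = (wh B [] e [ar b] ;; wh B [K] (p b) [] ;; wh B [] (C K b) [L]) ;; wh B [b] s []"
    by (simp add: seq_rewrite2[OF 1] 2 sz c)
  finally show ?thesis by - (rule iso_cancel_post[of "wh B [b] s []"]; simp)
qed

text \<open>The isomorphism e creates J and K inside \<open>gr\<close>, absorbs V and J into L by g,
  and pulls K out by \<open>p K\<close>. Interchanging a with J and then with K after creating both
  is the same as creating them on the other side (\<open>xr_nat\<close> at j); what remains is the
  crossing with K from \<open>hex\<close>.\<close>

lemma transfer_left:
  fixes j g
  assumes [simp]: "J \<in> Mor B" "K \<in> Mor B" "diso B j" "dsrc j = []" "dtrg j = [J, K]"
    and [simp]: "set V \<subseteq> Mor B" "diso B g" "dsrc g = V @ [ar J]" "dtrg g = [L]"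
    and [simp]: "a \<in> Mor B" "valid B v" "dsrc v = V @ [al a]" "dtrg v = a # V"
    and g: "wh B V (x a J) [] ;; wh B [] g [al a] ;; lam a = wh B [] v [ar J] ;; wh B [a] g []"
  defines "e \<equiv> wh B V (gr j) [] ;; wh B [] g [ar K] ;; p K"
  shows "v ;; wh B [a] e [] = wh B [] e [al a] ;; wh B [K] (lam a) [] ;; wh B [] (dinv B (C a K)) [L]"
proof -
  have 1: "v ;; wh B (a # V) (gr j) [] = wh B (V @ [al a]) (gr j) [] ;; wh B [] v [ar J, ar K]"
    using exchange[of v "gr j" "[]" "[]" "[]"] by simp
  have 2: "wh B [] v [ar J, ar K] ;; wh B [a] g [ar K] = wh B V (x a J) [ar K] ;; wh B [] g [al a, ar K] ;; wh B [] (lam a) [ar K]"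
    using wh_cong[OF g[symmetric], of "[]" "[ar K]"] by (simp add: wh_seq)
  have 3: "wh B [] (lam a) [ar K] ;; wh B [a] (p K) [] = wh B [L] (x a K) [] ;; wh B [] (p K) [al a] ;; wh B [K] (lam a) [] ;; wh B [] (dinv B (C a K)) [L]"
    using seq_cong_right[OF hex[of a K], of "wh B [] (dinv B (C a K)) [L]"] by (simp flip: wh_seq)
  have 4: "wh B [] g [al a, ar K] ;; wh B [L] (x a K) [] = wh B (V @ [ar J]) (x a K) [] ;; wh B [] g [ar K, al a]"
    using exchange[of g "x a K" "[]" "[]" "[]"] by simp
  have "wh B [al a] (gr j) [] ;; wh B [] (x a J) [ar K] ;; wh B [ar J] (x a K) [] = wh B [] (gr j) [al a]"
    using xr_nat[of a j] by (simp add: xr_Cons xr_Nil)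
  from wh_cong[OF this, of V "[]"]
  have 5: "wh B (V @ [al a]) (gr j) [] ;; wh B V (x a J) [ar K] ;; wh B (V @ [ar J]) (x a K) [] = wh B V (gr j) [al a]"
    by (simp add: wh_seq)
  have "v ;; wh B [a] e [] = v ;; wh B (a # V) (gr j) [] ;; wh B [a] g [ar K] ;; wh B [a] (p K) []"
    by (simp add: e_def wh_seq)
  also have "\<dots> = wh B (V @ [al a]) (gr j) [] ;; wh B V (x a J) [ar K] ;; wh B [] g [al a, ar K] ;; wh B [] (lam a) [ar K] ;; wh B [a] (p K) []"
    by (simp only: seq_rewrite2[OF 1] seq_rewrite2[OF 2] seq_assoc)
  also have "\<dots> = wh B V (gr j) [al a] ;; wh B [] g [ar K, al a] ;; wh B [] (p K) [al a] ;; wh B [K] (lam a) [] ;; wh B [] (dinv B (C a K)) [L]"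
    by (simp only: 3 seq_rewrite2[OF 4] seq_assoc seq_rewrite3[OF 5])
  also have "\<dots> = wh B [] e [al a] ;; wh B [K] (lam a) [] ;; wh B [] (dinv B (C a K)) [L]"
    by (simp add: e_def wh_seq)
  finally show ?thesis .
qed

text \<open>The mirror image, with e built from \<open>gl\<close> and \<open>lam\<close>. Here K is
  the first argument of \<open>hex\<close>, so the crossing that remains is \<open>C K b\<close> and
  not an inverse.\<close>

lemma transfer_right:
  fixes j d
  assumes [simp]: "J \<in> Mor B" "K \<in> Mor B" "diso B j" "dsrc j = []" "dtrg j = [J, K]"
    and [simp]: "set V \<subseteq> Mor B" "diso B d" "dsrc d = V @ [al J]" "dtrg d = [L]"
    and [simp]: "b \<in> Mor B" "valid B q" "dsrc q = V @ [ar b]" "dtrg q = b # V"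
    and d: "wh B [] d [ar b] ;; p b = wh B V (x J b) [] ;; wh B [] q [al J] ;; wh B [b] d []"
  defines "e \<equiv> wh B V (gl j) [] ;; wh B [] d [al K] ;; lam K"
  shows "q ;; wh B [b] e [] = wh B [] e [ar b] ;; wh B [K] (p b) [] ;; wh B [] (C K b) [L]"
proof -
  have 1: "q ;; wh B (b # V) (gl j) [] = wh B (V @ [ar b]) (gl j) [] ;; wh B [] q [al J, al K]"
    using exchange[of q "gl j" "[]" "[]" "[]"] by simp
  have "wh B V (dinv B (x J b)) [] ;; wh B [] d [ar b] ;; p b = wh B [] q [al J] ;; wh B [b] d []"
    unfolding d by (simp add: inv_wh[symmetric])
  from wh_cong[OF this[symmetric], of "[]" "[al K]"]
  have 2: "wh B [] q [al J, al K] ;; wh B [b] d [al K] = wh B V (dinv B (x J b)) [al K] ;; wh B [] d [ar b, al K] ;; wh B [] (p b) [al K]"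
    by (simp add: wh_seq)
  have 3: "wh B [] (p b) [al K] ;; wh B [b] (lam K) [] = wh B [L] (dinv B (x K b)) [] ;; wh B [] (lam K) [ar b] ;; wh B [K] (p b) [] ;; wh B [] (C K b) [L]"
    unfolding hex[of K b, OF assms(2) assms(10)] by (simp add: inv_wh[symmetric])
  have 4: "wh B [] d [ar b, al K] ;; wh B [L] (dinv B (x K b)) [] = wh B (V @ [al J]) (dinv B (x K b)) [] ;; wh B [] d [al K, ar b]"
    using exchange[of d "dinv B (x K b)" "[]" "[]" "[]"] by simp
  have j: "wh B [] (gl j) [ar b] ;; wh B [al J] (x K b) [] ;; wh B [] (x J b) [al K] = wh B [ar b] (gl j) []"
    using xl_nat[of b j] by (simp add: xl_Cons xl_Nil)
  have "wh B [ar b] (gl j) [] ;; wh B [] (dinv B (x J b)) [al K] ;; wh B [al J] (dinv B (x K b)) [] = wh B [] (gl j) [ar b]"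
    unfolding j[symmetric] by (simp add: inv_wh[symmetric])
  from wh_cong[OF this, of V "[]"]
  have 5: "wh B (V @ [ar b]) (gl j) [] ;; wh B V (dinv B (x J b)) [al K] ;; wh B (V @ [al J]) (dinv B (x K b)) [] = wh B V (gl j) [ar b]"
    by (simp add: wh_seq)
  have "q ;; wh B [b] e [] = q ;; wh B (b # V) (gl j) [] ;; wh B [b] d [al K] ;; wh B [b] (lam K) []"
    by (simp add: e_def wh_seq)
  also have "\<dots> = wh B (V @ [ar b]) (gl j) [] ;; wh B V (dinv B (x J b)) [al K] ;; wh B [] d [ar b, al K] ;; wh B [] (p b) [al K] ;; wh B [b] (lam K) []"
    by (simp only: seq_rewrite2[OF 1] seq_rewrite2[OF 2] seq_assoc)
  also have "\<dots> = wh B V (gl j) [ar b] ;; wh B [] d [al K, ar b] ;; wh B [] (lam K) [ar b] ;; wh B [K] (p b) [] ;; wh B [] (C K b) [L]"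
    by (simp only: 3 seq_rewrite2[OF 4] seq_assoc seq_rewrite3[OF 5])
  also have "\<dots> = wh B [] e [ar b] ;; wh B [K] (p b) [] ;; wh B [] (C K b) [L]"
    by (simp add: e_def wh_seq)
  finally show ?thesis .
qed

text \<open>
  Pushing \<open>e\<close> through the equation for \<open>c\<close> turns it into the one for \<open>C a b\<close>, conjugated by
  crossings with \<open>K\<close>.
\<close>

lemma braiding_transfer:
  assumes dual: "dual_pair K J \<delta> \<gamma>" and [simp]: "diso B e" "dsrc e = V" "dtrg e = [K, L]"
    and [simp]: "a \<in> Mor B" "b \<in> Mor B"
    and [simp]: "diso B v" "dsrc v = V @ [al a]" "dtrg v = a # V"
    and [simp]: "diso B q" "dsrc q = V @ [ar b]" "dtrg q = b # V"
    and [simp]: "valid B c" "dsrc c = [a, b]" "dtrg c = [b, a]"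
    and v: "v ;; wh B [a] e [] = wh B [] e [al a] ;; wh B [K] (lam a) [] ;; wh B [] (dinv B (C a K)) [L]"
    and q: "q ;; wh B [b] e [] = wh B [] e [ar b] ;; wh B [K] (p b) [] ;; wh B [] (C K b) [L]"
    and c: "wh B [] v [ar b] ;; wh B [a] q [] ;; wh B [] c V = wh B V (x a b) [] ;; wh B [] q [al a] ;; wh B [b] v []"
  shows "c = C a b"
proof -
  have K [simp]: "K \<in> Mor B" using dual unfolding dual_pair_def by simp
  have [simp]: "set V \<subseteq> Mor B" using valid_dsrc[of e] by simp
  have 1: "wh B [] c V ;; wh B [b, a] e [] = wh B [a, b] e [] ;; wh B [] c [K, L]"
    using exchange[of c e "[]" "[]" "[]"] by simp
  have 2: "wh B [a] q [] ;; wh B [a, b] e [] = wh B [a] e [ar b] ;; wh B [a, K] (p b) [] ;; wh B [a] (C K b) [L]"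
    using wh_cong[OF q, of "[a]" "[]"] by (simp add: wh_seq)
  have 3: "wh B [] v [ar b] ;; wh B [a] e [ar b] = wh B [] e [al a, ar b] ;; wh B [K] (lam a) [ar b] ;; wh B [] (dinv B (C a K)) [L, ar b]"
    using wh_cong[OF v, of "[]" "[ar b]"] by (simp add: wh_seq)
  have 4: "wh B [] (dinv B (C a K)) [L, ar b] ;; wh B [a, K] (p b) [] = wh B [K, a] (p b) [] ;; wh B [] (dinv B (C a K)) [b, L]"
    using exchange[of "dinv B (C a K)" "p b" "[]" "[]" "[]"] by simp
  let ?A = "wh B [K] (lam a) [ar b] ;; wh B [K, a] (p b) []"
  have lhs: "(wh B [] v [ar b] ;; wh B [a] q [] ;; wh B [] c V) ;; wh B [b, a] e []
     = wh B [] e [al a, ar b] ;; ?A ;; wh B [] (dinv B (C a K)) [b, L] ;; wh B [a] (C K b) [L] ;; wh B [] c [K, L]"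
    by (simp only: seq_assoc 1 seq_rewrite2[OF 2] seq_rewrite2[OF 3] seq_rewrite2[OF 4])
  have 5: "wh B [b] v [] ;; wh B [b, a] e [] = wh B [b] e [al a] ;; wh B [b, K] (lam a) [] ;; wh B [b] (dinv B (C a K)) [L]"
    using wh_cong[OF v, of "[b]" "[]"] by (simp add: wh_seq)
  have 6: "wh B [] q [al a] ;; wh B [b] e [al a] = wh B [] e [ar b, al a] ;; wh B [K] (p b) [al a] ;; wh B [] (C K b) [L, al a]"
    using wh_cong[OF q, of "[]" "[al a]"] by (simp add: wh_seq)
  have 7: "wh B V (x a b) [] ;; wh B [] e [ar b, al a] = wh B [] e [al a, ar b] ;; wh B [K, L] (x a b) []"
    using exchange[of e "x a b" "[]" "[]" "[]"] by simp
  have 8: "wh B [] (C K b) [L, al a] ;; wh B [b, K] (lam a) [] = wh B [K, b] (lam a) [] ;; wh B [] (C K b) [a, L]"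
    using exchange[of "C K b" "lam a" "[]" "[]" "[]"] by simp
  have 9: "wh B [K, L] (x a b) [] ;; wh B [K] (p b) [al a] ;; wh B [K, b] (lam a) []
      = ?A ;; wh B [K] (C a b) [L]"
    using wh_cong[OF hex[of a b], of "[K]" "[]"] by (simp add: wh_seq)
  have rhs: "(wh B V (x a b) [] ;; wh B [] q [al a] ;; wh B [b] v []) ;; wh B [b, a] e []
     = wh B [] e [al a, ar b] ;; ?A ;; wh B [K] (C a b) [L] ;; wh B [] (C K b) [a, L] ;; wh B [b] (dinv B (C a K)) [L]"
    by (simp only: seq_assoc 5 seq_rewrite2[OF 6] seq_rewrite2[OF 7] seq_rewrite2[OF 8] seq_rewrite3[OF 9])
  have "(wh B [] e [al a, ar b] ;; ?A) ;; wh B [] (dinv B (C a K)) [b, L] ;; wh B [a] (C K b) [L] ;; wh B [] c [K, L]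
     = (wh B [] e [al a, ar b] ;; ?A) ;; wh B [K] (C a b) [L] ;; wh B [] (C K b) [a, L] ;; wh B [b] (dinv B (C a K)) [L]"
    using lhs rhs c by (simp only: seq_assoc)
  then have "wh B [] (dinv B (C a K)) [b, L] ;; wh B [a] (C K b) [L] ;; wh B [] c [K, L]
     = wh B [K] (C a b) [L] ;; wh B [] (C K b) [a, L] ;; wh B [b] (dinv B (C a K)) [L]"
    by - (rule iso_cancel[of "wh B [] e [al a, ar b] ;; ?A"]; simp)
  then have "wh B [] (wh B [] (dinv B (C a K)) [b] ;; wh B [a] (C K b) [] ;; wh B [] c [K]) [L]
     = wh B [] (wh B [K] (C a b) [] ;; wh B [] (C K b) [a] ;; wh B [b] (dinv B (C a K)) []) [L]"
    by (simp add: wh_seq)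
  then have 10: "wh B [] (dinv B (C a K)) [b] ;; wh B [a] (C K b) [] ;; wh B [] c [K]
     = wh B [K] (C a b) [] ;; wh B [] (C K b) [a] ;; wh B [b] (dinv B (C a K)) []"
    by - (rule dual_pair_faithful[OF L_dual]; simp)
  have "wh B [a] (C K b) [] ;; wh B [] c [K]
     = wh B [] (C a K) [b] ;; (wh B [] (dinv B (C a K)) [b] ;; wh B [a] (C K b) [] ;; wh B [] c [K])"
    by (simp add: inv_wh[symmetric])
  \<comment> \<open>The factor in parentheses is one side of the Yang-Baxter equation for a, K, b;
    the other side ends with the crossing whose inverse follows.\<close>
  also have "\<dots> = (wh B [] (C a K) [b] ;; wh B [K] (C a b) [] ;; wh B [] (C K b) [a]) ;; wh B [b] (dinv B (C a K)) []"
    unfolding 10 by simp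
  also have "\<dots> = wh B [a] (C K b) [] ;; wh B [] (C a b) [K]"
    by (simp add: yang_baxter inv_wh[symmetric])
  finally have "wh B [] c [K] = wh B [] (C a b) [K]"
    by - (rule iso_cancel[of "wh B [a] (C K b) []"]; simp)
  then show ?thesis by - (rule dual_pair_faithful[OF dual]; simp)
qed

end

subsection \<open>Naturality cells of transformations\<close>

abbreviation nat_dia :: "('o, 'm, 'c, 'o2, 'm2, 'c2) trans \<Rightarrow> 'm \<Rightarrow> ('m2, 'c2) dia" where
  "nat_dia \<sigma> f \<equiv> ofR (natR \<sigma> f)"

locale monoidal_pair = D: monoidal_bicat D + C: monoidal_bicat C
  for D :: "('o, 'm, 'c) bicat" and C :: "('o2, 'm2, 'c2) bicat" (structure)
begin

abbreviation ptD where "ptD \<equiv> the_elem (Obj D)"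

lemma nat_dia_def: "PDom (TSrc \<sigma>) = D \<Longrightarrow> f \<in> Mor D \<Longrightarrow>
    nat_dia \<sigma> f = Dia [pf1 (TTrg \<sigma>) f, t1 \<sigma> ptD] (t2 \<sigma> f) [t1 \<sigma> ptD, pf1 (TSrc \<sigma>) f]"
  by (simp add: natR_def)

text \<open>The associators in the composite of transformations only rebracket: as a diagram its
  cell is the two given cells in succession, between unfolding and folding of the composite
  object.\<close>

lemma nat_dia_tcomp:
  assumes \<sigma>: "PDom (TSrc \<sigma>) = D" "PCod (TSrc \<sigma>) = C" and \<tau>: "PDom (TSrc \<tau>) = D" "pf1 (TSrc \<tau>) f = pf1 (TTrg \<sigma>) f"
    and f [simp]: "f \<in> Mor D" and diso: "diso C (nat_dia \<sigma> f)" "diso C (nat_dia \<tau> f)"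
  shows "nat_dia (\<tau> \<bullet>\<^sub>t \<sigma>) f = dinv C (wh C [pf1 (TTrg \<tau>) f] (dfold C [t1 \<tau> ptD, t1 \<sigma> ptD]) [])
      ;; wh C [] (nat_dia \<tau> f) [t1 \<sigma> ptD] ;; wh C [t1 \<tau> ptD] (nat_dia \<sigma> f) [] ;; wh C [] (dfold C [t1 \<tau> ptD, t1 \<sigma> ptD]) [pf1 (TSrc \<sigma>) f]"
    (is "?l = ?r") and "diso C (nat_dia (\<tau> \<bullet>\<^sub>t \<sigma>) f)"
proof -
  let ?s = "t1 \<sigma> ptD" and ?t = "t1 \<tau> ptD" and ?F = "pf1 (TSrc \<sigma>) f" and ?G = "pf1 (TTrg \<sigma>) f" and ?H = "pf1 (TTrg \<tau>) f"
  have n: "nat_dia \<sigma> f = Dia [?G, ?s] (t2 \<sigma> f) [?s, ?F]" "nat_dia \<tau> f = Dia [?H, ?t] (t2 \<tau> f) [?t, ?G]"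
    using \<sigma> \<tau> by (simp_all add: nat_dia_def)
  have i [simp]: "isoc C (t2 \<sigma> f)" "isoc C (t2 \<tau> f)" "?s \<in> Mor C" "?t \<in> Mor C" "?F \<in> Mor C" "?G \<in> Mor C" "?H \<in> Mor C"
    "Dom C (t2 \<sigma> f) = ?G \<odot> ?s" "Cod C (t2 \<sigma> f) = ?s \<odot> ?F" "Dom C (t2 \<tau> f) = ?H \<odot> ?t" "Cod C (t2 \<tau> f) = ?t \<odot> ?G"
    using diso unfolding n by (simp_all add: C.iso_Dia C.pth_Cons)
  have l: "nat_dia (\<tau> \<bullet>\<^sub>t \<sigma>) f = Dia [?H, ?t \<odot> ?s] (inv2 C (asc C ?t ?s ?F) \<cdot> (Id2 C ?t \<star> t2 \<sigma> f) \<cdot> asc C ?t ?G ?s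
      \<cdot> (t2 \<tau> f \<star> Id2 C ?s) \<cdot> inv2 C (asc C ?H ?t ?s)) [?t \<odot> ?s, ?F]"
    using \<sigma> \<tau> by (simp add: natR_def tcomp_def Let_def)
  show r: "?l = ?r"
    unfolding l
    by (rule C.dia_eqI)
      (simp_all add: n C.valid_Dia C.pth_Cons C.cell_seq C.cell_wh_right C.cell_wh_Cons C.glu_single C.glu_Cons)
  show "diso C (nat_dia (\<tau> \<bullet>\<^sub>t \<sigma>) f)"
    unfolding r using diso by (simp add: n)
qed

lemma modification_iso:
  assumes "invertible_modification \<sigma> \<tau> m" "PDom (TSrc \<sigma>) = D" "PCod (TSrc \<sigma>) = C"
  shows "diso C (Dia [t1 \<sigma> ptD] (m ptD) [t1 \<tau> ptD])"
proof -
  have "m ptD \<in> iso2 C (t1 \<sigma> ptD) (t1 \<tau> ptD)"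
    using assms D.Obj_eq unfolding invertible_modification_def Let_def by auto
  then have i: "isoc C (m ptD)" "Dom C (m ptD) = t1 \<sigma> ptD" "Cod C (m ptD) = t1 \<tau> ptD" unfolding C.iso2_iff by auto
  then have "t1 \<sigma> ptD \<in> Mor C" "t1 \<tau> ptD \<in> Mor C" using C.Dom_Mor C.Cod_Mor C.isoc_Cel by metis+
  then show ?thesis using i by (simp add: C.iso_Dia)
qed

lemma nat_dia_modification:
  assumes m: "invertible_modification \<sigma> \<tau> m" and \<sigma>: "PDom (TSrc \<sigma>) = D" "PCod (TSrc \<sigma>) = C" and \<tau>: "PDom (TSrc \<tau>) = D"
    "pf1 (TSrc \<tau>) f = pf1 (TSrc \<sigma>) f" "pf1 (TTrg \<tau>) f = pf1 (TTrg \<sigma>) f" and f [simp]: "f \<in> Mor D"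
    and diso: "diso C (nat_dia \<sigma> f)" "diso C (nat_dia \<tau> f)"
  shows "nat_dia \<sigma> f ;; wh C [] (Dia [t1 \<sigma> ptD] (m ptD) [t1 \<tau> ptD]) [pf1 (TSrc \<sigma>) f]
      = wh C [pf1 (TTrg \<sigma>) f] (Dia [t1 \<sigma> ptD] (m ptD) [t1 \<tau> ptD]) [] ;; nat_dia \<tau> f"
proof -
  let ?s = "t1 \<sigma> ptD" and ?t = "t1 \<tau> ptD" and ?F = "pf1 (TSrc \<sigma>) f" and ?G = "pf1 (TTrg \<sigma>) f"
  have n: "nat_dia \<sigma> f = Dia [?G, ?s] (t2 \<sigma> f) [?s, ?F]" "nat_dia \<tau> f = Dia [?G, ?t] (t2 \<tau> f) [?t, ?F]"
    using \<sigma> \<tau> by (simp_all add: nat_dia_def)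
  have i [simp]: "isoc C (t2 \<sigma> f)" "isoc C (t2 \<tau> f)" "?s \<in> Mor C" "?t \<in> Mor C" "?F \<in> Mor C" "?G \<in> Mor C"
    "Dom C (t2 \<sigma> f) = ?G \<odot> ?s" "Cod C (t2 \<sigma> f) = ?s \<odot> ?F" "Dom C (t2 \<tau> f) = ?G \<odot> ?t" "Cod C (t2 \<tau> f) = ?t \<odot> ?F"
    using diso unfolding n by (simp_all add: C.iso_Dia C.pth_Cons)
  have mi [simp]: "isoc C (m ptD)" "Dom C (m ptD) = t1 \<sigma> ptD" "Cod C (m ptD) = t1 \<tau> ptD"
    using modification_iso[OF m \<sigma>] by (simp_all add: C.iso_Dia)
  have "t2 \<tau> f \<cdot> (Id2 C ?G \<star> m ptD) = (m ptD \<star> Id2 C ?F) \<cdot> t2 \<sigma> f"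
    using m f \<sigma> unfolding invertible_modification_def Let_def by auto
  then show ?thesis
    by (intro C.dia_eqI)
      (simp_all add: n C.valid_Dia C.pth_Cons C.cell_seq C.cell_wh_right C.cell_wh_Cons C.glu_single)
qed

text \<open>The cell of the identity transformation erases the unit object on the right and creates
  it on the left.\<close>

lemma nat_dia_tid: assumes F: "pre_psf F D C" and [simp]: "f \<in> Mor D"
  shows "nat_dia (tid F) f = wh C [pf1 F f] (dinv C (dfold C [])) [] ;; wh C [] (dfold C []) [pf1 F f]"
    and "t1 (tid F) ptD = mon_unit C" and "diso C (nat_dia (tid F) f)"
    and "TSrc (tid F) = F" "TTrg (tid F) = F"
proof -
  interpret F: pre_psf F D C by fact
  show t1: "t1 (tid F) ptD = mon_unit C" by (simp add: tid_def F.pf0_pt mon_unit_def)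
  show s: "TSrc (tid F) = F" "TTrg (tid F) = F" by (simp_all add: tid_def)
  have "nat_dia (tid F) f = Dia [pf1 F f, C.U] (inv2 C (lun C (pf1 F f)) \<cdot> run C (pf1 F f)) [C.U, pf1 F f]"
    using t1 s by (simp add: nat_dia_def) (simp add: tid_def)
  also have "\<dots> = wh C [pf1 F f] (dinv C (dfold C [])) [] ;; wh C [] (dfold C []) [pf1 F f]"
    unfolding wh_def
    by (rule C.dia_eqI) (simp_all add: C.valid_Dia C.pth_Cons C.cell_seq C.cell_ten C.glu_single)
  finally show n: "nat_dia (tid F) f = wh C [pf1 F f] (dinv C (dfold C [])) [] ;; wh C [] (dfold C []) [pf1 F f]" .
  show "diso C (nat_dia (tid F) f)" unfolding n by simp
qed

lemma nat_dia_twl: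
  assumes H: "monoidal_psf H C E" and \<sigma>: "PDom (TSrc \<sigma>) = D" and f [simp]: "f \<in> Mor D" and diso: "diso C (nat_dia \<sigma> f)"
  shows "nat_dia (twl H \<sigma>) f = img H (nat_dia \<sigma> f)" "t1 (twl H \<sigma>) ptD = pf1 H (t1 \<sigma> ptD)"
    "TSrc (twl H \<sigma>) = H \<circ>\<^sub>p TSrc \<sigma>" "TTrg (twl H \<sigma>) = H \<circ>\<^sub>p TTrg \<sigma>" "diso E (nat_dia (twl H \<sigma>) f)"
proof -
  interpret H: monoidal_psf H C E by fact
  show [simp]: "t1 (twl H \<sigma>) ptD = pf1 H (t1 \<sigma> ptD)" "TSrc (twl H \<sigma>) = H \<circ>\<^sub>p TSrc \<sigma>" "TTrg (twl H \<sigma>) = H \<circ>\<^sub>p TTrg \<sigma>"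
    by (simp_all add: twl_def Let_def)
  have pd: "PDom (H \<circ>\<^sub>p K) = PDom K" "pf1 (H \<circ>\<^sub>p K) f = pf1 H (pf1 K f)" for K :: "('o, 'm, 'c, 'o2, 'm2, 'c2) psf" 
    by (simp_all add: pcomp_def)
  let ?s = "t1 \<sigma> ptD" and ?F = "pf1 (TSrc \<sigma>) f" and ?G = "pf1 (TTrg \<sigma>) f"
  have n: "nat_dia \<sigma> f = Dia [?G, ?s] (t2 \<sigma> f) [?s, ?F]"
    using \<sigma> by (simp_all add: nat_dia_def)
  have i [simp]: "isoc C (t2 \<sigma> f)" "?s \<in> Mor C" "?F \<in> Mor C" "?G \<in> Mor C"
    "Dom C (t2 \<sigma> f) = ?G \<odot> ?s" "Cod C (t2 \<sigma> f) = ?s \<odot> ?F" 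
    using diso unfolding n by (simp_all add: C.iso_Dia C.pth_Cons)
  show e: "nat_dia (twl H \<sigma>) f = img H (nat_dia \<sigma> f)"
    unfolding n
    by (subst nat_dia_def) (simp_all add: \<sigma> pd twl_def Let_def H.pfl_Cons)
  show "diso E (nat_dia (twl H \<sigma>) f)" unfolding e using diso by simp
qed

lemma nat_dia_twr:
  assumes K: "pre_psf K D C" and \<sigma>: "PDom (TSrc \<sigma>) = C" and f [simp]: "f \<in> Mor D"
  shows "nat_dia (twr \<sigma> K) f = nat_dia \<sigma> (pf1 K f)" "t1 (twr \<sigma> K) ptD = t1 \<sigma> (the_elem (Obj C))"
    "TSrc (twr \<sigma> K) = TSrc \<sigma> \<circ>\<^sub>p K" "TTrg (twr \<sigma> K) = TTrg \<sigma> \<circ>\<^sub>p K"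
proof -
  interpret K: pre_psf K D C by fact
  have "PDom (TSrc \<sigma> \<circ>\<^sub>p K) = D" by (simp add: pcomp_def)
  then show "nat_dia (twr \<sigma> K) f = nat_dia \<sigma> (pf1 K f)"
    using \<sigma> by (simp add: natR_def twr_def K.pf0_pt) (simp add: pcomp_def)
  show "t1 (twr \<sigma> K) ptD = t1 \<sigma> (the_elem (Obj C))"
    "TSrc (twr \<sigma> K) = TSrc \<sigma> \<circ>\<^sub>p K" "TTrg (twr \<sigma> K) = TTrg \<sigma> \<circ>\<^sub>p K"
    by (simp_all add: twr_def K.pf0_pt)
qed

end

subsection \<open>Adjoint equivalences\<close>

locale monoidal_adjeq = monoidal_pair D C for D :: "('o, 'm, 'c) bicat" and C :: "('o2, 'm2, 'c2) bicat" (structure) +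
  fixes e :: "('o, 'm, 'c, 'o2, 'm2, 'c2) adjeq" and F G :: "('o, 'm, 'c, 'o2, 'm2, 'c2) psf"
  assumes adjeq: "adjoint_equivalence F G e" and PD: "PDom F = D" and PC: "PCod F = C"
begin

sublocale f: monoidal_trans "fwd e" F G D C
  using adjeq D.monoidal_bicat_axioms C.monoidal_bicat_axioms unfolding adjoint_equivalence_def PD PC by (blast intro: monoidal_transI)

sublocale b: monoidal_trans "bwd e" G F D C
  using adjeq D.monoidal_bicat_axioms C.monoidal_bicat_axioms unfolding adjoint_equivalence_def PD PC by (blast intro: monoidal_transI)

definition un where "un = ofR (unitR e ptD)"
definition co where "co = ofR (counitR e ptD)"

abbreviation W where "W \<equiv> f.S"
abbreviation W' where "W' \<equiv> b.S"

lemma unit_typed: "diso C un" "dsrc un = [C.U]" "dtrg un = [W', W]"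
  and counit_typed: "diso C co" "dsrc co = [W, W']" "dtrg co = [C.U]"
proof -
  have "invertible_modification (tid F) (bwd e \<bullet>\<^sub>t fwd e) (adjunit e)"
    "invertible_modification (fwd e \<bullet>\<^sub>t bwd e) (tid G) (adjcounit e)"
    using adjeq unfolding adjoint_equivalence_def by auto
  moreover have t: "TSrc (tid F) = F" "TSrc (fwd e \<bullet>\<^sub>t bwd e) = G" "t1 (tid F) ptD = C.U" "t1 (tid G) ptD = C.U"
    using f.TSrc_eq f.TTrg_eq b.TSrc_eq by (simp_all add: tid_def tcomp_def Let_def mon_unit_def f.F.pf0_eq f.G.pf0_eq)
  moreover have t': "t1 (bwd e \<bullet>\<^sub>t fwd e) ptD = W' \<odot> W" "t1 (fwd e \<bullet>\<^sub>t bwd e) ptD = W \<odot> W'"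
    using f.TSrc_eq b.TSrc_eq by (simp_all add: tcomp_def Let_def)
  ultimately have "diso C (Dia [C.U] (adjunit e ptD) [W' \<odot> W])" "diso C (Dia [W \<odot> W'] (adjcounit e ptD) [C.U])"
    using modification_iso[of "tid F" "bwd e \<bullet>\<^sub>t fwd e" "adjunit e"] modification_iso[of "fwd e \<bullet>\<^sub>t bwd e" "tid G" "adjcounit e"]
    by simp_all
  then show "diso C un" "dsrc un = [C.U]" "dtrg un = [W', W]" "diso C co" "dsrc co = [W, W']" "dtrg co = [C.U]"
    unfolding un_def co_def unitR_def counitR_def f.TSrc_eq f.TTrg_eq
    by (simp_all add: t C.iso_Dia C.pth_Cons)
qed

lemma un_cell: "cell un = adjunit e ptD" and co_cell: "cell co = adjcounit e ptD"
  unfolding un_def co_def unitR_def counitR_def by simp_all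

text \<open>The unit and, below, the counit with the unit object removed, so that they start or end
  at the empty list as \<open>dual_pair\<close> demands.\<close>

definition eta where "eta = dfold C [] ;; un"
definition eps where "eps = co ;; dinv C (dfold C [])"

lemma eta_eps [simp]: "diso C eta" "dsrc eta = []" "dtrg eta = [W', W]" "diso C eps" "dsrc eps = [W, W']" "dtrg eps = []"
  "valid C eta" "valid C eps"
  unfolding eta_def eps_def using unit_typed counit_typed by simp_all

lemma triangle1: "wh C [W] eta [] ;; wh C [] eps [W] = idd C [W]"
  and triangle2: "wh C [] eta [W'] ;; wh C [W'] eps [] = idd C [W']"
proof -
  note [simp] = unit_typed counit_typed 
  note v = C.valids[OF C.iso_valid[OF unit_typed(1)]] C.valids[OF C.iso_valid[OF counit_typed(1)]]
  have i [simp]: "isoc C (adjunit e ptD)" "isoc C (adjcounit e ptD)"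
    using C.iso_cell[OF unit_typed(1)] C.iso_cell[OF counit_typed(1)] un_cell co_cell by simp_all
  have [simp]: "Dom C (adjunit e ptD) = C.U" "Cod C (adjunit e ptD) = W' \<odot> W" 
    "Dom C (adjcounit e ptD) = W \<odot> W'" "Cod C (adjcounit e ptD) = C.U"
    using v un_cell co_cell by (simp_all add: C.pth_Cons)
  have "lun C W \<cdot> (adjcounit e ptD \<star> Id2 C W) \<cdot> inv2 C (asc C W W' W) \<cdot> (Id2 C W \<star> adjunit e ptD) \<cdot> inv2 C (run C W) = Id2 C W \<and>
     run C W' \<cdot> (Id2 C W' \<star> adjcounit e ptD) \<cdot> asc C W' W W' \<cdot> (adjunit e ptD \<star> Id2 C W') \<cdot> inv2 C (lun C W') = Id2 C W'"
    using adjeq D.Obj_eq unfolding adjoint_equivalence_def PD PC Let_def by blast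
  then show "wh C [W] eta [] ;; wh C [] eps [W] = idd C [W]" "wh C [] eta [W'] ;; wh C [W'] eps [] = idd C [W']"
    unfolding eta_def eps_def C.wh_seq wh_def
    by (intro C.dia_eqI; simp add: C.cell_seq C.cell_ten C.glu_single C.glu_Cons C.pth_Cons un_cell co_cell)+
qed

lemma dual_W: "C.dual_pair W W' eps eta"
  unfolding C.dual_pair_def by (simp add: triangle1)

text \<open>Inverting the second triangle identity exchanges the roles of W and W'.\<close>

lemma dual_W': "C.dual_pair W' W (dinv C eta) (dinv C eps)"
proof -
  have "dinv C (wh C [] eta [W'] ;; wh C [W'] eps []) = dinv C (idd C [W'])" by (simp only: triangle2)
  then show ?thesis unfolding C.dual_pair_def by (simp add: C.inv_seq_eq C.inv_wh)
qed

text \<open>The counit is a modification. Its axiom expresses the naturality cell of the right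
  adjoint through that of the left adjoint, which links \<delta>, stated for the adjoint of r, to
  the cells in the braiding.\<close>

lemma counit_nat: assumes [simp]: "f \<in> Mor D"
  shows "wh C [] (f.n f) [W'] ;; wh C [W] (b.n f) [] ;; wh C [] eps [pf1 G f] = wh C [pf1 G f] eps []"
proof -
  note [simp] = counit_typed
  have TS: "PDom (TSrc (fwd e)) = D" "PDom (TSrc (bwd e)) = D" "PCod (TSrc (bwd e)) = C"
    "pf1 (TSrc (fwd e)) f = pf1 (TTrg (bwd e)) f"
    by (simp_all add: f.TSrc_eq b.TSrc_eq b.TTrg_eq f.F.PDom_eq f.G.PDom_eq f.G.PCod_eq)
  have n: "nat_dia (fwd e) f = f.n f" "nat_dia (bwd e) f = b.n f" by (simp_all add: f.natR_eq b.natR_eq)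
  note tc = nat_dia_tcomp[of "bwd e" "fwd e" f, OF TS(2,3,1,4)]
  have i: "diso C (nat_dia (fwd e \<bullet>\<^sub>t bwd e) f)" by (rule tc(2)) (simp_all add: n)
  note ti = nat_dia_tid[OF f.G.pre_psf_axioms assms]
  have m: "invertible_modification (fwd e \<bullet>\<^sub>t bwd e) (tid G) (adjcounit e)"
    using adjeq unfolding adjoint_equivalence_def by auto
  have s: "TSrc (fwd e \<bullet>\<^sub>t bwd e) = G" "TTrg (fwd e \<bullet>\<^sub>t bwd e) = G" "t1 (fwd e \<bullet>\<^sub>t bwd e) ptD = W \<odot> W'"
    using b.TSrc_eq f.TTrg_eq by (simp_all add: tcomp_def Let_def)
  define m' where "m' = Dia [W \<odot> W'] (adjcounit e ptD) [C.U]"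
  have co: "co = dfold C [W, W'] ;; m'"
    unfolding m'_def co_def counitR_def using C.valids[OF C.iso_valid[OF counit_typed(1)]]
    by (intro C.dia_eqI) (simp_all add: C.valid_Dia C.pth_Cons C.cell_seq f.TTrg_eq ti f.G.pf0_eq co_cell)
  have m'_iso: "diso C m'" "dsrc m' = [W \<odot> W']" "dtrg m' = [C.U]"
    using modification_iso[OF m] by (simp_all add: m'_def s f.G.PDom_eq f.G.PCod_eq ti)
  note [simp] = m'_iso
  have "nat_dia (fwd e \<bullet>\<^sub>t bwd e) f ;; wh C [] m' [pf1 G f] = wh C [pf1 G f] m' [] ;; nat_dia (tid G) f"
    using nat_dia_modification[OF m, of f] i ti unfolding m'_def by (simp add: s f.G.PDom_eq f.G.PCod_eq)
  then have "wh C [pf1 G f] (dfold C [W, W']) [] ;; nat_dia (fwd e \<bullet>\<^sub>t bwd e) f ;; wh C [] m' [pf1 G f]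
     = wh C [pf1 G f] (dfold C [W, W']) [] ;; wh C [pf1 G f] m' [] ;; nat_dia (tid G) f" by simp
  moreover have "wh C [pf1 G f] (dfold C [W, W']) [] ;; nat_dia (fwd e \<bullet>\<^sub>t bwd e) f = 
      wh C [] (f.n f) [W'] ;; wh C [W] (b.n f) [] ;; wh C [] (dfold C [W, W']) [pf1 G f]"
    by (subst tc(1)) (simp_all add: n f.TTrg_eq b.TSrc_eq C.pth_Cons)
  ultimately have "(wh C [] (f.n f) [W'] ;; wh C [W] (b.n f) [] ;; wh C [] (dfold C [W, W']) [pf1 G f]) ;; wh C [] m' [pf1 G f]
     = wh C [pf1 G f] (dfold C [W, W']) [] ;; wh C [pf1 G f] m' [] ;; nat_dia (tid G) f" by (metis C.seq_assoc)
  then have "(wh C [] (f.n f) [W'] ;; wh C [W] (b.n f) [] ;; wh C [] co [pf1 G f]) ;; wh C [] (dinv C (dfold C [])) [pf1 G f]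
    = (wh C [pf1 G f] co [] ;; nat_dia (tid G) f) ;; wh C [] (dinv C (dfold C [])) [pf1 G f]"
    by (simp add: co C.wh_seq)
  then show ?thesis
    by (simp add: ti eps_def C.wh_seq C.inv_wh[symmetric])
qed

end

subsection \<open>Pairs of diagrams and the unit bicategory\<close>

text \<open>The lists have to agree in length at both ends; in the pairs formed below the object I
  fills the places where a factor has nothing to show.\<close>

definition pairD :: "('m, 'c) dia \<Rightarrow> ('m2, 'c2) dia \<Rightarrow> ('m \<times> 'm2, 'c \<times> 'c2) dia" where
  "pairD f g = Dia (zip (dsrc f) (dsrc g)) (cell f, cell g) (zip (dtrg f) (dtrg g))"

lemma (in monoidal_product) pairD:
  assumes [simp]: "valid A f" "valid B g" "length (dsrc f) = length (dsrc g)" "length (dtrg f) = length (dtrg g)"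
  shows "valid (A \<times>\<^sub>b B) (pairD f g)" "img (pfst A B) (pairD f g) = f" "img (psnd A B) (pairD f g) = g"
    "dsrc (pairD f g) = zip (dsrc f) (dsrc g)" "dtrg (pairD f g) = zip (dtrg f) (dtrg g)"
proof -
  note v = A.valids[OF assms(1)] B.valids[OF assms(2)]
  show 1: "valid (A \<times>\<^sub>b B) (pairD f g)"
    using v unfolding pairD_def P.valid_Dia by (simp add: Mor_fst_snd pth_prod)
  show 2: "dsrc (pairD f g) = zip (dsrc f) (dsrc g)" "dtrg (pairD f g) = zip (dtrg f) (dtrg g)"
    unfolding pairD_def by simp_all
  show "img (pfst A B) (pairD f g) = f"
    by (rule A.dia_eqI) (simp_all add: 1 2 cell_img_proj, simp add: pairD_def)
  show "img (psnd A B) (pairD f g) = g"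
    by (rule B.dia_eqI) (simp_all add: 1 2 cell_img_proj, simp add: pairD_def)
qed

lemma unit_dia_valid [simp]: "valid unit_bicat (Dia us u vs)"
  by (simp add: unit_bicat_def hom2_def)

lemma unit_dia_eq: "valid unit_bicat f \<Longrightarrow> valid unit_bicat g \<Longrightarrow> dsrc f = dsrc g \<Longrightarrow> dtrg f = dtrg g \<Longrightarrow> f = g"
  by (cases f; cases g) auto

lemma (in monoidal_bicat) ofR_invR: "ofR (invR B r) = dinv B (ofR r)"
  by (cases r) (simp add: invR_def dinv_def)

lemma (in monoidal_bicat) lunR_iso: assumes [simp]: "f \<in> Mor B"
  shows "diso B (ofR (lunR B f))" "dsrc (ofR (lunR B f)) = [U, f]" "dtrg (ofR (lunR B f)) = [f]"
    "ofR (lunR B f) = wh B [] (dinv B (dfold B [])) [f]"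
proof -
  have e: "ofR (lunR B f) = Dia [U, f] (lun B f) [f]" by (simp add: lunR_def mon_unit_def)
  show "diso B (ofR (lunR B f))" "dsrc (ofR (lunR B f)) = [U, f]" "dtrg (ofR (lunR B f)) = [f]"
    unfolding e by (simp_all add: iso_Dia pth_Cons)
  then show "ofR (lunR B f) = wh B [] (dinv B (dfold B [])) [f]"
    unfolding wh_def by (intro dia_eqI) (simp_all add: cell_ten glu_single e)
qed

lemma (in monoidal_bicat) runR_iso: assumes [simp]: "f \<in> Mor B"
  shows "diso B (ofR (runR B f))" "dsrc (ofR (runR B f)) = [f, U]" "dtrg (ofR (runR B f)) = [f]"
    "ofR (runR B f) = wh B [f] (dinv B (dfold B [])) []"
proof -
  have e: "ofR (runR B f) = Dia [f, U] (run B f) [f]" by (simp add: runR_def mon_unit_def)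
  show "diso B (ofR (runR B f))" "dsrc (ofR (runR B f)) = [f, U]" "dtrg (ofR (runR B f)) = [f]"
    unfolding e by (simp_all add: iso_Dia pth_Cons)
  then show "ofR (runR B f) = wh B [f] (dinv B (dfold B [])) []"
    unfolding wh_def by (intro dia_eqI) (simp_all add: cell_ten glu_single e)
qed

lemma pre_psf_pconst: assumes "monoidal_bicat D" "monoidal_bicat C" shows "pre_psf (pconst D C (the_elem (Obj C))) D C"
proof -
  interpret D: monoidal_bicat D by fact
  interpret C: monoidal_bicat C by fact
  show ?thesis
    by unfold_locales (auto simp: pconst_def C.hom2_iff C.iso2_iff simp flip: mon_unit_def)
qed

section \<open>Doubly degenerate tricategories\<close>

locale dd_tricategory = tricategory T for T :: "('o, 'm, 'n, 'p) tricat" +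
  fixes B :: "('m, 'n, 'p) bicat" (structure)
  assumes dd: "doubly_degenerate T" and B_eq: "B = monB T"
begin

lemma pt_T0: "pt T \<in> T0 T"
  using dd unfolding doubly_degenerate_def pt_def by (metis is_singletonI' is_singleton_the_elem insertI1 empty_iff)

lemma Hom_pt [simp]: "Hom T (pt T) (pt T) = B"
  unfolding B_eq monB_def ..

sublocale monoidal_bicat B
proof -
  interpret bicategory B using Hom_bicategory[OF pt_T0 pt_T0] by simp
  show "monoidal_bicat B"
    using dd pt_T0 unfolding doubly_degenerate_def by unfold_locales (metis Hom_pt)
qed

abbreviation (input) M where "M \<equiv> ddTn T"
abbreviation (input) UF where "UF \<equiv> Uf T (pt T)"

lemma pt1_eq: "pt1 T = the_elem (Obj B)"
  unfolding pt1_def B_eq ..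

lemma Tn_pt: "pseudofunctor M (B \<times>\<^sub>b B) B"
  using Tn_psf[OF pt_T0 pt_T0 pt_T0] by (simp add: ddTn_def)

sublocale BB: monoidal_product B B
  using pseudofunctor.Dom_bicategory[OF Tn_pt] monoidal_bicat_axioms by (intro monoidal_productI)

sublocale M: monoidal_psf M "B \<times>\<^sub>b B" B
  unfolding monoidal_psf_def using Tn_pt monoidal_bicat_axioms BB.P.monoidal_bicat_axioms by blast

sublocale One: monoidal_bicat unit_bicat
proof -
  interpret bicategory unit_bicat using pseudofunctor.Dom_bicategory[OF Uf_psf[OF pt_T0]] .
  show "monoidal_bicat unit_bicat" by unfold_locales (rule ex1I[of _ "()"], simp_all add: unit_bicat_def)
qed

sublocale UF: monoidal_psf UF unit_bicat B
  unfolding monoidal_psf_def using Uf_psf[OF pt_T0] monoidal_bicat_axioms One.monoidal_bicat_axioms by simp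

sublocale id: monoidal_psf "pid B" B B by (rule monoidal_psf_pid) (rule monoidal_bicat_axioms)

definition I where "I = pf1 UF ()"

lemma I_Mor [simp]: "I \<in> Mor B"
  using UF.pf1_Mor[of "()"] unfolding I_def by (simp add: unit_bicat_def)

definition al where "al a = pf1 M (I, a)"
definition ar where "ar a = pf1 M (a, I)"

lemma al_ar_Mor [simp]: "a \<in> Mor B \<Longrightarrow> al a \<in> Mor B" "a \<in> Mor B \<Longrightarrow> ar a \<in> Mor B"
  unfolding al_def ar_def by simp_all

abbreviation K where "K \<equiv> unitf T (pt T) B"

lemma bang_pre: "pre_psf (pbang B) B unit_bicat"
proof -
  have "the_elem (Obj unit_bicat) = ()" by simp
  then show ?thesis using pre_psf_pconst[OF monoidal_bicat_axioms One.monoidal_bicat_axioms] unfolding pbang_def by simp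
qed

lemma K_pre: "pre_psf K B B"
  unfolding unitf_def by (rule pre_psf_pcomp[OF bang_pre UF.monoidal_psf_axioms])

lemma K_pf1 [simp]: "pf1 K a = I"
  by (simp add: unitf_def pcomp_def I_def pbang_def pconst_def)

definition JL where "JL = ppair K (pid B)"
definition JR where "JR = ppair (pid B) K"

lemma JL_pre: "pre_psf JL B (B \<times>\<^sub>b B)" and JR_pre: "pre_psf JR B (B \<times>\<^sub>b B)"
  unfolding JL_def JR_def using BB.pre_psf_ppair K_pre id.pre_psf_axioms by blast+

lemma J_pf1: "pf1 JL a = (I, a)" "pf1 JR a = (a, I)"
  by (simp_all add: JL_def JR_def ppair_def) (simp_all add: pid_def)

definition FL where "FL = M \<circ>\<^sub>p JL"
definition FR where "FR = M \<circ>\<^sub>p JR"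

lemma FL_eq: "tens T (pt T) (pt T) (pt T) K (pid B) = FL"
  and FR_eq: "tens T (pt T) (pt T) (pt T) (pid B) K = FR"
  by (simp_all add: tens_def FL_def FR_def JL_def JR_def ddTn_def)

lemma F_pf1 [simp]: "pf1 FL a = al a" "pf1 FR a = ar a"
  by (simp_all add: FL_def FR_def pcomp_def J_pf1 al_def ar_def)

lemma F_simps [simp]: "PDom FL = B" "PCod FL = B" "PDom FR = B" "PCod FR = B"
  using JL_pre JR_pre
  by (simp_all add: FL_def FR_def pcomp_def M.PCod_eq pre_psf_def pre_psf_axioms_def)

lemma img_F: assumes "valid B s" shows "img FL s = img M (img JL s)" "img FR s = img M (img JR s)"
  unfolding FL_def FR_def using img_pcomp JL_pre JR_pre M.monoidal_psf_axioms assms by blast+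

sublocale l: monoidal_adjeq B B "ddLe T" FL "pid B"
  using Le_adjeq[OF pt_T0 pt_T0] by unfold_locales (simp_all add: FL_eq ddLe_def)

sublocale r: monoidal_adjeq B B "ddRi T" FR "pid B"
  using Ri_adjeq[OF pt_T0 pt_T0] by unfold_locales (simp_all add: FR_eq ddRi_def)

lemma LR_eq [simp]: "ddL T = l.W" "ddLd T = l.W'" "ddR T = r.W" "ddRd T = r.W'"
  by (simp_all add: ddL_def ddLd_def ddR_def ddRd_def pt1_eq)

abbreviation L where "L \<equiv> l.W"
abbreviation Ld where "Ld \<equiv> l.W'"
abbreviation R where "R \<equiv> r.W"
abbreviation Rd where "Rd \<equiv> r.W'"

lemma pid_pf1 [simp]: "pf1 (pid B) = id"
  by (simp add: pid_def)

lemma n_typ: "a \<in> Mor B \<Longrightarrow> diso B (nat_dia (fwd (ddLe T)) a) \<and> dsrc (nat_dia (fwd (ddLe T)) a) = [a, L] \<and> dtrg (nat_dia (fwd (ddLe T)) a) = [L, al a]"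
  "a \<in> Mor B \<Longrightarrow> diso B (nat_dia (fwd (ddRi T)) a) \<and> dsrc (nat_dia (fwd (ddRi T)) a) = [a, R] \<and> dtrg (nat_dia (fwd (ddRi T)) a) = [R, ar a]"
  using l.f.natR_eq l.f.iso_n r.f.natR_eq r.f.iso_n by simp_all

lemma unit_counit: "ofR (unitR (ddLe T) (pt1 T)) = l.un" "ofR (counitR (ddLe T) (pt1 T)) = l.co"
  "ofR (unitR (ddRi T) (pt1 T)) = r.un" "ofR (counitR (ddRi T) (pt1 T)) = r.co"
  by (simp_all add: l.un_def l.co_def r.un_def r.co_def pt1_eq)

subsection \<open>The isomorphism between \<open>U\<close> and \<open>I\<close>\<close>

text \<open>The unit of the monoid I, as a cell from the empty list: the image of the only cell from
  the empty list to one object in the unit bicategory.\<close>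

definition nu where "nu = img UF (Dia [] () [()])"

lemma nu_typing [simp]: "diso B nu" "dsrc nu = []" "dtrg nu = [I]" "valid B nu"
proof -
  have "diso unit_bicat (Dia [] () [()])"
  proof -
    have "isoc unit_bicat ()" unfolding isoc_def inverse2_def by (rule exI[of _ "()"]) (simp add: unit_bicat_def hom2_def)
    then show ?thesis unfolding diso_def by simp
  qed
  then show "diso B nu" unfolding nu_def by (rule UF.img_iso)
  then show "valid B nu" by simp
  show "dsrc nu = []" "dtrg nu = [I]" unfolding nu_def by (simp_all add: I_def)
qed

lemma ddu_eq: "Dia [U] (ddu T) [I] = dinv B (dfold B []) ;; nu" and ddu_iso [simp]: "isoc B (ddu T)" "Dom B (ddu T) = U" "Cod B (ddu T) = I"
proof -
  have u: "ddu T = UF.pu" by (simp add: ddu_def)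
  have U1: "mon_unit unit_bicat = ()" by simp
  show "isoc B (ddu T)" "Dom B (ddu T) = U" "Cod B (ddu T) = I"
    unfolding u using UF.pfu_iso UF.pfu_Dom UF.pfu_Cod by (simp_all add: I_def)
  then show "Dia [U] (ddu T) [I] = dinv B (dfold B []) ;; nu"
  proof (intro dia_eqI)
    assume [simp]: "isoc B (ddu T)" "Dom B (ddu T) = U" "Cod B (ddu T) = I"
    have id: "pf2 UF () = Id2 B I" using UF.pf2_Id2[of "()"] by (simp add: unit_bicat_def I_def)
    have d: "pfu UF () = ddu T" by (simp add: ddu_def)
    have "cell nu = ddu T"
      unfolding nu_def by (simp add: UF.cell_img id d flip: I_def)
    then show "cell (Dia [U] (ddu T) [I]) = cell (dinv B (dfold B []) ;; nu)"
      by (simp add: cell_seq)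
  qed (simp_all add: valid_Dia)
qed

text \<open>The canonical isomorphism from the empty list to a list of copies of I. Taken as an
  image from the unit bicategory, it inherits the uniqueness of cells there.\<close>

definition unit_power where "unit_power us = img UF (Dia [] () (map (\<lambda>_. ()) us))"

lemma unit_power_Nil [simp]: "unit_power [] = idd B []"
proof -
  have "Dia [] () [] = idd unit_bicat []" by (rule unit_dia_eq) simp_all
  then show ?thesis unfolding unit_power_def by simp
qed

lemma Mor_unit_bicat [simp]: "Mor unit_bicat = UNIV" by (simp add: unit_bicat_def)

lemma unit_power_Cons: "unit_power (u # us) = nu ;; wh B [I] (unit_power us) []"
proof -
  have "Dia [] () (() # map (\<lambda>_. ()) us) = Dia [] () [()] ;;\<^bsub>unit_bicat\<^esub> wh unit_bicat [()] (Dia [] () (map (\<lambda>_. ()) us)) []"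
    by (rule unit_dia_eq) simp_all
  then show ?thesis unfolding unit_power_def nu_def by (simp del: img.simps add: I_def)
qed

lemma unit_power_typing [simp]: "diso B (unit_power us)" "dsrc (unit_power us) = []" "dtrg (unit_power us) = map (\<lambda>_. I) us" "valid B (unit_power us)"
proof -
  have d [simp]: "dsrc (unit_power us) = []" "dtrg (unit_power us) = map (\<lambda>_. I) us" for us :: "'a list"
    unfolding unit_power_def by (simp_all del: img.simps add: I_def)
  show "diso B (unit_power us)" by (induction us) (simp_all add: unit_power_Cons)
  then show "valid B (unit_power us)" by simp
  show "dsrc (unit_power us) = []" "dtrg (unit_power us) = map (\<lambda>_. I) us" by simp_all
qed

text \<open>The constant functor factors through the unit bicategory, where cells with the same
  endpoints coincide; so the cell of s is lost and only the lengths of its ends matter.\<close>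

lemma img_K: assumes "valid B s" shows "img K s = dinv B (unit_power (dsrc s)) ;; unit_power (dtrg s)"
proof -
  interpret b: pre_psf "pbang B" B unit_bicat by (rule bang_pre)
  let ?t = "\<lambda>us. Dia [] () (map (\<lambda>_. ()) us)"
  have "isoc unit_bicat ()" unfolding isoc_def inverse2_def by (rule exI[of _ "()"]) (simp add: unit_bicat_def hom2_def)
  then have [simp]: "diso unit_bicat (?t us)" for us unfolding diso_def by simp
  have "img (pbang B) s = dinv unit_bicat (?t (dsrc s)) ;;\<^bsub>unit_bicat\<^esub> ?t (dtrg s)"
    using assms by (intro unit_dia_eq) simp_all
  moreover have "img K s = img UF (img (pbang B) s)"
    unfolding unitf_def by (rule img_pcomp[OF bang_pre UF.monoidal_psf_axioms assms])
  ultimately show ?thesis unfolding unit_power_def by (simp del: img.simps)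
qed

subsection \<open>Interchange\<close>

text \<open>In either factor one of the two objects is I: it is erased on one side of the other
  object and created again on the other side.\<close>

definition X where "X a b = pairD (wh B [] (dinv B nu) [b] ;; wh B [b] nu []) (wh B [a] (dinv B nu) [] ;; wh B [] nu [a])"

lemma iso_prod_dia:
  assumes "valid (B \<times>\<^sub>b B) f" "diso B (img (pfst B B) f)" "diso B (img (psnd B B) f)" shows "diso (B \<times>\<^sub>b B) f"
  using assms BB.cell_img_proj[OF assms(1)] unfolding diso_def by (simp add: BB.isoc_prod)

lemma X_typing [simp]: assumes [simp]: "a \<in> Mor B" "b \<in> Mor B"
  shows "diso (B \<times>\<^sub>b B) (X a b)" "valid (B \<times>\<^sub>b B) (X a b)" "dsrc (X a b) = [(I, a), (b, I)]" "dtrg (X a b) = [(b, I), (I, a)]"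
    "img (pfst B B) (X a b) = wh B [] (dinv B nu) [b] ;; wh B [b] nu []"
    "img (psnd B B) (X a b) = wh B [a] (dinv B nu) [] ;; wh B [] nu [a]"
proof -
  let ?f = "wh B [] (dinv B nu) [b] ;; wh B [b] nu []" and ?g = "wh B [a] (dinv B nu) [] ;; wh B [] nu [a]"
  have "valid B ?f" "valid B ?g" "length (dsrc ?f) = length (dsrc ?g)" "length (dtrg ?f) = length (dtrg ?g)" by simp_all
  note p = BB.pairD[OF this, folded X_def]
  show "valid (B \<times>\<^sub>b B) (X a b)" "img (pfst B B) (X a b) = ?f" "img (psnd B B) (X a b) = ?g" by (fact p)+
  then show "diso (B \<times>\<^sub>b B) (X a b)" by (intro iso_prod_dia) simp_all
  show "dsrc (X a b) = [(I, a), (b, I)]" "dtrg (X a b) = [(b, I), (I, a)]" using p by simp_all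
qed

definition x where "x a b = img M (X a b)"

fun Xr where
  "Xr a [] = idd (B \<times>\<^sub>b B) [(I, a)]"
| "Xr a (u # us) = wh (B \<times>\<^sub>b B) [] (X a u) (map (\<lambda>b. (b, I)) us) ;;\<^bsub>B \<times>\<^sub>b B\<^esub> wh (B \<times>\<^sub>b B) [(u, I)] (Xr a us) []"

fun Xl where
  "Xl [] b = idd (B \<times>\<^sub>b B) [(b, I)]"
| "Xl (u # us) b = wh (B \<times>\<^sub>b B) [(I, u)] (Xl us b) [] ;;\<^bsub>B \<times>\<^sub>b B\<^esub> wh (B \<times>\<^sub>b B) [] (X u b) (map (\<lambda>a. (I, a)) us)"

lemma pair_list_Mor [simp]: "set us \<subseteq> Mor B \<Longrightarrow> (\<lambda>b. (b, I)) ` set us \<subseteq> Mor B \<times> Mor B"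
  "set us \<subseteq> Mor B \<Longrightarrow> (\<lambda>b. (I, b)) ` set us \<subseteq> Mor B \<times> Mor B"
  by auto

text \<open>In the first factor a single I travels along the list, and its intermediate creations
  and erasures cancel. In the second factor one copy of I after another passes a, and these erasures
  and creations collect to powers of the unit.\<close>

lemma Xr_projections: assumes [simp]: "a \<in> Mor B" shows "set us \<subseteq> Mor B \<Longrightarrow> valid (B \<times>\<^sub>b B) (Xr a us) \<and> dsrc (Xr a us) = (I, a) # map (\<lambda>b. (b, I)) us \<and>
    dtrg (Xr a us) = map (\<lambda>b. (b, I)) us @ [(I, a)] \<and>
    img (pfst B B) (Xr a us) = wh B [] (dinv B nu) us ;; wh B us nu [] \<and>
    img (psnd B B) (Xr a us) = wh B [a] (dinv B (unit_power us)) [] ;; wh B [] (unit_power us) [a]"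
proof (induction us)
  case Nil
  then show ?case by (simp add: comp_def)
next
  case (Cons u us)
  then have [simp]: "u \<in> Mor B" "set us \<subseteq> Mor B" by auto
  note IH = Cons.IH[OF this(2)]
  have v: "valid (B \<times>\<^sub>b B) (Xr a (u # us))" using IH by simp
  have "img (pfst B B) (Xr a (u # us)) = wh B [] (dinv B nu) (u # us) ;; wh B [u] nu us ;; wh B [u] (dinv B nu) us ;; wh B (u # us) nu []"
    using IH v by (simp add: wh_seq comp_def)
  also have "\<dots> = wh B [] (dinv B nu) (u # us) ;; wh B (u # us) nu []"
    by (simp add: inv_wh[symmetric])
  finally have 1: "img (pfst B B) (Xr a (u # us)) = wh B [] (dinv B nu) (u # us) ;; wh B (u # us) nu []" .
  have e1: "wh B [] nu (a # map (\<lambda>_. I) us) ;; wh B [I, a] (dinv B (unit_power us)) [] = wh B [a] (dinv B (unit_power us)) [] ;; wh B [] nu [a]"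
    using exchange[of nu "dinv B (unit_power us)" "[]" "[a]" "[]"] by simp
  have e2: "wh B [a] (dinv B nu) (map (\<lambda>_. I) us) ;; wh B [a] (dinv B (unit_power us)) [] = wh B [a] (dinv B (unit_power (u # us))) []"
  proof -
    have "wh B [] (dinv B nu) (map (\<lambda>_. I) us) ;; dinv B (unit_power us) = wh B [I] (dinv B (unit_power us)) [] ;; dinv B nu"
      using exchange[of "dinv B nu" "dinv B (unit_power us)" "[]" "[]" "[]"] by simp
    also have "\<dots> = dinv B (unit_power (u # us))"
      by (simp add: unit_power_Cons inv_seq_eq inv_wh)
    finally have e: "wh B [] (dinv B nu) (map (\<lambda>_. I) us) ;; dinv B (unit_power us) = dinv B (unit_power (u # us))" .
    show ?thesis using wh_cong[OF e, of "[a]" "[]"] by (simp add: wh_seq)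
  qed
  have "img (psnd B B) (Xr a (u # us)) = wh B [a] (dinv B nu) (map (\<lambda>_. I) us) ;; wh B [] nu (a # map (\<lambda>_. I) us)
      ;; wh B [I, a] (dinv B (unit_power us)) [] ;; wh B [I] (unit_power us) [a]"
    using IH v by (simp add: wh_seq comp_def)
  also have "\<dots> = wh B [a] (dinv B (unit_power (u # us))) [] ;; wh B [] (unit_power (u # us)) [a]"
    by (simp only: seq_rewrite2[OF e1] seq_assoc seq_rewrite2[OF e2]) (simp add: unit_power_Cons wh_seq)
  finally show ?case using 1 v IH by simp
qed

lemma Xl_projections: assumes [simp]: "b \<in> Mor B" shows "set us \<subseteq> Mor B \<Longrightarrow> valid (B \<times>\<^sub>b B) (Xl us b) \<and> dsrc (Xl us b) = map (\<lambda>a. (I, a)) us @ [(b, I)] \<and>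
    dtrg (Xl us b) = (b, I) # map (\<lambda>a. (I, a)) us \<and>
    img (pfst B B) (Xl us b) = wh B [] (dinv B (unit_power us)) [b] ;; wh B [b] (unit_power us) [] \<and>
    img (psnd B B) (Xl us b) = wh B us (dinv B nu) [] ;; wh B [] nu us"
proof (induction us)
  case Nil
  then show ?case by (simp add: comp_def)
next
  case (Cons u us)
  then have [simp]: "u \<in> Mor B" "set us \<subseteq> Mor B" by auto
  note IH = Cons.IH[OF this(2)]
  have v: "valid (B \<times>\<^sub>b B) (Xl (u # us) b)" using IH by simp
  have "img (psnd B B) (Xl (u # us) b) = wh B (u # us) (dinv B nu) [] ;; wh B [u] nu us ;; wh B [u] (dinv B nu) us ;; wh B [] nu (u # us)"
    using IH v by (simp add: wh_seq comp_def)
  also have "\<dots> = wh B (u # us) (dinv B nu) [] ;; wh B [] nu (u # us)"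
    by (simp add: inv_wh[symmetric])
  finally have 1: "img (psnd B B) (Xl (u # us) b) = wh B (u # us) (dinv B nu) [] ;; wh B [] nu (u # us)" .
  have e1: "wh B [I, b] (unit_power us) [] ;; wh B [] (dinv B nu) (b # map (\<lambda>_. I) us) = wh B [] (dinv B nu) [b] ;; wh B [b] (unit_power us) []"
    using exchange[of "dinv B nu" "unit_power us" "[]" "[b]" "[]"] by simp
  have e2: "unit_power us ;; wh B [] nu (map (\<lambda>_. I) us) = unit_power (u # us)"
    using exchange[of nu "unit_power us" "[]" "[]" "[]"] by (simp add: unit_power_Cons)
  have e3: "wh B [b] (unit_power us) [] ;; wh B [b] nu (map (\<lambda>_. I) us) = wh B [b] (unit_power (u # us)) []"
    using wh_cong[OF e2, of "[b]" "[]"] by (simp add: wh_seq)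
  have "img (pfst B B) (Xl (u # us) b) = wh B [I] (dinv B (unit_power us)) [b] ;; wh B [I, b] (unit_power us) []
      ;; wh B [] (dinv B nu) (b # map (\<lambda>_. I) us) ;; wh B [b] nu (map (\<lambda>_. I) us)"
    using IH v by (simp add: wh_seq comp_def)
  also have "\<dots> = wh B [] (dinv B (unit_power (u # us))) [b] ;; wh B [b] (unit_power (u # us)) []"
    by (simp only: seq_rewrite2[OF e1] seq_assoc e3) (simp add: unit_power_Cons wh_seq inv_seq_eq inv_wh)
  finally show ?case using 1 v IH by simp
qed

lemma img_J: assumes "valid B s"
  shows "valid (B \<times>\<^sub>b B) (img JR s)" "img (pfst B B) (img JR s) = s" "img (psnd B B) (img JR s) = dinv B (unit_power (dsrc s)) ;; unit_power (dtrg s)"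
    "valid (B \<times>\<^sub>b B) (img JL s)" "img (psnd B B) (img JL s) = s" "img (pfst B B) (img JL s) = dinv B (unit_power (dsrc s)) ;; unit_power (dtrg s)"
proof -
  interpret JR: pre_psf JR B "B \<times>\<^sub>b B" by (rule JR_pre)
  interpret JL: pre_psf JL B "B \<times>\<^sub>b B" by (rule JL_pre)
  show "valid (B \<times>\<^sub>b B) (img JR s)" "valid (B \<times>\<^sub>b B) (img JL s)" using assms by simp_all
  show "img (pfst B B) (img JR s) = s" "img (psnd B B) (img JR s) = dinv B (unit_power (dsrc s)) ;; unit_power (dtrg s)"
    "img (psnd B B) (img JL s) = s" "img (pfst B B) (img JL s) = dinv B (unit_power (dsrc s)) ;; unit_power (dtrg s)"
    unfolding JR_def JL_def using BB.img_ppair[OF id.pre_psf_axioms K_pre assms] BB.img_ppair[OF K_pre id.pre_psf_axioms assms]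
      img_pid[OF monoidal_bicat_axioms assms] img_K[OF assms] by simp_all
qed

lemma J_pf1': "pf1 JL = (\<lambda>a. (I, a))" "pf1 JR = (\<lambda>a. (a, I))"
  using J_pf1 by blast+

text \<open>In the first factor this is interchange of s with the unit I; in the second s has become
  an isomorphism between powers of I, which cancel.\<close>

lemma Xr_nat: assumes s [simp]: "valid B s" and [simp]: "a \<in> Mor B"
  shows "wh (B \<times>\<^sub>b B) [(I, a)] (img JR s) [] ;;\<^bsub>B \<times>\<^sub>b B\<^esub> Xr a (dtrg s) = Xr a (dsrc s) ;;\<^bsub>B \<times>\<^sub>b B\<^esub> wh (B \<times>\<^sub>b B) [] (img JR s) [(I, a)]"
proof -
  note [simp] = valid_dsrc[OF s] valid_dtrg[OF s] img_J[OF s] 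
  note X = Xr_projections[of a "dsrc s"] Xr_projections[of a "dtrg s"]
  have v: "valid (B \<times>\<^sub>b B) (wh (B \<times>\<^sub>b B) [(I, a)] (img JR s) [] ;;\<^bsub>B \<times>\<^sub>b B\<^esub> Xr a (dtrg s))"
    "valid (B \<times>\<^sub>b B) (Xr a (dsrc s) ;;\<^bsub>B \<times>\<^sub>b B\<^esub> wh (B \<times>\<^sub>b B) [] (img JR s) [(I, a)])"
    using X by (simp_all add: J_pf1')
  show ?thesis
  proof (rule BB.prod_eqI[OF v])
    have e1: "wh B [I] s [] ;; wh B [] (dinv B nu) (dtrg s) = wh B [] (dinv B nu) (dsrc s) ;; s"
      using exchange[of "dinv B nu" s "[]" "[]" "[]"] by simp
    have e2: "s ;; wh B (dtrg s) nu [] = wh B (dsrc s) nu [] ;; wh B [] s [I]"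
      using exchange[of s nu "[]" "[]" "[]"] by simp
    show "img (pfst B B) (wh (B \<times>\<^sub>b B) [(I, a)] (img JR s) [] ;;\<^bsub>B \<times>\<^sub>b B\<^esub> Xr a (dtrg s))
       = img (pfst B B) (Xr a (dsrc s) ;;\<^bsub>B \<times>\<^sub>b B\<^esub> wh (B \<times>\<^sub>b B) [] (img JR s) [(I, a)])"
      using X v by (simp add: seq_rewrite2[OF e1] e2)
    show "img (psnd B B) (wh (B \<times>\<^sub>b B) [(I, a)] (img JR s) [] ;;\<^bsub>B \<times>\<^sub>b B\<^esub> Xr a (dtrg s))
       = img (psnd B B) (Xr a (dsrc s) ;;\<^bsub>B \<times>\<^sub>b B\<^esub> wh (B \<times>\<^sub>b B) [] (img JR s) [(I, a)])"
      using X v by (simp add: wh_seq inv_wh[symmetric])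
  qed
qed

lemma Xl_nat: assumes s [simp]: "valid B s" and [simp]: "b \<in> Mor B"
  shows "wh (B \<times>\<^sub>b B) [] (img JL s) [(b, I)] ;;\<^bsub>B \<times>\<^sub>b B\<^esub> Xl (dtrg s) b = Xl (dsrc s) b ;;\<^bsub>B \<times>\<^sub>b B\<^esub> wh (B \<times>\<^sub>b B) [(b, I)] (img JL s) []"
proof -
  note [simp] = valid_dsrc[OF s] valid_dtrg[OF s] img_J[OF s] 
  note X = Xl_projections[of b "dsrc s"] Xl_projections[of b "dtrg s"]
  have v: "valid (B \<times>\<^sub>b B) (wh (B \<times>\<^sub>b B) [] (img JL s) [(b, I)] ;;\<^bsub>B \<times>\<^sub>b B\<^esub> Xl (dtrg s) b)"
    "valid (B \<times>\<^sub>b B) (Xl (dsrc s) b ;;\<^bsub>B \<times>\<^sub>b B\<^esub> wh (B \<times>\<^sub>b B) [(b, I)] (img JL s) [])"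
    using X by (simp_all add: J_pf1')
  show ?thesis
  proof (rule BB.prod_eqI[OF v])
    have e1: "wh B [] s [I] ;; wh B (dtrg s) (dinv B nu) [] = wh B (dsrc s) (dinv B nu) [] ;; s"
      using exchange[of s "dinv B nu" "[]" "[]" "[]"] by simp
    have e2: "s ;; wh B [] nu (dtrg s) = wh B [] nu (dsrc s) ;; wh B [I] s []"
      using exchange[of nu s "[]" "[]" "[]"] by simp
    show "img (psnd B B) (wh (B \<times>\<^sub>b B) [] (img JL s) [(b, I)] ;;\<^bsub>B \<times>\<^sub>b B\<^esub> Xl (dtrg s) b)
       = img (psnd B B) (Xl (dsrc s) b ;;\<^bsub>B \<times>\<^sub>b B\<^esub> wh (B \<times>\<^sub>b B) [(b, I)] (img JL s) [])"
      using X v by (simp add: seq_rewrite2[OF e1] e2)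
    show "img (pfst B B) (wh (B \<times>\<^sub>b B) [] (img JL s) [(b, I)] ;;\<^bsub>B \<times>\<^sub>b B\<^esub> Xl (dtrg s) b)
       = img (pfst B B) (Xl (dsrc s) b ;;\<^bsub>B \<times>\<^sub>b B\<^esub> wh (B \<times>\<^sub>b B) [(b, I)] (img JL s) [])"
      using X v by (simp add: wh_seq inv_wh[symmetric])
  qed
qed

end

subsection \<open>The isomorphism between \<open>R\<close> and \<open>L\<close>\<close>

text \<open>
  Any isomorphism \<open>R \<cong> L\<close> would give the same braiding, because scalars are central.
\<close>

context monoidal_bicat begin

definition rw_ok :: "('m, 'c) rewrite \<Rightarrow> 'm list \<Rightarrow> 'm list \<Rightarrow> bool" where
  "rw_ok r us vs \<longleftrightarrow> diso B (ofR r) \<and> dsrc (ofR r) = us \<and> dtrg (ofR r) = vs"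

lemma rw_okD: "rw_ok r us vs \<Longrightarrow> diso B (ofR r)" "rw_ok r us vs \<Longrightarrow> valid B (ofR r)" "rw_ok r us vs \<Longrightarrow> dsrc (ofR r) = us"
  "rw_ok r us vs \<Longrightarrow> dtrg (ofR r) = vs" "rw_ok r us vs \<Longrightarrow> fst r = us" "rw_ok r us vs \<Longrightarrow> snd (snd r) = vs"
  unfolding rw_ok_def by (cases r; auto)+

lemma rw_ok_inv: "rw_ok r us vs \<Longrightarrow> rw_ok (invR B r) vs us"
  unfolding rw_ok_def by (simp add: ofR_invR)

lemma rw_ok_lunR: "f \<in> Mor B \<Longrightarrow> rw_ok (lunR B f) [U, f] [f]"
  and rw_ok_runR: "f \<in> Mor B \<Longrightarrow> rw_ok (runR B f) [f, U] [f]"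
  unfolding rw_ok_def using lunR_iso runR_iso by blast+

lemma rw_ok_Dia: "isoc B \<alpha> \<Longrightarrow> Dom B \<alpha> = pth B us \<Longrightarrow> Cod B \<alpha> = pth B vs \<Longrightarrow> set us \<subseteq> Mor B \<Longrightarrow> set vs \<subseteq> Mor B
    \<Longrightarrow> rw_ok (us, \<alpha>, vs) us vs"
  unfolding rw_ok_def by (simp add: iso_Dia)

inductive pasting :: "'m list \<Rightarrow> (nat \<times> ('m, 'c) rewrite) list \<Rightarrow> 'm list \<Rightarrow> bool" where
  pasting_Nil: "set ws \<subseteq> Mor B \<Longrightarrow> pasting ws [] ws"
| pasting_Cons: "rw_ok r us vs \<Longrightarrow> us \<noteq> [] \<Longrightarrow> vs \<noteq> [] \<Longrightarrow> take i ws @ us @ drop (i + length us) ws = ws \<Longrightarrow>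
     pasting (take i ws @ vs @ drop (i + length us) ws) ss zs \<Longrightarrow> pasting ws ((i, r) # ss) zs"

lemma pasting_steps: "pasting ws ss zs \<Longrightarrow> set ws \<subseteq> Mor B \<and> diso B (steps B ws ss) \<and> dsrc (steps B ws ss) = ws \<and> dtrg (steps B ws ss) = zs
   \<and> (\<forall>(i, r) \<in> set ss. fst r \<noteq> [] \<and> snd (snd r) \<noteq> [])"
proof (induction rule: pasting.induct)
  case (pasting_Cons r us vs i ws ss zs)
  note r = rw_okD[OF pasting_Cons.hyps(1)]
  have M: "set us \<subseteq> Mor B" "set vs \<subseteq> Mor B" using valid_dsrc[OF r(2)] valid_dtrg[OF r(2)] r by simp_all
  let ?ws = "take i ws @ vs @ drop (i + length us) ws"
  have N: "set (take i ws) \<subseteq> Mor B" "set (drop (i + length us) ws) \<subseteq> Mor B"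
    using pasting_Cons.IH by simp_all
  have ws: "set ws \<subseteq> Mor B" using M N pasting_Cons.hyps(4) by (metis set_append Un_least)
  have v: "diso B (wh B (take i ws) (ofR r) (drop (i + length us) ws))" "dsrc (wh B (take i ws) (ofR r) (drop (i + length us) ws)) = ws"
    "dtrg (wh B (take i ws) (ofR r) (drop (i + length us) ws)) = ?ws"
    using r M N pasting_Cons.hyps(4) by simp_all
  have i: "diso B (wh B (take i ws) (ofR r) (drop (i + length us) ws) ;; steps B ?ws ss)"
    by (rule iso_seq) (use v pasting_Cons.IH in simp_all)
  have "steps B ws ((i, r) # ss) = wh B (take i ws) (ofR r) (drop (i + length us) ws) ;; steps B ?ws ss"
    unfolding steps.simps r(5,6) using iso_valid[OF i] v(2) dsrc_seq[OF iso_valid[OF v(1)], of "steps B ?ws ss"] v(3) pasting_Cons.IH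
    by (intro seq_idd_left) simp_all
  moreover have "dsrc (wh B (take i ws) (ofR r) (drop (i + length us) ws) ;; steps B ?ws ss) = ws"
    "dtrg (wh B (take i ws) (ofR r) (drop (i + length us) ws) ;; steps B ?ws ss) = zs"
    using iso_valid[OF i] v pasting_Cons.IH by (simp_all del: valid_wh add: iso_valid)
  ultimately show ?case using i ws pasting_Cons.IH pasting_Cons.hyps(2,3) r(5,6) by (simp del: steps.simps)
qed simp_all

lemma pasting_paste: assumes "pasting ws ss zs" "ws \<noteq> []"
  shows "steps B ws ss = Dia ws (paste B ws ss) zs" "diso B (steps B ws ss)"
proof -
  note p = pasting_steps[OF assms(1)]
  then show "diso B (steps B ws ss)" by blast
  have "cell (steps B ws ss) = paste B ws ss" using p assms(2) by (intro steps_paste[THEN conjunct2]) auto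
  then show "steps B ws ss = Dia ws (paste B ws ss) zs"
    using p by (metis iso_valid valid_eq)
qed

end

context dd_tricategory begin

lemma Id1_pt1: "Id1 B (pt1 T) = U"
  unfolding mon_unit_def pt1_eq ..

definition kap where "kap = ofR (ddkappaR T)"

abbreviation A where "A \<equiv> a1 T (ptarr T) (ptarr T) (ptarr T)"

lemma arr_simps [simp]: "dm (ptarr T) = pt T" "cd (ptarr T) = pt T" "cl (ptarr T) = pt1 T"
  by (simp_all add: ptarr_def)

lemma UF_pf0: "pf0 UF () = pt1 T"
  using UF.pf0_eq by (simp add: pt1_eq)

lemma M_pf0: "pf0 M (pt1 T, pt1 T) = pt1 T"
  using M.pf0_eq by (simp add: pt1_eq)

lemma un_pt: "un T (pt T) = ptarr T"
  by (simp add: un_def ptarr_def UF_pf0)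

lemma tn_pt: "tn T (ptarr T) (ptarr T) = ptarr T"
  using M_pf0 by (simp add: tn_def ddTn_def ptarr_def)

lemma one_pt: "one T (ptarr T) = U"
  by (simp add: one_def Id1_pt1)

lemma l1_pt: "l1 T (ptarr T) = L" and rb1_pt: "rb1 T (ptarr T) = Rd"
  by (simp_all add: l1_def rb1_def ddLe_def[symmetric] ddRi_def[symmetric] pt1_eq)

lemma lw_pt: "lw T (ptarr T) (pt T) f = pf1 M (U, f)" and rw_pt: "rw T (ptarr T) (pt T) f = pf1 M (f, U)"
  by (simp_all add: lw_def rw_def lten_def rten_def tens_def pcomp_def ppair_def pconst_def pid_def ddTn_def Id1_pt1)

lemma pt1_Obj: "pt1 T \<in> Obj B"
  unfolding pt1_eq using Obj_eq by blast

lemma Tn_pt_eq: "Tn T (pt T) (pt T) (pt T) = M"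
  by (simp add: ddTn_def)

lemma A_Mor [simp]: "A \<in> Mor B"
proof -
  let ?F = "As_src T (pt T) (pt T) (pt T) (pt T)" and ?G = "As_trg T (pt T) (pt T) (pt T) (pt T)"
  have "transformation (fwd (As T (pt T) (pt T) (pt T) (pt T))) ?F ?G (PDom ?F) (PCod ?F)"
    using As_adjeq[OF pt_T0 pt_T0 pt_T0 pt_T0] unfolding adjoint_equivalence_def by blast
  then interpret transformation "fwd (As T (pt T) (pt T) (pt T) (pt T))" ?F ?G "PDom ?F" "PCod ?F" .
  have "PDom ?F = B \<times>\<^sub>b B \<times>\<^sub>b B" "PCod ?F = B"
    by (simp_all add: As_src_def tens_def pcomp_def ppair_def proj3_1_def pfst_def Hom2_def Tn_pt_eq M.PCod_eq)
  then show ?thesis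
    using t1_type[of "(pt1 T, pt1 T, pt1 T)"] pt1_Obj hom1_Mor by (simp add: a1_def AsT_def)
qed

text \<open>The type of the cell comes from the composite transformation of which it is a component;
  unfolding that composite yields the three factors listed in the rewrite.\<close>

lemma muR_ok: "rw_ok (muR T (ptarr T) (ptarr T)) [pf1 M (U, L), A, pf1 M (Rd, U)] [U]"
proof -
  let ?\<sigma> = "mu_src T (pt T) (pt T) (pt T)"
  have m: "invertible_modification ?\<sigma> (tid M) (Tmu T (pt T) (pt T) (pt T))"
    using Tmu_modification[OF pt_T0 pt_T0 pt_T0] by (simp add: Tn_pt_eq)
  have D: "PDom (TSrc ?\<sigma>) = B \<times>\<^sub>b B" "PCod (TSrc ?\<sigma>) = B"
    by (simp_all add: mu_src_def Let_def tcomp_def ttens_def twl_def tpair_def twr_def pcomp_def ppair_def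
        r.b.TSrc_eq[unfolded ddRi_def] proj2_1_def pfst_def pid_def Tn_pt_eq M.PCod_eq)
  have t: "t1 ?\<sigma> (pt1 T, pt1 T) = pf1 M (U, L) \<odot> A \<odot> pf1 M (Rd, U)" "t1 (tid M) (pt1 T, pt1 T) = U"
    by (simp_all add: mu_src_def Let_def tcomp_def ttens_def twl_def tpair_def twr_def pcomp_def ppair_def ppair3_def
        r.b.TSrc_eq[unfolded ddRi_def] proj2_1_def proj2_2_def pfst_def psnd_def pid_def tid_def Tn_pt_eq M.PCod_eq
        unitf_def pbang_def pconst_def M_pf0 UF_pf0 a1_def AsT_def Id1_pt1 ddLe_def[symmetric] ddRi_def[symmetric] pt1_eq[symmetric])
  have "Tmu T (pt T) (pt T) (pt T) (pt1 T, pt1 T) \<in> iso2 B (t1 ?\<sigma> (pt1 T, pt1 T)) (t1 (tid M) (pt1 T, pt1 T))"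
    using m pt1_Obj unfolding invertible_modification_def Let_def D by auto
  then have "Tmu T (pt T) (pt T) (pt T) (pt1 T, pt1 T) \<in> iso2 B (pf1 M (U, L) \<odot> A \<odot> pf1 M (Rd, U)) U"
    unfolding t .
  then show ?thesis
    unfolding muR_def by (simp add: lw_pt rw_pt l1_pt rb1_pt un_pt tn_pt one_pt iso2_iff rw_ok_Dia pth_Cons)
qed

lemma lamR_ok: "rw_ok (lamR T (ptarr T) (ptarr T)) [pf1 M (L, U)] [L, A]"
proof -
  let ?\<sigma> = "lam_src T (pt T) (pt T) (pt T)" and ?\<tau> = "lam_trg T (pt T) (pt T) (pt T)"
  have m: "invertible_modification ?\<sigma> ?\<tau> (Tlam T (pt T) (pt T) (pt T))"
    using Tlam_modification[OF pt_T0 pt_T0 pt_T0] by simp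
  have D: "PDom (TSrc ?\<sigma>) = B \<times>\<^sub>b B" "PCod (TSrc ?\<sigma>) = B"
    by (simp_all add: lam_src_def Let_def tcomp_def ttens_def twl_def tpair_def twr_def pcomp_def ppair_def
        proj2_1_def pfst_def Tn_pt_eq M.PCod_eq)
  have As: "PCod (TSrc (fwd (As T (pt T) (pt T) (pt T) (pt T)))) = B"
    using As_adjeq[OF pt_T0 pt_T0 pt_T0 pt_T0] unfolding adjoint_equivalence_def transformation_def
    by (simp add: As_src_def tens_def pcomp_def Tn_pt_eq M.PCod_eq)
  have t: "t1 ?\<sigma> (pt1 T, pt1 T) = pf1 M (L, U)" "t1 ?\<tau> (pt1 T, pt1 T) = L \<odot> A"
    by (simp_all add: lam_src_def lam_trg_def Let_def tcomp_def ttens_def twl_def tpair_def twr_def pcomp_def ppair_def ppair3_def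
        proj2_1_def proj2_2_def pfst_def psnd_def pid_def tid_def Tn_pt_eq M.PCod_eq As
        unitf_def pbang_def pconst_def M_pf0 UF_pf0 a1_def AsT_def Id1_pt1 ddLe_def[symmetric] ddRi_def[symmetric] pt1_eq[symmetric])
  have "Tlam T (pt T) (pt T) (pt T) (pt1 T, pt1 T) \<in> iso2 B (t1 ?\<sigma> (pt1 T, pt1 T)) (t1 ?\<tau> (pt1 T, pt1 T))"
    using m pt1_Obj unfolding invertible_modification_def Let_def D by auto
  then have "Tlam T (pt T) (pt T) (pt T) (pt1 T, pt1 T) \<in> iso2 B (pf1 M (L, U)) (L \<odot> A)"
    unfolding t .
  then show ?thesis
    unfolding lamR_def by (simp add: lw_pt rw_pt l1_pt rb1_pt un_pt tn_pt one_pt iso2_iff rw_ok_Dia pth_Cons)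
qed

lemma adj_ok: "rw_ok (unitR (ddLe T) (pt1 T)) [U] [Ld, L]" "rw_ok (counitR (ddLe T) (pt1 T)) [L, Ld] [U]"
  "rw_ok (unitR (ddRi T) (pt1 T)) [U] [Rd, R]" "rw_ok (counitR (ddRi T) (pt1 T)) [R, Rd] [U]"
  unfolding rw_ok_def unit_counit using l.unit_typed l.counit_typed r.unit_typed r.counit_typed by simp_all

lemma nat_ok: "a \<in> Mor B \<Longrightarrow> rw_ok (natR (fwd (ddLe T)) a) [a, L] [L, al a]"
  "a \<in> Mor B \<Longrightarrow> rw_ok (natR (fwd (ddRi T)) a) [a, R] [R, ar a]"
  unfolding rw_ok_def using n_typ by auto

lemma ddI_ok: assumes [simp]: "a \<in> Mor B"
  shows "rw_ok (ddIr T a) [pf1 M (a, U)] [ar a]" "rw_ok (ddIl T a) [pf1 M (U, a)] [al a]"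
proof -
  have [simp]: "isoc B (pf2 M (Id2 B a, ddu T))" "isoc B (pf2 M (ddu T, Id2 B a))"
    by (rule M.pf2_iso, simp add: BB.isoc_prod)+
  show "rw_ok (ddIr T a) [pf1 M (a, U)] [ar a]" "rw_ok (ddIl T a) [pf1 M (U, a)] [al a]"
    unfolding ddIr_def ddIl_def cellR_def B_eq[symmetric] M.PDom_eq
    by (simp_all add: rw_ok_def iso_Dia ar_def al_def)
qed

text \<open>To type the image of a rewrite under the functor - \<boxtimes> U the typing of that
  functor is enough.\<close>

lemma rten_ok: "rw_ok (imgR (rten T (ptarr T) (pt T)) (invR B (unitR (ddRi T) (pt1 T)))) [pf1 M (Rd, U), pf1 M (R, U)] [pf1 M (U, U)]"
proof -
  let ?F = "M \<circ>\<^sub>p ppair (pid B) (pconst B B (pt1 T))"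
  have F: "rten T (ptarr T) (pt T) = ?F" by (simp add: rten_def tens_def Tn_pt_eq)
  have "pre_psf (pconst B B (pt1 T)) B B" unfolding pt1_eq by (rule pre_psf_pconst) (rule monoidal_bicat_axioms)+
  then have pre: "pre_psf ?F B B"
    by (intro pre_psf_pcomp[OF _ M.monoidal_psf_axioms] BB.pre_psf_ppair id.pre_psf_axioms)
  interpret F: pre_psf ?F B B by fact
  have p1: "pf1 ?F a = pf1 M (a, U)" for a by (simp add: pcomp_def ppair_def pid_def pconst_def Id1_pt1)
  have p2: "pf2 ?F a = pf2 M (a, Id2 B U)" for a by (simp add: pcomp_def ppair_def pid_def pconst_def Id1_pt1)
  obtain \<theta> where u: "unitR (ddRi T) (pt1 T) = ([U], \<theta>, [Rd, R])"
    using rw_okD(5,6)[OF adj_ok(3)] by (metis prod.collapse)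
  have \<theta> [simp]: "isoc B \<theta>" "Dom B \<theta> = U" "Cod B \<theta> = Rd \<odot> R"
    using adj_ok(3) unfolding u rw_ok_def by (simp_all add: iso_Dia pth_Cons)
  have c [simp]: "isoc B (pf2 M (inv2 B \<theta>, Id2 B U))" by (intro M.pf2_iso) (simp add: BB.isoc_prod)
  have e: "pflist ?F [Rd, R] = pfl ?F [Rd, R]" "pflist ?F [U] = pfl ?F [U]" by (simp_all only: pfl_def list.simps if_False refl)
  show ?thesis
    unfolding F u invR_def imgR_def prod.case e F.PCod_is list.map p1
    by (intro rw_ok_Dia) (simp_all add: F.pfl_Cons p1 p2 pth_Cons)
qed

lemma kap_pasting: "ddkappa T = cell kap" "diso B kap" "dsrc kap = [R]" "dtrg kap = [L]"
proof -
  have pfu: "rw_ok (pfuR M (pt1 T, pt1 T)) [U] [pf1 M (U, U)]"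
  proof -
    have o: "the_elem (Obj (B \<times>\<^sub>b B)) = (pt1 T, pt1 T)" by (simp add: pt1_eq)
    show ?thesis
      unfolding pfuR_def M.PCod_eq M.PDom_eq M_pf0 prod_bicat_simps fst_conv snd_conv Id1_pt1
      using M.pfu_iso[unfolded o] M.pfu_Dom[unfolded o] M.pfu_Cod[unfolded o] by (intro rw_ok_Dia) simp_all
  qed
  have UFI: "pf1 UF () = I" by (simp add: I_def)
  have box: "ddbox T a b = pf1 M (a, b)" for a b by (simp add: ddbox_def)
  have "\<exists>ss. ddkappa T = paste B [R] ss \<and> pasting [R] ss [L]"
    unfolding ddkappa_def Let_def B_eq[symmetric] LR_eq Id1_pt1 UFI box al_def[symmetric]
    \<comment> \<open>The derivation follows the definition of \<open>ddkappa\<close> rewrite by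
      rewrite and keeps track of the intermediate lists.\<close>
    apply (rule exI, rule conjI, rule refl)
    apply (rule pasting_Cons, rule rw_ok_inv, rule rw_ok_runR, simp, simp, simp, simp, simp)
    apply (rule pasting_Cons, rule rw_ok_inv, rule adj_ok, simp, simp, simp, simp)
    apply (rule pasting_Cons, rule nat_ok, simp, simp, simp, simp, simp)
    apply (rule pasting_Cons, rule rw_ok_inv, rule ddI_ok, simp, simp, simp, simp, simp)
    apply (rule pasting_Cons, rule rw_ok_inv, rule rw_ok_lunR, simp, simp, simp, simp, simp)
    apply (rule pasting_Cons, rule rw_ok_inv, rule muR_ok, simp, simp, simp, simp)
    apply (rule pasting_Cons, rule rten_ok, simp, simp, simp, simp)
    apply (rule pasting_Cons, rule rw_ok_inv, rule pfu, simp, simp, simp, simp)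
    apply (rule pasting_Cons, rule rw_ok_runR, simp, simp, simp, simp, simp)
    apply (rule pasting_Cons, rule ddI_ok, simp, simp, simp, simp, simp)
    apply (rule pasting_Cons, rule rw_ok_inv, rule rw_ok_lunR, simp, simp, simp, simp, simp)
    apply (rule pasting_Cons, rule adj_ok, simp, simp, simp, simp)
    apply (rule pasting_Cons, rule rw_ok_inv, rule nat_ok, simp, simp, simp, simp, simp)
    apply (rule pasting_Cons, rule rw_ok_inv, rule adj_ok, simp, simp, simp, simp)
    apply (rule pasting_Cons, rule rw_ok_lunR, simp, simp, simp, simp, simp)
    apply (rule pasting_Cons, rule rw_ok_inv, rule lamR_ok, simp, simp, simp, simp)
    apply (rule pasting_Cons, rule ddI_ok, simp, simp, simp, simp, simp)
    apply (rule pasting_Cons, rule rw_ok_inv, rule nat_ok, simp, simp, simp, simp, simp)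
    apply (rule pasting_Cons, rule adj_ok, simp, simp, simp, simp)
    apply (rule pasting_Cons, rule rw_ok_runR, simp, simp, simp, simp, simp)
    apply (rule pasting_Nil, simp)
    done
  then obtain ss where ss: "ddkappa T = paste B [R] ss" and p: "pasting [R] ss [L]" by blast
  have "kap = steps B [R] ss" using pasting_paste[OF p] by (simp add: kap_def ddkappaR_def ss)
  then show "diso B kap" "dsrc kap = [R]" "dtrg kap = [L]"
    using pasting_paste[OF p] by simp_all
  show "ddkappa T = cell kap" by (simp add: kap_def ddkappaR_def)
qed

end

subsection \<open>The equation of the braiding\<close>

context dd_tricategory begin

declare kap_pasting(2,3,4) [simp]

lemma kap_valid [simp]: "valid B kap" by simp

definition lam where "lam a = dinv B (nat_dia (fwd (ddLe T)) a)"
definition P where "P a = dinv B (nat_dia (fwd (ddRi T)) a)"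
text \<open>The cell of r, conjugated by R \<cong> L, so that both unit cells have the same
  invertible object L.\<close>

definition p where "p b = wh B [] (dinv B kap) [ar b] ;; P b ;; wh B [b] kap []"
definition C where "C a b = Dia [a, b] (dd_braiding T a b) [b, a]"

lemma lam_typing [simp]: "a \<in> Mor B \<Longrightarrow> diso B (lam a)" "a \<in> Mor B \<Longrightarrow> dsrc (lam a) = [L, al a]" "a \<in> Mor B \<Longrightarrow> dtrg (lam a) = [a, L]"
  "a \<in> Mor B \<Longrightarrow> valid B (lam a)"
  unfolding lam_def using n_typ by simp_all

lemma P_typing [simp]: "a \<in> Mor B \<Longrightarrow> diso B (P a)" "a \<in> Mor B \<Longrightarrow> dsrc (P a) = [R, ar a]" "a \<in> Mor B \<Longrightarrow> dtrg (P a) = [a, R]"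
  "a \<in> Mor B \<Longrightarrow> valid B (P a)"
  unfolding P_def using n_typ by simp_all

lemma p_typing [simp]: "a \<in> Mor B \<Longrightarrow> diso B (p a)" "a \<in> Mor B \<Longrightarrow> dsrc (p a) = [L, ar a]" "a \<in> Mor B \<Longrightarrow> dtrg (p a) = [a, L]"
  "a \<in> Mor B \<Longrightarrow> valid B (p a)"
  unfolding p_def by simp_all

abbreviation eps where "eps \<equiv> l.eps"
abbreviation eta where "eta \<equiv> l.eta"

text \<open>
  The cells \<open>\<rho>\<close> and \<open>\<lambda>\<close> of the multiplication have the form \<open>Theta q\<close>, where \<open>q\<close> is \<open>p\<close>
  or \<open>lam\<close> preceded by \<open>U \<cong> I\<close>, and \<open>Gamma\<close> is the part of the monoidal constraint of \<open>\<phi>\<close>, which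
  cancels an inner \<open>L\<^sup>\<cdot> R\<close>.
\<close>

definition Theta where "Theta q m c = wh B [] kap [m, Ld] ;; wh B [] q [Ld] ;; wh B [c] eps []"

definition Gamma where "Gamma m m' = wh B [R, m, Ld] kap [m', Ld] ;; wh B [R, m] (dinv B eta) [m', Ld]"

lemma Theta [simp]: assumes "diso B q" "dsrc q = [L, m]" "dtrg q = [c, L]" "m \<in> Mor B" "c \<in> Mor B"
  shows "diso B (Theta q m c)" "valid B (Theta q m c)" "dsrc (Theta q m c) = [R, m, Ld]" "dtrg (Theta q m c) = [c]"
  unfolding Theta_def using assms by simp_all

lemma Gamma [simp]: assumes "m \<in> Mor B" "m' \<in> Mor B"
  shows "diso B (Gamma m m')" "valid B (Gamma m m')" "dsrc (Gamma m m') = [R, m, Ld, R, m', Ld]" "dtrg (Gamma m m') = [R, m, m', Ld]"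
  unfolding Gamma_def using assms by simp_all

text \<open>A triangle identity, solved for the counit.\<close>

lemma eps_L: "wh B [] eps [L] = wh B [L] (dinv B eta) []"
proof -
  have "wh B [L] eta [] ;; wh B [] eps [L] = wh B [L] eta [] ;; wh B [L] (dinv B eta) []"
    by (simp add: l.triangle1 inv_wh[symmetric])
  then show ?thesis by - (rule iso_cancel[of "wh B [L] eta []"]; simp)
qed

text \<open>The counit of the first factor followed by R \<cong> L of the second equals R \<cong> L
  followed by an inverse unit (\<open>eps_L\<close>). Both cells act away from q and can be pulled
  to the front, where they form \<open>Gamma\<close>.\<close>

lemma Theta_ten:
  assumes [simp]: "diso B q" "dsrc q = [L, m]" "dtrg q = [c, L]" "m \<in> Mor B" "c \<in> Mor B"
    and [simp]: "diso B q'" "dsrc q' = [L, m']" "dtrg q' = [c', L]" "m' \<in> Mor B" "c' \<in> Mor B"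
  shows "Theta q m c \<otimes> Theta q' m' c' = Gamma m m' ;; wh B [] kap [m, m', Ld] ;; wh B [] q [m', Ld] ;; wh B [c] q' [Ld] ;; wh B [c, c'] eps []"
proof -
  have 1: "wh B [c] eps [R, m', Ld] ;; wh B [c] kap [m', Ld] = wh B [c, L, Ld] kap [m', Ld] ;; wh B [c, L] (dinv B eta) [m', Ld]"
    using exchange[of eps kap "[c]" "[]" "[m', Ld]"] wh_cong[OF eps_L, of "[c]" "[m', Ld]"] by simp
  have 2: "wh B [] q [Ld, R, m', Ld] ;; wh B [c, L, Ld] kap [m', Ld] = wh B [L, m, Ld] kap [m', Ld] ;; wh B [] q [Ld, L, m', Ld]"
    using exchange[of q kap "[]" "[Ld]" "[m', Ld]"] by simp
  have 3: "wh B [] kap [m, Ld, R, m', Ld] ;; wh B [L, m, Ld] kap [m', Ld] = wh B [R, m, Ld] kap [m', Ld] ;; wh B [] kap [m, Ld, L, m', Ld]"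
    using exchange[of kap kap "[]" "[m, Ld]" "[m', Ld]"] by simp
  have 4: "wh B [] q [Ld, L, m', Ld] ;; wh B [c, L] (dinv B eta) [m', Ld] = wh B [L, m] (dinv B eta) [m', Ld] ;; wh B [] q [m', Ld]"
    using exchange[of q "dinv B eta" "[]" "[]" "[m', Ld]"] by simp
  have 5: "wh B [] kap [m, Ld, L, m', Ld] ;; wh B [L, m] (dinv B eta) [m', Ld] = wh B [R, m] (dinv B eta) [m', Ld] ;; wh B [] kap [m, m', Ld]"
    using exchange[of kap "dinv B eta" "[]" "[m]" "[m', Ld]"] by simp
  have "Theta q m c \<otimes> Theta q' m' c' = wh B [] (Theta q m c) [R, m', Ld] ;; wh B [c] (Theta q' m' c') []"
    by (rule ten_wh[of _ "[R, m, Ld]" "[c]" _ "[R, m', Ld]" "[c']"]) (simp_all add: homI)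
  also have "\<dots> = wh B [] kap [m, Ld, R, m', Ld] ;; wh B [] q [Ld, R, m', Ld] ;; wh B [c] eps [R, m', Ld] ;; wh B [c] kap [m', Ld]
     ;; wh B [c] q' [Ld] ;; wh B [c, c'] eps []"
    unfolding Theta_def by (simp add: wh_seq)
  also have "\<dots> = wh B [R, m, Ld] kap [m', Ld] ;; wh B [R, m] (dinv B eta) [m', Ld] ;; wh B [] kap [m, m', Ld] ;; wh B [] q [m', Ld] ;; wh B [c] q' [Ld] ;; wh B [c, c'] eps []"
    by (simp only: seq_rewrite2[OF 1] seq_rewrite2[OF 2] seq_rewrite2[OF 3] seq_rewrite2[OF 4] seq_rewrite2[OF 5] seq_assoc)
  finally show ?thesis unfolding Gamma_def by simp
qed

text \<open>Strips the multiplication off an equation: \<open>Gamma\<close>, the outer R \<cong> L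
  and the final counit occur on both sides and are invertible, and the dual of L is removed by
  faithfulness.\<close>

lemma Theta_conj:
  assumes [simp]: "diso B q" "dsrc q = [L, m]" "dtrg q = [c, L]" "m \<in> Mor B" "c \<in> Mor B"
    and [simp]: "diso B q'" "dsrc q' = [L, m']" "dtrg q' = [c', L]" "m' \<in> Mor B" "c' \<in> Mor B"
    and [simp]: "valid B y" "dsrc y = [m, m']" "dtrg y = [m', m]" "valid B d" "dsrc d = [c, c']" "dtrg d = [c', c]"
    and eq: "(Theta q m c \<otimes> Theta q' m' c') ;; d = Gamma m m' ;; wh B [R] y [Ld] ;; dinv B (Gamma m' m) ;; (Theta q' m' c' \<otimes> Theta q m c)"
  shows "wh B [] q [m'] ;; wh B [c] q' [] ;; wh B [] d [L] = wh B [L] y [] ;; wh B [] q' [m] ;; wh B [c'] q []"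
proof -
  have 1: "wh B [c, c'] eps [] ;; d = wh B [] d [L, Ld] ;; wh B [c', c] eps []"
    using exchange[of d eps "[]" "[]" "[]"] by simp
  have 2: "wh B [R] y [Ld] ;; wh B [] kap [m', m, Ld] = wh B [] kap [m, m', Ld] ;; wh B [L] y [Ld]"
    using exchange[of kap y "[]" "[]" "[Ld]"] by simp
  let ?g = "Gamma m m' ;; wh B [] kap [m, m', Ld]"
  have "?g ;; (wh B [] q [m', Ld] ;; wh B [c] q' [Ld] ;; wh B [] d [L, Ld] ;; wh B [c', c] eps [])
    = (Theta q m c \<otimes> Theta q' m' c') ;; d"
    by (simp add: Theta_ten 1)
  also have "\<dots> = ?g ;; (wh B [L] y [Ld] ;; wh B [] q' [m, Ld] ;; wh B [c'] q [Ld] ;; wh B [c', c] eps [])"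
    unfolding eq by (simp add: Theta_ten seq_rewrite2[OF 2])
  finally have "wh B [] q [m', Ld] ;; wh B [c] q' [Ld] ;; wh B [] d [L, Ld] ;; wh B [c', c] eps []
     = wh B [L] y [Ld] ;; wh B [] q' [m, Ld] ;; wh B [c'] q [Ld] ;; wh B [c', c] eps []"
    by - (rule iso_cancel[of ?g]; simp)
  then have "(wh B [] q [m', Ld] ;; wh B [c] q' [Ld] ;; wh B [] d [L, Ld]) ;; wh B [c', c] eps []
     = (wh B [L] y [Ld] ;; wh B [] q' [m, Ld] ;; wh B [c'] q [Ld]) ;; wh B [c', c] eps []" by simp
  then have "wh B [] q [m', Ld] ;; wh B [c] q' [Ld] ;; wh B [] d [L, Ld]
     = wh B [L] y [Ld] ;; wh B [] q' [m, Ld] ;; wh B [c'] q [Ld]"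
    by - (rule iso_cancel_post[of "wh B [c', c] eps []"]; simp)
  then show ?thesis
    by - (rule dual_pair_faithful[OF l.dual_W']; simp add: wh_seq)
qed

section \<open>The multiplication as diagrams\<close>

definition Ir where "Ir a = ofR (ddIr T a)"
definition Il where "Il a = ofR (ddIl T a)"

lemma I_typ [simp]: assumes "a \<in> Mor B" shows "diso B (Ir a)" "dsrc (Ir a) = [pf1 M (a, U)]" "dtrg (Ir a) = [ar a]" "valid B (Ir a)"
  "diso B (Il a)" "dsrc (Il a) = [pf1 M (U, a)]" "dtrg (Il a) = [al a]" "valid B (Il a)"
  using ddI_ok[OF assms] unfolding rw_ok_def Ir_def Il_def by auto

lemma kap_ok: "rw_ok (ddkappaR T) [R] [L]"
  unfolding rw_ok_def kap_def[symmetric] by simp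

text \<open>The composite for \<rho> replaces R by L only after the naturality cell, whereas
  \<open>Theta\<close> does so at the beginning; the conjugation in \<open>p\<close> makes up for
  the difference.\<close>

lemma dd_rho_eq: assumes [simp]: "a \<in> Mor B"
  shows "Dia [R, pf1 M (a, U), Ld] (dd_rho T a) [a] = Theta (wh B [L] (Ir a) [] ;; p a) (pf1 M (a, U)) a"
proof -
  define ss where "ss = [(1 :: nat, ddIr T a), (0, invR B (natR (fwd (ddRi T)) a)), (1, ddkappaR T), (1, counitR (ddLe T) (pt1 T)), (0, runR B a)]"
  have d: "dd_rho T a = paste B [R, pf1 M (a, U), Ld] ss"
    by (simp add: dd_rho_def Let_def B_eq[symmetric] dd_list_def Id1_pt1 ss_def)
  have "pasting [R, pf1 M (a, U), Ld] ss [a]"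
    unfolding ss_def
    apply (rule pasting_Cons, rule ddI_ok, simp, simp, simp, simp, simp)
    apply (rule pasting_Cons, rule rw_ok_inv, rule nat_ok, simp, simp, simp, simp, simp)
    apply (rule pasting_Cons, rule kap_ok, simp, simp, simp, simp)
    apply (rule pasting_Cons, rule adj_ok, simp, simp, simp, simp)
    apply (rule pasting_Cons, rule rw_ok_runR, simp, simp, simp, simp, simp)
    apply (rule pasting_Nil, simp)
    done
  note pa = pasting_paste(1)[OF this]
  note [simp] = l.counit_typed n_typ kap_def[symmetric] Ir_def[symmetric] P_def[symmetric]
  note f [simp] = rw_okD(5,6)[OF ddI_ok(1)[OF assms]] rw_okD(5,6)[OF rw_ok_inv[OF nat_ok(2)[OF assms]]] rw_okD(5,6)[OF kap_ok]
    rw_okD(5,6)[OF adj_ok(2)] rw_okD(5,6)[OF rw_ok_runR[OF assms]]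
  have "steps B [R, pf1 M (a, U), Ld] ss = wh B [R] (Ir a) [Ld] ;; wh B [] (P a) [Ld] ;; wh B [a] kap [Ld] ;; wh B [a] l.co [] ;; wh B [a] (dinv B (dfold B [])) []"
    unfolding ss_def by (simp add: ofR_invR unit_counit runR_iso(4))
  also have "\<dots> = wh B [R] (Ir a) [Ld] ;; wh B [] (P a ;; wh B [a] kap []) [Ld] ;; wh B [a] eps []"
    by (simp add: l.eps_def wh_seq)
  also have "P a ;; wh B [a] kap [] = wh B [] kap [ar a] ;; p a"
    by (simp add: p_def inv_wh[symmetric])
  also have "wh B [R] (Ir a) [Ld] ;; wh B [] (wh B [] kap [ar a] ;; p a) [Ld] ;; wh B [a] eps []
     = wh B [R] (Ir a) [Ld] ;; wh B [] kap [ar a, Ld] ;; wh B [] (p a) [Ld] ;; wh B [a] eps []" by (simp add: wh_seq)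
  also have "\<dots> = Theta (wh B [L] (Ir a) [] ;; p a) (pf1 M (a, U)) a"
    using seq_rewrite2[OF exchange[of kap "Ir a" "[]" "[]" "[Ld]", symmetric]] by (simp add: Theta_def wh_seq)
  finally show ?thesis using pa d by simp
qed

lemma dd_lam_eq: assumes [simp]: "a \<in> Mor B"
  shows "Dia [R, pf1 M (U, a), Ld] (dd_lam T a) [a] = Theta (wh B [L] (Il a) [] ;; lam a) (pf1 M (U, a)) a"
proof -
  define ss where "ss = [(0 :: nat, ddkappaR T), (1, ddIl T a), (0, invR B (natR (fwd (ddLe T)) a)), (1, counitR (ddLe T) (pt1 T)), (0, runR B a)]"
  have d: "dd_lam T a = paste B [R, pf1 M (U, a), Ld] ss"
    by (simp add: dd_lam_def Let_def B_eq[symmetric] dd_list_def Id1_pt1 ss_def)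
  have "pasting [R, pf1 M (U, a), Ld] ss [a]"
    unfolding ss_def
    apply (rule pasting_Cons, rule kap_ok, simp, simp, simp, simp)
    apply (rule pasting_Cons, rule ddI_ok, simp, simp, simp, simp, simp)
    apply (rule pasting_Cons, rule rw_ok_inv, rule nat_ok, simp, simp, simp, simp, simp)
    apply (rule pasting_Cons, rule adj_ok, simp, simp, simp, simp)
    apply (rule pasting_Cons, rule rw_ok_runR, simp, simp, simp, simp, simp)
    apply (rule pasting_Nil, simp)
    done
  note pa = pasting_paste(1)[OF this]
  note [simp] = l.counit_typed n_typ kap_def[symmetric] Il_def[symmetric] lam_def[symmetric]
  note f [simp] = rw_okD(5,6)[OF ddI_ok(2)[OF assms]] rw_okD(5,6)[OF rw_ok_inv[OF nat_ok(1)[OF assms]]] rw_okD(5,6)[OF kap_ok]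
    rw_okD(5,6)[OF adj_ok(2)] rw_okD(5,6)[OF rw_ok_runR[OF assms]]
  have "steps B [R, pf1 M (U, a), Ld] ss = wh B [] kap [pf1 M (U, a), Ld] ;; wh B [L] (Il a) [Ld] ;; wh B [] (lam a) [Ld] ;; wh B [a] l.co [] ;; wh B [a] (dinv B (dfold B [])) []"
    unfolding ss_def by (simp add: ofR_invR unit_counit runR_iso(4))
  also have "\<dots> = Theta (wh B [L] (Il a) [] ;; lam a) (pf1 M (U, a)) a"
    by (simp add: Theta_def wh_seq l.eps_def)
  finally show ?thesis using pa d by simp
qed

text \<open>The first three rewrites of the constraint form \<open>Gamma\<close>: inverse unit and
  left unitor together cancel the dual of L against L down to the empty list.\<close>

lemma dd_pfc_eq: assumes [simp]: "XY \<in> Mor (B \<times>\<^sub>b B)" "XY' \<in> Mor (B \<times>\<^sub>b B)"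
  defines "m \<equiv> pf1 M XY" and "m' \<equiv> pf1 M XY'" and "m'' \<equiv> pf1 M (comp1 (B \<times>\<^sub>b B) XY XY')"
  defines "G \<equiv> Gamma m m' ;; wh B [R] (Dia [m, m'] (pfc M XY XY') [m'']) [Ld]"
  shows "pfc (dd_phi T) XY XY' = cell G \<cdot> glu B [R, m, Ld] [R, m', Ld]"
    and "diso B G" "dsrc G = [R, m, Ld, R, m', Ld]" "dtrg G = [R, m'', Ld]" "valid B G"
proof -
  have m [simp]: "m \<in> Mor B" "m' \<in> Mor B" "m'' \<in> Mor B" unfolding m_def m'_def m''_def by (simp_all del: prod_bicat_simps)
  have ok: "rw_ok (pfcR M XY XY') [m, m'] [m'']"
    unfolding pfcR_def M.PDom_eq m_def[symmetric] m'_def[symmetric] m''_def[symmetric]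
    by (rule rw_ok_Dia) (simp_all add: pth_Cons del: prod_bicat_simps, simp_all add: m_def m'_def m''_def del: prod_bicat_simps)
  define ss where "ss = [(3 :: nat, ddkappaR T), (2, invR B (unitR (ddLe T) (pt1 T))), (2, lunR B m'), (1, pfcR M XY XY')]"
  let ?ws = "[R, m, Ld, R, m', Ld]"
  have "pasting ?ws ss [R, m'', Ld]"
    unfolding ss_def
    apply (rule pasting_Cons, rule kap_ok, simp, simp, simp, simp)
    apply (rule pasting_Cons, rule rw_ok_inv, rule adj_ok, simp, simp, simp, simp)
    apply (rule pasting_Cons, rule rw_ok_lunR, simp, simp, simp, simp, simp)
    apply (rule pasting_Cons, rule ok, simp, simp, simp, simp)
    apply (rule pasting_Nil, simp)
    done
  note pa = pasting_paste[OF this]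
  note [simp] = l.unit_typed kap_def[symmetric]
  note f [simp] = rw_okD[OF ok] rw_okD(5,6)[OF rw_ok_inv[OF adj_ok(1)]] rw_okD(5,6)[OF kap_ok]
     rw_okD(5,6)[OF rw_ok_lunR[OF m(2)]]
  have pfc: "ofR (pfcR M XY XY') = Dia [m, m'] (pfc M XY XY') [m'']"
    by (simp add: pfcR_def m_def m'_def m''_def M.PDom_eq)
  have "steps B ?ws ss = wh B [R, m, Ld] kap [m', Ld] ;; wh B [R, m] (dinv B l.un) [m', Ld]
     ;; wh B [R, m] (dinv B (dfold B [])) [m', Ld] ;; wh B [R] (ofR (pfcR M XY XY')) [Ld]"
    unfolding ss_def by (simp add: ofR_invR unit_counit lunR_iso(4))
  also have "\<dots> = G"
    unfolding G_def Gamma_def l.eta_def by (simp add: inv_seq_eq wh_seq pfc)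
  finally have s: "steps B ?ws ss = G" .
  show "diso B G" "valid B G" "dsrc G = [R, m, Ld, R, m', Ld]" "dtrg G = [R, m'', Ld]"
    using pa unfolding s by simp_all
  have "pfc (dd_phi T) XY XY' = paste B ?ws ss \<cdot> glue B [R, m, Ld] [R, m', Ld]"
    by (simp only: dd_phi_def Let_def psf.simps dd_list_def LR_eq B_eq[symmetric] append.simps m_def m'_def ss_def)
  also have "paste B ?ws ss = cell G" using pa unfolding s by simp
  also have "glue B [R, m, Ld] [R, m', Ld] = glu B [R, m, Ld] [R, m', Ld]" by (rule glue_eq) simp_all
  finally show "pfc (dd_phi T) XY XY' = cell G \<cdot> glu B [R, m, Ld] [R, m', Ld]" .
qed

text \<open>The unitors from the middle of the induced braiding, as cells of the product from two
  pairs to one pair.\<close>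

definition N1 where "N1 a b = Dia [(U, a), (b, U)] (lun B b, run B a) [(b, a)]"
definition N2 where "N2 a b = Dia [(b, U), (U, a)] (run B b, lun B a) [(b, a)]"

lemma N_typing [simp]: assumes [simp]: "a \<in> Mor B" "b \<in> Mor B"
  shows "diso (B \<times>\<^sub>b B) (N1 a b)" "dsrc (N1 a b) = [(U, a), (b, U)]" "dtrg (N1 a b) = [(b, a)]" "valid (B \<times>\<^sub>b B) (N1 a b)"
    "diso (B \<times>\<^sub>b B) (N2 a b)" "dsrc (N2 a b) = [(b, U), (U, a)]" "dtrg (N2 a b) = [(b, a)]" "valid (B \<times>\<^sub>b B) (N2 a b)"
    "img (pfst B B) (N1 a b) = wh B [] (dinv B (dfold B [])) [b]" "img (psnd B B) (N1 a b) = wh B [a] (dinv B (dfold B [])) []"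
    "img (pfst B B) (N2 a b) = wh B [b] (dinv B (dfold B [])) []" "img (psnd B B) (N2 a b) = wh B [] (dinv B (dfold B [])) [a]"
proof -
  show i: "diso (B \<times>\<^sub>b B) (N1 a b)" "diso (B \<times>\<^sub>b B) (N2 a b)"
    unfolding N1_def N2_def BB.P.iso_Dia by (simp_all add: BB.isoc_prod BB.P.pth_Cons)
  then show v: "valid (B \<times>\<^sub>b B) (N1 a b)" "valid (B \<times>\<^sub>b B) (N2 a b)" by simp_all
  show d: "dsrc (N1 a b) = [(U, a), (b, U)]" "dtrg (N1 a b) = [(b, a)]" "dsrc (N2 a b) = [(b, U), (U, a)]" "dtrg (N2 a b) = [(b, a)]"
    unfolding N1_def N2_def by simp_all
  have e: "ofR (lunR B b) = Dia [U, b] (lun B b) [b]" "ofR (runR B b) = Dia [b, U] (run B b) [b]" if "b \<in> Mor B" for b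
    using that by (simp_all add: lunR_def runR_def mon_unit_def)
  show "img (pfst B B) (N1 a b) = wh B [] (dinv B (dfold B [])) [b]"
    unfolding lunR_iso(4)[symmetric, OF assms(2)] using v d e[OF assms(2)] lunR_iso[OF assms(2)]
    by (intro dia_eqI) (simp_all add: BB.cell_img_proj, simp add: N1_def)
  show "img (psnd B B) (N1 a b) = wh B [a] (dinv B (dfold B [])) []"
    unfolding runR_iso(4)[symmetric, OF assms(1)] using v d e[OF assms(1)] runR_iso[OF assms(1)]
    by (intro dia_eqI) (simp_all add: BB.cell_img_proj, simp add: N1_def)
  show "img (pfst B B) (N2 a b) = wh B [b] (dinv B (dfold B [])) []"
    unfolding runR_iso(4)[symmetric, OF assms(2)] using v d e[OF assms(2)] runR_iso[OF assms(2)]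
    by (intro dia_eqI) (simp_all add: BB.cell_img_proj, simp add: N2_def)
  show "img (psnd B B) (N2 a b) = wh B [] (dinv B (dfold B [])) [a]"
    unfolding lunR_iso(4)[symmetric, OF assms(1)] using v d e[OF assms(1)] lunR_iso[OF assms(1)]
    by (intro dia_eqI) (simp_all add: BB.cell_img_proj, simp add: N2_def)
qed

text \<open>The interchange of U \<boxtimes> a with b \<boxtimes> U; through \<open>xU_x\<close> it
  becomes the interchange with I.\<close>

definition xU where "xU a b = img M (N1 a b) ;; dinv B (img M (N2 a b))"

lemma xU_typing [simp]: assumes [simp]: "a \<in> Mor B" "b \<in> Mor B"
  shows "diso B (xU a b)" "valid B (xU a b)" "dsrc (xU a b) = [pf1 M (U, a), pf1 M (b, U)]" "dtrg (xU a b) = [pf1 M (b, U), pf1 M (U, a)]"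
  unfolding xU_def by (simp_all add: M.img_iso)

text \<open>The constraint of \<phi> is \<open>Gamma\<close> followed by the constraint of
  \<boxtimes>. The latter and the unitors together are an image under \<boxtimes>, so the induced
  braiding is the interchange conjugated by \<lambda> and \<rho>.\<close>

lemma braiding_conj: assumes [simp]: "a \<in> Mor B" "b \<in> Mor B"
  defines "ua \<equiv> pf1 M (U, a)" and "bu \<equiv> pf1 M (b, U)"
  defines "La \<equiv> Theta (wh B [L] (Il a) [] ;; lam a) ua a" and "Rb \<equiv> Theta (wh B [L] (Ir b) [] ;; p b) bu b"
  shows "C a b = dinv B (La \<otimes> Rb) ;; Gamma ua bu ;; wh B [R] (xU a b) [Ld] ;; dinv B (Gamma bu ua) ;; (Rb \<otimes> La)"
    and "diso B (C a b)"
proof -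
  have [simp]: "ua \<in> Mor B" "bu \<in> Mor B" unfolding ua_def bu_def by simp_all
  have La: "La = Dia [R, ua, Ld] (dd_lam T a) [a]" and Rb: "Rb = Dia [R, bu, Ld] (dd_rho T b) [b]"
    unfolding La_def Rb_def ua_def bu_def by (simp_all add: dd_lam_eq dd_rho_eq)
  have LR [simp]: "diso B La" "dsrc La = [R, ua, Ld]" "dtrg La = [a]" "diso B Rb" "dsrc Rb = [R, bu, Ld]" "dtrg Rb = [b]" "valid B La" "valid B Rb"
    unfolding La_def Rb_def by (simp_all add: ua_def bu_def)
  have cLR [simp]: "cell La = dd_lam T a" "cell Rb = dd_rho T b" unfolding La Rb by simp_all
  have ci [simp]: "isoc B (dd_lam T a)" "Dom B (dd_lam T a) = pth B [R, ua, Ld]" "Cod B (dd_lam T a) = a"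
     "isoc B (dd_rho T b)" "Dom B (dd_rho T b) = pth B [R, bu, Ld]" "Cod B (dd_rho T b) = b"
    using LR(1,4) unfolding La Rb iso_Dia by simp_all
  let ?s = "(U, a)" and ?t = "(b, U)"
  have st: "?s \<in> Mor (B \<times>\<^sub>b B)" "?t \<in> Mor (B \<times>\<^sub>b B)" by simp_all
  let ?c1 = "pf1 M (U \<odot> b, a \<odot> U)" and ?c2 = "pf1 M (b \<odot> U, U \<odot> a)" and ?ab = "pf1 M (b, a)"
  define D1 where "D1 = Dia [ua, bu] (pfc M ?s ?t) [?c1]"
  define D2 where "D2 = Dia [bu, ua] (pfc M ?t ?s) [?c2]"
  define n1 where "n1 = Dia [?c1] (pf2 M (lun B b, run B a)) [?ab]"
  define n2 where "n2 = Dia [?c2] (pf2 M (run B b, lun B a)) [?ab]"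
  have i2 [simp]: "isoc (B \<times>\<^sub>b B) (lun B b, run B a)" "isoc (B \<times>\<^sub>b B) (run B b, lun B a)" by (simp_all add: BB.isoc_prod)
  have i2' [simp]: "(lun B b, run B a) \<in> Cel (B \<times>\<^sub>b B)" "(run B b, lun B a) \<in> Cel (B \<times>\<^sub>b B)" by simp_all
  have pc [simp]: "isoc B (pfc M ?s ?t)" "Dom B (pfc M ?s ?t) = ua \<odot> bu" "Cod B (pfc M ?s ?t) = ?c1"
     "isoc B (pfc M ?t ?s)" "Dom B (pfc M ?t ?s) = bu \<odot> ua" "Cod B (pfc M ?t ?s) = ?c2"
    using M.pfc_iso[OF st] M.pfc_iso[OF st(2,1)] M.pfc_Dom[OF st] M.pfc_Dom[OF st(2,1)] M.pfc_Cod[OF st] M.pfc_Cod[OF st(2,1)]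
    by (simp_all add: ua_def bu_def)
  have p2 [simp]: "isoc B (pf2 M (lun B b, run B a))" "Dom B (pf2 M (lun B b, run B a)) = ?c1" "Cod B (pf2 M (lun B b, run B a)) = ?ab"
     "isoc B (pf2 M (run B b, lun B a))" "Dom B (pf2 M (run B b, lun B a)) = ?c2" "Cod B (pf2 M (run B b, lun B a)) = ?ab"
    using M.pf2_iso[OF i2(1)] M.pf2_iso[OF i2(2)] M.pf2_Dom[OF i2'(1)] M.pf2_Dom[OF i2'(2)] M.pf2_Cod[OF i2'(1)] M.pf2_Cod[OF i2'(2)]
    by simp_all
  have c12 [simp]: "?c1 \<in> Mor B" "?c2 \<in> Mor B" "?ab \<in> Mor B" by simp_all
  have D [simp]: "diso B D1" "diso B D2" "diso B n1" "diso B n2"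
     "dsrc D1 = [ua, bu]" "dtrg D1 = [?c1]" "dsrc D2 = [bu, ua]" "dtrg D2 = [?c2]" "dsrc n1 = [?c1]" "dtrg n1 = [?ab]" "dsrc n2 = [?c2]" "dtrg n2 = [?ab]"
    unfolding D1_def D2_def n1_def n2_def iso_Dia by (simp_all add: pth_Cons)
  \<comment> \<open>An image absorbs the constraint that merges its two source objects; here it is
    split off again to match the definition of the braiding.\<close>
  have N: "img M (N1 a b) = D1 ;; n1" "img M (N2 a b) = D2 ;; n2"
    unfolding N1_def N2_def D1_def D2_def n1_def n2_def
    by (rule dia_eqI; simp add: valid_Dia pth_Cons M.PCod_eq cell_seq M.pfl_Cons BB.pth_prod ua_def[symmetric] bu_def[symmetric])+
  define G1 where "G1 = Gamma ua bu ;; wh B [R] D1 [Ld]"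
  define G2 where "G2 = Gamma bu ua ;; wh B [R] D2 [Ld]"
  have G1: "pfc (dd_phi T) ?s ?t = cell G1 \<cdot> glu B [R, ua, Ld] [R, bu, Ld]" "diso B G1" "dsrc G1 = [R, ua, Ld, R, bu, Ld]" "dtrg G1 = [R, ?c1, Ld]" "valid B G1"
    by (rule dd_pfc_eq[OF st, unfolded prod_bicat_simps fst_conv snd_conv ua_def[symmetric] bu_def[symmetric] D1_def[symmetric] G1_def[symmetric]])+
  have G2: "pfc (dd_phi T) ?t ?s = cell G2 \<cdot> glu B [R, bu, Ld] [R, ua, Ld]" "diso B G2" "dsrc G2 = [R, bu, Ld, R, ua, Ld]" "dtrg G2 = [R, ?c2, Ld]" "valid B G2"
    by (rule dd_pfc_eq[OF st(2,1), unfolded prod_bicat_simps fst_conv snd_conv ua_def[symmetric] bu_def[symmetric] D2_def[symmetric] G2_def[symmetric]])+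
  note [simp] = G1(2-) G2(2-)
  define w1 where "w1 = wh B [R] n1 [Ld]"
  define w2 where "w2 = wh B [R] n2 [Ld]"
  have w [simp]: "diso B w1" "diso B w2" "valid B w1" "valid B w2" "dsrc w1 = [R, ?c1, Ld]" "dtrg w1 = [R, ?ab, Ld]" "dsrc w2 = [R, ?c2, Ld]" "dtrg w2 = [R, ?ab, Ld]"
    unfolding w1_def w2_def by simp_all
  have cw: "cell w1 = pf2 (dd_phi T) (lun B b, run B a)" "inv2 B (cell w2) = pf2 (dd_phi T) (inv2 B (run B b), inv2 B (lun B a))"
  proof -
    show "cell w1 = pf2 (dd_phi T) (lun B b, run B a)"
      unfolding w1_def by (simp add: cell_wh_Cons cell_wh_right glu_single dd_phi_def Let_def B_eq[symmetric])
        (simp add: n1_def)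
    have "inv2 B (pf2 M (run B b, lun B a)) = pf2 M (inv2 (B \<times>\<^sub>b B) (run B b, lun B a))"
      using M.pf2_inv[OF i2(2)] by simp
    also have "inv2 (B \<times>\<^sub>b B) (run B b, lun B a) = (inv2 B (run B b), inv2 B (lun B a))"
      by (subst BB.inv2_prod) simp_all
    finally have e: "inv2 B (pf2 M (run B b, lun B a)) = pf2 M (inv2 B (run B b), inv2 B (lun B a))" .
    have "inv2 B (cell w2) = Id2 B R \<star> (inv2 B (pf2 M (run B b, lun B a)) \<star> Id2 B Ld)"
      unfolding w2_def by (simp add: cell_wh_Cons cell_wh_right glu_single) (simp add: n2_def)
    then show "inv2 B (cell w2) = pf2 (dd_phi T) (inv2 B (run B b), inv2 B (lun B a))"
      unfolding e by (simp add: dd_phi_def Let_def B_eq[symmetric])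
  qed
  define Z where "Z = dinv B (La \<otimes> Rb) ;; G1 ;; w1 ;; dinv B w2 ;; dinv B G2 ;; (Rb \<otimes> La)"
  have Z [simp]: "diso B Z" "dsrc Z = [a, b]" "dtrg Z = [b, a]" unfolding Z_def by simp_all
  have ic [simp]: "isoc B (cell G1)" "isoc B (cell G2)" "isoc B (cell w1)" "isoc B (cell w2)"
    using iso_cell[of G1] iso_cell[of G2] iso_cell[of w1] iso_cell[of w2] by simp_all
  note v [simp] = valids(2,3)[of G1] valids(2,3)[of G2] valids(2,3)[of w1] valids(2,3)[of w2]
  let ?g1 = "glu B [R, ua, Ld] [R, bu, Ld]" and ?g2 = "glu B [R, bu, Ld] [R, ua, Ld]"
  have t: "cell (La \<otimes> Rb) = (dd_lam T a \<star> dd_rho T b) \<cdot> inv2 B ?g1" "cell (Rb \<otimes> La) = (dd_rho T b \<star> dd_lam T a) \<cdot> inv2 B ?g2"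
    by (simp_all add: cell_ten glu_single)
  have cZ: "cell Z = (dd_rho T b \<star> dd_lam T a) \<cdot> inv2 B ?g2 \<cdot> inv2 B (cell G2) \<cdot> inv2 B (cell w2) \<cdot> cell w1 \<cdot> cell G1 \<cdot> ?g1
       \<cdot> (inv2 B (dd_lam T a) \<star> inv2 B (dd_rho T b))"
    unfolding Z_def by (simp add: cell_seq t)
  have pc: "PCod (dd_phi T) = B" by (simp add: dd_phi_def Let_def B_eq)
  have "dd_braiding T a b = (dd_rho T b \<star> dd_lam T a) \<cdot> inv2 B (pfc (dd_phi T) (b, U) (U, a)) \<cdot>
      pf2 (dd_phi T) (inv2 B (run B b), inv2 B (lun B a)) \<cdot> pf2 (dd_phi T) (lun B b, run B a) \<cdot>
      pfc (dd_phi T) (U, a) (b, U) \<cdot> (inv2 B (dd_lam T a) \<star> inv2 B (dd_rho T b))"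
    by (simp only: dd_braiding_def induced_braiding_def Let_def dd_mult_def mult.simps pc)
  then have "dd_braiding T a b = cell Z"
    unfolding G1(1) G2(1) cw[symmetric] cZ by simp
  then have CZ: "C a b = Z" unfolding C_def using valid_eq[of Z] Z by simp
  then show "diso B (C a b)" by simp
  have "wh B [R] (xU a b) [Ld] = wh B [R] D1 [Ld] ;; w1 ;; dinv B w2 ;; dinv B (wh B [R] D2 [Ld])"
    unfolding xU_def N w1_def w2_def by (simp add: inv_seq_eq wh_seq inv_wh)
  then show "C a b = dinv B (La \<otimes> Rb) ;; Gamma ua bu ;; wh B [R] (xU a b) [Ld] ;; dinv B (Gamma bu ua) ;; (Rb \<otimes> La)"
    unfolding CZ Z_def G1_def G2_def by (simp add: inv_seq_eq)
qed

end

section \<open>From the unit object U to the monoid I\<close>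

context dd_tricategory begin

definition DIr where "DIr a = Dia [(a, U)] (Id2 B a, ddu T) [(a, I)]"
definition DIl where "DIl a = Dia [(U, a)] (ddu T, Id2 B a) [(I, a)]"

lemma DIr_DIl [simp]: assumes [simp]: "a \<in> Mor B"
  shows "valid (B \<times>\<^sub>b B) (DIr a)" "dsrc (DIr a) = [(a, U)]" "dtrg (DIr a) = [(a, I)]"
    "img (pfst B B) (DIr a) = idd B [a]" "img (psnd B B) (DIr a) = dinv B (dfold B []) ;; nu"
    "valid (B \<times>\<^sub>b B) (DIl a)" "dsrc (DIl a) = [(U, a)]" "dtrg (DIl a) = [(I, a)]"
    "img (psnd B B) (DIl a) = idd B [a]" "img (pfst B B) (DIl a) = dinv B (dfold B []) ;; nu"
    "img M (DIr a) = Ir a" "img M (DIl a) = Il a"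
proof -
  show v: "valid (B \<times>\<^sub>b B) (DIr a)" "valid (B \<times>\<^sub>b B) (DIl a)"
    unfolding DIr_def DIl_def BB.P.valid_single by simp_all
  show d: "dsrc (DIr a) = [(a, U)]" "dtrg (DIr a) = [(a, I)]" "dsrc (DIl a) = [(U, a)]" "dtrg (DIl a) = [(I, a)]"
    unfolding DIr_def DIl_def by simp_all
  have c: "cell (DIr a) = (Id2 B a, ddu T)" "cell (DIl a) = (ddu T, Id2 B a)" unfolding DIr_def DIl_def by simp_all
  show "img (pfst B B) (DIr a) = idd B [a]" "img (psnd B B) (DIl a) = idd B [a]"
    using v by (intro dia_eqI; simp add: BB.cell_img_proj c d)+
  show "img (psnd B B) (DIr a) = dinv B (dfold B []) ;; nu" "img (pfst B B) (DIl a) = dinv B (dfold B []) ;; nu"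
    unfolding ddu_eq[symmetric] using v by (intro dia_eqI; simp add: BB.cell_img_proj c d valid_single)+
  show "img M (DIr a) = Ir a" "img M (DIl a) = Il a"
    using v unfolding DIr_def DIl_def
    by (simp_all only: M.img_single, simp_all add: Ir_def Il_def ddIr_def ddIl_def cellR_def M.PDom_eq flip: B_eq)
qed

text \<open>Verified in the product: in each factor both sides do nothing but erase and create units
  around one object.\<close>

lemma xU_x: assumes [simp]: "a \<in> Mor B" "b \<in> Mor B"
  shows "xU a b ;; wh B [] (Ir b) [pf1 M (U, a)] ;; wh B [ar b] (Il a) []
    = wh B [] (Il a) [pf1 M (b, U)] ;; wh B [al a] (Ir b) [] ;; x a b"
proof -
  let ?P = "B \<times>\<^sub>b B"
  let ?l = "N1 a b ;;\<^bsub>?P\<^esub> dinv ?P (N2 a b) ;;\<^bsub>?P\<^esub> wh ?P [] (DIr b) [(U, a)] ;;\<^bsub>?P\<^esub> wh ?P [(b, I)] (DIl a) []"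
  let ?r = "wh ?P [] (DIl a) [(b, U)] ;;\<^bsub>?P\<^esub> wh ?P [(I, a)] (DIr b) [] ;;\<^bsub>?P\<^esub> X a b"
  have v: "valid ?P ?l" "valid ?P ?r" by simp_all
  have "?l = ?r"
  proof (rule BB.prod_eqI[OF v])
    show "img (pfst B B) ?l = img (pfst B B) ?r"
      using v by (simp add: wh_seq inv_wh[symmetric])
    show "img (psnd B B) ?l = img (psnd B B) ?r"
      using v by (simp add: wh_seq inv_wh[symmetric])
  qed
  then have "img M ?l = img M ?r" by simp
  then show ?thesis using v by (simp add: xU_def x_def al_def ar_def)
qed

lemma x_typing [simp]: assumes [simp]: "a \<in> Mor B" "b \<in> Mor B"
  shows "diso B (x a b)" "valid B (x a b)" "dsrc (x a b) = [al a, ar b]" "dtrg (x a b) = [ar b, al a]"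
  unfolding x_def by (simp_all add: al_def ar_def)

lemma C_typing [simp]: "a \<in> Mor B \<Longrightarrow> b \<in> Mor B \<Longrightarrow> diso B (C a b)" "a \<in> Mor B \<Longrightarrow> b \<in> Mor B \<Longrightarrow> valid B (C a b)"
   "dsrc (C a b) = [a, b]" "dtrg (C a b) = [b, a]"
  using braiding_conj(2)[of a b] by simp_all (simp_all add: C_def)

text \<open>The equation that determines \<open>C a b\<close>, not a hexagon axiom of a braiding.
  The multiplication is stripped off by \<open>Theta_conj\<close>; then the isomorphisms from U to I
  slide to the front, turn the interchange with U into \<open>x\<close>, and cancel.\<close>

lemma hexagon: assumes [simp]: "a \<in> Mor B" "b \<in> Mor B"
  shows "wh B [] (lam a) [ar b] ;; wh B [a] (p b) [] ;; wh B [] (C a b) [L]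
     = wh B [L] (x a b) [] ;; wh B [] (p b) [al a] ;; wh B [b] (lam a) []"
proof -
  let ?ua = "pf1 M (U, a)" and ?bu = "pf1 M (b, U)"
  let ?q = "wh B [L] (Il a) [] ;; lam a" and ?q' = "wh B [L] (Ir b) [] ;; p b"
  have [simp]: "?ua \<in> Mor B" "?bu \<in> Mor B" by simp_all
  have "(Theta ?q ?ua a \<otimes> Theta ?q' ?bu b) ;; C a b
    = Gamma ?ua ?bu ;; wh B [R] (xU a b) [Ld] ;; dinv B (Gamma ?bu ?ua) ;; (Theta ?q' ?bu b \<otimes> Theta ?q ?ua a)"
    by (subst braiding_conj(1)) simp_all
  from Theta_conj[OF _ _ _ _ _ _ _ _ _ _ _ _ _ _ _ _ this]
  have "wh B [] ?q [?bu] ;; wh B [a] ?q' [] ;; wh B [] (C a b) [L] = wh B [L] (xU a b) [] ;; wh B [] ?q' [?ua] ;; wh B [b] ?q []"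
    by simp
  then have 0: "wh B [L] (Il a) [?bu] ;; wh B [] (lam a) [?bu] ;; wh B [a, L] (Ir b) [] ;; wh B [a] (p b) [] ;; wh B [] (C a b) [L]
     = wh B [L] (xU a b) [] ;; wh B [L] (Ir b) [?ua] ;; wh B [] (p b) [?ua] ;; wh B [b, L] (Il a) [] ;; wh B [b] (lam a) []"
    by (simp add: wh_seq)
  have 1: "wh B [] (lam a) [?bu] ;; wh B [a, L] (Ir b) [] = wh B [L, al a] (Ir b) [] ;; wh B [] (lam a) [ar b]"
    using exchange[of "lam a" "Ir b" "[]" "[]" "[]"] by simp
  have 2: "wh B [] (p b) [?ua] ;; wh B [b, L] (Il a) [] = wh B [L, ar b] (Il a) [] ;; wh B [] (p b) [al a]"
    using exchange[of "p b" "Il a" "[]" "[]" "[]"] by simp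
  have 3: "wh B [L] (xU a b) [] ;; wh B [L] (Ir b) [?ua] ;; wh B [L, ar b] (Il a) [] = wh B [L] (Il a) [?bu] ;; wh B [L, al a] (Ir b) [] ;; wh B [L] (x a b) []"
    using wh_cong[OF xU_x[of a b], of "[L]" "[]"] by (simp add: wh_seq)
  let ?g = "wh B [L] (Il a) [?bu] ;; wh B [L, al a] (Ir b) []"
  have "?g ;; wh B [] (lam a) [ar b] ;; wh B [a] (p b) [] ;; wh B [] (C a b) [L]
     = ?g ;; wh B [L] (x a b) [] ;; wh B [] (p b) [al a] ;; wh B [b] (lam a) []"
    using 0 by (simp only: seq_rewrite2[OF 1] seq_rewrite2[OF 2] seq_rewrite3[OF 3] seq_assoc)
  then show ?thesis by - (rule iso_cancel[of ?g]; simp)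
qed

section \<open>Naturality on lists\<close>

fun plist where
  "plist [] = idd B [L]"
| "plist (u # us) = wh B [] (p u) (map ar us) ;; wh B [u] (plist us) []"

lemma map_ar_Mor [simp]: "set us \<subseteq> Mor B \<Longrightarrow> ar ` set us \<subseteq> Mor B" "set us \<subseteq> Mor B \<Longrightarrow> al ` set us \<subseteq> Mor B"
  by auto

lemma map_pf1_F [simp]: "map (pf1 FR) us = map ar us" "map (pf1 FL) us = map al us"
  by simp_all

text \<open>Between consecutive cells p the isomorphism R \<cong> L meets its inverse, so only the
  outermost ones survive around the list cell of r.\<close>

lemma plist_eq: "set us \<subseteq> Mor B \<Longrightarrow>
    plist us = wh B [] (dinv B kap) (map ar us) ;; dinv B (tlist (fwd (ddRi T)) us) ;; wh B us kap []"
proof (induction us)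
  case Nil
  then show ?case by simp
next
  case (Cons u us)
  then have [simp]: "u \<in> Mor B" "set us \<subseteq> Mor B" by auto
  have P: "dinv B (r.f.n u) = P u" by (simp add: P_def r.f.natR_eq)
  have i [simp]: "diso B (Dia [u, R] (t2 (fwd (ddRi T)) u) [R, ar u])"
    using r.f.iso_n[of u] by simp
  have P: "dinv B (Dia [u, R] (t2 (fwd (ddRi T)) u) [R, ar u]) = P u" using P by simp
  let ?t = "tlist (fwd (ddRi T)) us"
  have [simp]: "diso B ?t" "dsrc ?t = us @ [R]" "dtrg ?t = R # map ar us"
    using r.f.iso_tlist[of us] r.f.dsrc_tlist[of us] r.f.dtrg_tlist[of us] by simp_all
  have "dinv B (tlist (fwd (ddRi T)) (u # us)) = wh B [] (P u) (map ar us) ;; wh B [u] (dinv B ?t) []"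
    by (simp add: inv_seq_eq inv_wh P)
  moreover have "plist (u # us) = wh B [] (dinv B kap) (ar u # map ar us) ;; wh B [] (P u) (map ar us) ;; (wh B [u] kap (map ar us)
     ;; wh B [u] (dinv B kap) (map ar us)) ;; wh B [u] (dinv B ?t) [] ;; wh B (u # us) kap []"
    using Cons.IH by (simp add: p_def wh_seq)
  moreover have "wh B [u] kap (map ar us) ;; wh B [u] (dinv B kap) (map ar us) = idd B (u # R # map ar us)"
    by (simp add: inv_wh[symmetric])
  ultimately show ?case by simp
qed

text \<open>Naturality of r on lists, inverted and conjugated by R \<cong> L, which acts beside s
  and commutes with it.\<close>

lemma p_natural: assumes s [simp]: "valid B s"
  shows "wh B [L] (img FR s) [] ;; plist (dtrg s) = plist (dsrc s) ;; wh B [] s [L]"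
proof -
  note [simp] = valid_dsrc[OF s] valid_dtrg[OF s]
  let ?t = "\<lambda>us. tlist (fwd (ddRi T)) us"
  have t [simp]: "diso B (?t us)" "dsrc (?t us) = us @ [R]" "dtrg (?t us) = R # map ar us" if "set us \<subseteq> Mor B" for us
    using that r.f.iso_tlist[of us] r.f.dsrc_tlist[of us] r.f.dtrg_tlist[of us] by simp_all
  have g [simp]: "valid B (img FR s)" by (rule r.f.F.valid_img) simp
  have n: "wh B [] s [R] ;; ?t (dtrg s) = ?t (dsrc s) ;; wh B [R] (img FR s) []"
    using r.f.tlist_nat[of s] by (simp add: img_pid monoidal_bicat_axioms)
  have 1: "wh B [R] (img FR s) [] ;; dinv B (?t (dtrg s)) = dinv B (?t (dsrc s)) ;; wh B [] s [R]"
  proof -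
    have "wh B [R] (img FR s) [] ;; dinv B (?t (dtrg s)) = dinv B (?t (dsrc s)) ;; (?t (dsrc s) ;; wh B [R] (img FR s) []) ;; dinv B (?t (dtrg s))"
      by simp
    also have "\<dots> = dinv B (?t (dsrc s)) ;; wh B [] s [R]" unfolding n[symmetric] by simp
    finally show ?thesis .
  qed
  have 2: "wh B [L] (img FR s) [] ;; wh B [] (dinv B kap) (map ar (dtrg s)) = wh B [] (dinv B kap) (map ar (dsrc s)) ;; wh B [R] (img FR s) []"
    using exchange[of "dinv B kap" "img FR s" "[]" "[]" "[]"] by simp
  have 3: "wh B [] s [R] ;; wh B (dtrg s) kap [] = wh B (dsrc s) kap [] ;; wh B [] s [L]"
    using exchange[of s kap "[]" "[]" "[]"] by simp
  have "wh B [L] (img FR s) [] ;; plist (dtrg s) = wh B [L] (img FR s) [] ;; wh B [] (dinv B kap) (map ar (dtrg s)) ;; dinv B (?t (dtrg s)) ;; wh B (dtrg s) kap []"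
    by (simp add: plist_eq)
  also have "\<dots> = wh B [] (dinv B kap) (map ar (dsrc s)) ;; dinv B (?t (dsrc s)) ;; wh B (dsrc s) kap [] ;; wh B [] s [L]"
    by (simp only: seq_rewrite2[OF 1] seq_rewrite2[OF 2] 3 seq_assoc)
  also have "\<dots> = plist (dsrc s) ;; wh B [] s [L]" by (simp add: plist_eq)
  finally show ?thesis .
qed

lemma Xr_simps: assumes "a \<in> Mor B" "set us \<subseteq> Mor B"
  shows "valid (B \<times>\<^sub>b B) (Xr a us)" "dsrc (Xr a us) = (I, a) # map (\<lambda>b. (b, I)) us" "dtrg (Xr a us) = map (\<lambda>b. (b, I)) us @ [(I, a)]"
    "valid (B \<times>\<^sub>b B) (Xl us a)" "dsrc (Xl us a) = map (\<lambda>b. (I, b)) us @ [(a, I)]" "dtrg (Xl us a) = (a, I) # map (\<lambda>b. (I, b)) us"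
  using Xr_projections[OF assms] Xl_projections[OF assms] by simp_all

sublocale bd: braiding_data B L Ld eps eta al ar "img FL" "img FR" lam p x C plist "\<lambda>a us. img M (Xr a us)" "\<lambda>us b. img M (Xl us b)"
proof unfold_locales
  show "dual_pair L Ld eps eta" by (rule l.dual_W)
  show "diso B (img FL f)" "diso B (img FR f)" if "diso B f" for f
    using that l.f.F.img_iso r.f.F.img_iso by blast+
  show "valid B (img FL f)" "valid B (img FR f)" if "valid B f" for f
    using that l.f.F.valid_img r.f.F.valid_img by blast+
  show "wh B [L] (img FR f) [] ;; plist (dtrg f) = plist (dsrc f) ;; wh B [] f [L]" if "valid B f" for f
    using that by (rule p_natural)
  show "img M (Xr a []) = idd B [al a]" if "a \<in> Mor B" for a using that by (simp add: al_def)
  show "img M (Xl [] b) = idd B [ar b]" if "b \<in> Mor B" for b using that by (simp add: ar_def)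
next
  fix a u us assume [simp]: "a \<in> Mor B" "u \<in> Mor B" "set us \<subseteq> Mor B"
  note [simp] = Xr_simps[OF \<open>a \<in> Mor B\<close> \<open>set us \<subseteq> Mor B\<close>]
  have ar: "map (\<lambda>x. pf1 M (x, I)) us = map ar us" "map (\<lambda>x. pf1 M (I, x)) us = map al us"
    by (simp_all add: ar_def al_def)
  show "img M (Xr a (u # us)) = wh B [] (x a u) (map ar us) ;; wh B [ar u] (img M (Xr a us)) []"
    by (simp add: x_def comp_def ar) (simp add: ar_def)
  show "img M (Xl (u # us) a) = wh B [al u] (img M (Xl us a)) [] ;; wh B [] (x u a) (map al us)"
    by (simp add: x_def comp_def ar) (simp add: al_def)
next
  fix a f assume [simp]: "a \<in> Mor B" and f [simp]: "valid B f"
  note [simp] = valid_dsrc[OF f] valid_dtrg[OF f] img_J[OF f] Xr_simps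
  let ?P = "B \<times>\<^sub>b B"
  have 1: "img M (wh ?P [(I, a)] (img JR f) [] ;;\<^bsub>?P\<^esub> Xr a (dtrg f)) = img M (Xr a (dsrc f) ;;\<^bsub>?P\<^esub> wh ?P [] (img JR f) [(I, a)])"
    using Xr_nat[of f a] by simp
  have 2: "img M (wh ?P [] (img JL f) [(a, I)] ;;\<^bsub>?P\<^esub> Xl (dtrg f) a) = img M (Xl (dsrc f) a ;;\<^bsub>?P\<^esub> wh ?P [(a, I)] (img JL f) [])"
    using Xl_nat[of f a] by simp
  show "wh B [al a] (img FR f) [] ;; img M (Xr a (dtrg f)) = img M (Xr a (dsrc f)) ;; wh B [] (img FR f) [al a]"
    using 1 by (simp add: J_pf1' img_F) (simp add: al_def)
  show "wh B [] (img FL f) [ar a] ;; img M (Xl (dtrg f) a) = img M (Xl (dsrc f) a) ;; wh B [ar a] (img FL f) []"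
    using 2 by (simp add: J_pf1' img_F) (simp add: ar_def)
qed (simp_all add: hexagon)

end

section \<open>Functors\<close>

subsection \<open>The equation of the image of the braiding\<close>

locale dd_functor = s: dd_tricategory T B + t: dd_tricategory T' B' + weak_functor T T' F
  for T :: "('o, 'm, 'n, 'p) tricat" and T' :: "('o2, 'm2, 'n2, 'p2) tricat"
    and F :: "('o, 'm, 'n, 'p, 'o2, 'm2, 'n2, 'p2) trifun"
    and B :: "('m, 'n, 'p) bicat" and B' :: "('m2, 'n2, 'p2) bicat" (structure)
begin

abbreviation (input) G where "G \<equiv> Fl F (pt T) (pt T)"

lemma F0_pt [simp]: "F0 F (pt T) = pt T'"
  using F0_type[OF s.pt_T0] t.pt_T0 t.dd unfolding doubly_degenerate_def by blast

sublocale G: monoidal_psf G B B'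
  using Fl_psf[OF s.pt_T0 s.pt_T0] s.monoidal_bicat_axioms t.monoidal_bicat_axioms unfolding monoidal_psf_def by simp

definition JC where "JC = ppair (G \<circ>\<^sub>p pfst B B) (G \<circ>\<^sub>p psnd B B)"

lemma JC_pre: "pre_psf JC (B \<times>\<^sub>b B) (B' \<times>\<^sub>b B')"
  unfolding JC_def
  by (intro t.BB.pre_psf_ppair pre_psf_pcomp[OF s.BB.fs.pre_psf_axioms G.monoidal_psf_axioms]
      pre_psf_pcomp[OF s.BB.sn.pre_psf_axioms G.monoidal_psf_axioms])

definition Csrc where "Csrc = ddTn T' \<circ>\<^sub>p JC"

lemma Chi_src_eq: "Chi_src T T' F (pt T) (pt T) (pt T) = Csrc"
  by (simp add: Chi_src_def tens_def Csrc_def JC_def ddTn_def proj2_1_def proj2_2_def)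

abbreviation chi where "chi \<equiv> Chi F (pt T) (pt T) (pt T)"
abbreviation iota where "iota \<equiv> Iot F (pt T)"

sublocale chi: monoidal_adjeq "B \<times>\<^sub>b B" B' chi Csrc "G \<circ>\<^sub>p ddTn T"
proof unfold_locales
  show "adjoint_equivalence Csrc (G \<circ>\<^sub>p ddTn T) chi"
    using Chi_adjeq[OF s.pt_T0 s.pt_T0 s.pt_T0] by (simp add: Chi_src_eq s.Tn_pt_eq)
  show "PDom Csrc = B \<times>\<^sub>b B" "PCod Csrc = B'"
    using JC_pre by (simp_all add: Csrc_def pcomp_def pre_psf_def pre_psf_axioms_def t.M.PCod_eq)
qed

sublocale iota: monoidal_adjeq unit_bicat B' iota "Uf T' (pt T')" "G \<circ>\<^sub>p Uf T (pt T)"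
proof unfold_locales
  show "adjoint_equivalence (Uf T' (pt T')) (G \<circ>\<^sub>p Uf T (pt T)) iota"
    using Iot_adjeq[OF s.pt_T0] by simp
qed (simp_all add: t.UF.PDom_eq t.UF.PCod_eq)

definition J where "J = iota.W"
definition K where "K = iota.W'"
definition W where "W = chi.W"

lemma W_eqs [simp]: "t1 (fwd iota) () = J" "t1 (bwd iota) () = K" "t1 (fwd chi) (the_elem (Obj B), the_elem (Obj B)) = W"
  by (simp_all add: J_def K_def W_def)

lemma J_K_W_Mor [simp]: "J \<in> Mor B'" "K \<in> Mor B'" "W \<in> Mor B'"
  unfolding J_def K_def W_def using iota.f.S_Mor iota.b.S_Mor chi.f.S_Mor by blast+

abbreviation gf where "gf \<equiv> pf1 G"
abbreviation GL where "GL \<equiv> gf s.L"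
abbreviation GR where "GR \<equiv> gf s.R"
abbreviation V where "V \<equiv> [GL, W]"

lemma Csrc_pf1: "pf1 Csrc q = pf1 (ddTn T') (gf (fst q), gf (snd q))" "pf1 (G \<circ>\<^sub>p ddTn T) q = gf (pf1 (ddTn T) q)"
  by (simp_all add: Csrc_def JC_def pcomp_def ppair_def)

text \<open>The naturality cell of \<chi>: the object W is moved past F(X \<boxtimes> Y), which
  turns into F X \<boxtimes>' F Y.\<close>

definition th where "th X Y = nat_dia (fwd chi) (X, Y)"

lemma th_typing [simp]: assumes [simp]: "X \<in> Mor B" "Y \<in> Mor B"
  shows "diso B' (th X Y)" "valid B' (th X Y)" "dsrc (th X Y) = [gf (pf1 (ddTn T) (X, Y)), W]" "dtrg (th X Y) = [W, pf1 (ddTn T') (gf X, gf Y)]"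
  unfolding th_def using chi.f.iso_n[of "(X, Y)"] chi.f.valid_n[of "(X, Y)"] by (simp_all add: chi.f.natR_eq Csrc_pf1)

lemma th_fold: assumes [simp]: "X \<in> Mor B" "Y \<in> Mor B"
  shows "Dia [gf (pf1 (ddTn T) (X, Y)), W] (t2 (fwd chi) (X, Y)) [W, pf1 (ddTn T') (gf X, gf Y)] = th X Y"
  unfolding th_def using chi.f.natR_eq[of "(X, Y)"] by (simp add: Csrc_pf1)

lemma chi_tlist2: assumes [simp]: "X \<in> Mor B" "Y \<in> Mor B" "X' \<in> Mor B" "Y' \<in> Mor B"
  shows "tlist (fwd chi) [(X, Y), (X', Y')] = wh B' [gf (pf1 (ddTn T) (X, Y))] (th X' Y') [] ;; wh B' [] (th X Y) [pf1 (ddTn T') (gf X', gf Y')]"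
  by (simp add: Csrc_pf1 th_fold)

section \<open>The object V in the role of L'\<close>

abbreviation GI where "GI \<equiv> gf s.I"

definition gnu where "gnu = img G s.nu"

lemma gnu_typing [simp]: "diso B' gnu" "valid B' gnu" "dsrc gnu = []" "dtrg gnu = [GI]"
  unfolding gnu_def by simp_all

text \<open>The comparison of I' with F I goes through the empty list; likewise that of I' with U'
  below.\<close>

definition kk where "kk = dinv B' t.nu ;; gnu"

lemma kk_typing [simp]: "diso B' kk" "valid B' kk" "dsrc kk = [t.I]" "dtrg kk = [GI]"
  unfolding kk_def by simp_all

definition k2 where "k2 = dinv B' t.nu ;; dfold B' []"

lemma k2_typing [simp]: "diso B' k2" "valid B' k2" "dsrc k2 = [t.I]" "dtrg k2 = [t.U]"
  unfolding k2_def by simp_all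

abbreviation M' where "M' \<equiv> ddTn T'"
abbreviation P' where "P' \<equiv> B' \<times>\<^sub>b B'"

lemma pair1: assumes [simp]: "valid B' f" "dsrc f = [m]" "dtrg f = [m']" "c \<in> Mor B'"
  shows "valid P' (pairD f (idd B' [c]))" "dsrc (pairD f (idd B' [c])) = [(m, c)]" "dtrg (pairD f (idd B' [c])) = [(m', c)]"
    "img (pfst B' B') (pairD f (idd B' [c])) = f" "img (psnd B' B') (pairD f (idd B' [c])) = idd B' [c]"
    "valid P' (pairD (idd B' [c]) f)" "dsrc (pairD (idd B' [c]) f) = [(c, m)]" "dtrg (pairD (idd B' [c]) f) = [(c, m')]"
    "img (pfst B' B') (pairD (idd B' [c]) f) = idd B' [c]" "img (psnd B' B') (pairD (idd B' [c]) f) = f"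
  using t.BB.pairD[of f "idd B' [c]"] t.BB.pairD[of "idd B' [c]" f] by simp_all

lemma pair1_iso: assumes "diso B' f" "dsrc f = [m]" "dtrg f = [m']" "c \<in> Mor B'"
  shows "diso P' (pairD f (idd B' [c]))" "diso P' (pairD (idd B' [c]) f)"
  using pair1[of f m m' c] assms by (auto intro!: t.iso_prod_dia)

definition PL where "PL c = pairD kk (idd B' [c])"
definition PR where "PR c = pairD (idd B' [c]) kk"
definition QL where "QL c = pairD k2 (idd B' [c])"
definition QR where "QR c = pairD (idd B' [c]) k2"

lemma unit_pairs_typing [simp]: assumes "c \<in> Mor B'"
  shows "diso P' (PL c)" "valid P' (PL c)" "dsrc (PL c) = [(t.I, c)]" "dtrg (PL c) = [(GI, c)]"
    "img (pfst B' B') (PL c) = kk" "img (psnd B' B') (PL c) = idd B' [c]"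
    "diso P' (PR c)" "valid P' (PR c)" "dsrc (PR c) = [(c, t.I)]" "dtrg (PR c) = [(c, GI)]"
    "img (psnd B' B') (PR c) = kk" "img (pfst B' B') (PR c) = idd B' [c]"
    "diso P' (QL c)" "valid P' (QL c)" "dsrc (QL c) = [(t.I, c)]" "dtrg (QL c) = [(t.U, c)]"
    "img (pfst B' B') (QL c) = k2" "img (psnd B' B') (QL c) = idd B' [c]"
    "diso P' (QR c)" "valid P' (QR c)" "dsrc (QR c) = [(c, t.I)]" "dtrg (QR c) = [(c, t.U)]"
    "img (psnd B' B') (QR c) = k2" "img (pfst B' B') (QR c) = idd B' [c]"
  unfolding PL_def PR_def QL_def QR_def using assms by (simp_all add: pair1 pair1_iso)

text \<open>The analogue of \<lambda> for V: replace I' by F I, pass W by the inverse naturality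
  cell of \<chi>, then apply F to \<open>lam\<close>. The cell q is the same with
  \<open>p\<close>.\<close>

definition v where "v a = wh B' V (img M' (PL (gf a))) [] ;; wh B' [GL] (dinv B' (th s.I a)) [] ;; wh B' [] (img G (s.lam a)) [W]"
definition q where "q b = wh B' V (img M' (PR (gf b))) [] ;; wh B' [GL] (dinv B' (th b s.I)) [] ;; wh B' [] (img G (s.p b)) [W]"

lemma v_q_typing [simp]: assumes [simp]: "a \<in> Mor B"
  shows "diso B' (v a)" "valid B' (v a)" "dsrc (v a) = V @ [t.al (gf a)]" "dtrg (v a) = gf a # V"
    "diso B' (q a)" "valid B' (q a)" "dsrc (q a) = V @ [t.ar (gf a)]" "dtrg (q a) = gf a # V"
  unfolding v_def q_def by (simp_all add: t.al_def t.ar_def s.al_def s.ar_def)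

text \<open>Two cells of the shape of v and q, applied one after the other, can be carried out stage
  by stage, since their stages act on disjoint segments.\<close>

lemma merge:
  assumes [simp]: "valid B' H" "dsrc H = [m]" "dtrg H = [m1]" "valid B' \<theta>" "dsrc \<theta> = [W, m1]" "dtrg \<theta> = [m2, W]"
      "valid B' g" "dsrc g = [GL, m2]" "dtrg g = [c, GL]"
    and [simp]: "valid B' H'" "dsrc H' = [m']" "dtrg H' = [m1']" "valid B' \<theta>'" "dsrc \<theta>' = [W, m1']" "dtrg \<theta>' = [m2', W]"
      "valid B' g'" "dsrc g' = [GL, m2']" "dtrg g' = [c', GL]"
  shows "wh B' [] (wh B' V H [] ;; wh B' [GL] \<theta> [] ;; wh B' [] g [W]) [m'] ;; wh B' [c] (wh B' V H' [] ;; wh B' [GL] \<theta>' [] ;; wh B' [] g' [W]) []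
    = wh B' V H [m'] ;; wh B' [GL, W, m1] H' [] ;; wh B' [GL] \<theta> [m1'] ;; wh B' [GL, m2] \<theta>' [] ;; wh B' [] g [m2', W] ;; wh B' [c] g' [W]"
proof -
  have [simp]: "m' \<in> Mor B'" "m1' \<in> Mor B'" "m2' \<in> Mor B'" "m \<in> Mor B'" "m1 \<in> Mor B'" "m2 \<in> Mor B'" "c \<in> Mor B'" "c' \<in> Mor B'"
    using t.valid_dsrc[of H'] t.valid_dtrg[of H'] t.valid_dtrg[of \<theta>'] t.valid_dsrc[of H] t.valid_dtrg[of H] t.valid_dtrg[of \<theta>] t.valid_dtrg[of g] t.valid_dtrg[of g']
    by simp_all
  have 1: "wh B' [] g [W, m'] ;; wh B' [c, GL, W] H' [] = wh B' [GL, m2, W] H' [] ;; wh B' [] g [W, m1']"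
    using t.exchange[of g H' "[]" "[W]" "[]"] by simp
  have 2: "wh B' [GL] \<theta> [m'] ;; wh B' [GL, m2, W] H' [] = wh B' [GL, W, m1] H' [] ;; wh B' [GL] \<theta> [m1']"
    using t.exchange[of \<theta> H' "[GL]" "[]" "[]"] by simp
  have 3: "wh B' [] g [W, m1'] ;; wh B' [c, GL] \<theta>' [] = wh B' [GL, m2] \<theta>' [] ;; wh B' [] g [m2', W]"
    using t.exchange[of g \<theta>' "[]" "[]" "[]"] by simp
  show ?thesis
    by (simp only: t.wh_seq t.wh_wh append.simps append_Nil2 t.seq_assoc) (simp only: t.seq_rewrite2[OF 1] t.seq_rewrite2[OF 2] t.seq_rewrite2[OF 3] t.seq_assoc)
qed

definition y where "y a b = img Csrc (s.X a b)"

lemma img_JC: assumes [simp]: "valid (B \<times>\<^sub>b B) f"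
  shows "valid P' (img JC f)" "img (pfst B' B') (img JC f) = img G (img (pfst B B) f)" "img (psnd B' B') (img JC f) = img G (img (psnd B B) f)"
    "img Csrc f = img M' (img JC f)"
proof -
  interpret JC: pre_psf JC "B \<times>\<^sub>b B" P' by (rule JC_pre)
  note pre = pre_psf_pcomp[OF s.BB.fs.pre_psf_axioms G.monoidal_psf_axioms] pre_psf_pcomp[OF s.BB.sn.pre_psf_axioms G.monoidal_psf_axioms]
  show "valid P' (img JC f)" by simp
  show "img (pfst B' B') (img JC f) = img G (img (pfst B B) f)" "img (psnd B' B') (img JC f) = img G (img (psnd B B) f)"
    unfolding JC_def t.BB.img_ppair[OF pre assms]
    using img_pcomp[OF s.BB.fs.pre_psf_axioms G.monoidal_psf_axioms assms] img_pcomp[OF s.BB.sn.pre_psf_axioms G.monoidal_psf_axioms assms] by simp_all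
  show "img Csrc f = img M' (img JC f)"
    unfolding Csrc_def by (rule img_pcomp[OF JC_pre t.M.monoidal_psf_axioms assms])
qed

lemma JC_pf1: "pf1 JC = (\<lambda>q. (gf (fst q), gf (snd q)))"
  by (simp add: JC_def ppair_def pcomp_def comp_def)

text \<open>Replacing I' by F I on both objects commutes with interchange; in each factor of the
  product this only concerns units.\<close>

lemma y_x: assumes [simp]: "a \<in> Mor B" "b \<in> Mor B"
  shows "wh B' [] (img M' (PL (gf a))) [t.ar (gf b)] ;; wh B' [pf1 M' (GI, gf a)] (img M' (PR (gf b))) [] ;; y a b
    = t.x (gf a) (gf b) ;; wh B' [] (img M' (PR (gf b))) [t.al (gf a)] ;; wh B' [pf1 M' (gf b, GI)] (img M' (PL (gf a))) []"
    and "valid B' (y a b)" "dsrc (y a b) = [pf1 M' (GI, gf a), pf1 M' (gf b, GI)]" "dtrg (y a b) = [pf1 M' (gf b, GI), pf1 M' (GI, gf a)]"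
proof -
  let ?a = "gf a" and ?b = "gf b"
  let ?l = "wh P' [] (PL ?a) [(?b, t.I)] ;;\<^bsub>P'\<^esub> wh P' [(GI, ?a)] (PR ?b) [] ;;\<^bsub>P'\<^esub> img JC (s.X a b)"
  let ?r = "t.X ?a ?b ;;\<^bsub>P'\<^esub> wh P' [] (PR ?b) [(t.I, ?a)] ;;\<^bsub>P'\<^esub> wh P' [(?b, GI)] (PL ?a) []"
  note X [simp] = img_JC[OF s.X_typing(2)[OF assms]]
  have vl: "valid P' ?l" and vr: "valid P' ?r" by (simp_all add: JC_pf1)
  have "?l = ?r"
  proof (rule t.BB.prod_eqI[OF vl vr])
    show "img (pfst B' B') ?l = img (pfst B' B') ?r"
      by (simp add: JC_pf1 t.wh_seq t.inv_wh[symmetric] kk_def gnu_def[symmetric])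
    show "img (psnd B' B') ?l = img (psnd B' B') ?r"
      by (simp add: JC_pf1 t.wh_seq t.inv_wh[symmetric] kk_def gnu_def[symmetric])
  qed
  then have "img M' ?l = img M' ?r" by simp
  then show "wh B' [] (img M' (PL (gf a))) [t.ar (gf b)] ;; wh B' [pf1 M' (GI, gf a)] (img M' (PR (gf b))) [] ;; y a b
    = t.x (gf a) (gf b) ;; wh B' [] (img M' (PR (gf b))) [t.al (gf a)] ;; wh B' [pf1 M' (gf b, GI)] (img M' (PL (gf a))) []"
    by (simp add: JC_pf1 y_def t.x_def t.al_def t.ar_def)
  show "valid B' (y a b)" "dsrc (y a b) = [pf1 M' (GI, gf a), pf1 M' (gf b, GI)]" "dtrg (y a b) = [pf1 M' (gf b, GI), pf1 M' (GI, gf a)]"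
    unfolding y_def by (simp_all add: JC_pf1)
qed

definition EC where "EC a b = img G (s.C a b)"

lemma EC_typing [simp]: "a \<in> Mor B \<Longrightarrow> b \<in> Mor B \<Longrightarrow> valid B' (EC a b)" "dsrc (EC a b) = [gf a, gf b]" "dtrg (EC a b) = [gf b, gf a]"
  unfolding EC_def by simp_all

text \<open>The image under F of the equation for the braiding is whiskered with W
  (\<open>E\<close>). Naturality of \<chi> at the interchange carries it across W
  (\<open>n\<close>), and \<open>y_x\<close> replaces the unit F I by I'.\<close>

lemma functor_hexagon: assumes [simp]: "a \<in> Mor B" "b \<in> Mor B"
  shows "wh B' [] (v a) [t.ar (gf b)] ;; wh B' [gf a] (q b) [] ;; wh B' [] (EC a b) V
     = wh B' V (t.x (gf a) (gf b)) [] ;; wh B' [] (q b) [t.al (gf a)] ;; wh B' [gf b] (v a) []"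
proof -
  let ?a = "gf a" and ?b = "gf b"
  let ?l1 = "gf (s.al a)" and ?r1 = "gf (s.ar b)" and ?l = "pf1 M' (GI, ?a)" and ?r = "pf1 M' (?b, GI)"
  let ?tl = "dinv B' (th s.I a)" and ?tr = "dinv B' (th b s.I)"
  let ?hl = "img M' (PL ?a)" and ?hr = "img M' (PR ?b)"
  note [simp] = y_x(2-4)
  have tr [simp]: "gf (pf1 (ddTn T) (s.I, a)) = ?l1" "gf (pf1 (ddTn T) (b, s.I)) = ?r1" by (simp_all add: s.al_def s.ar_def)
  have pr [simp]: "pf1 M' (t.I, ?a) = t.al ?a" "pf1 M' (?b, t.I) = t.ar ?b" by (simp_all add: t.al_def t.ar_def)
  have E: "wh B' [] (img G (s.lam a)) [?r1, W] ;; wh B' [?a] (img G (s.p b)) [W] ;; wh B' [] (EC a b) V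
     = wh B' [GL] (img G (s.x a b)) [W] ;; wh B' [] (img G (s.p b)) [?l1, W] ;; wh B' [?b] (img G (s.lam a)) [W]"
  proof -
    have "img G (wh B [] (s.lam a) [s.ar b] ;;\<^bsub>B\<^esub> wh B [a] (s.p b) [] ;;\<^bsub>B\<^esub> wh B [] (s.C a b) [s.L])
      = img G (wh B [s.L] (s.x a b) [] ;;\<^bsub>B\<^esub> wh B [] (s.p b) [s.al a] ;;\<^bsub>B\<^esub> wh B [b] (s.lam a) [])"
      by (simp only: s.hexagon[OF assms])
    then have "wh B' [] (img G (s.lam a)) [?r1] ;; wh B' [?a] (img G (s.p b)) [] ;; wh B' [] (EC a b) [GL]
       = wh B' [GL] (img G (s.x a b)) [] ;; wh B' [] (img G (s.p b)) [?l1] ;; wh B' [?b] (img G (s.lam a)) []"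
      by (simp add: EC_def)
    from t.wh_cong[OF this, of "[]" "[W]"] show ?thesis by (simp add: t.wh_seq)
  qed
  \<comment> \<open>Naturality of \<chi> at the diagram \<open>s.X a b\<close>, read with the
    inverses of its cells.\<close>
  have n: "wh B' [] ?tl [?r] ;; wh B' [?l1] ?tr [] ;; wh B' [] (img G (s.x a b)) [W] = wh B' [W] (y a b) [] ;; wh B' [] ?tr [?l] ;; wh B' [?r1] ?tl []"
  proof -
    let ?t1 = "wh B' [?l1] (th b s.I) [] ;; wh B' [] (th s.I a) [?r]" and ?t2 = "wh B' [?r1] (th s.I a) [] ;; wh B' [] (th b s.I) [?l]"
    have "img (G \<circ>\<^sub>p ddTn T) (s.X a b) = img G (s.x a b)"
      unfolding s.x_def by (rule img_pcomp[OF s.M.pre_psf_axioms G.monoidal_psf_axioms]) simp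
    then have "wh B' [] (img G (s.x a b)) [W] ;; ?t2 = ?t1 ;; wh B' [W] (y a b) []"
      using chi.f.tlist_nat[of "s.X a b"] by (simp add: chi_tlist2 y_def del: chi.f.tlist_Cons)
    moreover have i: "diso B' ?t1" "dsrc ?t1 = [?l1, ?r1, W]" "dtrg ?t1 = [W, ?l, ?r]" "diso B' ?t2" "dsrc ?t2 = [?r1, ?l1, W]" "dtrg ?t2 = [W, ?r, ?l]" by simp_all
    ultimately have "wh B' [W] (y a b) [] ;; dinv B' ?t2 = dinv B' ?t1 ;; wh B' [] (img G (s.x a b)) [W]"
      by (intro t.inv_commute[of ?t1 ?t2 "wh B' [W] (y a b) []" "wh B' [] (img G (s.x a b)) [W]"]) simp_all
    then show ?thesis by (simp add: t.inv_seq_eq t.inv_wh)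
  qed
  have n': "wh B' [GL] ?tl [?r] ;; wh B' [GL, ?l1] ?tr [] ;; wh B' [GL] (img G (s.x a b)) [W] = wh B' V (y a b) [] ;; wh B' [GL] ?tr [?l] ;; wh B' [GL, ?r1] ?tl []"
    using t.wh_cong[OF n, of "[GL]" "[]"] by (simp add: t.wh_seq)
  have y': "wh B' V ?hl [t.ar ?b] ;; wh B' [GL, W, ?l] ?hr [] ;; wh B' V (y a b) [] = wh B' V (t.x ?a ?b) [] ;; wh B' V ?hr [t.al ?a] ;; wh B' [GL, W, ?r] ?hl []"
    using t.wh_cong[OF y_x(1)[OF assms], of V "[]"] by (simp add: t.wh_seq)
  have m: "wh B' [] (v a) [t.ar ?b] ;; wh B' [?a] (q b) [] 
     = wh B' V ?hl [t.ar ?b] ;; wh B' [GL, W, ?l] ?hr [] ;; wh B' [GL] ?tl [?r] ;; wh B' [GL, ?l1] ?tr [] ;; wh B' [] (img G (s.lam a)) [?r1, W] ;; wh B' [?a] (img G (s.p b)) [W]"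
    unfolding v_def q_def by (rule merge) simp_all
  have "wh B' [] (v a) [t.ar ?b] ;; wh B' [?a] (q b) [] ;; wh B' [] (EC a b) V
     = wh B' V ?hl [t.ar ?b] ;; wh B' [GL, W, ?l] ?hr [] ;; wh B' [GL] ?tl [?r] ;; wh B' [GL, ?l1] ?tr [] ;; wh B' [] (img G (s.lam a)) [?r1, W] ;; wh B' [?a] (img G (s.p b)) [W] ;; wh B' [] (EC a b) V"
    by (simp only: t.seq_rewrite2[OF m] t.seq_assoc)
  also have "\<dots> = wh B' V (t.x ?a ?b) [] ;; wh B' V ?hr [t.al ?a] ;; wh B' [GL, W, ?r] ?hl [] ;; wh B' [GL] ?tr [?l] ;; wh B' [GL, ?r1] ?tl []
       ;; wh B' [] (img G (s.p b)) [?l1, W] ;; wh B' [?b] (img G (s.lam a)) [W]"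
    by (simp only: E t.seq_rewrite3[OF n'] t.seq_rewrite3[OF y'] t.seq_assoc)
  also have "\<dots> = wh B' V (t.x ?a ?b) [] ;; wh B' [] (q b) [t.al ?a] ;; wh B' [?b] (v a) []"
    unfolding v_def q_def by (rule arg_cong[of _ _ "\<lambda>z. wh B' V (t.x ?a ?b) [] ;; z"], rule merge[symmetric]) simp_all
  finally show ?thesis .
qed

end

subsection \<open>Comparison of the unit objects\<close>

text \<open>The case of three transformations, which is the shape of the source of \<gamma> and of
  the target of \<delta>; \<phi> is the bracketing of the composite object.\<close>

lemma (in monoidal_pair) nat_dia_tcomp3:
  assumes \<rho>: "PDom (TSrc \<rho>) = D" "PCod (TSrc \<rho>) = C" and \<sigma>: "PDom (TSrc \<sigma>) = D" "PCod (TSrc \<sigma>) = C" "pf1 (TSrc \<sigma>) f = pf1 (TTrg \<rho>) f"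
    and \<tau>: "PDom (TSrc \<tau>) = D" "pf1 (TSrc \<tau>) f = pf1 (TTrg \<sigma>) f"
    and f [simp]: "f \<in> Mor D" and diso: "diso C (nat_dia \<rho> f)" "diso C (nat_dia \<sigma> f)" "diso C (nat_dia \<tau> f)"
  defines "t \<equiv> t1 \<tau> ptD" and "s \<equiv> t1 \<sigma> ptD" and "r \<equiv> t1 \<rho> ptD"
  defines "\<phi> \<equiv> wh C [t] (dfold C [s, r]) [] ;; dfold C [t, s \<odot> r]"
  shows "nat_dia (\<tau> \<bullet>\<^sub>t \<sigma> \<bullet>\<^sub>t \<rho>) f = dinv C (wh C [pf1 (TTrg \<tau>) f] \<phi> [])
      ;; wh C [] (nat_dia \<tau> f) [s, r] ;; wh C [t] (nat_dia \<sigma> f) [r] ;; wh C [t, s] (nat_dia \<rho> f) [] ;; wh C [] \<phi> [pf1 (TSrc \<rho>) f]"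
    and "diso C (nat_dia (\<tau> \<bullet>\<^sub>t \<sigma> \<bullet>\<^sub>t \<rho>) f)" and "t1 (\<tau> \<bullet>\<^sub>t \<sigma> \<bullet>\<^sub>t \<rho>) ptD = t \<odot> s \<odot> r"
    and "diso C \<phi>" "dsrc \<phi> = [t, s, r]" "dtrg \<phi> = [t \<odot> s \<odot> r]"
    and "TSrc (\<tau> \<bullet>\<^sub>t \<sigma> \<bullet>\<^sub>t \<rho>) = TSrc \<rho>" "TTrg (\<tau> \<bullet>\<^sub>t \<sigma> \<bullet>\<^sub>t \<rho>) = TTrg \<tau>"
proof -
  let ?F = "pf1 (TSrc \<rho>) f" and ?G = "pf1 (TTrg \<rho>) f" and ?H = "pf1 (TTrg \<sigma>) f" and ?K = "pf1 (TTrg \<tau>) f"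
  have n: "nat_dia \<rho> f = Dia [?G, r] (t2 \<rho> f) [r, ?F]" "nat_dia \<sigma> f = Dia [?H, s] (t2 \<sigma> f) [s, ?G]" "nat_dia \<tau> f = Dia [?K, t] (t2 \<tau> f) [t, ?H]"
    using \<rho> \<sigma> \<tau> by (simp_all add: nat_dia_def t_def s_def r_def)
  have ty [simp]: "dsrc (nat_dia \<rho> f) = [?G, r]" "dtrg (nat_dia \<rho> f) = [r, ?F]" "dsrc (nat_dia \<sigma> f) = [?H, s]" "dtrg (nat_dia \<sigma> f) = [s, ?G]"
    "dsrc (nat_dia \<tau> f) = [?K, t]" "dtrg (nat_dia \<tau> f) = [t, ?H]" unfolding n by simp_all
  have [simp]: "r \<in> Mor C" "s \<in> Mor C" "t \<in> Mor C" "?F \<in> Mor C" "?G \<in> Mor C" "?H \<in> Mor C" "?K \<in> Mor C"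
    using diso unfolding n by (simp_all add: C.iso_Dia)
  note [simp] = diso
  have tc: "TSrc (\<sigma> \<bullet>\<^sub>t \<rho>) = TSrc \<rho>" "TTrg (\<sigma> \<bullet>\<^sub>t \<rho>) = TTrg \<sigma>" "t1 (\<sigma> \<bullet>\<^sub>t \<rho>) ptD = s \<odot> r"
    using \<rho> by (simp_all add: tcomp_def Let_def s_def r_def)
  show T: "TSrc (\<tau> \<bullet>\<^sub>t \<sigma> \<bullet>\<^sub>t \<rho>) = TSrc \<rho>" "TTrg (\<tau> \<bullet>\<^sub>t \<sigma> \<bullet>\<^sub>t \<rho>) = TTrg \<tau>" "t1 (\<tau> \<bullet>\<^sub>t \<sigma> \<bullet>\<^sub>t \<rho>) ptD = t \<odot> s \<odot> r"
    using \<rho> by (simp_all add: tcomp_def Let_def s_def r_def t_def)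
  show ph [simp]: "diso C \<phi>" "dsrc \<phi> = [t, s, r]" "dtrg \<phi> = [t \<odot> s \<odot> r]"
    unfolding \<phi>_def by (simp_all add: C.pth_Cons)
  have i: "diso C (nat_dia (\<sigma> \<bullet>\<^sub>t \<rho>) f)" using nat_dia_tcomp(2)[OF \<rho> \<sigma>(1,3) f diso(1,2)] .
  have P: "PDom (TSrc (\<sigma> \<bullet>\<^sub>t \<rho>)) = D" "PCod (TSrc (\<sigma> \<bullet>\<^sub>t \<rho>)) = C" "pf1 (TSrc \<tau>) f = pf1 (TTrg (\<sigma> \<bullet>\<^sub>t \<rho>)) f"
    using \<rho> \<tau> tc by simp_all
  show "diso C (nat_dia (\<tau> \<bullet>\<^sub>t \<sigma> \<bullet>\<^sub>t \<rho>) f)" using nat_dia_tcomp(2)[OF P(1,2) \<tau>(1) P(3) f i diso(3)] .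
  have 1: "nat_dia (\<sigma> \<bullet>\<^sub>t \<rho>) f = dinv C (wh C [?H] (dfold C [s, r]) []) ;; wh C [] (nat_dia \<sigma> f) [r] ;; wh C [s] (nat_dia \<rho> f) [] ;; wh C [] (dfold C [s, r]) [?F]"
    using nat_dia_tcomp(1)[OF \<rho> \<sigma>(1,3) f diso(1,2)] by (simp add: s_def r_def)
  have 2: "nat_dia (\<tau> \<bullet>\<^sub>t \<sigma> \<bullet>\<^sub>t \<rho>) f = dinv C (wh C [?K] (dfold C [t, s \<odot> r]) []) ;; wh C [] (nat_dia \<tau> f) [s \<odot> r] ;; wh C [t] (nat_dia (\<sigma> \<bullet>\<^sub>t \<rho>) f) [] ;; wh C [] (dfold C [t, s \<odot> r]) [?F]"
    using nat_dia_tcomp(1)[OF P(1,2) \<tau>(1) P(3) f i diso(3)] by (simp add: tc t_def)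
  have 3: "wh C [] (nat_dia \<tau> f) [s \<odot> r] ;; wh C [t, ?H] (dinv C (dfold C [s, r])) [] = wh C [?K, t] (dinv C (dfold C [s, r])) [] ;; wh C [] (nat_dia \<tau> f) [s, r]"
    using C.exchange[of "nat_dia \<tau> f" "dinv C (dfold C [s, r])" "[]" "[]" "[]"] by (simp add: C.pth_Cons)
  have "nat_dia (\<tau> \<bullet>\<^sub>t \<sigma> \<bullet>\<^sub>t \<rho>) f = dinv C (wh C [?K] (dfold C [t, s \<odot> r]) []) ;; wh C [] (nat_dia \<tau> f) [s \<odot> r] ;; wh C [t, ?H] (dinv C (dfold C [s, r])) []
     ;; wh C [t] (nat_dia \<sigma> f) [r] ;; wh C [t, s] (nat_dia \<rho> f) [] ;; wh C [t] (dfold C [s, r]) [?F] ;; wh C [] (dfold C [t, s \<odot> r]) [?F]"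
    unfolding 2 1 by (simp add: C.wh_seq C.inv_wh)
  also have "\<dots> = dinv C (wh C [?K] \<phi> []) ;; wh C [] (nat_dia \<tau> f) [s, r] ;; wh C [t] (nat_dia \<sigma> f) [r] ;; wh C [t, s] (nat_dia \<rho> f) [] ;; wh C [] \<phi> [?F]"
    unfolding \<phi>_def by (simp add: C.seq_rewrite2[OF 3] C.wh_seq C.inv_wh C.inv_seq_eq C.pth_Cons)
  finally show "nat_dia (\<tau> \<bullet>\<^sub>t \<sigma> \<bullet>\<^sub>t \<rho>) f = dinv C (wh C [?K] \<phi> []) ;; wh C [] (nat_dia \<tau> f) [s, r] ;; wh C [t] (nat_dia \<sigma> f) [r] ;; wh C [t, s] (nat_dia \<rho> f) [] ;; wh C [] \<phi> [?F]" .
qed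

text \<open>Takes the folded composite object out of a modification axiom by adding the fold to the
  modification itself.\<close>

lemma (in monoidal_bicat) modification_unfold:
  assumes [simp]: "diso B ph" "u \<in> Mor B" "v \<in> Mor B" "valid B X" "dsrc X = u # dsrc ph" "dtrg X = dsrc ph @ [v]" "valid B m" "dsrc m = dtrg ph"
    and N: "N = dinv B (wh B [u] ph []) ;; X ;; wh B [] ph [v]" and m: "N ;; wh B [] m [v] = wh B [u] m [] ;; Y"
  shows "X ;; wh B [] (ph ;; m) [v] = wh B [u] (ph ;; m) [] ;; Y"
proof -
  have "X ;; wh B [] (ph ;; m) [v] = (wh B [u] ph [] ;; dinv B (wh B [u] ph []) ;; X ;; wh B [] ph [v]) ;; wh B [] m [v]"
    using valid_dtrg[of ph] valid_dsrc[of ph] by (simp add: wh_seq)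
  also have "\<dots> = wh B [u] ph [] ;; (N ;; wh B [] m [v])" unfolding N by simp
  also have "\<dots> = wh B [u] (ph ;; m) [] ;; Y" unfolding m by (simp add: wh_seq)
  finally show ?thesis .
qed

lemma (in monoidal_pair) nat_dia_tpair:
  assumes "PDom (TSrc \<sigma>) = D" "PDom (TSrc \<tau>) = D" "f \<in> Mor D"
  shows "nat_dia (tpair \<sigma> \<tau>) f = pairD (nat_dia \<sigma> f) (nat_dia \<tau> f)"
  using assms by (simp add: natR_def tpair_def pairD_def) (simp add: ppair_def)

context dd_functor begin

sublocale bc: monoidal_pair B B' by unfold_locales
sublocale bp: monoidal_pair B "B \<times>\<^sub>b B" by unfold_locales
sublocale bu: monoidal_pair B unit_bicat by unfold_locales
sublocale bq: monoidal_pair B P' by unfold_locales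

text \<open>Naturality of \<iota> at the cell from the empty list to one object leaves no choice: F
  I is erased and I' created.\<close>

lemma iota_naturality: "nat_dia (fwd iota) () = wh B' [] (dinv B' gnu) [J] ;; wh B' [J] t.nu []" and iota_naturality_typing [simp]: "diso B' (nat_dia (fwd iota) ())" "valid B' (nat_dia (fwd iota) ())"
    "dsrc (nat_dia (fwd iota) ()) = [GI, J]" "dtrg (nat_dia (fwd iota) ()) = [J, t.I]"
proof -
  have p1: "pf1 (G \<circ>\<^sub>p Uf T (pt T)) () = GI" "pf1 (Uf T' (pt T')) () = t.I" by (simp_all add: pcomp_def s.I_def t.I_def)
  have n: "nat_dia (fwd iota) () = Dia [GI, J] (t2 (fwd iota) ()) [J, t.I]"
    using iota.f.natR_eq[of "()"] by (simp add: p1)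
  show i [simp]: "diso B' (nat_dia (fwd iota) ())" using iota.f.iso_n[of "()"] by (simp add: p1 n)
  then show [simp]: "valid B' (nat_dia (fwd iota) ())" by simp
  show [simp]: "dsrc (nat_dia (fwd iota) ()) = [GI, J]" "dtrg (nat_dia (fwd iota) ()) = [J, t.I]" unfolding n by simp_all
  let ?s = "Dia [] () [()]"
  have g: "img (G \<circ>\<^sub>p Uf T (pt T)) ?s = gnu"
    unfolding gnu_def s.nu_def by (rule img_pcomp[OF s.UF.pre_psf_axioms G.monoidal_psf_axioms]) simp
  have t: "img (Uf T' (pt T')) ?s = t.nu" unfolding t.nu_def ..
  have "wh B' [] (img (G \<circ>\<^sub>p Uf T (pt T)) ?s) [iota.W] ;; tlist (fwd iota) [()] = tlist (fwd iota) [] ;; wh B' [iota.W] (img (Uf T' (pt T')) ?s) []"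
    using iota.f.tlist_nat[of ?s] by (simp del: img.simps iota.f.tlist_Cons)
  then have "wh B' [] gnu [J] ;; nat_dia (fwd iota) () = wh B' [J] t.nu []"
    unfolding g t J_def[symmetric] by (simp add: p1 n[symmetric])
  then have "dinv B' (wh B' [] gnu [J]) ;; wh B' [] gnu [J] ;; nat_dia (fwd iota) () = dinv B' (wh B' [] gnu [J]) ;; wh B' [J] t.nu []" by simp
  then show "nat_dia (fwd iota) () = wh B' [] (dinv B' gnu) [J] ;; wh B' [J] t.nu []" by (simp add: t.inv_wh[symmetric])
qed

abbreviation ntid where "ntid a \<equiv> nat_dia (tid G) a"

lemma ntid_typing: assumes [simp]: "a \<in> Mor B"
  shows "ntid a = wh B' [gf a] (dinv B' (dfold B' [])) [] ;; wh B' [] (dfold B' []) [gf a]" "diso B' (ntid a)" "valid B' (ntid a)"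
    "dsrc (ntid a) = [gf a, t.U]" "dtrg (ntid a) = [t.U, gf a]"
  using bc.nat_dia_tid[OF G.pre_psf_axioms assms] by simp_all

text \<open>The naturality cells of \<iota> tensored with an identity on the right and on the left,
  as they occur in \<gamma> and \<delta>.\<close>

definition N3 where "N3 a = img M' (pairD (nat_dia (fwd iota) ()) (ntid a))"
definition N4 where "N4 a = img M' (pairD (ntid a) (nat_dia (fwd iota) ()))"

abbreviation JU where "JU \<equiv> pf1 M' (J, t.U)"
abbreviation UJ where "UJ \<equiv> pf1 M' (t.U, J)"

lemma pairN: assumes [simp]: "a \<in> Mor B"
  shows "diso P' (pairD (nat_dia (fwd iota) ()) (ntid a))" "diso P' (pairD (ntid a) (nat_dia (fwd iota) ()))"
    "img (pfst B' B') (pairD (nat_dia (fwd iota) ()) (ntid a)) = nat_dia (fwd iota) ()" "img (psnd B' B') (pairD (nat_dia (fwd iota) ()) (ntid a)) = ntid a"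
    "img (pfst B' B') (pairD (ntid a) (nat_dia (fwd iota) ())) = ntid a" "img (psnd B' B') (pairD (ntid a) (nat_dia (fwd iota) ())) = nat_dia (fwd iota) ()"
    "dsrc (pairD (nat_dia (fwd iota) ()) (ntid a)) = [(GI, gf a), (J, t.U)]" "dtrg (pairD (nat_dia (fwd iota) ()) (ntid a)) = [(J, t.U), (t.I, gf a)]"
    "dsrc (pairD (ntid a) (nat_dia (fwd iota) ())) = [(gf a, GI), (t.U, J)]" "dtrg (pairD (ntid a) (nat_dia (fwd iota) ())) = [(t.U, J), (gf a, t.I)]"
proof -
  note [simp] = ntid_typing(2-)[OF assms]
  have l: "length (dsrc (nat_dia (fwd iota) ())) = length (dsrc (ntid a))" "length (dtrg (nat_dia (fwd iota) ())) = length (dtrg (ntid a))" by simp_all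
  note p = t.BB.pairD[OF iota_naturality_typing(2) ntid_typing(3)[OF assms] l] t.BB.pairD[OF ntid_typing(3)[OF assms] iota_naturality_typing(2) l[symmetric]]
  show "img (pfst B' B') (pairD (nat_dia (fwd iota) ()) (ntid a)) = nat_dia (fwd iota) ()" "img (psnd B' B') (pairD (nat_dia (fwd iota) ()) (ntid a)) = ntid a"
    "img (pfst B' B') (pairD (ntid a) (nat_dia (fwd iota) ())) = ntid a" "img (psnd B' B') (pairD (ntid a) (nat_dia (fwd iota) ())) = nat_dia (fwd iota) ()"
    by (fact p)+
  then show "diso P' (pairD (nat_dia (fwd iota) ()) (ntid a))" "diso P' (pairD (ntid a) (nat_dia (fwd iota) ()))"
    using p by (auto intro!: t.iso_prod_dia)
  show "dsrc (pairD (nat_dia (fwd iota) ()) (ntid a)) = [(GI, gf a), (J, t.U)]" "dtrg (pairD (nat_dia (fwd iota) ()) (ntid a)) = [(J, t.U), (t.I, gf a)]"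
    "dsrc (pairD (ntid a) (nat_dia (fwd iota) ())) = [(gf a, GI), (t.U, J)]" "dtrg (pairD (ntid a) (nat_dia (fwd iota) ())) = [(t.U, J), (gf a, t.I)]"
    by (simp_all add: p)
qed

lemma N3_N4_typing [simp]: assumes [simp]: "a \<in> Mor B"
  shows "diso B' (N3 a)" "valid B' (N3 a)" "dsrc (N3 a) = [pf1 M' (GI, gf a), JU]" "dtrg (N3 a) = [JU, t.al (gf a)]"
    "diso B' (N4 a)" "valid B' (N4 a)" "dsrc (N4 a) = [pf1 M' (gf a, GI), UJ]" "dtrg (N4 a) = [UJ, t.ar (gf a)]"
  unfolding N3_def N4_def by (simp_all add: pairN t.al_def t.ar_def)

text \<open>In both factors the cell of \<iota> tensored with an identity only moves units; so, once
  U' is replaced by I', it is the interchange with J.\<close>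

lemma N3_x: assumes [simp]: "a \<in> Mor B"
  shows "wh B' [] (img M' (PL (gf a))) [t.ar J] ;; wh B' [pf1 M' (GI, gf a)] (img M' (QR J)) [] ;; N3 a
     = t.x (gf a) J ;; wh B' [] (img M' (QR J)) [t.al (gf a)]"
proof -
  let ?a = "gf a"
  let ?l = "wh P' [] (PL ?a) [(J, t.I)] ;;\<^bsub>P'\<^esub> wh P' [(GI, ?a)] (QR J) [] ;;\<^bsub>P'\<^esub> pairD (nat_dia (fwd iota) ()) (ntid a)"
  let ?r = "t.X ?a J ;;\<^bsub>P'\<^esub> wh P' [] (QR J) [(t.I, ?a)]"
  note [simp] = pairN[OF assms]
  have vl: "valid P' ?l" and vr: "valid P' ?r" by simp_all
  have "?l = ?r"
  proof (rule t.BB.prod_eqI[OF vl vr])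
    show "img (pfst B' B') ?l = img (pfst B' B') ?r"
      by simp (simp add: iota_naturality kk_def t.wh_seq t.inv_wh[symmetric])
    show "img (psnd B' B') ?l = img (psnd B' B') ?r"
      by simp (simp add: ntid_typing(1) k2_def t.wh_seq t.inv_wh[symmetric])
  qed
  then have "img M' ?l = img M' ?r" by simp
  then show ?thesis by (simp add: N3_def t.x_def t.al_def t.ar_def)
qed

text \<open>The counterpart for J in the second argument; here the cell undoes the interchange,
  which is why it enters the transfer inverted.\<close>

lemma N4_x: assumes [simp]: "b \<in> Mor B"
  shows "t.x J (gf b) ;; wh B' [] (img M' (PR (gf b))) [t.al J] ;; wh B' [pf1 M' (gf b, GI)] (img M' (QL J)) [] ;; N4 b
     = wh B' [] (img M' (QL J)) [t.ar (gf b)]"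
proof -
  let ?b = "gf b"
  let ?l = "t.X J ?b ;;\<^bsub>P'\<^esub> wh P' [] (PR ?b) [(t.I, J)] ;;\<^bsub>P'\<^esub> wh P' [(?b, GI)] (QL J) [] ;;\<^bsub>P'\<^esub> pairD (ntid b) (nat_dia (fwd iota) ())"
  let ?r = "wh P' [] (QL J) [(?b, t.I)]"
  note [simp] = pairN[OF assms]
  have vl: "valid P' ?l" and vr: "valid P' ?r" by simp_all
  have "?l = ?r"
  proof (rule t.BB.prod_eqI[OF vl vr])
    show "img (pfst B' B') ?l = img (pfst B' B') ?r"
      by simp (simp add: ntid_typing(1) k2_def t.wh_seq t.inv_wh[symmetric])
    show "img (psnd B' B') ?l = img (psnd B' B') ?r"
      by simp (simp add: iota_naturality kk_def t.wh_seq t.inv_wh[symmetric])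
  qed
  then have "img M' ?l = img M' ?r" by simp
  then show ?thesis by (simp add: N4_def t.x_def t.al_def t.ar_def)
qed

subsection \<open>The unit constraints of the functor\<close>

definition tpl where "tpl = tpair (twr (fwd iota) (pbang B)) (tid G)"
definition tpr where "tpr = tpair (tid G) (twr (fwd iota) (pbang B))"

lemma twr_iota: assumes "a \<in> Mor B"
  shows "nat_dia (twr (fwd iota) (pbang B)) a = nat_dia (fwd iota) ()" "t1 (twr (fwd iota) (pbang B)) (the_elem (Obj B)) = J"
    "PDom (TSrc (twr (fwd iota) (pbang B))) = B" "pf1 (TSrc (twr (fwd iota) (pbang B))) a = t.I" "pf1 (TTrg (twr (fwd iota) (pbang B))) a = GI"
  using bu.nat_dia_twr[OF s.bang_pre _ assms, of "fwd iota"] t.UF.PDom_eq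
  by (simp_all add: iota.f.TSrc_eq iota.f.TTrg_eq) (simp_all add: pcomp_def pbang_def pconst_def s.I_def t.I_def)

lemma ttens_components: assumes [simp]: "a \<in> Mor B"
  shows "nat_dia (twl M' tpl) a = N3 a" "t1 (twl M' tpl) (the_elem (Obj B)) = JU" "PDom (TSrc (twl M' tpl)) = B" "PCod (TSrc (twl M' tpl)) = B'"
     "pf1 (TSrc (twl M' tpl)) a = t.al (gf a)" "pf1 (TTrg (twl M' tpl)) a = pf1 M' (GI, gf a)"
    "nat_dia (twl M' tpr) a = N4 a" "t1 (twl M' tpr) (the_elem (Obj B)) = UJ" "PDom (TSrc (twl M' tpr)) = B" "PCod (TSrc (twl M' tpr)) = B'"
     "pf1 (TSrc (twl M' tpr)) a = t.ar (gf a)" "pf1 (TTrg (twl M' tpr)) a = pf1 M' (gf a, GI)"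
proof -
  note tid = bc.nat_dia_tid[OF G.pre_psf_axioms assms]
  note tw = twr_iota[OF assms]
  have D: "PDom (TSrc tpl) = B" "PDom (TSrc tpr) = B" using tid tw by (simp_all add: tpl_def tpr_def tpair_def ppair_def)
  have t1: "t1 tpl (the_elem (Obj B)) = (J, t.U)" "t1 tpr (the_elem (Obj B)) = (t.U, J)"
    using tid tw by (simp_all add: tpl_def tpr_def tpair_def)
  have n: "nat_dia tpl a = pairD (nat_dia (fwd iota) ()) (ntid a)" "nat_dia tpr a = pairD (ntid a) (nat_dia (fwd iota) ())"
    unfolding tpl_def tpr_def using tid tw by (simp_all add: bq.nat_dia_tpair)
  have p: "pf1 (TSrc tpl) a = (t.I, gf a)" "pf1 (TTrg tpl) a = (GI, gf a)" "pf1 (TSrc tpr) a = (gf a, t.I)" "pf1 (TTrg tpr) a = (gf a, GI)"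
    using tid tw by (simp_all add: tpl_def tpr_def tpair_def) (simp_all add: ppair_def tw tid)
  note l = bq.nat_dia_twl[OF t.M.monoidal_psf_axioms D(1) assms] bq.nat_dia_twl[OF t.M.monoidal_psf_axioms D(2) assms]
  have i: "diso P' (nat_dia tpl a)" "diso P' (nat_dia tpr a)" unfolding n by (simp_all add: pairN)
  show "nat_dia (twl M' tpl) a = N3 a" "nat_dia (twl M' tpr) a = N4 a" unfolding N3_def N4_def n[symmetric] using l(1)[OF i(1)] l(6)[OF i(2)] by simp_all
  show "t1 (twl M' tpl) (the_elem (Obj B)) = JU" "t1 (twl M' tpr) (the_elem (Obj B)) = UJ" using l(2)[OF i(1)] l(7)[OF i(2)] t1 by simp_all
  have ts: "TSrc (twl M' tpl) = M' \<circ>\<^sub>p TSrc tpl" "TTrg (twl M' tpl) = M' \<circ>\<^sub>p TTrg tpl" "TSrc (twl M' tpr) = M' \<circ>\<^sub>p TSrc tpr" "TTrg (twl M' tpr) = M' \<circ>\<^sub>p TTrg tpr"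
    using l(3,4)[OF i(1)] l(8,9)[OF i(2)] by simp_all
  show "PDom (TSrc (twl M' tpl)) = B" "PCod (TSrc (twl M' tpl)) = B'" "PDom (TSrc (twl M' tpr)) = B" "PCod (TSrc (twl M' tpr)) = B'"
     "pf1 (TSrc (twl M' tpl)) a = t.al (gf a)" "pf1 (TTrg (twl M' tpl)) a = pf1 M' (GI, gf a)"
     "pf1 (TSrc (twl M' tpr)) a = t.ar (gf a)" "pf1 (TTrg (twl M' tpr)) a = pf1 M' (gf a, GI)"
    unfolding ts using D p by (simp_all add: pcomp_def t.M.PCod_eq t.al_def t.ar_def)
qed

lemma chi_twr: assumes [simp]: "a \<in> Mor B"
  shows "nat_dia (twr (fwd chi) s.JL) a = th s.I a" "t1 (twr (fwd chi) s.JL) (the_elem (Obj B)) = W" "PDom (TSrc (twr (fwd chi) s.JL)) = B"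
     "PCod (TSrc (twr (fwd chi) s.JL)) = B'" "pf1 (TSrc (twr (fwd chi) s.JL)) a = pf1 M' (GI, gf a)" "pf1 (TTrg (twr (fwd chi) s.JL)) a = gf (s.al a)"
    "nat_dia (twr (fwd chi) s.JR) a = th a s.I" "t1 (twr (fwd chi) s.JR) (the_elem (Obj B)) = W" "PDom (TSrc (twr (fwd chi) s.JR)) = B"
     "PCod (TSrc (twr (fwd chi) s.JR)) = B'" "pf1 (TSrc (twr (fwd chi) s.JR)) a = pf1 M' (gf a, GI)" "pf1 (TTrg (twr (fwd chi) s.JR)) a = gf (s.ar a)"
proof -
  have D: "PDom (TSrc (fwd chi)) = B \<times>\<^sub>b B" by (simp add: chi.f.TSrc_eq chi.f.F.PDom_eq)
  note l = bp.nat_dia_twr[OF s.JL_pre D assms] bp.nat_dia_twr[OF s.JR_pre D assms]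
  have PD: "PDom s.JL = B" "PDom s.JR = B" using s.JL_pre s.JR_pre unfolding pre_psf_def pre_psf_axioms_def by auto
  show "nat_dia (twr (fwd chi) s.JL) a = th s.I a" "t1 (twr (fwd chi) s.JL) (the_elem (Obj B)) = W"
    "nat_dia (twr (fwd chi) s.JR) a = th a s.I" "t1 (twr (fwd chi) s.JR) (the_elem (Obj B)) = W"
    unfolding l th_def by (simp_all add: s.J_pf1)
  have c: "PDom (Q \<circ>\<^sub>p H) = PDom H" "PCod (Q \<circ>\<^sub>p H) = PCod Q" "pf1 (Q \<circ>\<^sub>p H) a = pf1 Q (pf1 H a)" 
    for Q :: "('m \<times> 'm, 'n \<times> 'n, 'p \<times> 'p, 'm2, 'n2, 'p2) psf" and H :: "('m, 'n, 'p, 'm \<times> 'm, 'n \<times> 'n, 'p \<times> 'p) psf"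
    by (simp_all add: pcomp_def)
  show "PDom (TSrc (twr (fwd chi) s.JL)) = B" "PCod (TSrc (twr (fwd chi) s.JL)) = B'"
     "pf1 (TSrc (twr (fwd chi) s.JL)) a = pf1 M' (GI, gf a)" "pf1 (TTrg (twr (fwd chi) s.JL)) a = gf (s.al a)"
     "PDom (TSrc (twr (fwd chi) s.JR)) = B"
     "PCod (TSrc (twr (fwd chi) s.JR)) = B'" "pf1 (TSrc (twr (fwd chi) s.JR)) a = pf1 M' (gf a, GI)" "pf1 (TTrg (twr (fwd chi) s.JR)) a = gf (s.ar a)"
    unfolding l chi.f.TSrc_eq chi.f.TTrg_eq c by (simp_all add: PD Csrc_pf1 s.J_pf1 chi.f.F.PCod_eq s.al_def s.ar_def)
qed

text \<open>The modification \<gamma>, unfolded: its component is read as a diagram from three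
  objects to L', and its axiom at a is the stated compatibility.\<close>

lemma gamma_cell: obtains g0 where "diso B' g0" "dsrc g0 = [GL, W, JU]" "dtrg g0 = [t.L]"
  "\<And>a. a \<in> Mor B \<Longrightarrow> wh B' [] (dinv B' (img G (s.lam a))) [W, JU] ;; wh B' [GL] (th s.I a) [JU] ;; wh B' V (N3 a) [] ;; wh B' [] g0 [t.al (gf a)]
      = wh B' [gf a] g0 [] ;; dinv B' (t.lam (gf a))"
proof -
  let ?\<tau> = "twl G (fwd (ddLe T))" and ?\<sigma> = "twr (fwd chi) s.JL" and ?\<rho> = "twl M' tpl"
  let ?src = "?\<tau> \<bullet>\<^sub>t ?\<sigma> \<bullet>\<^sub>t ?\<rho>" and ?trg = "twr (fwd (ddLe T')) G"
  let ?m = "Gam F (pt T) (pt T)"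
  have src: "gam_src T T' F (pt T) (pt T) = ?src"
    by (simp add: gam_src_def ddLe_def s.JL_def ttens_def tpl_def ddTn_def)
  have trg: "gam_trg T T' F (pt T) (pt T) = ?trg"
    by (simp add: gam_trg_def ddLe_def)
  have m: "invertible_modification ?src ?trg ?m"
    using Gam_modification[OF s.pt_T0 s.pt_T0] unfolding src trg .
  have DL: "PDom (TSrc (fwd (ddLe T))) = B" "PDom (TSrc (fwd (ddLe T'))) = B'"
    by (simp_all add: s.l.f.TSrc_eq t.l.f.TSrc_eq)
  have T: "nat_dia ?\<tau> a = dinv B' (img G (s.lam a))" "t1 ?\<tau> (the_elem (Obj B)) = GL" "PDom (TSrc ?\<tau>) = B" "PCod (TSrc ?\<tau>) = B'"
      "pf1 (TSrc ?\<tau>) a = gf (s.al a)" "pf1 (TTrg ?\<tau>) a = gf a" if a [simp]: "a \<in> Mor B" for a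
  proof -
    have i: "diso B (nat_dia (fwd (ddLe T)) a)" using s.n_typ(1)[OF a] by blast
    note l = s.l.nat_dia_twl[OF G.monoidal_psf_axioms DL(1) a i]
    have "nat_dia (fwd (ddLe T)) a = dinv B (s.lam a)" using i by (simp add: s.lam_def)
    then show "nat_dia ?\<tau> a = dinv B' (img G (s.lam a))" "t1 ?\<tau> (the_elem (Obj B)) = GL" using l by simp_all
    show "PDom (TSrc ?\<tau>) = B" "PCod (TSrc ?\<tau>) = B'" "pf1 (TSrc ?\<tau>) a = gf (s.al a)" "pf1 (TTrg ?\<tau>) a = gf a"
      unfolding l by (simp_all add: pcomp_def s.l.f.TSrc_eq s.l.f.TTrg_eq)
  qed
  have R: "nat_dia ?trg a = dinv B' (t.lam (gf a))" "t1 ?trg (the_elem (Obj B)) = t.L" "PDom (TSrc ?trg) = B" 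
      "pf1 (TSrc ?trg) a = t.al (gf a)" "pf1 (TTrg ?trg) a = gf a" if a [simp]: "a \<in> Mor B" for a
  proof -
    have i: "diso B' (nat_dia (fwd (ddLe T')) (gf a))" using t.n_typ(1)[of "gf a"] by simp
    note l = bc.nat_dia_twr[OF G.pre_psf_axioms DL(2) a]
    show "nat_dia ?trg a = dinv B' (t.lam (gf a))" "t1 ?trg (the_elem (Obj B)) = t.L" using l i by (simp_all add: t.lam_def)
    show "PDom (TSrc ?trg) = B" "pf1 (TSrc ?trg) a = t.al (gf a)" "pf1 (TTrg ?trg) a = gf a"
      unfolding l by (simp_all add: pcomp_def t.l.f.TSrc_eq t.l.f.TTrg_eq)
  qed
  have nU [simp]: "mon_unit B \<in> Mor B" by simp
  have c3: "nat_dia ?src a = dinv B' (wh B' [gf a] (wh B' [GL] (dfold B' [W, JU]) [] ;; dfold B' [GL, W \<odot> JU]) [])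
      ;; wh B' [] (dinv B' (img G (s.lam a))) [W, JU] ;; wh B' [GL] (th s.I a) [JU] ;; wh B' [GL, W] (N3 a) [] ;; wh B' [] (wh B' [GL] (dfold B' [W, JU]) [] ;; dfold B' [GL, W \<odot> JU]) [t.al (gf a)]"
     and c3': "diso B' (nat_dia ?src a)" "t1 ?src (the_elem (Obj B)) = GL \<odot> W \<odot> JU"
       "PDom (TSrc ?src) = B" "PCod (TSrc ?src) = B'" "pf1 (TSrc ?src) a = t.al (gf a)" "pf1 (TTrg ?src) a = gf a" if a [simp]: "a \<in> Mor B" for a
  proof -
    note A = ttens_components[OF a] chi_twr[OF a] T[OF a]
    note tc = bc.nat_dia_tcomp3[of ?\<rho> ?\<sigma> a ?\<tau>]
    show "nat_dia ?src a = dinv B' (wh B' [gf a] (wh B' [GL] (dfold B' [W, JU]) [] ;; dfold B' [GL, W \<odot> JU]) [])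
      ;; wh B' [] (dinv B' (img G (s.lam a))) [W, JU] ;; wh B' [GL] (th s.I a) [JU] ;; wh B' [GL, W] (N3 a) [] ;; wh B' [] (wh B' [GL] (dfold B' [W, JU]) [] ;; dfold B' [GL, W \<odot> JU]) [t.al (gf a)]"
      using tc(1) by (simp add: A)
    show "diso B' (nat_dia ?src a)" "t1 ?src (the_elem (Obj B)) = GL \<odot> W \<odot> JU" using tc(2,3) by (simp_all add: A)
    show "PDom (TSrc ?src) = B" "PCod (TSrc ?src) = B'" "pf1 (TSrc ?src) a = t.al (gf a)" "pf1 (TTrg ?src) a = gf a"
      using tc(7,8) by (simp_all add: A)
  qed
  \<comment> \<open>The bracketing of the composite object in the source of \<gamma>.\<close>
  let ?ph = "wh B' [GL] (dfold B' [W, JU]) [] ;; dfold B' [GL, W \<odot> JU]"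
  have [simp]: "diso B' ?ph" "dsrc ?ph = [GL, W, JU]" "dtrg ?ph = [GL \<odot> W \<odot> JU]" by (simp_all add: t.pth_Cons)
  define mg where "mg = Dia [GL \<odot> W \<odot> JU] (?m (the_elem (Obj B))) [t.L]"
  have mg [simp]: "diso B' mg" "dsrc mg = [GL \<odot> W \<odot> JU]" "dtrg mg = [t.L]"
    using bc.modification_iso[OF m] c3'(2-4)[OF nU] R(2)[OF nU] by (simp_all add: mg_def)
  show thesis
  proof (rule that[of "?ph ;; mg"])
    show "diso B' (?ph ;; mg)" "dsrc (?ph ;; mg) = [GL, W, JU]" "dtrg (?ph ;; mg) = [t.L]" by (simp_all add: t.pth_Cons)
    fix a assume a [simp]: "a \<in> Mor B"
    have "nat_dia ?src a ;; wh B' [] mg [t.al (gf a)] = wh B' [gf a] mg [] ;; dinv B' (t.lam (gf a))"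
      using bc.nat_dia_modification[OF m, of a] c3'[OF a] R[OF a] by (simp add: mg_def)
    then have "(wh B' [] (dinv B' (img G (s.lam a))) [W, JU] ;; wh B' [GL] (th s.I a) [JU] ;; wh B' V (N3 a) []) ;; wh B' [] (?ph ;; mg) [t.al (gf a)]
      = wh B' [gf a] (?ph ;; mg) [] ;; dinv B' (t.lam (gf a))"
      using c3[OF a] by (intro t.modification_unfold[where N = "nat_dia ?src a"]) (simp_all add: s.al_def t.al_def t.pth_Cons)
    then show "wh B' [] (dinv B' (img G (s.lam a))) [W, JU] ;; wh B' [GL] (th s.I a) [JU] ;; wh B' V (N3 a) [] ;; wh B' [] (?ph ;; mg) [t.al (gf a)]
      = wh B' [gf a] (?ph ;; mg) [] ;; dinv B' (t.lam (gf a))"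
      by (simp only: t.seq_assoc)
  qed
qed

end

text \<open>From \<open>counit_nat\<close>: next to the counit, the cell P of r can be exchanged for
  the naturality cell of the right adjoint.\<close>

lemma (in dd_tricategory) P_counit: assumes [simp]: "a \<in> Mor B"
  shows "wh B [] (P a) [Rd] ;; wh B [a] r.eps [] = wh B [R] (nat_dia (bwd (ddRi T)) a) [] ;; wh B [] r.eps [a]"
    and "diso B (nat_dia (bwd (ddRi T)) a)" "dsrc (nat_dia (bwd (ddRi T)) a) = [ar a, Rd]" "dtrg (nat_dia (bwd (ddRi T)) a) = [Rd, a]"
proof -
  have b: "r.b.n a = nat_dia (bwd (ddRi T)) a" by (rule r.b.natR_eq[symmetric]) simp
  show i [simp]: "diso B (nat_dia (bwd (ddRi T)) a)" unfolding b[symmetric] by (rule r.b.iso_n) simp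
  show [simp]: "dsrc (nat_dia (bwd (ddRi T)) a) = [ar a, Rd]" "dtrg (nat_dia (bwd (ddRi T)) a) = [Rd, a]" unfolding b[symmetric] by simp_all
  have f: "r.f.n a = dinv B (P a)" using r.f.natR_eq[of a] n_typ(2)[of a] by (simp add: P_def)
  have "wh B [] (dinv B (P a)) [Rd] ;; wh B [R] (nat_dia (bwd (ddRi T)) a) [] ;; wh B [] r.eps [a] = wh B [a] r.eps []"
    using r.counit_nat[OF assms] unfolding f b by simp
  then have "wh B [] (P a) [Rd] ;; wh B [a] r.eps [] = wh B [] (P a) [Rd] ;; wh B [] (dinv B (P a)) [Rd] ;; wh B [R] (nat_dia (bwd (ddRi T)) a) [] ;; wh B [] r.eps [a]" by simp
  then show "wh B [] (P a) [Rd] ;; wh B [a] r.eps [] = wh B [R] (nat_dia (bwd (ddRi T)) a) [] ;; wh B [] r.eps [a]"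
    by (simp add: inv_wh[symmetric])
qed

section \<open>Comparison of V with L' through \<gamma> and the mate of \<delta>\<close>

context dd_functor begin

lemma box_fold: "pf1 M' (t.I, c) = t.al c" "pf1 M' (c, t.I) = t.ar c" "pf1 (ddTn T) (s.I, a) = s.al a" "pf1 (ddTn T) (a, s.I) = s.ar a"
  by (simp_all add: t.al_def t.ar_def s.al_def s.ar_def)

abbreviation GRd where "GRd \<equiv> gf s.Rd"
abbreviation Ss where "Ss a \<equiv> nat_dia (bwd (ddRi T)) a"
abbreviation St where "St a \<equiv> nat_dia (bwd (ddRi T')) a"

text \<open>The modification \<delta>, unfolded. Its composite side is the target, so the bracketing
  has to be removed after its component.\<close>

lemma delta_cell: obtains m0 where "diso B' m0" "dsrc m0 = [GRd]" "dtrg m0 = [W, UJ, t.Rd]"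
  "\<And>a. a \<in> Mor B \<Longrightarrow> img G (Ss a) ;; wh B' [] m0 [gf a]
      = wh B' [gf (s.ar a)] m0 [] ;; wh B' [] (th a s.I) [UJ, t.Rd] ;; wh B' [W] (N4 a) [t.Rd] ;; wh B' [W, UJ] (St (gf a)) []"
proof -
  let ?src = "twl G (bwd (ddRi T))" and ?\<tau> = "twr (fwd chi) s.JR" and ?\<sigma> = "twl M' tpr" and ?\<rho> = "twr (bwd (ddRi T')) G"
  let ?trg = "?\<tau> \<bullet>\<^sub>t ?\<sigma> \<bullet>\<^sub>t ?\<rho>"
  let ?m = "Del F (pt T) (pt T)"
  have src: "del_src T T' F (pt T) (pt T) = ?src"
    by (simp add: del_src_def ddRi_def)
  have trg: "del_trg T T' F (pt T) (pt T) = ?trg"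
    by (simp add: del_trg_def ddRi_def s.JR_def ttens_def tpr_def ddTn_def)
  have m: "invertible_modification ?src ?trg ?m"
    using Del_modification[OF s.pt_T0 s.pt_T0] unfolding src trg .
  have DL: "PDom (TSrc (bwd (ddRi T))) = B" "PDom (TSrc (bwd (ddRi T'))) = B'"
    by (simp_all add: s.r.b.TSrc_eq t.r.b.TSrc_eq s.id.PDom_eq t.id.PDom_eq)
  have T: "nat_dia ?src a = img G (Ss a)" "t1 ?src (the_elem (Obj B)) = GRd" "PDom (TSrc ?src) = B" "PCod (TSrc ?src) = B'"
      "pf1 (TSrc ?src) a = gf a" "pf1 (TTrg ?src) a = gf (s.ar a)" if a [simp]: "a \<in> Mor B" for a
  proof -
    note l = s.l.nat_dia_twl[OF G.monoidal_psf_axioms DL(1) a s.P_counit(2)[OF a]]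
    show "nat_dia ?src a = img G (Ss a)" "t1 ?src (the_elem (Obj B)) = GRd" using l by simp_all
    show "PDom (TSrc ?src) = B" "PCod (TSrc ?src) = B'" "pf1 (TSrc ?src) a = gf a" "pf1 (TTrg ?src) a = gf (s.ar a)"
      unfolding l by (simp_all add: pcomp_def s.r.b.TSrc_eq s.r.b.TTrg_eq s.id.PDom_eq)
  qed
  have R: "nat_dia ?\<rho> a = St (gf a)" "t1 ?\<rho> (the_elem (Obj B)) = t.Rd" "PDom (TSrc ?\<rho>) = B" "PCod (TSrc ?\<rho>) = B'"
      "pf1 (TSrc ?\<rho>) a = gf a" "pf1 (TTrg ?\<rho>) a = t.ar (gf a)" if a [simp]: "a \<in> Mor B" for a
  proof -
    note l = bc.nat_dia_twr[OF G.pre_psf_axioms DL(2) a]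
    show "nat_dia ?\<rho> a = St (gf a)" "t1 ?\<rho> (the_elem (Obj B)) = t.Rd" using l by simp_all
    show "PDom (TSrc ?\<rho>) = B" "PCod (TSrc ?\<rho>) = B'" "pf1 (TSrc ?\<rho>) a = gf a" "pf1 (TTrg ?\<rho>) a = t.ar (gf a)"
      unfolding l by (simp_all add: pcomp_def t.r.b.TSrc_eq t.r.b.TTrg_eq t.id.PCod_eq)
  qed
  have nU [simp]: "mon_unit B \<in> Mor B" by simp
  let ?ph = "wh B' [W] (dfold B' [UJ, t.Rd]) [] ;; dfold B' [W, UJ \<odot> t.Rd]"
  let ?X = "\<lambda>a. wh B' [] (th a s.I) [UJ, t.Rd] ;; wh B' [W] (N4 a) [t.Rd] ;; wh B' [W, UJ] (St (gf a)) []"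
  have c3: "nat_dia ?trg a = dinv B' (wh B' [gf (s.ar a)] ?ph []) ;; ?X a ;; wh B' [] ?ph [gf a]"
     and c3': "diso B' (nat_dia ?trg a)" "t1 ?trg (the_elem (Obj B)) = W \<odot> UJ \<odot> t.Rd"
       "PDom (TSrc ?trg) = B" "PCod (TSrc ?trg) = B'" "pf1 (TSrc ?trg) a = gf a" "pf1 (TTrg ?trg) a = gf (s.ar a)" if a [simp]: "a \<in> Mor B" for a
  proof -
    note A = ttens_components[OF a] chi_twr[OF a] R[OF a] t.P_counit(2)[of "gf a"]
    note tc = bc.nat_dia_tcomp3[of ?\<rho> ?\<sigma> a ?\<tau>]
    show "nat_dia ?trg a = dinv B' (wh B' [gf (s.ar a)] ?ph []) ;; ?X a ;; wh B' [] ?ph [gf a]"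
      using tc(1) by (simp add: A)
    show "diso B' (nat_dia ?trg a)" "t1 ?trg (the_elem (Obj B)) = W \<odot> UJ \<odot> t.Rd" using tc(2,3) by (simp_all add: A)
    show "PDom (TSrc ?trg) = B" "PCod (TSrc ?trg) = B'" "pf1 (TSrc ?trg) a = gf a" "pf1 (TTrg ?trg) a = gf (s.ar a)"
      using tc(7,8) by (simp_all add: A)
  qed
  have ph [simp]: "diso B' ?ph" "dsrc ?ph = [W, UJ, t.Rd]" "dtrg ?ph = [W \<odot> UJ \<odot> t.Rd]" by (simp_all add: t.pth_Cons)
  define md where "md = Dia [GRd] (?m (the_elem (Obj B))) [W \<odot> UJ \<odot> t.Rd]"
  have md [simp]: "diso B' md" "dsrc md = [GRd]" "dtrg md = [W \<odot> UJ \<odot> t.Rd]"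
    using bc.modification_iso[OF m] T(2-4)[OF nU] c3'(2)[OF nU] by (simp_all add: md_def)
  define m0 where "m0 = md ;; dinv B' ?ph"
  have m0 [simp]: "diso B' m0" "dsrc m0 = [GRd]" "dtrg m0 = [W, UJ, t.Rd]" unfolding m0_def by (simp_all only: t.iso_seq t.iso_inv md ph t.dsrc_inv t.dtrg_inv t.dsrc_seq t.dtrg_seq t.iso_valid)
  show thesis
  proof (rule that[OF m0])
    fix a assume a [simp]: "a \<in> Mor B"
    note [simp] = t.P_counit(2-4)
    have ra: "pf1 M' (gf a, t.I) = t.ar (gf a)" "gf (pf1 (ddTn T) (a, s.I)) = gf (s.ar a)" by (simp_all add: t.ar_def s.ar_def)
    have X: "valid B' (?X a)" "dsrc (?X a) = [gf (s.ar a), W, UJ, t.Rd]" "dtrg (?X a) = [W, UJ, t.Rd, gf a]"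
      by (simp_all add: ra)
    have "img G (Ss a) ;; wh B' [] md [gf a] = wh B' [gf (s.ar a)] md [] ;; nat_dia ?trg a"
      using bc.nat_dia_modification[OF m, of a] T[OF a] c3'[OF a] s.P_counit(2)[OF a] by (simp add: md_def)
    then have "(img G (Ss a) ;; wh B' [] md [gf a]) ;; wh B' [] (dinv B' ?ph) [gf a]
        = wh B' [gf (s.ar a)] md [] ;; dinv B' (wh B' [gf (s.ar a)] ?ph []) ;; ?X a ;; (wh B' [] ?ph [gf a] ;; wh B' [] (dinv B' ?ph) [gf a])"
      unfolding c3[OF a] by (simp only: t.seq_assoc)
    also have "wh B' [] ?ph [gf a] ;; wh B' [] (dinv B' ?ph) [gf a] = idd B' [W, UJ, t.Rd, gf a]"
      using t.wh_seq[of "[]" ?ph "dinv B' ?ph" "[gf a]", symmetric] t.seq_inv[OF ph(1)] ph(2) by simp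
    also have "dinv B' (wh B' [gf (s.ar a)] ?ph []) = wh B' [gf (s.ar a)] (dinv B' ?ph) []"
      by (rule t.inv_wh) (simp_all only: ph, simp_all)
    finally have "img G (Ss a) ;; wh B' [] m0 [gf a] = wh B' [gf (s.ar a)] m0 [] ;; (?X a ;; idd B' [W, UJ, t.Rd, gf a])"
      unfolding m0_def t.wh_seq[of _ md] by (simp only: t.seq_assoc)
    also have "?X a ;; idd B' [W, UJ, t.Rd, gf a] = ?X a" by (rule t.seq_idd_right[OF X(1,3)])
    finally show "img G (Ss a) ;; wh B' [] m0 [gf a] = wh B' [gf (s.ar a)] m0 [] ;; ?X a" .
  qed
qed

text \<open>The isomorphism is that from \<gamma>, preceded by the replacement of I' by U' beside J;
  this replacement turns the naturality cell of \<iota> into an interchange (\<open>N3_x\<close>),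
  as required by \<open>transfer_left\<close>.\<close>

lemma left_transfer: obtains g where "diso B' g" "dsrc g = V @ [t.ar J]" "dtrg g = [t.L]"
  "\<And>a. a \<in> Mor B \<Longrightarrow> wh B' V (t.x (gf a) J) [] ;; wh B' [] g [t.al (gf a)] ;; t.lam (gf a) = wh B' [] (v a) [t.ar J] ;; wh B' [gf a] g []"
proof -
  obtain g0 where g0 [simp]: "diso B' g0" "dsrc g0 = [GL, W, JU]" "dtrg g0 = [t.L]"
    and G0: "\<And>a. a \<in> Mor B \<Longrightarrow> wh B' [] (dinv B' (img G (s.lam a))) [W, JU] ;; wh B' [GL] (th s.I a) [JU] ;; wh B' V (N3 a) [] ;; wh B' [] g0 [t.al (gf a)]
      = wh B' [gf a] g0 [] ;; dinv B' (t.lam (gf a))" using gamma_cell by blast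
  let ?Q = "img M' (QR J)"
  note [simp] = box_fold
  show thesis
  proof (rule that[of "wh B' V ?Q [] ;; g0"])
    show "diso B' (wh B' V ?Q [] ;; g0)" "dsrc (wh B' V ?Q [] ;; g0) = V @ [t.ar J]" "dtrg (wh B' V ?Q [] ;; g0) = [t.L]" by simp_all
    fix a assume a [simp]: "a \<in> Mor B"
    let ?a = "gf a" and ?H = "img M' (PL (gf a))" and ?m = "pf1 M' (GI, gf a)"
    have g: "wh B' [?a] g0 [] = wh B' [] (dinv B' (img G (s.lam a))) [W, JU] ;; wh B' [GL] (th s.I a) [JU] ;; wh B' V (N3 a) [] ;; wh B' [] g0 [t.al ?a] ;; t.lam ?a"
      using t.seq_cong_right[OF G0[OF a], of "t.lam ?a"] by simp
    have 1: "wh B' [] (img G (s.lam a)) [W, t.ar J] ;; wh B' [?a, GL, W] ?Q [] = wh B' [GL, gf (s.al a), W] ?Q [] ;; wh B' [] (img G (s.lam a)) [W, JU]"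
      using t.exchange[of "img G (s.lam a)" ?Q "[]" "[W]" "[]"] by simp
    have 2: "wh B' [GL] (dinv B' (th s.I a)) [t.ar J] ;; wh B' [GL, gf (s.al a), W] ?Q [] = wh B' [GL, W, ?m] ?Q [] ;; wh B' [GL] (dinv B' (th s.I a)) [JU]"
      using t.exchange[of "dinv B' (th s.I a)" ?Q "[GL]" "[]" "[]"] by simp
    have 3: "wh B' V ?H [t.ar J] ;; wh B' [GL, W, ?m] ?Q [] ;; wh B' V (N3 a) [] = wh B' V (t.x ?a J) [] ;; wh B' V ?Q [t.al ?a]"
      using t.wh_cong[OF N3_x[OF a], of V "[]"] by (simp add: t.wh_seq)
    have "wh B' [] (v a) [t.ar J] ;; wh B' [?a] (wh B' V ?Q [] ;; g0) []
       = wh B' V ?H [t.ar J] ;; wh B' [GL] (dinv B' (th s.I a)) [t.ar J] ;; wh B' [] (img G (s.lam a)) [W, t.ar J] ;; wh B' [?a, GL, W] ?Q [] ;; wh B' [?a] g0 []"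
      unfolding v_def by (simp add: t.wh_seq)
    also have "\<dots> = wh B' V ?H [t.ar J] ;; wh B' [GL, W, ?m] ?Q [] ;; wh B' [GL] (dinv B' (th s.I a)) [JU] ;; wh B' [] (img G (s.lam a)) [W, JU] ;; wh B' [?a] g0 []"
      by (simp only: t.seq_rewrite2[OF 1] t.seq_rewrite2[OF 2] t.seq_assoc)
    also have "\<dots> = wh B' V ?H [t.ar J] ;; wh B' [GL, W, ?m] ?Q [] ;; wh B' V (N3 a) [] ;; wh B' [] g0 [t.al ?a] ;; t.lam ?a"
      unfolding g by (simp add: t.inv_wh[symmetric])
    also have "\<dots> = wh B' V (t.x ?a J) [] ;; wh B' V ?Q [t.al ?a] ;; wh B' [] g0 [t.al ?a] ;; t.lam ?a"
      by (simp only: t.seq_rewrite3[OF 3] t.seq_assoc)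
    also have "\<dots> = wh B' V (t.x ?a J) [] ;; wh B' [] (wh B' V ?Q [] ;; g0) [t.al ?a] ;; t.lam ?a"
      by (simp add: t.wh_seq)
    finally show "wh B' V (t.x ?a J) [] ;; wh B' [] (wh B' V ?Q [] ;; g0) [t.al ?a] ;; t.lam ?a = wh B' [] (v a) [t.ar J] ;; wh B' [?a] (wh B' V ?Q [] ;; g0) []" by simp
  qed
qed

text \<open>Since \<delta> concerns right adjoints, its mate is formed. The claim is proved after
  whiskering with the dual of R' and applying the counit, where \<open>P_counit\<close> leads back
  to the naturality cells occurring in \<delta>.\<close>

lemma right_transfer0: obtains d where "diso B' d" "dsrc d = [GR, W, UJ]" "dtrg d = [t.R]"
  "\<And>b. b \<in> Mor B \<Longrightarrow> wh B' [] d [t.ar (gf b)] ;; t.P (gf b)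
     = wh B' [GR, W] (dinv B' (N4 b)) [] ;; wh B' [GR] (dinv B' (th b s.I)) [UJ] ;; wh B' [] (img G (s.P b)) [W, UJ] ;; wh B' [gf b] d []"
proof -
  obtain m0 where m0 [simp]: "diso B' m0" "dsrc m0 = [GRd]" "dtrg m0 = [W, UJ, t.Rd]"
    and D0: "\<And>a. a \<in> Mor B \<Longrightarrow> img G (Ss a) ;; wh B' [] m0 [gf a]
      = wh B' [gf (s.ar a)] m0 [] ;; wh B' [] (th a s.I) [UJ, t.Rd] ;; wh B' [W] (N4 a) [t.Rd] ;; wh B' [W, UJ] (St (gf a)) []"
    using delta_cell by blast
  note [simp] = s.P_counit(2-4) t.P_counit(2-4)
  define ge where "ge = img G s.r.eps"
  have ge [simp]: "diso B' ge" "dsrc ge = [GR, GRd]" "dtrg ge = []" unfolding ge_def by simp_all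
  \<comment> \<open>The mate of \<delta>: create the dual of R' together with R', apply the inverse
    of \<delta>, and cancel F R against the image of its dual.\<close>
  define d where "d = wh B' [GR, W, UJ] t.r.eta [] ;; wh B' [GR] (dinv B' m0) [t.R] ;; wh B' [] ge [t.R]"
  have d [simp]: "diso B' d" "dsrc d = [GR, W, UJ]" "dtrg d = [t.R]" unfolding d_def by simp_all
  \<comment> \<open>Transposing d back; the zigzag at the dual of R' straightens out.\<close>
  have dd: "wh B' [] d [t.Rd] ;; t.r.eps = wh B' [GR] (dinv B' m0) [] ;; ge"
  proof -
    have 1: "wh B' [] ge [t.R, t.Rd] ;; t.r.eps = wh B' [GR, GRd] t.r.eps [] ;; ge"
      using t.exchange[of ge t.r.eps "[]" "[]" "[]"] by simp
    have 2: "wh B' [GR] (dinv B' m0) [t.R, t.Rd] ;; wh B' [GR, GRd] t.r.eps [] = wh B' [GR, W, UJ, t.Rd] t.r.eps [] ;; wh B' [GR] (dinv B' m0) []"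
      using t.exchange[of "dinv B' m0" t.r.eps "[GR]" "[]" "[]"] by simp
    have 3: "wh B' [GR, W, UJ] t.r.eta [t.Rd] ;; wh B' [GR, W, UJ, t.Rd] t.r.eps [] = idd B' [GR, W, UJ, t.Rd]"
      using t.wh_cong[OF t.r.triangle2, of "[GR, W, UJ]" "[]"] by (simp add: t.wh_seq)
    have "wh B' [] d [t.Rd] ;; t.r.eps = wh B' [GR, W, UJ] t.r.eta [t.Rd] ;; wh B' [GR] (dinv B' m0) [t.R, t.Rd] ;; wh B' [] ge [t.R, t.Rd] ;; t.r.eps"
      unfolding d_def by (simp add: t.wh_seq)
    also have "\<dots> = idd B' [GR, W, UJ, t.Rd] ;; wh B' [GR] (dinv B' m0) [] ;; ge"
      by (simp only: 1 t.seq_rewrite2[OF 2] t.seq_rewrite2[OF 3] t.seq_assoc)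
    also have "\<dots> = wh B' [GR] (dinv B' m0) [] ;; ge" by simp
    finally show ?thesis .
  qed
  show thesis
  proof (rule that[OF d])
    fix b assume b [simp]: "b \<in> Mor B"
    let ?b = "gf b" and ?P = "img G (s.P b)" and ?S = "img G (Ss b)" and ?r = "gf (s.ar b)" and ?m = "pf1 M' (gf b, GI)"
    note [simp] = box_fold
    let ?Z = "wh B' [GR, W] (dinv B' (N4 b)) [] ;; wh B' [GR] (dinv B' (th b s.I)) [UJ] ;; wh B' [] ?P [W, UJ]"
    have SG: "wh B' [] ?P [GRd] ;; wh B' [?b] ge [] = wh B' [GR] ?S [] ;; wh B' [] ge [?b]"
    proof -
      have "img G (wh B [] (s.P b) [s.Rd] ;;\<^bsub>B\<^esub> wh B [b] s.r.eps []) = img G (wh B [s.R] (Ss b) [] ;;\<^bsub>B\<^esub> wh B [] s.r.eps [b])"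
        by (simp only: s.P_counit(1)[OF b])
      then show ?thesis unfolding ge_def by simp
    qed
    have "?S = (?S ;; wh B' [] m0 [?b]) ;; wh B' [] (dinv B' m0) [?b]"
      by (simp add: t.inv_wh[symmetric])
    then have S: "?S = wh B' [?r] m0 [] ;; wh B' [] (th b s.I) [UJ, t.Rd] ;; wh B' [W] (N4 b) [t.Rd] ;; wh B' [W, UJ] (St ?b) [] ;; wh B' [] (dinv B' m0) [?b]"
      unfolding D0[OF b] by simp
    have S2: "wh B' [W] (dinv B' (N4 b)) [t.Rd] ;; wh B' [] (dinv B' (th b s.I)) [UJ, t.Rd] ;; wh B' [?r] (dinv B' m0) [] ;; ?S
        = wh B' [W, UJ] (St ?b) [] ;; wh B' [] (dinv B' m0) [?b]"
      unfolding S by (simp add: t.inv_wh[symmetric])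
    have S3: "wh B' [GR, W] (dinv B' (N4 b)) [t.Rd] ;; wh B' [GR] (dinv B' (th b s.I)) [UJ, t.Rd] ;; wh B' [GR, ?r] (dinv B' m0) [] ;; wh B' [GR] ?S []
        = wh B' [GR, W, UJ] (St ?b) [] ;; wh B' [GR] (dinv B' m0) [?b]"
      using t.wh_cong[OF S2, of "[GR]" "[]"] by (simp add: t.wh_seq)
    have dd': "wh B' [] d [t.Rd, ?b] ;; wh B' [] t.r.eps [?b] = wh B' [GR] (dinv B' m0) [?b] ;; wh B' [] ge [?b]"
      using t.wh_cong[OF dd, of "[]" "[?b]"] by (simp add: t.wh_seq)
    have dd'': "wh B' [?b] d [t.Rd] ;; wh B' [?b] t.r.eps [] = wh B' [?b, GR] (dinv B' m0) [] ;; wh B' [?b] ge []"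
      using t.wh_cong[OF dd, of "[?b]" "[]"] by (simp add: t.wh_seq)
    have 1: "wh B' [] d [t.ar ?b, t.Rd] ;; wh B' [t.R] (St ?b) [] = wh B' [GR, W, UJ] (St ?b) [] ;; wh B' [] d [t.Rd, ?b]"
      using t.exchange[of d "St ?b" "[]" "[]" "[]"] by simp
    have 2: "wh B' [] ?P [W, UJ, t.Rd] ;; wh B' [?b, GR] (dinv B' m0) [] = wh B' [GR, ?r] (dinv B' m0) [] ;; wh B' [] ?P [GRd]"
      using t.exchange[of ?P "dinv B' m0" "[]" "[]" "[]"] by simp
    have "wh B' [] (wh B' [] d [t.ar ?b] ;; t.P ?b) [t.Rd] ;; wh B' [?b] t.r.eps []
       = wh B' [] d [t.ar ?b, t.Rd] ;; (wh B' [] (t.P ?b) [t.Rd] ;; wh B' [?b] t.r.eps [])"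
      by (simp add: t.wh_seq)
    also have "\<dots> = wh B' [] d [t.ar ?b, t.Rd] ;; wh B' [t.R] (St ?b) [] ;; wh B' [] t.r.eps [?b]"
      by (subst t.P_counit(1)) simp_all
    also have "\<dots> = wh B' [GR, W, UJ] (St ?b) [] ;; wh B' [GR] (dinv B' m0) [?b] ;; wh B' [] ge [?b]"
      by (simp only: t.seq_rewrite2[OF 1] dd' t.seq_assoc)
    also have "\<dots> = wh B' [GR, W] (dinv B' (N4 b)) [t.Rd] ;; wh B' [GR] (dinv B' (th b s.I)) [UJ, t.Rd] ;; wh B' [GR, ?r] (dinv B' m0) [] ;; wh B' [GR] ?S [] ;; wh B' [] ge [?b]"
      using t.seq_cong_right[OF S3, of "wh B' [] ge [?b]"] by simp
    also have "\<dots> = wh B' [GR, W] (dinv B' (N4 b)) [t.Rd] ;; wh B' [GR] (dinv B' (th b s.I)) [UJ, t.Rd] ;; wh B' [] ?P [W, UJ, t.Rd] ;; wh B' [?b] d [t.Rd] ;; wh B' [?b] t.r.eps []"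
      by (simp only: dd'' t.seq_rewrite2[OF 2] SG t.seq_assoc)
    also have "\<dots> = wh B' [] (?Z ;; wh B' [?b] d []) [t.Rd] ;; wh B' [?b] t.r.eps []"
      by (simp add: t.wh_seq)
    finally have "wh B' [] (wh B' [] d [t.ar ?b] ;; t.P ?b) [t.Rd] = wh B' [] (?Z ;; wh B' [?b] d []) [t.Rd]"
      by - (rule t.iso_cancel_post[of "wh B' [?b] t.r.eps []"]; simp)
    then have "wh B' [] d [t.ar ?b] ;; t.P ?b = ?Z ;; wh B' [?b] d []"
      by - (rule t.dual_pair_faithful[OF t.r.dual_W']; simp)
    then show "wh B' [] d [t.ar ?b] ;; t.P ?b = wh B' [GR, W] (dinv B' (N4 b)) [] ;; wh B' [GR] (dinv B' (th b s.I)) [UJ] ;; wh B' [] ?P [W, UJ] ;; wh B' [?b] d []"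
      by simp
  qed
qed

text \<open>Adapts the mate of \<delta> to V and L': R is exchanged for L by F applied to R \<cong>
  L and by R' \<cong> L', and U' for I' beside J, where \<open>N4_x\<close> produces the
  interchange.\<close>

lemma right_transfer: obtains d where "diso B' d" "dsrc d = V @ [t.al J]" "dtrg d = [t.L]"
  "\<And>b. b \<in> Mor B \<Longrightarrow> wh B' [] d [t.ar (gf b)] ;; t.p (gf b) = wh B' V (t.x J (gf b)) [] ;; wh B' [] (q b) [t.al J] ;; wh B' [gf b] d []"
proof -
  obtain d0 where d0 [simp]: "diso B' d0" "dsrc d0 = [GR, W, UJ]" "dtrg d0 = [t.R]"
   and D: "\<And>b. b \<in> Mor B \<Longrightarrow> wh B' [] d0 [t.ar (gf b)] ;; t.P (gf b)
     = wh B' [GR, W] (dinv B' (N4 b)) [] ;; wh B' [GR] (dinv B' (th b s.I)) [UJ] ;; wh B' [] (img G (s.P b)) [W, UJ] ;; wh B' [gf b] d0 []"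
    using right_transfer0 by blast
  define gk where "gk = img G s.kap"
  have gk [simp]: "diso B' gk" "dsrc gk = [GR]" "dtrg gk = [GL]" unfolding gk_def by simp_all
  let ?Q = "img M' (QL J)"
  note [simp] = box_fold
  let ?d = "wh B' [] (dinv B' gk) [W, t.al J] ;; wh B' [GR, W] ?Q [] ;; d0 ;; t.kap"
  show thesis
  proof (rule that[of ?d])
    show "diso B' ?d" "dsrc ?d = V @ [t.al J]" "dtrg ?d = [t.L]" by simp_all
    fix b assume b [simp]: "b \<in> Mor B"
    let ?b = "gf b" and ?P = "img G (s.P b)" and ?r = "gf (s.ar b)" and ?m = "pf1 M' (gf b, GI)" and ?H = "img M' (PR (gf b))"
    let ?t = "dinv B' (th b s.I)" and ?x = "t.x J (gf b)"
    have xN: "?x ;; wh B' [] ?H [t.al J] ;; wh B' [?m] ?Q [] = wh B' [] ?Q [t.ar ?b] ;; dinv B' (N4 b)"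
      using t.seq_cong_right[OF N4_x[OF b], of "dinv B' (N4 b)"] by simp
    have xN': "wh B' [GR, W] ?x [] ;; wh B' [GR, W] ?H [t.al J] ;; wh B' [GR, W, ?m] ?Q [] = wh B' [GR, W] ?Q [t.ar ?b] ;; wh B' [GR, W] (dinv B' (N4 b)) []"
      using t.wh_cong[OF xN, of "[GR, W]" "[]"] by (simp add: t.wh_seq)
    have "img G (s.p b) = wh B' [] (dinv B' gk) [?r] ;; ?P ;; wh B' [?b] gk []"
      unfolding s.p_def gk_def by simp
    then have p: "wh B' [] (img G (s.p b)) [W, t.al J] = wh B' [] (dinv B' gk) [?r, W, t.al J] ;; wh B' [] ?P [W, t.al J] ;; wh B' [?b] gk [W, t.al J]"
      by (simp add: t.wh_seq)
    have lhs: "wh B' [] ?d [t.ar ?b] ;; t.p ?b = wh B' [] (dinv B' gk) [W, t.al J, t.ar ?b] ;; wh B' [GR, W] ?Q [t.ar ?b] ;; wh B' [] d0 [t.ar ?b] ;; t.P ?b ;; wh B' [?b] t.kap []"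
      unfolding t.p_def by (simp add: t.wh_seq t.inv_wh[symmetric])
    have 1: "wh B' [GL] ?t [t.al J] ;; wh B' [] (dinv B' gk) [?r, W, t.al J] = wh B' [] (dinv B' gk) [W, ?m, t.al J] ;; wh B' [GR] ?t [t.al J]"
      using t.exchange[of "dinv B' gk" ?t "[]" "[]" "[t.al J]"] by simp
    have 2: "wh B' V ?H [t.al J] ;; wh B' [] (dinv B' gk) [W, ?m, t.al J] = wh B' [] (dinv B' gk) [W, t.ar ?b, t.al J] ;; wh B' [GR, W] ?H [t.al J]"
      using t.exchange[of "dinv B' gk" ?H "[]" "[W]" "[t.al J]"] by simp
    have 3: "wh B' V ?x [] ;; wh B' [] (dinv B' gk) [W, t.ar ?b, t.al J] = wh B' [] (dinv B' gk) [W, t.al J, t.ar ?b] ;; wh B' [GR, W] ?x []"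
      using t.exchange[of "dinv B' gk" ?x "[]" "[W]" "[]"] by simp
    have 4: "wh B' [] ?P [W, t.al J] ;; wh B' [?b, GR, W] ?Q [] = wh B' [GR, ?r, W] ?Q [] ;; wh B' [] ?P [W, UJ]"
      using t.exchange[of ?P ?Q "[]" "[W]" "[]"] by simp
    have 5: "wh B' [GR] ?t [t.al J] ;; wh B' [GR, ?r, W] ?Q [] = wh B' [GR, W, ?m] ?Q [] ;; wh B' [GR] ?t [UJ]"
      using t.exchange[of ?t ?Q "[GR]" "[]" "[]"] by simp
    have "wh B' V ?x [] ;; wh B' [] (q b) [t.al J] ;; wh B' [?b] ?d []
      = wh B' V ?x [] ;; wh B' V ?H [t.al J] ;; wh B' [GL] ?t [t.al J] ;; wh B' [] (dinv B' gk) [?r, W, t.al J] ;; wh B' [] ?P [W, t.al J]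
         ;; (wh B' [?b] gk [W, t.al J] ;; wh B' [?b] (dinv B' gk) [W, t.al J]) ;; wh B' [?b, GR, W] ?Q [] ;; wh B' [?b] d0 [] ;; wh B' [?b] t.kap []"
      unfolding q_def by (simp add: t.wh_seq p)
    also have "\<dots> = wh B' V ?x [] ;; wh B' V ?H [t.al J] ;; wh B' [GL] ?t [t.al J] ;; wh B' [] (dinv B' gk) [?r, W, t.al J] ;; wh B' [] ?P [W, t.al J]
         ;; wh B' [?b, GR, W] ?Q [] ;; wh B' [?b] d0 [] ;; wh B' [?b] t.kap []"
      by (simp add: t.inv_wh[symmetric])
    also have "\<dots> = wh B' [] (dinv B' gk) [W, t.al J, t.ar ?b] ;; wh B' [GR, W] ?x [] ;; wh B' [GR, W] ?H [t.al J] ;; wh B' [GR, W, ?m] ?Q [] ;; wh B' [GR] ?t [UJ]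
        ;; wh B' [] ?P [W, UJ] ;; wh B' [?b] d0 [] ;; wh B' [?b] t.kap []"
      by (simp only: t.seq_rewrite2[OF 1] t.seq_rewrite2[OF 2] t.seq_rewrite2[OF 3] t.seq_rewrite2[OF 4] t.seq_rewrite2[OF 5] t.seq_assoc)
    also have "\<dots> = wh B' [] (dinv B' gk) [W, t.al J, t.ar ?b] ;; wh B' [GR, W] ?Q [t.ar ?b] ;; (wh B' [GR, W] (dinv B' (N4 b)) [] ;; wh B' [GR] ?t [UJ]
        ;; wh B' [] ?P [W, UJ] ;; wh B' [?b] d0 []) ;; wh B' [?b] t.kap []"
      by (simp only: t.seq_rewrite3[OF xN'] t.seq_assoc)
    also have "\<dots> = wh B' [] ?d [t.ar ?b] ;; t.p ?b"
      unfolding lhs D[OF b, symmetric] by simp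
    finally show "wh B' [] ?d [t.ar ?b] ;; t.p ?b = wh B' V ?x [] ;; wh B' [] (q b) [t.al J] ;; wh B' [?b] ?d []" by simp
  qed
qed

subsection \<open>Preservation of the braiding\<close>

theorem braided: assumes a [simp]: "a \<in> Mor B" and b [simp]: "b \<in> Mor B"
  shows "EC a b = t.C (gf a) (gf b)"
proof -
  obtain g where g [simp]: "diso B' g" "dsrc g = V @ [t.ar J]" "dtrg g = [t.L]"
    and g': "\<And>a. a \<in> Mor B \<Longrightarrow> wh B' V (t.x (gf a) J) [] ;; wh B' [] g [t.al (gf a)] ;; t.lam (gf a) = wh B' [] (v a) [t.ar J] ;; wh B' [gf a] g []"
    by (rule left_transfer) (rule that)
  obtain d where d [simp]: "diso B' d" "dsrc d = V @ [t.al J]" "dtrg d = [t.L]"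
    and d': "\<And>b. b \<in> Mor B \<Longrightarrow> wh B' [] d [t.ar (gf b)] ;; t.p (gf b) = wh B' V (t.x J (gf b)) [] ;; wh B' [] (q b) [t.al J] ;; wh B' [gf b] d []"
    by (rule right_transfer) (rule that)
  have dual: "t.dual_pair K J (dinv B' iota.eta) (dinv B' iota.eps)"
    unfolding J_def K_def by (rule iota.dual_W')
  let ?j = "dinv B' iota.eps"
  have j [simp]: "diso B' ?j" "dsrc ?j = []" "dtrg ?j = [J, K]"
    using dual unfolding t.dual_pair_def by simp_all
  have V [simp]: "set V \<subseteq> Mor B'" by simp
  \<comment> \<open>The isomorphism from \<gamma>, compatible with \<lambda>; the next one comes
    from \<delta> and is compatible with p.\<close>
  define el where "el = wh B' V (img t.FR ?j) [] ;; wh B' [] g [t.ar K] ;; t.p K"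
  define er where "er = wh B' V (img t.FL ?j) [] ;; wh B' [] d [t.al K] ;; t.lam K"
  have el [simp]: "diso B' el" "dsrc el = V" "dtrg el = [K, t.L]" 
    unfolding el_def using t.bd.gr_iso[OF j(1)] by simp_all
  have er [simp]: "diso B' er" "dsrc er = V" "dtrg er = [K, t.L]" 
    unfolding er_def using t.bd.gl_iso[OF j(1)] by simp_all
  have 1: "v a ;; wh B' [gf a] el [] = wh B' [] el [t.al (gf a)] ;; wh B' [K] (t.lam (gf a)) [] ;; wh B' [] (dinv B' (t.C (gf a) K)) [t.L]"
    unfolding el_def by (rule t.bd.transfer_left[of J K ?j V g "gf a" "v a"]) (simp_all add: g'[OF a])
  have "q b ;; wh B' [gf b] er [] = wh B' [] er [t.ar (gf b)] ;; wh B' [K] (t.p (gf b)) [] ;; wh B' [] (t.C K (gf b)) [t.L]"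
    unfolding er_def by (rule t.bd.transfer_right[of J K ?j V d "gf b" "q b"]) (simp_all add: d'[OF b])
  \<comment> \<open>The compatibility with p passes from \<open>er\<close> to \<open>el\<close>, so
    that one isomorphism has both properties.\<close>
  then have 2: "q b ;; wh B' [gf b] el [] = wh B' [] el [t.ar (gf b)] ;; wh B' [K] (t.p (gf b)) [] ;; wh B' [] (t.C K (gf b)) [t.L]"
    by (intro t.bd.adjust_scalar[OF dual, of el V er "gf b" "q b"]) simp_all
  show ?thesis
    by (rule t.bd.braiding_transfer[OF dual, of el V "gf a" "gf b" "v a" "q b" "EC a b"]) (simp_all add: 1 2 functor_hexagon)
qed

end

theorem corollary2p12:
  fixes B :: "('o, 'm, 'n, 'p) tricat"
    and B' :: "('o2, 'm2, 'n2, 'p2) tricat"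
    and F :: "('o, 'm, 'n, 'p, 'o2, 'm2, 'n2, 'p2) trifun"
  assumes "tricategory B" and "doubly_degenerate B"
    and "tricategory B'" and "doubly_degenerate B'"
    and "weak_functor B B' F"
  shows "braided_monoidal_functor (monB B) (dd_braiding B) (monB B') (dd_braiding B')
           (Fl F (pt B) (pt B))"
proof -
  interpret s: dd_tricategory B "monB B" using assms by (simp add: dd_tricategory_def dd_tricategory_axioms_def)
  interpret t: dd_tricategory B' "monB B'" using assms by (simp add: dd_tricategory_def dd_tricategory_axioms_def)
  interpret f: dd_functor B B' F "monB B" "monB B'"
    using assms(5) s.dd_tricategory_axioms t.dd_tricategory_axioms by (simp add: dd_functor_def)
  let ?G = "Fl F (pt B) (pt B)"
  have "pfc ?G Y X \<cdot>\<^bsub>monB B'\<^esub> dd_braiding B' (pf1 ?G X) (pf1 ?G Y) = pf2 ?G (dd_braiding B X Y) \<cdot>\<^bsub>monB B'\<^esub> pfc ?G X Y"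
    if [simp]: "X \<in> Mor (monB B)" "Y \<in> Mor (monB B)" for X Y
  proof -
    have c: "dd_braiding B X Y \<in> Cel (monB B)" "Dom (monB B) (dd_braiding B X Y) = comp1 (monB B) X Y" "Cod (monB B) (dd_braiding B X Y) = comp1 (monB B) Y X"
      using s.C_typing(2)[OF that] unfolding s.C_def s.valid_Dia by (simp_all add: s.pth_Cons)
    have "cell (f.EC X Y) = dd_braiding B' (pf1 ?G X) (pf1 ?G Y)"
      unfolding f.braided[OF that] t.C_def by simp
    \<comment> \<open>The image of a diagram contains the monoidal constraints of F, so equality of
      the diagrams is the condition on a braided functor with one constraint moved to the other
      side.\<close>
    moreover have "cell (f.EC X Y) = inv2 (monB B') (pfc ?G Y X) \<cdot>\<^bsub>monB B'\<^esub> pf2 ?G (dd_braiding B X Y) \<cdot>\<^bsub>monB B'\<^esub> pfc ?G X Y"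
      unfolding f.EC_def using s.C_typing(2)[OF that] by (simp add: f.G.cell_img f.G.pfl_Cons) (simp add: s.C_def)
    ultimately have e: "dd_braiding B' (pf1 ?G X) (pf1 ?G Y) = inv2 (monB B') (pfc ?G Y X) \<cdot>\<^bsub>monB B'\<^esub> pf2 ?G (dd_braiding B X Y) \<cdot>\<^bsub>monB B'\<^esub> pfc ?G X Y"
      by simp
    show ?thesis unfolding e using c by simp
  qed
  moreover have "monoidal_category (monB B)" "monoidal_category (monB B')"
    unfolding monoidal_category_def using s.bicategory_axioms t.bicategory_axioms s.one_object t.one_object by blast+
  ultimately show ?thesis
    unfolding braided_monoidal_functor_def monoidal_functor_def using f.G.pseudofunctor_axioms by blast
qed

end
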